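(* Let $0<\alpha\le1$ and let $\{X_{i,k}:i\ge0,k\ge1\}$ be independent real random variables with mean zero, variance one and $\sup_{i,k}\mathbb E|X_{i,k}|^l<\infty$ for each $l\ge3$, independent of the fractional Poisson process $N^\alpha$. Let $S^{(n)}_j(t)=\sum_{k=1}^{[nt]}X_{j,k}$, $\mathcal S^\alpha_{j,n}(t)=\sum_{k=1}^{N^\alpha(nt)}X_{j,k}$, and for $0\le r\le n-1$ let $$\beta_{r,n}(t)=\sum_{j=0}^{n-1}S^{(n)}_j(t)\cos\Big(\frac{2\pi rj}{n}\Big)+\iota\sum_{j=0}^{n-1}S^{(n)}_j(t)\sin\Big(\frac{2\pi rj}{n}\Big),$$ $$\beta^\alpha_{r,n}(t)=\sum_{j=0}^{n-1}\mathcal S^\alpha_{j,n}(t)\cos\Big(\frac{2\pi rj}{n}\Big)+\iota\sum_{j=0}^{n-1}\mathcal S^\alpha_{j,n}(t)\sin\Big(\frac{2\pi rj}{n}\Big)$$ be the eigenvalues of the circulant matrices $((S^{(n)}_{(j-i+n)\bmod n}(t)))_{1\le i,j\le n}$ and $((\mathcal S^\alpha_{(j-i+n)\bmod n,\,n}(t)))_{1\le i,j\le n}$, respectively. Let $U_n$ be uniformly distributed on $\{0,1,\dots,n-1\}$ and independent of everything else, and set $Z_n(t)=\beta_{U_n,n}(t)$, $Z_n^\alpha(t)=\beta^\alpha_{U_n,n}(t)$. Then, as $n\to\infty$, the processes $n^{-1}Z_n(\cdot)$ and $n^{-(1+\alpha)/2}Z^\alpha_n(\cdot)$ converge weakly,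 in suitable Skorokhod topologies, respectively to $CBM(\cdot)$ and $CBM^\alpha(\cdot)$.
   Context: $\iota=\sqrt{-1}$; $[x]$ is the greatest integer $\le x$. $\{H^\alpha(t)\}_{t\ge0}$ is an $\alpha$-stable subordinator ($0<\alpha<1$): non-decreasing Lévy process with $\mathbb Ee^{-uH^\alpha(t)}=e^{-tu^\alpha}$, $u>0$. Its inverse is $L^\alpha(t)=\inf\{s\ge0:H^\alpha(s)\ge t\}$, and $L^\alpha(t)=t$ when $\alpha=1$. The fractional Poisson process is $N^\alpha(t)=N(L^\alpha(t))$, with $N$ a Poisson process of rate one independent of $L^\alpha$. $CBM(t)=(B_1(t)+\iota B_2(t))/\sqrt2$ with $B_1,B_2$ independent standard Brownian motions; $CBM^\alpha(t)=CBM(L^\alpha(t))$ with $L^\alpha$ independent of $CBM$. The processes are viewed as random elements of the Skorokhod space of càdlàg functions $[0,\infty)\to\mathbb C\cong\mathbb R^2$. *)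

theory Defs
  imports "HOL-Probability.Probability" "Jordan_Normal_Form.Char_Poly"
begin

section \<open>The Skorokhod space of cadlag functions on the half-line\<close>

text \<open>
  Functions on \<open>[0,\<infinity>)\<close> are represented as functions on the reals that are \<open>extensional\<close> on
  \<open>{0..}\<close>, as in the library's product measure \<open>Pi\<^sub>M {0..} _\<close>.
\<close>

definition cadlag :: "(real \<Rightarrow> 'b::metric_space) \<Rightarrow> bool" where
  "cadlag x \<longleftrightarrow> (\<forall>t\<ge>0. (x \<longlongrightarrow> x t) (at_right t)) \<and> (\<forall>t>0. \<exists>l. (x \<longlongrightarrow> l) (at_left t))"

definition skorokhod_space :: "(real \<Rightarrow> 'b::metric_space) set" where
  "skorokhod_space = {x \<in> extensional {0..}. cadlag x}"

definition time_changes :: "(real \<Rightarrow> real) set" where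
  "time_changes = {l. strict_mono_on {0..} l \<and> l ` {0..} = {0..}}"

text \<open>
  \<open>y\<close> lies in \<open>skorokhod_nbhd x T e\<close> iff some time change \<open>l\<close> satisfies both
  \<open>sup {\<bar>l t - t\<bar> | t \<ge> 0} < e\<close> and \<open>sup {dist (y (l t)) (x t) | 0 \<le> t \<le> T} < e\<close>. These sets are the
  basic neighbourhoods of \<open>x\<close> for the \<open>J\<^sub>1\<close> topology; the usual description of its convergent
  sequences is lemma \<open>limitin_skorokhod_topology\<close> below.
\<close>

definition skorokhod_nbhd ::
  "(real \<Rightarrow> 'b::metric_space) \<Rightarrow> real \<Rightarrow> real \<Rightarrow> (real \<Rightarrow> 'b) set" where
  "skorokhod_nbhd x T e = {y \<in> skorokhod_space. \<exists>l\<in>time_changes. \<exists>d<e.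
     (\<forall>t\<ge>0. \<bar>l t - t\<bar> \<le> d) \<and> (\<forall>t\<in>{0..T}. dist (y (l t)) (x t) \<le> d)}"

definition skorokhod_topology :: "(real \<Rightarrow> 'b::metric_space) topology" where
  "skorokhod_topology = topology (\<lambda>U. U \<subseteq> skorokhod_space \<and>
     (\<forall>x\<in>U. \<exists>T\<ge>0. \<exists>e>0. skorokhod_nbhd x T e \<subseteq> U))"

lemma skorokhod_nbhd_mono:
  assumes "T \<le> T'" "e' \<le> e" shows "skorokhod_nbhd x T' e' \<subseteq> skorokhod_nbhd x T e"
proof
  fix y assume "y \<in> skorokhod_nbhd x T' e'"
  then obtain l d where "y \<in> skorokhod_space" "l \<in> time_changes" "d < e'"
    "\<forall>t\<ge>0. \<bar>l t - t\<bar> \<le> d" "\<forall>t\<in>{0..T'}. dist (y (l t)) (x t) \<le> d"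
    unfolding skorokhod_nbhd_def by blast
  with assms show "y \<in> skorokhod_nbhd x T e"
    unfolding skorokhod_nbhd_def by (auto intro!: bexI[of _ l] exI[of _ d])
qed

lemma openin_skorokhod_topology:
  fixes U :: "(real \<Rightarrow> 'b::metric_space) set"
  shows "openin skorokhod_topology U \<longleftrightarrow> U \<subseteq> skorokhod_space \<and>
     (\<forall>x\<in>U. \<exists>T\<ge>0. \<exists>e>0. skorokhod_nbhd x T e \<subseteq> U)"
proof -
  have "istopology (\<lambda>U :: (real \<Rightarrow> 'b::metric_space) set. U \<subseteq> skorokhod_space \<and>
     (\<forall>x\<in>U. \<exists>T\<ge>0. \<exists>e>0. skorokhod_nbhd x T e \<subseteq> U))" (is "istopology ?P")
    unfolding istopology_def
  proof (intro conjI allI impI)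
    fix S T :: "(real \<Rightarrow> 'b) set" assume S: "?P S" and T: "?P T"
    show "S \<inter> T \<subseteq> skorokhod_space" using S by blast
    show "\<forall>x\<in>S \<inter> T. \<exists>Ta\<ge>0. \<exists>e>0. skorokhod_nbhd x Ta e \<subseteq> S \<inter> T"
    proof
      fix x assume x: "x \<in> S \<inter> T"
      obtain a e where a: "a \<ge> 0" "e > 0" "skorokhod_nbhd x a e \<subseteq> S" using S x by blast
      obtain b f where b: "b \<ge> 0" "f > 0" "skorokhod_nbhd x b f \<subseteq> T" using T x by blast
      have "skorokhod_nbhd x (max a b) (min e f) \<subseteq> S \<inter> T"
        using a(3) b(3) skorokhod_nbhd_mono[of a "max a b" "min e f" e x]
          skorokhod_nbhd_mono[of b "max a b" "min e f" f x] by auto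
      moreover have "max a b \<ge> 0" "min e f > 0" using a b by auto
      ultimately show "\<exists>Ta\<ge>0. \<exists>e>0. skorokhod_nbhd x Ta e \<subseteq> S \<inter> T" by blast
    qed
  next
    fix \<K> :: "(real \<Rightarrow> 'b) set set" assume K: "\<forall>K\<in>\<K>. ?P K"
    then show "\<Union>\<K> \<subseteq> skorokhod_space" by blast
    show "\<forall>x\<in>\<Union>\<K>. \<exists>T\<ge>0. \<exists>e>0. skorokhod_nbhd x T e \<subseteq> \<Union>\<K>"
    proof
      fix x assume "x \<in> \<Union>\<K>"
      then obtain K where "K \<in> \<K>" "x \<in> K" by blast
      moreover from this obtain T e where "T \<ge> 0" "e > 0" "skorokhod_nbhd x T e \<subseteq> K" using K by meson
      ultimately show "\<exists>T\<ge>0. \<exists>e>0. skorokhod_nbhd x T e \<subseteq> \<Union>\<K>" by (meson Union_upper subset_trans)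
    qed
  qed
  then show ?thesis unfolding skorokhod_topology_def by simp
qed

lemma topspace_skorokhod_topology [simp]: "topspace skorokhod_topology = skorokhod_space"
proof
  show "topspace skorokhod_topology \<subseteq> (skorokhod_space :: (real \<Rightarrow> 'a) set)"
    using openin_topspace openin_skorokhod_topology by blast
  have "skorokhod_nbhd x 0 1 \<subseteq> skorokhod_space" for x :: "real \<Rightarrow> 'a"
    unfolding skorokhod_nbhd_def by blast
  then have "\<forall>x\<in>skorokhod_space :: (real \<Rightarrow> 'a) set. \<exists>T\<ge>0. \<exists>e>0. skorokhod_nbhd x T e \<subseteq> skorokhod_space"
    by (intro ballI exI[of _ "0::real"] exI[of _ "1::real"] conjI) simp_all
  then have "openin skorokhod_topology (skorokhod_space :: (real \<Rightarrow> 'a) set)"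
    unfolding openin_skorokhod_topology by blast
  then show "(skorokhod_space :: (real \<Rightarrow> 'a) set) \<subseteq> topspace skorokhod_topology"
    by (rule openin_subset)
qed

lemma id_time_change: "(\<lambda>t. t) \<in> time_changes"
  unfolding time_changes_def by (auto simp: strict_mono_on_def)

lemma time_change_compose:
  assumes "k \<in> time_changes" "l \<in> time_changes" shows "(\<lambda>t. k (l t)) \<in> time_changes"
proof -
  have "(\<lambda>t. k (l t)) ` {0..} = k ` (l ` {0..})" by auto
  moreover have "strict_mono_on {0..} (\<lambda>t. k (l t))"
  proof (rule strict_mono_onI)
    fix r s :: real assume rs: "r \<in> {0..}" "s \<in> {0..}" "r < s"
    then have "l r < l s" "l r \<in> {0..}" "l s \<in> {0..}"
      using assms(2) by (auto simp: time_changes_def strict_mono_on_def)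
    then show "k (l r) < k (l s)" using assms(1) by (auto simp: time_changes_def strict_mono_on_def)
  qed
  ultimately show ?thesis using assms by (simp add: time_changes_def)
qed

lemma centre_in_skorokhod_nbhd:
  "x \<in> skorokhod_space \<Longrightarrow> 0 < e \<Longrightarrow> x \<in> skorokhod_nbhd x T e"
  unfolding skorokhod_nbhd_def using id_time_change by (auto intro!: bexI[of _ "\<lambda>t. t"] exI[of _ 0])

lemma openin_skorokhod_nbhd: "openin skorokhod_topology (skorokhod_nbhd x T e)"
  unfolding openin_skorokhod_topology
proof (intro conjI ballI)
  show "skorokhod_nbhd x T e \<subseteq> skorokhod_space" unfolding skorokhod_nbhd_def by blast
  fix y assume "y \<in> skorokhod_nbhd x T e"
  then obtain l d where l: "l \<in> time_changes" and d: "d < e"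
    and ld: "\<And>t. t \<ge> 0 \<Longrightarrow> \<bar>l t - t\<bar> \<le> d" and yd: "\<And>t. t \<in> {0..T} \<Longrightarrow> dist (y (l t)) (x t) \<le> d"
    unfolding skorokhod_nbhd_def by blast
  have l0: "l t \<ge> 0" if "t \<ge> 0" for t using l that unfolding time_changes_def by auto
  have lm: "l s \<le> l t" if "0 \<le> s" "s \<le> t" for s t
    using l that unfolding time_changes_def strict_mono_on_def
    by (cases "s = t") (auto intro: less_imp_le)
  define T' where "T' = (if 0 \<le> T then l T else 0)"
  have "skorokhod_nbhd y T' (e - d) \<subseteq> skorokhod_nbhd x T e"
  proof
    fix z assume "z \<in> skorokhod_nbhd y T' (e - d)"
    then obtain k c where z: "z \<in> skorokhod_space" and k: "k \<in> time_changes" and c: "c < e - d"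
      and kc: "\<And>t. t \<ge> 0 \<Longrightarrow> \<bar>k t - t\<bar> \<le> c"
      and zc: "\<And>t. t \<in> {0..T'} \<Longrightarrow> dist (z (k t)) (y t) \<le> c"
      unfolding skorokhod_nbhd_def by blast
    have "\<bar>k (l t) - t\<bar> \<le> c + d" if "t \<ge> 0" for t
      using kc[OF l0[OF that]] ld[OF that] by linarith
    moreover have "dist (z (k (l t))) (x t) \<le> c + d" if "t \<in> {0..T}" for t
    proof -
      have "l t \<in> {0..T'}" using that l0 lm[of t T] by (auto simp: T'_def)
      then show ?thesis using zc[of "l t"] yd[OF that] dist_triangle[of "z (k (l t))" "x t" "y (l t)"]
        by linarith
    qed
    ultimately show "z \<in> skorokhod_nbhd x T e"
      unfolding skorokhod_nbhd_def mem_Collect_eq using z c time_change_compose[OF k l]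
      by (intro conjI bexI[of _ "\<lambda>t. k (l t)"] exI[of _ "c + d"]) (simp_all add: less_diff_eq)
  qed
  moreover have "T' \<ge> 0" "e - d > 0" using d l0 by (auto simp: T'_def)
  ultimately show "\<exists>T'\<ge>0. \<exists>e'>0. skorokhod_nbhd y T' e' \<subseteq> skorokhod_nbhd x T e" by blast
qed

lemma limitin_skorokhod_topology:
  assumes xs: "\<And>n. xs n \<in> skorokhod_space" and x: "x \<in> skorokhod_space"
  shows "limitin skorokhod_topology xs x sequentially \<longleftrightarrow>
    (\<exists>l. (\<forall>n. l n \<in> time_changes) \<and> uniform_limit {0..} l (\<lambda>t. t) sequentially \<and>
         (\<forall>T. uniform_limit {0..T} (\<lambda>n t. xs n (l n t)) x sequentially))" (is "?L \<longleftrightarrow> ?R")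
proof
  assume ?L
  define A where "A n = {m. m \<le> n \<and> xs n \<in> skorokhod_nbhd x (real m) (1 / real (Suc m))}" for n
  define P where "P n l \<longleftrightarrow> l \<in> time_changes \<and> (A n \<noteq> {} \<longrightarrow>
     (\<forall>t\<ge>0. \<bar>l t - t\<bar> < 1 / real (Suc (Max (A n)))) \<and>
     (\<forall>t\<in>{0..real (Max (A n))}. dist (xs n (l t)) (x t) < 1 / real (Suc (Max (A n)))))" for n l
  have finA: "finite (A n)" for n unfolding A_def by (rule finite_subset[of _ "{..n}"]) auto
  have "\<exists>l. P n l" for n
  proof (cases "A n = {}")
    case True
    then show ?thesis using id_time_change unfolding P_def by blast
  next
    case False
    then have "Max (A n) \<in> A n" using finA by (rule Max_in[rotated])
    then have "xs n \<in> skorokhod_nbhd x (real (Max (A n))) (1 / real (Suc (Max (A n))))"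
      unfolding A_def by blast
    then obtain l d where "l \<in> time_changes" "d < 1 / real (Suc (Max (A n)))"
      "\<forall>t\<ge>0. \<bar>l t - t\<bar> \<le> d" "\<forall>t\<in>{0..real (Max (A n))}. dist (xs n (l t)) (x t) \<le> d"
      unfolding skorokhod_nbhd_def by blast
    then show ?thesis unfolding P_def by (intro exI[of _ l]) (meson le_less_trans)
  qed
  then obtain l where l: "\<And>n. P n (l n)" by metis
  have key: "\<forall>\<^sub>F n in sequentially. (\<forall>t\<ge>0. \<bar>l n t - t\<bar> < e) \<and> (\<forall>t\<in>{0..T}. dist (xs n (l n t)) (x t) < e)"
    if "e > 0" for e T
  proof -
    obtain m0 :: nat where m0: "1 / real (Suc m0) < e" using nat_approx_posE[OF \<open>e > 0\<close>] by blast
    obtain m1 :: nat where m1: "T \<le> real m1" using real_arch_simple by blast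
    define m where "m = max m0 m1"
    have "\<forall>\<^sub>F n in sequentially. xs n \<in> skorokhod_nbhd x (real m) (1 / real (Suc m))"
      using \<open>?L\<close> openin_skorokhod_nbhd[of x "real m" "1 / real (Suc m)"]
        centre_in_skorokhod_nbhd[OF x, of "1 / real (Suc m)" "real m"]
      unfolding limitin_def by (meson of_nat_0_less_iff zero_less_Suc zero_less_divide_1_iff)
    then show ?thesis using eventually_ge_at_top[of m]
    proof eventually_elim
      case (elim n)
      then have mA: "m \<in> A n" unfolding A_def by simp
      then have le: "m \<le> Max (A n)" using finA by simp
      have "1 / real (Suc (Max (A n))) \<le> 1 / real (Suc m0)"
        using le unfolding m_def by (intro divide_left_mono) auto
      then have less: "1 / real (Suc (Max (A n))) < e" using m0 by linarith
      have T: "T \<le> real (Max (A n))" using le m1 unfolding m_def by linarith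
      have "\<forall>t\<ge>0. \<bar>l n t - t\<bar> < 1 / real (Suc (Max (A n)))"
        and "\<forall>t\<in>{0..real (Max (A n))}. dist (xs n (l n t)) (x t) < 1 / real (Suc (Max (A n)))"
        using l[of n] mA unfolding P_def by blast+
      moreover have "t \<in> {0..real (Max (A n))}" if "t \<in> {0..T}" for t using that T by simp
      ultimately show ?case using less less_trans by blast
    qed
  qed
  have "uniform_limit {0..} l (\<lambda>t. t) sequentially"
  proof (rule uniform_limitI)
    fix e :: real assume "e > 0"
    show "\<forall>\<^sub>F n in sequentially. \<forall>t\<in>{0..}. dist (l n t) t < e"
      using key[OF \<open>e > 0\<close>, of 0] by eventually_elim (auto simp: dist_real_def)
  qed
  moreover have "uniform_limit {0..T} (\<lambda>n t. xs n (l n t)) x sequentially" for T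
  proof (rule uniform_limitI)
    fix e :: real assume "e > 0"
    show "\<forall>\<^sub>F n in sequentially. \<forall>t\<in>{0..T}. dist (xs n (l n t)) (x t) < e"
      using key[OF \<open>e > 0\<close>, of T] by eventually_elim auto
  qed
  ultimately show ?R using l unfolding P_def by blast
next
  assume ?R
  then obtain l where l: "\<And>n. l n \<in> time_changes" "uniform_limit {0..} l (\<lambda>t. t) sequentially"
    "\<And>T. uniform_limit {0..T} (\<lambda>n t. xs n (l n t)) x sequentially" by blast
  show ?L unfolding limitin_def
  proof (intro conjI allI impI)
    show "x \<in> topspace skorokhod_topology" using x by simp
    fix U assume U: "openin skorokhod_topology U \<and> x \<in> U"
    then obtain T e where e: "e > 0" "skorokhod_nbhd x T e \<subseteq> U"
      unfolding openin_skorokhod_topology by blast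
    have e2: "e / 2 > 0" using e by simp
    have "\<forall>\<^sub>F n in sequentially. \<forall>t\<in>{0..}. dist (l n t) t < e / 2"
      "\<forall>\<^sub>F n in sequentially. \<forall>t\<in>{0..T}. dist (xs n (l n t)) (x t) < e / 2"
      using l(2) l(3)[of T] e2 unfolding uniform_limit_iff by blast+
    then show "\<forall>\<^sub>F n in sequentially. xs n \<in> U"
    proof eventually_elim
      case (elim n)
      have "xs n \<in> skorokhod_nbhd x T e"
        unfolding skorokhod_nbhd_def mem_Collect_eq
        using elim xs l(1) e by (intro conjI bexI[of _ "l n"] exI[of _ "e / 2"])
          (auto simp: dist_real_def intro: less_imp_le)
      then show ?case using e by blast
    qed
  qed
qed

definition skorokhod_borel :: "(real \<Rightarrow> 'b::metric_space) measure" where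
  "skorokhod_borel = sigma skorokhod_space {U. openin skorokhod_topology U}"


section \<open>Processes and weak convergence\<close>

definition sample_path :: "(real \<Rightarrow> 'a \<Rightarrow> 'b) \<Rightarrow> 'a \<Rightarrow> real \<Rightarrow> 'b" where
  "sample_path Y \<omega> = (\<lambda>t\<in>{0..}. Y t \<omega>)"

text \<open>
  Processes such as the inverse of a subordinator have cadlag paths only almost surely, so a process
  is identified with a random element of the Skorokhod space up to indistinguishability. The law of
  \<open>R\<close> does not depend on the choice of \<open>R\<close>.
\<close>

definition skorokhod_version ::
  "'a measure \<Rightarrow> (real \<Rightarrow> 'a \<Rightarrow> 'b::metric_space) \<Rightarrow> ('a \<Rightarrow> real \<Rightarrow> 'b) \<Rightarrow> bool" where
  "skorokhod_version M Y R \<longleftrightarrow>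
     R \<in> M \<rightarrow>\<^sub>M skorokhod_borel \<and> (AE \<omega> in M. R \<omega> = sample_path Y \<omega>)"

definition converges_weakly_J1 ::
  "'a measure \<Rightarrow> (nat \<Rightarrow> real \<Rightarrow> 'a \<Rightarrow> 'b::metric_space) \<Rightarrow> 'c measure \<Rightarrow> (real \<Rightarrow> 'c \<Rightarrow> 'b) \<Rightarrow> bool"
  where
  "converges_weakly_J1 M Y M' Y' \<longleftrightarrow>
     (\<exists>R R'. (\<forall>n. skorokhod_version M (Y n) (R n)) \<and> skorokhod_version M' Y' R' \<and>
       (\<forall>f :: (real \<Rightarrow> 'b) \<Rightarrow> real.
          continuous_map skorokhod_topology euclideanreal f \<and> bounded (f ` skorokhod_space) \<longrightarrow>
          (\<lambda>n. \<integral>\<omega>. f (R n \<omega>) \<partial>M) \<longlonglongrightarrow> (\<integral>\<omega>. f (R' \<omega>) \<partial>M')))"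

text \<open>
  Independence of two random elements with values in possibly different types; the library's
  \<open>indep_var\<close> requires both to have the same type.
\<close>

definition independent_elements ::
  "'a measure \<Rightarrow> 'b measure \<Rightarrow> ('a \<Rightarrow> 'b) \<Rightarrow> 'c measure \<Rightarrow> ('a \<Rightarrow> 'c) \<Rightarrow> bool" where
  "independent_elements M K A K' B \<longleftrightarrow> A \<in> M \<rightarrow>\<^sub>M K \<and> B \<in> M \<rightarrow>\<^sub>M K' \<and>
     prob_space.indep_set M {A -` S \<inter> space M | S. S \<in> sets K} {B -` S \<inter> space M | S. S \<in> sets K'}"

abbreviation path_algebra :: "(real \<Rightarrow> 'b::topological_space) measure" where
  "path_algebra \<equiv> Pi\<^sub>M {0..} (\<lambda>_. borel)"

text \<open>Stochastic continuity follows from stationarity of the increments and right continuity at 0.\<close>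

definition levy_process :: "'a measure \<Rightarrow> (real \<Rightarrow> 'a \<Rightarrow> real) \<Rightarrow> bool" where
  "levy_process M Y \<longleftrightarrow>
     (\<forall>t\<ge>0. Y t \<in> borel_measurable M) \<and>
     (AE \<omega> in M. Y 0 \<omega> = 0) \<and>
     (\<forall>(m::nat) t. 0 \<le> t 0 \<and> (\<forall>i<m. t i \<le> t (Suc i)) \<longrightarrow>
        prob_space.indep_vars M (\<lambda>_. borel) (\<lambda>i \<omega>. Y (t (Suc i)) \<omega> - Y (t i) \<omega>) {..<m}) \<and>
     (\<forall>s\<ge>0. \<forall>h\<ge>0. distr M borel (\<lambda>\<omega>. Y (s + h) \<omega> - Y s \<omega>) = distr M borel (Y h)) \<and>
     (AE \<omega> in M. cadlag (\<lambda>t. Y t \<omega>))"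

definition standard_brownian_motion :: "'a measure \<Rightarrow> (real \<Rightarrow> 'a \<Rightarrow> real) \<Rightarrow> bool" where
  "standard_brownian_motion M B \<longleftrightarrow>
     levy_process M B \<and>
     (AE \<omega> in M. continuous_on {0..} (\<lambda>t. B t \<omega>)) \<and>
     (\<forall>t>0. distributed M lborel (B t) (normal_density 0 (sqrt t)))"

definition unit_poisson_process :: "'a measure \<Rightarrow> (real \<Rightarrow> 'a \<Rightarrow> nat) \<Rightarrow> bool" where
  "unit_poisson_process M N \<longleftrightarrow>
     levy_process M (\<lambda>t \<omega>. real (N t \<omega>)) \<and>
     (\<forall>t\<ge>0. N t \<in> M \<rightarrow>\<^sub>M count_space UNIV \<and>
            distr M (count_space UNIV) (N t) = measure_pmf (poisson_pmf t))"

definition stable_subordinator :: "'a measure \<Rightarrow> real \<Rightarrow> (real \<Rightarrow> 'a \<Rightarrow> real) \<Rightarrow> bool" where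
  "stable_subordinator M \<alpha> H \<longleftrightarrow>
     levy_process M H \<and>
     (AE \<omega> in M. mono_on {0..} (\<lambda>t. H t \<omega>)) \<and>
     (\<forall>t\<ge>0. \<forall>u>0. (\<integral>\<omega>. exp (- u * H t \<omega>) \<partial>M) = exp (- t * u powr \<alpha>))"

text \<open>
  The infimum is over a nonempty set for all \<open>t\<close>, almost surely: a stable subordinator is almost
  surely unbounded.
\<close>

definition inverse_stable_subordinator :: "'a measure \<Rightarrow> real \<Rightarrow> (real \<Rightarrow> 'a \<Rightarrow> real) \<Rightarrow> bool" where
  "inverse_stable_subordinator M \<alpha> L \<longleftrightarrow>
     (if \<alpha> = 1 then \<forall>t\<ge>0. \<forall>\<omega>\<in>space M. L t \<omega> = t
      else \<exists>H. stable_subordinator M \<alpha> H \<and>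
             (\<forall>t\<ge>0. \<forall>\<omega>\<in>space M. L t \<omega> = Inf {s. 0 \<le> s \<and> t \<le> H s \<omega>}))"

definition time_changed :: "(real \<Rightarrow> 'a \<Rightarrow> 'b) \<Rightarrow> (real \<Rightarrow> 'a \<Rightarrow> real) \<Rightarrow> real \<Rightarrow> 'a \<Rightarrow> 'b" where
  "time_changed Y L t \<omega> = Y (L t \<omega>) \<omega>"

definition cbm :: "(real \<Rightarrow> 'a \<Rightarrow> real) \<Rightarrow> (real \<Rightarrow> 'a \<Rightarrow> real) \<Rightarrow> real \<Rightarrow> 'a \<Rightarrow> complex" where
  "cbm B1 B2 t \<omega> = (of_real (B1 t \<omega>) + \<i> * of_real (B2 t \<omega>)) / of_real (sqrt 2)"


section \<open>Circulant matrices of random walks\<close>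

definition circulant_mat :: "nat \<Rightarrow> (nat \<Rightarrow> real) \<Rightarrow> complex mat" where
  "circulant_mat n c = mat n n (\<lambda>(i, j). of_real (c ((j + n - i) mod n)))"

definition circulant_eigenvalue :: "nat \<Rightarrow> (nat \<Rightarrow> real) \<Rightarrow> nat \<Rightarrow> complex" where
  "circulant_eigenvalue n c r =
     of_real (\<Sum>j<n. c j * cos (2 * pi * real r * real j / real n)) +
     \<i> * of_real (\<Sum>j<n. c j * sin (2 * pi * real r * real j / real n))"

definition walk :: "(nat \<Rightarrow> nat \<Rightarrow> 'a \<Rightarrow> real) \<Rightarrow> nat \<Rightarrow> nat \<Rightarrow> 'a \<Rightarrow> real" where
  "walk X j m \<omega> = (\<Sum>k=1..m. X j k \<omega>)"

lemma circulant_eigenvalue_cis: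
  "circulant_eigenvalue n c r = (\<Sum>j<n. of_real (c j) * cis (2 * pi * real r * real j / real n))"
  unfolding circulant_eigenvalue_def
  by (simp add: complex_eq_iff)

lemma cis_mod:
  assumes "n > 0"
  shows "cis (2 * pi * real r * real (m mod n) / real n) = cis (2 * pi * real r * real m / real n)"
proof -
  have "2 * pi * real r * real m / real n =
    2 * pi * real r * real (m mod n) / real n + 2 * pi * real (r * (m div n))"
  proof -
    have "real m = real (m mod n) + real n * real (m div n)"
      by (metis of_nat_add of_nat_mult mod_mult_div_eq)
    then show ?thesis using assms by (simp add: field_simps)
  qed
  moreover have "cis (2 * pi * real (r * (m div n))) = 1" by (rule cis_multiple_2pi) auto
  ultimately show ?thesis by (simp flip: cis_mult)
qed

lemma sum_cis_orthogonal:
  assumes "r < n" "s < n"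
  shows "(\<Sum>k<n. cis (2 * pi * real r * real k / real n) * cis (- (2 * pi * real s * real k / real n)))
       = (if r = s then of_nat n else 0)"
proof (cases "r = s")
  case True
  then show ?thesis by (simp add: cis_mult)
next
  case False
  define z where "z j = cis (2 * pi * real j / real n)" for j
  define w where "w = z r * cnj (z s)"
  have inj: "inj_on z {..<n}" and rt: "z j ^ n = 1" if "j < n" for j
    using Complex.bij_betw_roots_unity[of n] assms that unfolding bij_betw_def z_def by auto
  have w1: "w \<noteq> 1"
  proof
    assume "w = 1"
    then have "z r * (cnj (z s) * z s) = z s" unfolding w_def by (metis mult.assoc mult_1)
    moreover have "cnj (z s) * z s = 1" unfolding z_def by (simp add: cis_cnj cis_mult)
    ultimately have "z r = z s" by simp
    then show False using inj[OF assms(1)] assms False by (auto dest: inj_onD)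
  qed
  have "w ^ n = 1" unfolding w_def power_mult_distrib
    using rt[OF assms(1)] rt[OF assms(2)] by (metis complex_cnj_one complex_cnj_power mult_1)
  moreover have "cis (2 * pi * real r * real k / real n) * cis (- (2 * pi * real s * real k / real n)) = w ^ k"
    for k
  proof -
    have "w ^ k = cis (real k * (2 * pi * real r / real n)) * cis (real k * (- (2 * pi * real s / real n)))"
      unfolding w_def z_def power_mult_distrib cis_cnj Complex.DeMoivre ..
    moreover have "real k * (2 * pi * real r / real n) = 2 * pi * real r * real k / real n"
      "real k * (- (2 * pi * real s / real n)) = - (2 * pi * real s * real k / real n)" by simp_all
    ultimately show ?thesis by (simp only:)
  qed
  ultimately show ?thesis using w1 False by (simp add: sum_gp_strict)
qed

lemma char_poly_circulant_mat:
  assumes "n > 0"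
  shows "char_poly (circulant_mat n c) = (\<Prod>r\<leftarrow>[0..<n]. [:- circulant_eigenvalue n c r, 1:])"
proof -
  define e where "e r k = cis (2 * pi * real r * real k / real n)" for r k
  define P where "P = mat n n (\<lambda>(i, r). e r i)"
  define Q where "Q = mat n n (\<lambda>(r, i). cis (- (2 * pi * real r * real i / real n)) / of_nat n)"
  define D where "D = mat n n (\<lambda>(r, s). if r = s then circulant_eigenvalue n c r else 0)"
  let ?A = "circulant_mat n c"
  have carr: "P \<in> carrier_mat n n" "Q \<in> carrier_mat n n" "D \<in> carrier_mat n n" "?A \<in> carrier_mat n n"
    unfolding P_def Q_def D_def circulant_mat_def by auto
  have QP: "Q * P = 1\<^sub>m n"
  proof (rule eq_matI)
    fix s r assume sr: "s < dim_row (1\<^sub>m n :: complex mat)" "r < dim_col (1\<^sub>m n :: complex mat)"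
    have "(Q * P) $$ (s, r) = (\<Sum>k<n. e r k * cis (- (2 * pi * real s * real k / real n))) / of_nat n"
      using sr unfolding P_def Q_def
      by (simp add: scalar_prod_def atLeast0LessThan sum_divide_distrib mult.commute)
    also have "\<dots> = 1\<^sub>m n $$ (s, r)" unfolding e_def using sr sum_cis_orthogonal[of r n s] by auto
    finally show "(Q * P) $$ (s, r) = 1\<^sub>m n $$ (s, r)" .
  qed (auto simp: P_def Q_def)
  have PQ: "P * Q = 1\<^sub>m n" by (rule mat_mult_left_right_inverse[OF carr(2,1) QP])
  have AP: "?A * P = P * D"
  proof (rule eq_matI)
    fix i r assume "i < dim_row (P * D)" "r < dim_col (P * D)"
    then have ir: "i < n" "r < n" using carr by auto
    have "(?A * P) $$ (i, r) = (\<Sum>j<n. of_real (c ((j + n - i) mod n)) * e r j)"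
      using ir unfolding circulant_mat_def P_def by (simp add: scalar_prod_def atLeast0LessThan)
    also have "\<dots> = (\<Sum>j<n. of_real (c ((j + n - i) mod n)) * (e r ((j + n - i) mod n) * e r i))"
    proof (rule sum.cong[OF refl])
      fix j assume j: "j \<in> {..<n}"
      have "e r ((j + n - i) mod n) * e r i = e r (j + n - i) * e r i"
        unfolding e_def using cis_mod[OF assms] by simp
      also have "\<dots> = e r (j + n)"
        using ir assms unfolding e_def cis_mult by (simp add: of_nat_diff field_simps)
      also have "\<dots> = e r ((j + n) mod n)" unfolding e_def by (rule cis_mod[OF assms, symmetric])
      also have "\<dots> = e r j" using j by simp
      finally show "of_real (c ((j + n - i) mod n)) * e r j =
        of_real (c ((j + n - i) mod n)) * (e r ((j + n - i) mod n) * e r i)" by simp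
    qed
    also have "\<dots> = (\<Sum>m<n. of_real (c m) * (e r m * e r i))"
    proof (rule sum.reindex_bij_witness[of _ "\<lambda>m. (m + i) mod n" "\<lambda>j. (j + n - i) mod n"])
      fix j assume j: "j \<in> {..<n}"
      have "((j + n - i) mod n + i) mod n = (j + n - i + i) mod n" by (rule mod_add_left_eq)
      then show "((j + n - i) mod n + i) mod n = j" using ir j by simp
    next
      fix m assume m: "m \<in> {..<n}"
      have "((m + i) mod n + n - i) mod n = ((m + i) mod n + (n - i)) mod n" using ir by simp
      also have "\<dots> = (m + i + (n - i)) mod n" by (rule mod_add_left_eq)
      finally show "((m + i) mod n + n - i) mod n = m" using ir m by simp
    qed (use assms in auto)
    also have "\<dots> = e r i * circulant_eigenvalue n c r"
      unfolding circulant_eigenvalue_cis e_def by (simp add: sum_distrib_left mult_ac)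
    also have "\<dots> = (P * D) $$ (i, r)"
    proof -
      have "(P * D) $$ (i, r) = (\<Sum>s<n. e s i * (if s = r then circulant_eigenvalue n c s else 0))"
        using ir unfolding P_def D_def by (simp add: scalar_prod_def atLeast0LessThan)
      also have "\<dots> = (\<Sum>s<n. if s = r then e s i * circulant_eigenvalue n c s else 0)"
        by (rule sum.cong) auto
      finally show ?thesis using ir by simp
    qed
    finally show "(?A * P) $$ (i, r) = (P * D) $$ (i, r)" .
  qed (use carr in auto)
  have "?A = ?A * (P * Q)" using carr PQ by simp
  also have "\<dots> = P * D * Q" using carr AP by (metis assoc_mult_mat)
  finally have "similar_mat ?A D"
    unfolding similar_mat_def similar_mat_wit_def Let_def using carr PQ QP by (metis carrier_matD(1) insert_subset empty_subsetI)
  then have "char_poly ?A = char_poly D" by (rule char_poly_similar)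
  also have "\<dots> = (\<Prod>a\<leftarrow>diag_mat D. [:- a, 1:])"
    by (rule char_poly_upper_triangular[OF carr(3)]) (auto simp: upper_triangular_def D_def)
  also have "diag_mat D = map (circulant_eigenvalue n c) [0..<n]"
    unfolding diag_mat_def D_def by (auto intro!: map_cong)
  finally show ?thesis by (simp add: comp_def)
qed

end

theory Submission
  imports Defs "HOL-Real_Asymp.Real_Asymp"
begin

text \<open>
  The limit processes have continuous paths. At such a path a \<open>J\<^sub>1\<close>-continuous functional is
  determined by countably many lower bounds on uniform balls around step functions, so weak
  convergence follows from convergence of the finite-dimensional distributions together with a
  uniform modulus estimate on grids.

  Conditionally on the clock and on \<open>U\<^sub>n = r\<close>, an increment of the eigenvalue process is a sum of
  independent variables weighted by \<open>cos (2 \<pi> r j / n)\<close> and \<open>sin (2 \<pi> r j / n)\<close>. For \<open>r \<notin> {0, n / 2}\<close>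
  these weights are orthogonal with equal norms, so a third-moment expansion of the characteristic
  function yields independent centred Gaussian increments whose variance is the increment of the
  clock; the exceptional \<open>r\<close> have probability at most \<open>2 / n\<close>. The modulus estimate is a
  fourth-moment maximal inequality on the blocks of the grid.

  The rescaled clock \<open>N (L (n t)) / n\<^sup>\<alpha>\<close> is uniformly close to \<open>L (n t) / n\<^sup>\<alpha>\<close> by Chebyshev's
  inequality and monotonicity, and the latter has the finite-dimensional distributions of \<open>L\<close>
  because the stable subordinator is self-similar.
\<close>

section \<open>Measurability in the Skorokhod space\<close>

text \<open>A lower bound in the limit is enough: applied to \<open>f + B\<close> and to
  \<open>B - f\<close> it gives both inequalities, so only minorants of functionals are constructed.
  The fourth moment enters tightness because it bounds the oscillation over a block by the square of
  the clock increment; summed over the grid these squares tend to the quadratic variation of a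
  continuous monotone path, which is zero. For characteristic functions the third moment controls
  the error: about n c(n) variables enter, each with weight of order (n c(n))^(-1/2), so the
  third-order errors add up to order (n c(n))^(-1/2). The squared cosines and the squared sines each
  sum to n / 2; this is the factor sqrt 2 in complex Brownian motion. Conditioning is done by Fubini
  on a countable variable: the prelimit clocks are natural numbers seen on a finite grid. The limit
  clock is real, so its grid values are first rounded to a lattice, and continuity of Brownian paths
  removes the rounding. Both limits are instances of one locale in which the clock and its
  normalisation are free.\<close>

text \<open>Cuts [a, c) into finitely many half-open pieces, half-open because a cadlag path may
  jump where a piece ends. The inductive form lets \<open>time_change_on_partition\<close> build its
  time change one piece at a time.\<close>

inductive osc_partition :: "(real \<Rightarrow> 'b::metric_space) \<Rightarrow> real \<Rightarrow> real \<Rightarrow> real \<Rightarrow> bool" for x e where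
  refl: "osc_partition x e a a"
| step: "osc_partition x e a b \<Longrightarrow> b < c \<Longrightarrow> (\<And>s. s \<in> {b..<c} \<Longrightarrow> dist (x s) (x b) \<le> e) \<Longrightarrow>
    osc_partition x e a c"

lemma osc_partition_trans:
  assumes "osc_partition x e b c" "osc_partition x e a b"
  shows "osc_partition x e a c"
  using assms by (induction) (auto intro: osc_partition.step)

text \<open>Compactness of [0, T] in the form of \<open>Bolzano\<close>: near each t one piece
  ending at t and one starting at t suffice, by the left limit and by right continuity. Two points
  left of t are compared through the left limit, at a cost of e / 2 each.\<close>

lemma cadlag_osc_partition:
  assumes x: "cadlag x" and e: "e > 0" and T: "0 \<le> T"
  shows "osc_partition x e 0 T"
proof -
  \<comment> \<open>\<open>cadlag\<close> speaks of times from 0 on, while \<open>Bolzano\<close>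
    also offers intervals that reach left of 0; hence the guard.\<close>
  define P where "P a b \<longleftrightarrow> (0 \<le> a \<longrightarrow> osc_partition x e a b)" for a b
  have "P 0 T"
    using T
  proof (induction rule: Bolzano)
    case (trans a b c)
    then show ?case using osc_partition_trans unfolding P_def by fastforce
  next
    case (local t)
    have "(x \<longlongrightarrow> x t) (at_right t)" using x local by (auto simp: cadlag_def)
    then have "\<forall>\<^sub>F s in at_right t. dist (x s) (x t) < e" using e by (rule tendstoD)
    then obtain r where r: "r > t" "\<And>s. t < s \<Longrightarrow> s < r \<Longrightarrow> dist (x s) (x t) < e"
      by (auto simp: eventually_at_right_field)
    have "\<exists>q<t. \<forall>u s. q < u \<longrightarrow> 0 \<le> u \<longrightarrow> u < t \<longrightarrow> u \<le> s \<longrightarrow> s < t \<longrightarrow> dist (x s) (x u) \<le> e"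
    proof (cases "t > 0")
      case True
      then obtain l where "(x \<longlongrightarrow> l) (at_left t)" using x by (auto simp: cadlag_def)
      then have "\<forall>\<^sub>F s in at_left t. dist (x s) l < e / 2" using e by (intro tendstoD) auto
      then obtain q where q: "q < t" "\<And>s. q < s \<Longrightarrow> s < t \<Longrightarrow> dist (x s) l < e / 2"
        by (auto simp: eventually_at_left_field)
      have "dist (x s) (x u) \<le> e" if "q < u" "u < t" "u \<le> s" "s < t" for u s
        using q(2)[of u] q(2)[of s] that dist_triangle2[of "x s" "x u" l] by auto
      with q(1) show ?thesis by blast
    qed (use local in \<open>auto intro!: exI[of _ "t - 1"]\<close>)
    then obtain q where q: "q < t" "\<And>u s. q < u \<Longrightarrow> 0 \<le> u \<Longrightarrow> u < t \<Longrightarrow> u \<le> s \<Longrightarrow> s < t \<Longrightarrow> dist (x s) (x u) \<le> e"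
      by blast
    show ?case unfolding P_def
    proof (intro exI[of _ "min (r - t) (t - q)"] conjI allI impI)
      show "min (r - t) (t - q) > 0" using r q by simp
      fix a b assume ab: "a \<le> t \<and> t \<le> b \<and> b - a < min (r - t) (t - q)" "0 \<le> a"
      have 1: "osc_partition x e a t"
      proof (cases "a = t")
        case False
        then show ?thesis using ab by (intro osc_partition.step[OF osc_partition.refl]) (auto intro!: q)
      qed (auto intro: osc_partition.refl)
      show "osc_partition x e a b"
      proof (cases "b = t")
        case False
        have "dist (x s) (x t) \<le> e" if "s \<in> {t..<b}" for s
          using r(2)[of s] ab that e by (cases "s = t") auto
        then show ?thesis using ab False by (intro osc_partition.step[OF 1]) auto
      qed (use 1 in auto)
    qed
  qed
  then show ?thesis by (simp add: P_def)
qed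

section \<open>Approximation of cadlag paths by step functions on a grid\<close>

definition discretize :: "nat \<Rightarrow> (nat \<Rightarrow> 'b) \<Rightarrow> real \<Rightarrow> 'b" where
  "discretize m a = (\<lambda>t\<in>{0..}. a (nat \<lfloor>real m * t\<rfloor>))"

lemma floor_mult_at_right:
  fixes t :: real
  assumes "m > 0" shows "\<forall>\<^sub>F s in at_right t. \<lfloor>real m * s\<rfloor> = \<lfloor>real m * t\<rfloor>"
proof -
  have "real m * t < \<lfloor>real m * t\<rfloor> + 1" by linarith
  then have "t < (\<lfloor>real m * t\<rfloor> + 1) / real m" using assms by (simp add: field_simps)
  then have "\<forall>\<^sub>F s in at_right t. s < (\<lfloor>real m * t\<rfloor> + 1) / real m \<and> t < s"
    by (auto simp: eventually_at_right_field)
  then show ?thesis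
  proof eventually_elim
    case (elim s)
    then have 1: "real m * s < \<lfloor>real m * t\<rfloor> + 1" "real m * t \<le> real m * s"
      using assms by (auto simp: field_simps)
    show ?case
      by (rule floor_unique) (use 1 of_int_floor_le[of "real m * t"] in linarith)+
  qed
qed

lemma floor_mult_at_left:
  fixes t :: real
  assumes "m > 0" shows "\<forall>\<^sub>F s in at_left t. \<lfloor>real m * s\<rfloor> = \<lceil>real m * t\<rceil> - 1"
proof -
  have "t > (\<lceil>real m * t\<rceil> - 1) / real m" using assms by (simp add: field_simps) linarith
  then have "\<forall>\<^sub>F s in at_left t. s > (\<lceil>real m * t\<rceil> - 1) / real m \<and> s < t"
    by (auto simp: eventually_at_left_field)
  then show ?thesis
  proof eventually_elim
    case (elim s)
    then have 1: "real m * s > \<lceil>real m * t\<rceil> - 1" "real m * s < real m * t"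
      using assms by (auto simp: field_simps)
    show ?case
      by (rule floor_unique) (use 1 le_of_int_ceiling[of "real m * t"] in \<open>simp; linarith\<close>)+
  qed
qed

lemma cadlag_cong:
  assumes "\<And>t. t \<ge> 0 \<Longrightarrow> x t = y t" shows "cadlag x \<longleftrightarrow> cadlag y"
proof -
  have "(x \<longlongrightarrow> x t) (at_right t) \<longleftrightarrow> (y \<longlongrightarrow> y t) (at_right t)" if "t \<ge> 0" for t
  proof -
    have "\<forall>\<^sub>F s in at_right t. x s = y s"
      using that assms by (auto simp: eventually_at_right_field intro!: exI[of _ "t + 1"])
    then show ?thesis using assms[OF that] tendsto_cong by metis
  qed
  moreover have "(x \<longlongrightarrow> l) (at_left t) \<longleftrightarrow> (y \<longlongrightarrow> l) (at_left t)" if "t > 0" for t l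
  proof -
    have "\<forall>\<^sub>F s in at_left t. x s = y s"
      using that assms by (auto simp: eventually_at_left_field intro!: exI[of _ 0])
    then show ?thesis by (rule tendsto_cong)
  qed
  ultimately show ?thesis by (auto simp: cadlag_def)
qed

lemma sample_path_in_skorokhod_space:
  "cadlag (\<lambda>t. Y t \<omega>) \<Longrightarrow> sample_path Y \<omega> \<in> skorokhod_space"
  using cadlag_cong[of "sample_path Y \<omega>" "\<lambda>t. Y t \<omega>"]
  by (auto simp: skorokhod_space_def sample_path_def)

lemma discretize_in_skorokhod_space:
  assumes "m > 0" shows "discretize m a \<in> skorokhod_space"
proof -
  have "cadlag (\<lambda>t. a (nat \<lfloor>real m * t\<rfloor>))"
    unfolding cadlag_def
  proof (intro conjI allI impI exI)
    fix t :: real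
    show "((\<lambda>t. a (nat \<lfloor>real m * t\<rfloor>)) \<longlongrightarrow> a (nat \<lfloor>real m * t\<rfloor>)) (at_right t)"
      by (rule tendsto_eventually, rule eventually_mono[OF floor_mult_at_right[OF assms]]) simp
    show "((\<lambda>t. a (nat \<lfloor>real m * t\<rfloor>)) \<longlongrightarrow> a (nat (\<lceil>real m * t\<rceil> - 1))) (at_left t)"
      by (rule tendsto_eventually, rule eventually_mono[OF floor_mult_at_left[OF assms]]) simp
  qed
  then show ?thesis using cadlag_cong[of "discretize m a" "\<lambda>t. a (nat \<lfloor>real m * t\<rfloor>)"]
    by (auto simp: skorokhod_space_def discretize_def)
qed

text \<open>Each break point b moves to the next grid point \<lceil>m b\<rceil> / m, with linear
  interpolation in between. Rounding up is what makes it work: for t in the piece [b, c) the index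
  \<lfloor>m (l t)\<rfloor> lies between \<lceil>m b\<rceil> and \<lceil>m c\<rceil> - 1, so that
  the grid point below l t is again in [b, c). Both values of x are then within e of x b, which
  gives 2 * e. The mesh must be smaller than every piece, or two break points could collide.\<close>

lemma time_change_on_partition:
  assumes "osc_partition x e 0 T" "e \<ge> 0"
  shows "\<forall>\<^sub>F m in sequentially. \<exists>l. strict_mono_on {0..T} l \<and> l ` {0..T} = {0..\<lceil>real m * T\<rceil> / real m} \<and>
    (\<forall>t\<in>{0..T}. t \<le> l t \<and> l t \<le> t + 1 / real m) \<and> l 0 = 0 \<and> l T = \<lceil>real m * T\<rceil> / real m \<and>
    (\<forall>t\<in>{0..<T}. dist (x (real (nat \<lfloor>real m * l t\<rfloor>) / real m)) (x t) \<le> 2 * e)"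
proof -
  have "osc_partition x e a T \<Longrightarrow> a = 0 \<Longrightarrow> e \<ge> 0 \<Longrightarrow> T \<ge> 0 \<and> (\<forall>\<^sub>F m in sequentially.
    \<exists>l. strict_mono_on {0..T} l \<and> l ` {0..T} = {0..\<lceil>real m * T\<rceil> / real m} \<and>
    (\<forall>t\<in>{0..T}. t \<le> l t \<and> l t \<le> t + 1 / real m) \<and> l 0 = 0 \<and> l T = \<lceil>real m * T\<rceil> / real m \<and>
    (\<forall>t\<in>{0..<T}. dist (x (real (nat \<lfloor>real m * l t\<rfloor>) / real m)) (x t) \<le> 2 * e))" for a
  proof (induction rule: osc_partition.induct)
    case (refl a)
    then show ?case by (auto intro!: always_eventually exI[of _ "\<lambda>t. t"] simp: strict_mono_on_def)
  next
    case (step a b c)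
    then have b0: "b \<ge> 0" by auto
    obtain m0 :: nat where m0: "1 / real (Suc m0) < c - b"
      using nat_approx_posE[of "c - b"] step.hyps by auto
    from step have "\<forall>\<^sub>F m in sequentially. \<exists>l. strict_mono_on {0..b} l \<and> l ` {0..b} = {0..\<lceil>real m * b\<rceil> / real m} \<and>
      (\<forall>t\<in>{0..b}. t \<le> l t \<and> l t \<le> t + 1 / real m) \<and> l 0 = 0 \<and> l b = \<lceil>real m * b\<rceil> / real m \<and>
      (\<forall>t\<in>{0..<b}. dist (x (real (nat \<lfloor>real m * l t\<rfloor>) / real m)) (x t) \<le> 2 * e)" by auto
    then have "\<forall>\<^sub>F m in sequentially.
    \<exists>l. strict_mono_on {0..c} l \<and> l ` {0..c} = {0..\<lceil>real m * c\<rceil> / real m} \<and>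
    (\<forall>t\<in>{0..c}. t \<le> l t \<and> l t \<le> t + 1 / real m) \<and> l 0 = 0 \<and> l c = \<lceil>real m * c\<rceil> / real m \<and>
    (\<forall>t\<in>{0..<c}. dist (x (real (nat \<lfloor>real m * l t\<rfloor>) / real m)) (x t) \<le> 2 * e)"
      using eventually_ge_at_top[of "Suc m0"]
    proof eventually_elim
      case (elim m)
      then have m: "real m > 0" by auto
      have "1 / real m \<le> 1 / real (Suc m0)" using elim by (intro divide_left_mono) auto
      then have mc: "1 / real m < c - b" using m0 by simp
      define sb where "sb = \<lceil>real m * b\<rceil> / real m"
      define sc where "sc = \<lceil>real m * c\<rceil> / real m"
      have mm: "real m * sb = \<lceil>real m * b\<rceil>" "real m * sc = \<lceil>real m * c\<rceil>" using m by (auto simp: sb_def sc_def)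
      have sb: "b \<le> sb" "sb \<le> b + 1 / real m" and sc: "c \<le> sc" "sc \<le> c + 1 / real m"
        unfolding sb_def sc_def using m
          le_of_int_ceiling[of "real m * b"] of_int_ceiling_le_add_one[of "real m * b"]
          le_of_int_ceiling[of "real m * c"] of_int_ceiling_le_add_one[of "real m * c"]
        by (simp_all add: pos_le_divide_eq pos_divide_le_eq distrib_left mult.commute[of _ "real m"])
      have less: "sb < sc" using sb sc mc by linarith
      from elim obtain l where l: "strict_mono_on {0..b} l" "l ` {0..b} = {0..sb}"
        "\<And>t. t\<in>{0..b} \<Longrightarrow> t \<le> l t \<and> l t \<le> t + 1 / real m" "l 0 = 0" "l b = sb"
        "\<And>t. t\<in>{0..<b} \<Longrightarrow> dist (x (real (nat \<lfloor>real m * l t\<rfloor>) / real m)) (x t) \<le> 2 * e"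
        unfolding sb_def by blast
      define k where "k t = sb + (t - b) * ((sc - sb) / (c - b))" for t
      define l' where "l' t = (if t \<le> b then l t else k t)" for t
      have kb: "k b = sb" "k c = sc" using step.hyps by (auto simp: k_def)
      have slope: "(sc - sb) / (c - b) > 0" using less step.hyps by simp
      have kmono: "k s < k t" if "s < t" for s t
        unfolding k_def using mult_strict_right_mono[OF _ slope, of "s - b" "t - b"] that by simp
      have l'k: "l' t = k t" if "t \<ge> b" for t using that l(5) kb by (auto simp: l'_def)
      have lb: "l t \<le> sb" if "t \<in> {0..b}" for t using l(2) that by auto
      have kimg: "k ` {b..c} = {sb..sc}"
      proof
        show "k ` {b..c} \<subseteq> {sb..sc}" using kmono kb by (fastforce simp: le_less)
        show "{sb..sc} \<subseteq> k ` {b..c}"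
        proof
          fix y assume y: "y \<in> {sb..sc}"
          define t where "t = b + (y - sb) / ((sc - sb) / (c - b))"
          have "k t = y" unfolding t_def k_def using slope less step.hyps by simp
          moreover have "t \<in> {b..c}" using kmono kb y \<open>k t = y\<close>
            by (metis atLeastAtMost_iff linorder_not_less)
          ultimately show "y \<in> k ` {b..c}" by blast
        qed
      qed
      have smono: "strict_mono_on {0..c} l'"
      proof (rule strict_mono_onI)
        fix s t assume st: "s \<in> {0..c}" "t \<in> {0..c}" "s < t"
        consider "t \<le> b" | "s \<ge> b" | "s < b" "b < t" by linarith
        then show "l' s < l' t"
        proof cases
          case 1
          then show ?thesis using st l(1) by (auto simp: l'_def strict_mono_on_def)
        next
          case 2
          then show ?thesis using st kmono l'k by auto
        next
          case 3
          then have "l' s \<le> sb" using lb st by (auto simp: l'_def)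
          also have "sb < l' t" using 3 kmono[of b t] kb by (auto simp: l'_def)
          finally show ?thesis .
        qed
      qed
      moreover have "l' ` {0..c} = {0..sc}"
      proof -
        have "{0..c} = {0..b} \<union> {b..c}" using b0 step.hyps by auto
        then have "l' ` {0..c} = l' ` {0..b} \<union> l' ` {b..c}" by auto
        also have "l' ` {0..b} = {0..sb}" using l(2) by (auto simp: l'_def)
        also have "l' ` {b..c} = {sb..sc}" using l'k kimg by (metis (no_types, lifting) atLeastAtMost_iff image_cong)
        finally show ?thesis using less b0 sb by auto
      qed
      moreover have "t \<le> l' t \<and> l' t \<le> t + 1 / real m" if t: "t \<in> {0..c}" for t
      proof (cases "t \<le> b")
        case False
        \<comment> \<open>The displacement of t is the convex combination, with weights 1 - w and w,
          of the displacements of b and c, and both of these lie between 0 and 1 / m.\<close>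
        define w where "w = (t - b) / (c - b)"
        have w: "0 \<le> w" "w \<le> 1" "t = b + w * (c - b)" using False t step.hyps by (auto simp: w_def field_simps)
        have "k t = sb + w * (sc - sb)" by (simp add: k_def w_def)
        then have "k t - t = (1 - w) * (sb - b) + w * (sc - c)"
          by (subst w(3)) (simp add: algebra_simps)
        moreover have "(1 - w) * (sb - b) + w * (sc - c) \<le> (1 - w) * (1 / real m) + w * (1 / real m)"
          using w sb sc by (intro add_mono mult_left_mono) auto
        moreover have "(1 - w) * (1 / real m) + w * (1 / real m) = 1 / real m" by (simp add: diff_divide_distrib)
        moreover have "(1 - w) * (sb - b) + w * (sc - c) \<ge> 0" using w sb sc by simp
        ultimately show ?thesis using False by (auto simp: l'_def)
      qed (use t l(3) in \<open>auto simp: l'_def\<close>)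
      moreover have "l' 0 = 0" using b0 l by (auto simp: l'_def)
      moreover have "l' c = sc" using l'k kb step.hyps by auto
      moreover have "dist (x (real (nat \<lfloor>real m * l' t\<rfloor>) / real m)) (x t) \<le> 2 * e" if t: "t \<in> {0..<c}" for t
      proof (cases "t < b")
        case False
        then have "l' t \<in> {sb..<sc}" using kmono[of t c] kmono[of b t] kb t l'k[of t] by (cases "t = b") auto
        then have "\<lceil>real m * b\<rceil> \<le> real m * l' t" "real m * l' t < \<lceil>real m * c\<rceil>"
          using m by (auto simp: mm[symmetric])
        then have f: "\<lceil>real m * b\<rceil> \<le> \<lfloor>real m * l' t\<rfloor>" "\<lfloor>real m * l' t\<rfloor> \<le> \<lceil>real m * c\<rceil> - 1" by linarith+
        have "0 \<le> real m * b" using b0 m by simp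
        then have "\<lceil>real m * b\<rceil> \<ge> 0" by linarith
        then have "\<lfloor>real m * l' t\<rfloor> \<ge> 0" using f(1) by linarith
        then have r: "real (nat \<lfloor>real m * l' t\<rfloor>) = \<lfloor>real m * l' t\<rfloor>" by simp
        have "real m * b \<le> \<lfloor>real m * l' t\<rfloor>" using f(1) by linarith
        moreover have "\<lfloor>real m * l' t\<rfloor> < real m * c" using f(2) by linarith
        ultimately have "real (nat \<lfloor>real m * l' t\<rfloor>) / real m \<in> {b..<c}" unfolding r using m by (auto simp: field_simps)
        then have "dist (x (real (nat \<lfloor>real m * l' t\<rfloor>) / real m)) (x b) \<le> e" using step.hyps by blast
        moreover have "dist (x t) (x b) \<le> e" using step.hyps False t by auto
        ultimately show ?thesis using dist_triangle2[of "x (real (nat \<lfloor>real m * l' t\<rfloor>) / real m)" "x t" "x b"] by linarith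
      qed (use t l(6) in \<open>auto simp: l'_def\<close>)
      ultimately show ?case unfolding sc_def by (intro exI[of _ l']) blast
    qed
    then show ?case using b0 step.hyps by auto
  qed
  then show ?thesis using assms by auto
qed

lemma discretize_in_skorokhod_nbhd:
  assumes x: "x \<in> skorokhod_space" and e: "e > 0" and T: "T \<ge> 0"
  shows "\<forall>\<^sub>F m in sequentially. discretize m (\<lambda>i. x (real i / real m)) \<in> skorokhod_nbhd x T e"
proof -
  have cad: "cadlag x" using x by (simp add: skorokhod_space_def)
  obtain m0 :: nat where m0: "1 / real (Suc m0) < e / 2"
    using nat_approx_posE[of "e / 2"] e by auto
  \<comment> \<open>e / 4 becomes e / 2 in \<open>time_change_on_partition\<close>. The estimate
    there excludes the right end point, so the partition has to go past T.\<close>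
  have "osc_partition x (e / 4) 0 (T + 1)" using cadlag_osc_partition[OF cad, of "e/4" "T+1"] e T by auto
  from time_change_on_partition[OF this] eventually_ge_at_top[of "Suc m0"] e
  have "\<forall>\<^sub>F m in sequentially. m \<ge> Suc m0 \<and> (\<exists>l. strict_mono_on {0..T+1} l \<and> l ` {0..T+1} = {0..\<lceil>real m * (T+1)\<rceil> / real m} \<and>
    (\<forall>t\<in>{0..T+1}. t \<le> l t \<and> l t \<le> t + 1 / real m) \<and> l 0 = 0 \<and> l (T+1) = \<lceil>real m * (T+1)\<rceil> / real m \<and>
    (\<forall>t\<in>{0..<T+1}. dist (x (real (nat \<lfloor>real m * l t\<rfloor>) / real m)) (x t) \<le> 2 * (e/4)))"
    by (intro eventually_conj) auto
  then show ?thesis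
  proof eventually_elim
    case (elim m)
    define s where "s = \<lceil>real m * (T+1)\<rceil> / real m"
    have m: "real m > 0" and "m \<ge> Suc m0" using elim by auto
    then have "1 / real m \<le> 1 / real (Suc m0)" by (intro divide_left_mono) auto
    then have me: "1 / real m < e / 2" using m0 by simp
    from elim obtain l where l: "strict_mono_on {0..T+1} l" "l ` {0..T+1} = {0..s}"
      "\<And>t. t\<in>{0..T+1} \<Longrightarrow> t \<le> l t \<and> l t \<le> t + 1 / real m" "l 0 = 0" "l (T+1) = s"
      "\<And>t. t\<in>{0..<T+1} \<Longrightarrow> dist (x (real (nat \<lfloor>real m * l t\<rfloor>) / real m)) (x t) \<le> e / 2"
      unfolding s_def by auto
    \<comment> \<open>Past T + 1 the time change is a translation, with displacement at most 1 / m
      because l maps T + 1 to s.\<close>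
    define l' where "l' t = (if t \<le> T + 1 then l t else t + (s - (T+1)))" for t
    have sT: "T + 1 \<le> s" "s \<le> T + 1 + 1 / real m" using l(3)[of "T+1"] l(5) T by auto
    have smono: "strict_mono_on {0..} l'"
    proof (rule strict_mono_onI)
      fix u v :: real assume uv: "u \<in> {0..}" "v \<in> {0..}" "u < v"
      consider "v \<le> T+1" | "u > T+1" | "u \<le> T+1" "T+1 < v" by linarith
      then show "l' u < l' v"
      proof cases
        case 1
        then show ?thesis using uv l(1) by (auto simp: l'_def strict_mono_on_def)
      next
        case 3
        then have "l u \<le> s" using l(2) uv by auto
        then show ?thesis using 3 by (auto simp: l'_def)
      qed (use uv in \<open>auto simp: l'_def\<close>)
    qed
    have img: "l' ` {0..} = {0..}"
    proof -
      have "{0..} = {0..T+1} \<union> {T+1<..}" using T by auto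
      then have "l' ` {0..} = l' ` {0..T+1} \<union> l' ` {T+1<..}" by (metis image_Un)
      also have "l' ` {0..T+1} = {0..s}" using l(2) by (auto simp: l'_def)
      also have "l' ` {T+1<..} = {s<..}"
      proof
        show "l' ` {T + 1<..} \<subseteq> {s<..}" by (auto simp: l'_def)
        show "{s<..} \<subseteq> l' ` {T + 1<..}"
        proof
          fix y assume "y \<in> {s<..}"
          then show "y \<in> l' ` {T + 1<..}" by (intro image_eqI[of _ _ "y - (s - (T+1))"]) (auto simp: l'_def)
        qed
      qed
      finally show ?thesis using sT T by auto
    qed
    show ?case unfolding skorokhod_nbhd_def mem_Collect_eq
    proof (intro conjI bexI[of _ l'] exI[of _ "e / 2"] allI ballI impI)
      show "discretize m (\<lambda>i. x (real i / real m)) \<in> skorokhod_space"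
        using m by (intro discretize_in_skorokhod_space) auto
      show "e / 2 < e" using e by simp
      show "\<bar>l' t - t\<bar> \<le> e / 2" if "t \<ge> 0" for t
        using l(3)[of t] sT me that by (auto simp: l'_def)
      show "dist (discretize m (\<lambda>i. x (real i / real m)) (l' t)) (x t) \<le> e / 2" if "t \<in> {0..T}" for t
        using l(6)[of t] l(3)[of t] that T by (auto simp: l'_def discretize_def)
    qed (use smono img in \<open>auto simp: time_changes_def\<close>)
  qed
qed

section \<open>Symmetry and triangle property of the basic neighbourhoods\<close>

text \<open>The inverse time change may carry [0, T] past T, though by less than e; hence the longer
  horizon on the other side.\<close>

lemma skorokhod_nbhd_sym:
  assumes y: "y \<in> skorokhod_nbhd x (T + e) e" and x: "x \<in> skorokhod_space"
  shows "x \<in> skorokhod_nbhd y T e"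
proof -
  from y obtain l d where l: "l \<in> time_changes" and d: "d < e"
    and ld: "\<And>t. t \<ge> 0 \<Longrightarrow> \<bar>l t - t\<bar> \<le> d" and yd: "\<And>t. t \<in> {0..T+e} \<Longrightarrow> dist (y (l t)) (x t) \<le> d"
    unfolding skorokhod_nbhd_def by blast
  define k where "k = the_inv_into {0..} l"
  have inj: "inj_on l {0..}" and img: "l ` {0..} = {0..}"
    using l by (auto simp: time_changes_def intro: strict_mono_on_imp_inj_on)
  have kl: "l (k t) = t" and k0: "k t \<ge> 0" if "t \<ge> 0" for t
    using f_the_inv_into_f[OF inj, of t] the_inv_into_into[OF inj, of t "{0..}"] img that by (auto simp: k_def)
  have lk: "k (l t) = t" if "t \<ge> 0" for t
    using the_inv_into_f_f[OF inj, of t] that by (simp add: k_def)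
  have "k \<in> time_changes"
    unfolding time_changes_def
  proof (intro CollectI conjI strict_mono_onI)
    fix r s :: real assume rs: "r \<in> {0..}" "s \<in> {0..}" "r < s"
    show "k r < k s"
    proof (rule ccontr)
      assume "\<not> k r < k s"
      then have "l (k s) \<le> l (k r)" using l k0 rs
        by (cases "k s = k r") (auto simp: time_changes_def strict_mono_on_def less_imp_le)
      then show False using kl rs by auto
    qed
  next
    have "t \<in> k ` {0..}" if "t \<ge> 0" for t
      using lk[OF that] img that by (intro image_eqI[of _ _ "l t"]) auto
    then show "k ` {0..} = {0..}" using k0 by auto
  qed
  moreover have "\<bar>k t - t\<bar> \<le> d" if "t \<ge> 0" for t using ld[OF k0[OF that]] kl[OF that] by auto
  moreover have "dist (x (k t)) (y t) \<le> d" if "t \<in> {0..T}" for t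
  proof -
    have "k t \<in> {0..T+e}" using k0[of t] calculation(2)[of t] that d by auto
    then show ?thesis using yd[of "k t"] kl[of t] that by (auto simp: dist_commute)
  qed
  ultimately show ?thesis using x d unfolding skorokhod_nbhd_def by blast
qed

text \<open>The first time change may carry [0, T] almost as far as T + d, and up to there the
  second estimate must hold. Together with \<open>skorokhod_nbhd_sym\<close> this does the work of a
  metric.\<close>

lemma skorokhod_nbhd_trans:
  assumes "z \<in> skorokhod_nbhd y (T + d) d'" "y \<in> skorokhod_nbhd x T d"
  shows "z \<in> skorokhod_nbhd x T (d + d')"
proof -
  from assms(1) obtain k c where z: "z \<in> skorokhod_space" and k: "k \<in> time_changes" and c: "c < d'"
      and kc: "\<And>t. t \<ge> 0 \<Longrightarrow> \<bar>k t - t\<bar> \<le> c"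
      and zc: "\<And>t. t \<in> {0..T+d} \<Longrightarrow> dist (z (k t)) (y t) \<le> c"
      unfolding skorokhod_nbhd_def by blast
  from assms(2) obtain l b where l: "l \<in> time_changes" and b: "b < d"
    and lb: "\<And>t. t \<ge> 0 \<Longrightarrow> \<bar>l t - t\<bar> \<le> b" and yb: "\<And>t. t \<in> {0..T} \<Longrightarrow> dist (y (l t)) (x t) \<le> b"
    unfolding skorokhod_nbhd_def by blast
  have l0: "l t \<ge> 0" if "t \<ge> 0" for t using l that unfolding time_changes_def by auto
  have 1: "\<bar>k (l t) - t\<bar> \<le> b + c" if "t \<ge> 0" for t using kc[OF l0[OF that]] lb[OF that] by linarith
  have 2: "dist (z (k (l t))) (x t) \<le> b + c" if "t \<in> {0..T}" for t
    using zc[of "l t"] yb[OF that] l0[of t] lb[of t] that b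
      dist_triangle[of "z (k (l t))" "x t" "y (l t)"] by force
  show ?thesis unfolding skorokhod_nbhd_def mem_Collect_eq
    using z 1 2 b c time_change_compose[OF k l]
    by (intro conjI bexI[of _ "\<lambda>t. k (l t)"] exI[of _ "b + c"]) auto
qed

text \<open>Under the identity time change only the finitely many coordinates up to m T matter for a
  basic neighbourhood, so the product topology is fine enough. This is the link from J1-open sets to
  Borel sets of sequences.\<close>

lemma open_discretize_preimage:
  fixes U :: "(real \<Rightarrow> 'b::metric_space) set"
  assumes "openin skorokhod_topology U" "m > 0"
  shows "open {a. discretize m a \<in> U}"
proof (subst open_subopen, intro ballI)
  fix a assume "a \<in> {a. discretize m a \<in> U}"
  then obtain T e where Te: "T \<ge> 0" "e > 0" "skorokhod_nbhd (discretize m a) T e \<subseteq> U"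
    using assms(1) unfolding openin_skorokhod_topology by blast
  define V where "V = {b. \<forall>i\<in>{..nat \<lfloor>real m * T\<rfloor>}. b i \<in> ball (a i) (e / 2)}"
  have "open V" unfolding V_def by (rule product_topology_basis') auto
  moreover have "a \<in> V" using Te by (auto simp: V_def)
  moreover have "V \<subseteq> {a. discretize m a \<in> U}"
  proof
    fix b assume b: "b \<in> V"
    have "dist (discretize m b t) (discretize m a t) \<le> e / 2" if "t \<in> {0..T}" for t
    proof -
      have "nat \<lfloor>real m * t\<rfloor> \<le> nat \<lfloor>real m * T\<rfloor>" using that by (intro nat_mono floor_mono mult_left_mono) auto
      then have "b (nat \<lfloor>real m * t\<rfloor>) \<in> ball (a (nat \<lfloor>real m * t\<rfloor>)) (e/2)" using b by (auto simp: V_def)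
      then show ?thesis using that by (simp add: discretize_def dist_commute less_imp_le)
    qed
    then have "discretize m b \<in> skorokhod_nbhd (discretize m a) T e"
      unfolding skorokhod_nbhd_def using Te discretize_in_skorokhod_space[OF assms(2)] id_time_change
      by (auto intro!: bexI[of _ "\<lambda>t. t"] exI[of _ "e / 2"])
    then show "b \<in> {a. discretize m a \<in> U}" using Te by blast
  qed
  ultimately show "\<exists>T. open T \<and> a \<in> T \<and> T \<subseteq> {a. discretize m a \<in> U}" by blast
qed

text \<open>
  Since \<^term>\<open>skorokhod_topology\<close> is not known to be metrizable here, an open set is recovered from the
  discretizations of a path through the sets \<open>W k\<close> of points having a neighbourhood of uniform size \<open>1 / k\<close> in it.
\<close>

lemma sample_path_measurable:
  fixes Y :: "real \<Rightarrow> 'a \<Rightarrow> 'b::{metric_space, second_countable_topology}"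
  assumes Y: "\<And>t. t \<ge> 0 \<Longrightarrow> Y t \<in> borel_measurable M"
    and cad: "\<And>\<omega>. \<omega> \<in> space M \<Longrightarrow> cadlag (\<lambda>t. Y t \<omega>)"
  shows "sample_path Y \<in> M \<rightarrow>\<^sub>M skorokhod_borel"
  unfolding skorokhod_borel_def
proof (rule measurable_measure_of)
  show "{U. openin skorokhod_topology U} \<subseteq> Pow (skorokhod_space :: (real \<Rightarrow> 'b) set)"
    using openin_skorokhod_topology by auto
  show "sample_path Y \<in> space M \<rightarrow> skorokhod_space" by (auto intro!: sample_path_in_skorokhod_space cad)
  fix U :: "(real \<Rightarrow> 'b) set" assume "U \<in> {U. openin skorokhod_topology U}"
  then have U: "openin skorokhod_topology U" by simp
  define W where "W k = \<Union>{V. openin skorokhod_topology V \<and>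
    (\<forall>y\<in>V. skorokhod_nbhd y (real k) (1 / real (Suc k)) \<subseteq> U)}" for k
  define D where "D m \<omega> = discretize (Suc m) (\<lambda>i. Y (real i / real (Suc m)) \<omega>)" for m \<omega>
  have D_eq: "D m \<omega> = discretize (Suc m) (\<lambda>i. sample_path Y \<omega> (real i / real (Suc m)))" for m \<omega>
    by (simp add: D_def sample_path_def)
  have W: "openin skorokhod_topology (W k)" for k unfolding W_def by (rule openin_Union) auto
  have meas: "{\<omega> \<in> space M. D m \<omega> \<in> W k} \<in> sets M" for m k
  proof -
    have "(\<lambda>\<omega> i. Y (real i / real (Suc m)) \<omega>) \<in> borel_measurable M"
      by (intro measurable_coordinatewise_then_product Y) auto
    moreover have "{a. discretize (Suc m) a \<in> W k} \<in> sets borel"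
      using open_discretize_preimage[OF W] by auto
    ultimately have "(\<lambda>\<omega> i. Y (real i / real (Suc m)) \<omega>) -` {a. discretize (Suc m) a \<in> W k} \<inter> space M \<in> sets M"
      by (rule measurable_sets)
    then show ?thesis unfolding D_def by (simp add: vimage_def Int_def conj_commute)
  qed
  have conv: "\<forall>\<^sub>F m in sequentially. D m \<omega> \<in> skorokhod_nbhd (sample_path Y \<omega>) T e"
    if "\<omega> \<in> space M" "T \<ge> 0" "e > 0" for \<omega> T e
    using eventually_compose_filterlim[OF discretize_in_skorokhod_nbhd[OF
        sample_path_in_skorokhod_space[where Y=Y, OF cad[OF that(1)]] that(3,2)] filterlim_Suc]
    unfolding D_eq .
  have eq: "sample_path Y \<omega> \<in> U \<longleftrightarrow> (\<exists>k. \<exists>j. \<forall>m\<ge>j. D m \<omega> \<in> W k)" if w: "\<omega> \<in> space M" for \<omega>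
  proof
    let ?x = "sample_path Y \<omega>"
    have x: "?x \<in> skorokhod_space" using sample_path_in_skorokhod_space[where Y=Y, OF cad[OF w]] .
    assume "?x \<in> U"
    then obtain T e where Te: "T \<ge> 0" "e > 0" "skorokhod_nbhd ?x T e \<subseteq> U"
      using U unfolding openin_skorokhod_topology by blast
    obtain k0 :: nat where k0: "1 / real (Suc k0) < e / 2" using nat_approx_posE[of "e / 2"] Te by auto
    obtain k1 :: nat where k1: "T + e / 2 \<le> real k1" using real_arch_simple by blast
    define k where "k = max k0 k1"
    have "1 / real (Suc k) \<le> 1 / real (Suc k0)" unfolding k_def by (intro divide_left_mono) auto
    then have k: "1 / real (Suc k) \<le> e / 2" "T + e / 2 \<le> real k" using k0 k1 by (auto simp: k_def)
    have "skorokhod_nbhd y (real k) (1 / real (Suc k)) \<subseteq> U" if "y \<in> skorokhod_nbhd ?x T (e/2)" for y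
    proof
      fix z assume "z \<in> skorokhod_nbhd y (real k) (1 / real (Suc k))"
      then have "z \<in> skorokhod_nbhd y (T + e/2) (e/2)" using skorokhod_nbhd_mono[OF k(2,1)] by blast
      from skorokhod_nbhd_trans[OF this that] show "z \<in> U" using Te by auto
    qed
    then have "skorokhod_nbhd ?x T (e/2) \<subseteq> W k" unfolding W_def using openin_skorokhod_nbhd[of ?x T "e/2"] by (intro Union_upper) simp
    moreover have "\<forall>\<^sub>F m in sequentially. D m \<omega> \<in> skorokhod_nbhd ?x T (e/2)"
      using conv[OF w] Te by auto
    ultimately have "\<forall>\<^sub>F m in sequentially. D m \<omega> \<in> W k" by (auto elim: eventually_mono)
    then show "\<exists>k. \<exists>j. \<forall>m\<ge>j. D m \<omega> \<in> W k" unfolding eventually_sequentially by (rule exI)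
  next
    assume "\<exists>k. \<exists>j. \<forall>m\<ge>j. D m \<omega> \<in> W k"
    then obtain k where "\<forall>\<^sub>F m in sequentially. D m \<omega> \<in> W k" unfolding eventually_sequentially by (rule exE)
    \<comment> \<open>The horizon exceeds k by the radius, which is what
      \<open>skorokhod_nbhd_sym\<close> loses.\<close>
    moreover have "\<forall>\<^sub>F m in sequentially. D m \<omega> \<in> skorokhod_nbhd (sample_path Y \<omega>) (real k + 1 / real (Suc k)) (1 / real (Suc k))"
      by (rule conv[OF w]) auto
    ultimately have "\<forall>\<^sub>F m in sequentially. sample_path Y \<omega> \<in> U"
    proof eventually_elim
      case (elim m)
      have "sample_path Y \<omega> \<in> skorokhod_nbhd (D m \<omega>) (real k) (1 / real (Suc k))"
        by (rule skorokhod_nbhd_sym[OF elim(2) sample_path_in_skorokhod_space[where Y=Y, OF cad[OF w]]])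
      moreover obtain V where "D m \<omega> \<in> V" "\<forall>y\<in>V. skorokhod_nbhd y (real k) (1 / real (Suc k)) \<subseteq> U"
        using elim(1) unfolding W_def by auto
      ultimately show ?case by (meson subsetD)
    qed
    then show "sample_path Y \<omega> \<in> U" by simp
  qed
  have "sample_path Y -` U \<inter> space M = {\<omega> \<in> space M. \<exists>k. \<exists>j. \<forall>m. m \<ge> j \<longrightarrow> D m \<omega> \<in> W k}"
    using eq by auto
  also have "\<dots> \<in> sets M"
    by (intro sets.sets_Collect_countable_Ex sets.sets_Collect_countable_All sets.sets_Collect_imp
        sets.sets_Collect_const meas)
  finally show "sample_path Y -` U \<inter> space M \<in> sets M" .
qed

lemma skorokhod_version_exists:
  fixes Y :: "real \<Rightarrow> 'a \<Rightarrow> 'b::{metric_space, second_countable_topology}"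
  assumes Y: "\<And>t. t \<ge> 0 \<Longrightarrow> Y t \<in> borel_measurable M"
    and cad: "AE \<omega> in M. cadlag (\<lambda>t. Y t \<omega>)"
  shows "\<exists>R. skorokhod_version M Y R"
proof -
  from cad obtain N where N: "N \<in> null_sets M" "{\<omega> \<in> space M. \<not> cadlag (\<lambda>t. Y t \<omega>)} \<subseteq> N"
    unfolding eventually_ae_filter by blast
  \<comment> \<open>A constant path is cadlag, so after the change on the null set every path is, as
    \<open>sample_path_measurable\<close> demands.\<close>
  define Y0 where "Y0 t \<omega> = (if \<omega> \<in> N then undefined else Y t \<omega>)" for t \<omega>
  have "Y0 t \<in> borel_measurable M" if "t \<ge> 0" for t
    unfolding Y0_def using N Y[OF that] by (intro measurable_If) auto
  moreover have "cadlag (\<lambda>t. Y0 t \<omega>)" if "\<omega> \<in> space M" for \<omega>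
  proof (cases "\<omega> \<in> N")
    case True
    then show ?thesis unfolding Y0_def cadlag_def by auto
  next
    case False
    then have "cadlag (\<lambda>t. Y t \<omega>)" using that N by blast
    then show ?thesis using False by (simp add: Y0_def)
  qed
  ultimately have "sample_path Y0 \<in> M \<rightarrow>\<^sub>M skorokhod_borel" by (rule sample_path_measurable)
  moreover have "AE \<omega> in M. sample_path Y0 \<omega> = sample_path Y \<omega>"
    using AE_not_in[OF N(1)] by eventually_elim (auto simp: sample_path_def Y0_def)
  ultimately show ?thesis unfolding skorokhod_version_def by blast
qed

section \<open>A criterion for weak convergence to a continuous process\<close>

text \<open>The values are given as a list of pairs of rationals so that the indices in
  \<open>ball_index\<close> form a countable type, which \<open>from_nat\<close> enumerates.\<close>

definition grid_step :: "nat \<Rightarrow> (rat \<times> rat) list \<Rightarrow> real \<Rightarrow> complex" where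
  "grid_step m zs t =
     (let i = nat \<lfloor>real m * t\<rfloor> in
      if i < length zs then Complex (of_rat (fst (zs ! i))) (of_rat (snd (zs ! i))) else 0)"

lemma complex_rat_approx:
  assumes "d > 0" shows "\<exists>q. cmod (z - Complex (of_rat (fst q)) (of_rat (snd q))) < d"
proof -
  obtain a where a: "Re z - d / 2 < real_of_rat a" "real_of_rat a < Re z"
    using of_rat_dense[of "Re z - d/2" "Re z"] assms by auto
  obtain b where b: "Im z - d / 2 < real_of_rat b" "real_of_rat b < Im z"
    using of_rat_dense[of "Im z - d/2" "Im z"] assms by auto
  have "cmod (z - Complex (of_rat a) (of_rat b)) \<le> \<bar>Re z - of_rat a\<bar> + \<bar>Im z - of_rat b\<bar>"
    using cmod_le[of "z - Complex (of_rat a) (of_rat b)"] by simp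
  also have "\<dots> < d" using a b by linarith
  finally show ?thesis by (intro exI[of _ "(a, b)"]) simp
qed

lemma floor_grid:
  assumes "m > 0" "0 \<le> (t::real)" "t \<le> real T"
  shows "nat \<lfloor>real m * t\<rfloor> \<le> m * T" "real (nat \<lfloor>real m * t\<rfloor>) / real m \<le> t"
    "t < real (nat \<lfloor>real m * t\<rfloor>) / real m + 1 / real m"
proof -
  have nn: "real m * t \<ge> 0" using assms by simp
  then have r: "real (nat \<lfloor>real m * t\<rfloor>) = \<lfloor>real m * t\<rfloor>" by simp
  have "real m * t \<le> real m * real T" using assms by (intro mult_left_mono) auto
  then have "real (nat \<lfloor>real m * t\<rfloor>) \<le> real (m * T)" unfolding r by simp linarith
  then show "nat \<lfloor>real m * t\<rfloor> \<le> m * T" by (metis of_nat_le_iff)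
  have "\<lfloor>real m * t\<rfloor> \<le> real m * t" "real m * t < \<lfloor>real m * t\<rfloor> + 1" by linarith+
  then show "real (nat \<lfloor>real m * t\<rfloor>) / real m \<le> t" "t < real (nat \<lfloor>real m * t\<rfloor>) / real m + 1 / real m"
    unfolding r using assms by (simp_all add: pos_divide_le_eq pos_less_divide_eq mult.commute flip: add_divide_distrib)
qed

lemma grid_step_approx:
  assumes x: "continuous_on {0..} x" and d: "d > 0"
  shows "\<exists>m zs. m > 0 \<and> (\<forall>t\<in>{0..real T}. cmod (x t - grid_step m zs t) < d)"
proof -
  have "uniformly_continuous_on {0..real T} x"
    by (intro compact_uniformly_continuous continuous_on_subset[OF x]) auto
  then obtain r where r: "r > 0" "\<And>s t. s \<in> {0..real T} \<Longrightarrow> t \<in> {0..real T} \<Longrightarrow> dist s t < r \<Longrightarrow> dist (x s) (x t) < d / 2"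
    unfolding uniformly_continuous_on_def using d by (meson half_gt_zero)
  obtain m0 where m0: "1 / real (Suc m0) < r" using nat_approx_posE[OF r(1)] by auto
  define m where "m = Suc m0"
  have "\<forall>i. \<exists>q. cmod (x (real i / real m) - Complex (of_rat (fst q)) (of_rat (snd q))) < d / 2"
    using complex_rat_approx[of "d/2"] d by simp
  from choice[OF this] obtain q where
    q: "\<And>i. cmod (x (real i / real m) - Complex (of_rat (fst (q i))) (of_rat (snd (q i)))) < d / 2" by blast
  \<comment> \<open>The last of the m * T + 1 entries is for t = T, whose index is m * T.\<close>
  define zs where "zs = map q [0..<m * T + 1]"
  have "cmod (x t - grid_step m zs t) < d" if t: "t \<in> {0..real T}" for t
  proof -
    define i where "i = nat \<lfloor>real m * t\<rfloor>"
    have i: "i \<le> m * T" "real i / real m \<le> t" "t < real i / real m + 1 / real m"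
      using floor_grid[of m t T] t unfolding i_def m_def by auto
    have "grid_step m zs t = Complex (of_rat (fst (q i))) (of_rat (snd (q i)))"
      unfolding grid_step_def i_def[symmetric] Let_def zs_def using i(1) by (simp del: upt_Suc)
    then have "cmod (x (real i / real m) - grid_step m zs t) < d / 2" using q[of i] by simp
    moreover have "dist (x t) (x (real i / real m)) < d / 2"
      using i t m0 by (intro r) (auto simp: m_def dist_real_def)
    ultimately show ?thesis
      using norm_triangle_ineq[of "x t - x (real i / real m)" "x (real i / real m) - grid_step m zs t"]
      by (simp add: dist_norm)
  qed
  then show ?thesis by (intro exI[of _ m] exI[of _ zs]) (auto simp: m_def)
qed

text \<open>Floors nest: \<lfloor>\<lfloor>N t\<rfloor> / k\<rfloor> = \<lfloor>N t / k\<rfloor>, so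
  rounding t down to the finer grid does not leave its cell of the coarser one. It allows finitely
  many step functions with different meshes to be tested on one common grid.\<close>

lemma grid_step_refine:
  assumes "m dvd N" "m > 0" "N > 0" "t \<ge> 0"
  shows "grid_step m zs (real (nat \<lfloor>real N * t\<rfloor>) / real N) = grid_step m zs t"
proof -
  obtain k where k: "N = m * k" using assms by blast
  have k0: "k > 0" using k assms by (cases k) auto
  have nn: "real N * t \<ge> 0" using assms by simp
  then have r: "real (nat \<lfloor>real N * t\<rfloor>) = \<lfloor>real N * t\<rfloor>" by simp
  have "\<lfloor>real m * (\<lfloor>real N * t\<rfloor> / real N)\<rfloor> = \<lfloor>\<lfloor>real N * t\<rfloor> / real k\<rfloor>"
    using assms k k0 by simp
  also have "\<dots> = \<lfloor>real N * t\<rfloor> div int k"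
    by (metis floor_divide_of_int_eq of_int_of_nat_eq)
  also have "\<dots> = \<lfloor>real N * t / real k\<rfloor>"
    by (metis floor_divide_real_eq_div of_int_of_nat_eq of_nat_0_le_iff)
  also have "real N * t / real k = real m * t" using k k0 by simp
  finally show ?thesis unfolding grid_step_def r by simp
qed

lemma continuous_imp_cadlag: "continuous_on {0..} x \<Longrightarrow> cadlag x" for x :: "real \<Rightarrow> 'b::metric_space"
  unfolding cadlag_def
proof (intro conjI allI impI)
  fix t :: real assume x: "continuous_on {0..} x"
  show "(x \<longlongrightarrow> x t) (at_right t)" if "0 \<le> t"
    using x that by (auto simp: continuous_on_def intro: tendsto_within_subset[of _ _ _ "{0..}"])
  assume t: "0 < t"
  have "(x \<longlongrightarrow> x t) (at t within {0..t})"
    using x t by (auto simp: continuous_on_def intro: tendsto_within_subset[of _ _ _ "{0..}"])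
  then show "\<exists>l. (x \<longlongrightarrow> l) (at_left t)" using t by (metis at_within_Icc_at_left)
qed

type_synonym ball_index = "nat \<times> nat \<times> nat \<times> rat \<times> (rat \<times> rat) list"

text \<open>
  An index \<open>(m, T, k, c, zs)\<close> stands for the bound \<open>f \<ge> c\<close> on the uniform ball of radius
  \<open>2 / (k + 1)\<close> over \<open>[0, T]\<close> around a step function. Countably many such bounds recover \<open>f\<close> at
  every continuous path, although the uniform topology on cadlag paths is not separable.
\<close>

fun lower_bound :: "((real \<Rightarrow> complex) \<Rightarrow> real) \<Rightarrow> ball_index \<Rightarrow> bool" where
  "lower_bound f (m, T, k, c, zs) \<longleftrightarrow> m > 0 \<and> 0 \<le> c \<and>
     (\<forall>y\<in>skorokhod_space. (\<forall>t\<in>{0..real T}. cmod (y t - grid_step m zs t) < 2 / real (Suc k)) \<longrightarrow> of_rat c \<le> f y)"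

text \<open>The identity is a time change, so a J1-neighbourhood of x contains a uniform ball of
  radius e. With 3 / (k + 1) < e it holds all paths within 2 / (k + 1) of a step function that is
  itself within 1 / (k + 1) of x; uniform continuity of x supplies the step function.\<close>

lemma lower_bound_exists:
  assumes f: "continuous_map skorokhod_topology euclideanreal f" and f0: "\<And>y. y \<in> skorokhod_space \<Longrightarrow> 0 \<le> f y"
    and x: "x \<in> skorokhod_space" "continuous_on {0..} x" and r: "r < f x"
  shows "\<exists>m T k c zs. lower_bound f (m, T, k, c, zs) \<and> r < of_rat c \<and>
    (\<forall>t\<in>{0..real T}. cmod (x t - grid_step m zs t) \<le> 1 / real (Suc k))"
proof -
  have "\<exists>c T e. r < of_rat c \<and> 0 \<le> c \<and> T \<ge> 0 \<and> e > 0 \<and> (\<forall>y\<in>skorokhod_nbhd x T e. of_rat c \<le> f y)"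
  \<comment> \<open>The bound c has to be nonnegative; for negative r the trivial bound c = 0 will
    do.\<close>
  proof (cases "r < 0")
    case True
    then show ?thesis using f0 by (intro exI[of _ 0] exI[of _ "1::real"]) (auto simp: skorokhod_nbhd_def)
  next
    case False
    obtain c where c: "r < of_rat c" "of_rat c < f x" using of_rat_dense[OF r] by auto
    have "openin skorokhod_topology {y \<in> topspace skorokhod_topology. f y \<in> {of_rat c<..}}"
      using f by (rule openin_continuous_map_preimage) auto
    then obtain T e where "T \<ge> 0" "e > 0" "skorokhod_nbhd x T e \<subseteq> {y \<in> topspace skorokhod_topology. f y \<in> {of_rat c<..}}"
      using c x unfolding openin_skorokhod_topology by auto
    moreover have "0 \<le> c" using c False by (meson less_le_trans linorder_not_less not_less_iff_gr_or_eq of_rat_less_0_iff order_less_trans)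
    ultimately show ?thesis using c by (intro exI[of _ c] exI[of _ T] exI[of _ e]) (auto simp: less_imp_le subset_iff)
  qed
  then obtain c T e where c: "r < of_rat c" "0 \<le> c" and Te: "T \<ge> 0" "e > 0"
    and fc: "\<And>y. y \<in> skorokhod_nbhd x T e \<Longrightarrow> of_rat c \<le> f y" by blast
  obtain k where k: "1 / real (Suc k) < e / 3" using nat_approx_posE[of "e/3"] Te by auto
  obtain T' :: nat where T': "T \<le> real T'" using real_arch_simple by blast
  obtain m zs where m: "m > 0" and z: "\<And>t. t\<in>{0..real T'} \<Longrightarrow> cmod (x t - grid_step m zs t) < 1 / real (Suc k)"
    using grid_step_approx[OF x(2), of "1 / real (Suc k)" T'] by (metis of_nat_0_less_iff zero_less_Suc zero_less_divide_1_iff)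
  have "of_rat c \<le> f y" if y: "y \<in> skorokhod_space" and yz: "\<forall>t\<in>{0..real T'}. cmod (y t - grid_step m zs t) < 2 / real (Suc k)" for y
  proof -
    have "dist (y t) (x t) \<le> 3 / real (Suc k)" if t: "t \<in> {0..T}" for t
    proof -
      have t': "t \<in> {0..real T'}" using t T' by auto
      have "dist (y t) (x t) \<le> cmod (y t - grid_step m zs t) + cmod (x t - grid_step m zs t)"
        using dist_triangle2[of "y t" "x t" "grid_step m zs t"] by (simp add: dist_norm)
      also have "\<dots> \<le> 2 / real (Suc k) + 1 / real (Suc k)" using bspec[OF yz t'] z[OF t'] by linarith
      finally show ?thesis by (simp flip: add_divide_distrib)
    qed
    moreover have "3 / real (Suc k) < e" using k by (simp add: field_simps)
    ultimately have "y \<in> skorokhod_nbhd x T e"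
      unfolding skorokhod_nbhd_def using y id_time_change
      by (auto intro!: bexI[of _ "\<lambda>t. t"] exI[of _ "3 / real (Suc k)"])
    then show ?thesis by (rule fc)
  qed
  then show ?thesis using c m z
    by (intro exI[of _ m] exI[of _ T'] exI[of _ k] exI[of _ c] exI[of _ zs]) (auto intro: less_imp_le)
qed

section \<open>Minorants of a functional\<close>

text \<open>A continuous cut-off of the ball: each factor is 1 up to distance 1 / (k + 1) and
  vanishes from 3 / (2 (k + 1)) on. The gap that remains below the radius 2 / (k + 1) is left for
  the oscillation of the path between grid points.\<close>

fun bump :: "nat \<Rightarrow> ball_index \<Rightarrow> (nat \<Rightarrow> complex) \<Rightarrow> real" where
  "bump N (m, T, k, c, zs) a =
     of_rat c * (\<Prod>i\<le>N * T. max 0 (min 1 (3 - 2 * real (Suc k) * cmod (a i - grid_step m zs (real i / real N)))))"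

primrec bumps :: "((real \<Rightarrow> complex) \<Rightarrow> real) \<Rightarrow> nat \<Rightarrow> nat \<Rightarrow> (nat \<Rightarrow> complex) \<Rightarrow> real" where
  "bumps f N 0 a = 0"
| "bumps f N (Suc p) a =
     max (bumps f N p a) (if lower_bound f (from_nat p) then bump N (from_nat p) a else 0)"

text \<open>Membership in the closed ball is tested at rational times, which makes it an event. For
  continuous paths \<open>in_ball_all\<close> recovers all times.\<close>

fun in_ball :: "ball_index \<Rightarrow> (real \<Rightarrow> complex) \<Rightarrow> bool" where
  "in_ball (m, T, k, c, zs) x \<longleftrightarrow>
     (\<forall>q::rat. of_rat q \<in> {0..real T} \<longrightarrow> cmod (x (of_rat q) - grid_step m zs (of_rat q)) \<le> 1 / real (Suc k))"

text \<open>Counterpart of \<open>bumps\<close> that sees the path and not only its grid values. The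
  limit process is estimated through \<open>ball_bounds\<close>, which is below
  \<open>bumps\<close>; the prelimit processes through \<open>bumps\<close>, which is below f if the
  path oscillates little within grid cells.\<close>

primrec ball_bounds :: "((real \<Rightarrow> complex) \<Rightarrow> real) \<Rightarrow> nat \<Rightarrow> (real \<Rightarrow> complex) \<Rightarrow> real" where
  "ball_bounds f 0 x = 0"
| "ball_bounds f (Suc p) x = max (ball_bounds f p x)
     (case from_nat p of (m, T, k, c, zs) \<Rightarrow>
        if lower_bound f (m, T, k, c, zs) \<and> in_ball (m, T, k, c, zs) x then of_rat c else 0)"

lemma in_ballD:
  "in_ball (m, T, k, c, zs) x \<Longrightarrow> of_rat q \<in> {0..real T} \<Longrightarrow>
    cmod (x (of_rat q) - grid_step m zs (of_rat q)) \<le> 1 / real (Suc k)"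
  unfolding in_ball.simps by blast

text \<open>The path and the step function are both right continuous, so a violation at some t < T
  persists up to a rational time shortly after t. The end point T is rational itself.\<close>

lemma in_ball_all:
  assumes x: "continuous_on {0..} x" and m: "m > 0" and b: "in_ball (m, T, k, c, zs) x" and t: "t \<in> {0..real T}"
  shows "cmod (x t - grid_step m zs t) \<le> 1 / real (Suc k)"
proof (cases "t = real T")
  case True
  then show ?thesis using in_ballD[OF b, of "of_nat T"] by simp
next
  case False
  then have tT: "t < real T" "0 \<le> t" using t by auto
  show ?thesis
  proof (rule ccontr)
    assume "\<not> ?thesis"
    then have g: "1 / real (Suc k) < cmod (x t - grid_step m zs t)" by simp
    have "(x \<longlongrightarrow> x t) (at_right t)" using continuous_imp_cadlag[OF x] tT by (auto simp: cadlag_def)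
    then have "((\<lambda>s. cmod (x s - grid_step m zs t)) \<longlongrightarrow> cmod (x t - grid_step m zs t)) (at_right t)"
      by (intro tendsto_intros)
    then have "\<forall>\<^sub>F s in at_right t. 1 / real (Suc k) < cmod (x s - grid_step m zs t)"
      using g by (rule order_tendstoD)
    moreover have "\<forall>\<^sub>F s in at_right t. s < real T" using tT by (auto simp: eventually_at_right_field)
    moreover note floor_mult_at_right[OF m, of t]
    ultimately have "\<forall>\<^sub>F s in at_right t. s < real T \<and> 1 / real (Suc k) < cmod (x s - grid_step m zs s)"
    proof eventually_elim
      case (elim s)
      have "grid_step m zs s = grid_step m zs t" using elim(3) by (simp add: grid_step_def)
      then show ?case using elim by simp
    qed
    then obtain b where b': "b > t" "\<And>s. t < s \<Longrightarrow> s < b \<Longrightarrow> s < real T \<and> 1 / real (Suc k) < cmod (x s - grid_step m zs s)"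
      by (auto simp: eventually_at_right_field)
    obtain q where q: "t < of_rat q" "of_rat q < b" using of_rat_dense[OF b'(1)] by auto
    have mem: "real_of_rat q \<in> {0..real T}"
      unfolding atLeastAtMost_iff using b'(2)[OF q] q tT by (intro conjI) linarith+
    show False using in_ballD[OF b mem] b'(2)[OF q] by linarith
  qed
qed

lemma bumps_nonneg: "0 \<le> bumps f N p a" by (induction p) auto

lemma bumps_mono_N: "p \<le> q \<Longrightarrow> ball_bounds f p x \<le> ball_bounds f q x"
  by (induction q) (auto simp: le_Suc_eq)

lemma ball_bounds_nonneg: "0 \<le> ball_bounds f p x" using bumps_mono_N[of 0 p] by simp

lemma bump_le: "0 \<le> c \<Longrightarrow> bump N (m, T, k, c, zs) a \<le> of_rat c"
  by (auto intro!: mult_left_le prod_le_1)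

lemma continuous_on_bump: "continuous_on UNIV (bump N I)"
proof -
  obtain m T k c zs where "I = (m, T, k, c, zs)" by (cases I) auto
  moreover have "continuous_on UNIV (\<lambda>a::nat \<Rightarrow> complex. a i)" for i
    by (rule continuous_on_product_coordinates)
  ultimately show ?thesis
    by (auto intro!: continuous_intros cong: continuous_on_cong simp flip: fun_eq_iff)
qed

lemma continuous_on_bumps: "continuous_on UNIV (bumps f N p)"
proof (induction p)
  case 0
  have "bumps f N 0 = (\<lambda>a. 0)" by (rule ext) simp
  then show ?case by simp
next
  case (Suc p)
  have "bumps f N (Suc p) = (\<lambda>a. max (bumps f N p a) (if lower_bound f (from_nat p) then bump N (from_nat p) a else 0))"
    by (rule ext) simp
  then show ?case using Suc continuous_on_bump[of N "from_nat p"]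
    by (cases "lower_bound f (from_nat p)") (auto intro!: continuous_on_max)
qed

text \<open>Dependence on finitely many coordinates makes \<open>bumps\<close> a test function for
  finite-dimensional distributions.\<close>

lemma bumps_local: "\<exists>K. \<forall>a b. (\<forall>i\<le>K. a i = b i) \<longrightarrow> bumps f N p a = bumps f N p b"
proof (induction p)
  case (Suc p)
  then obtain K where K: "\<And>a b. (\<forall>i\<le>K. a i = b i) \<Longrightarrow> bumps f N p a = bumps f N p b" by blast
  obtain m T k c zs where I: "(from_nat p :: ball_index) = (m, T, k, c, zs)" by (cases "from_nat p :: ball_index") auto
  have "bumps f N (Suc p) a = bumps f N (Suc p) b" if "\<forall>i\<le>max K (N * T). a i = b i" for a b
  proof -
    have "bumps f N p a = bumps f N p b" using that by (intro K) auto
    moreover have "bump N (m, T, k, c, zs) a = bump N (m, T, k, c, zs) b"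
      using that by (auto intro!: prod.cong)
    ultimately show ?thesis by (simp add: I del: bump.simps lower_bound.simps)
  qed
  then show ?case by blast
qed auto

text \<open>Grid times i / N are rational, so a path in the closed ball makes every factor of its
  bump equal to 1.\<close>

lemma ball_bounds_le_bumps:
  assumes "N > 0"
  shows "ball_bounds f p x \<le> bumps f N p (\<lambda>i. x (real i / real N))"
proof (induction p)
  case (Suc p)
  obtain m T k c zs where I: "(from_nat p :: ball_index) = (m, T, k, c, zs)" by (cases "from_nat p :: ball_index") auto
  have "bump N (m, T, k, c, zs) (\<lambda>i. x (real i / real N)) = of_rat c" if "in_ball (m, T, k, c, zs) x"
  proof -
    have "max 0 (min 1 (3 - 2 * real (Suc k) * cmod (x (real i / real N) - grid_step m zs (real i / real N)))) = 1"
      if i: "i \<le> N * T" for i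
    proof -
      have "real i \<le> real N * real T" using i by (metis of_nat_le_iff of_nat_mult)
      then have "real_of_rat (of_nat i / of_nat N) \<in> {0..real T}" using assms
        by (simp add: of_rat_divide pos_divide_le_eq mult.commute)
      then have "cmod (x (real i / real N) - grid_step m zs (real i / real N)) \<le> 1 / real (Suc k)"
        using in_ballD[OF \<open>in_ball (m, T, k, c, zs) x\<close>, of "of_nat i / of_nat N"] by (simp add: of_rat_divide)
      then have "real (Suc k) * cmod (x (real i / real N) - grid_step m zs (real i / real N)) \<le> 1"
        by (simp add: field_simps)
      then have "1 \<le> 3 - 2 * real (Suc k) * cmod (x (real i / real N) - grid_step m zs (real i / real N))"
        by (simp only: mult.assoc)
      then show ?thesis by (simp only: min_absorb1 max_absorb2 zero_le_one)
    qed
    then show ?thesis by simp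
  qed
  moreover have "0 \<le> bump N (m, T, k, c, zs) (\<lambda>i. x (real i / real N))" if "0 \<le> c"
    using that by (auto intro!: mult_nonneg_nonneg prod_nonneg)
  ultimately show ?case using Suc by (auto simp: I simp del: bump.simps in_ball.simps)
qed simp

text \<open>If a bump does not vanish, all grid values are closer than 3 / (2 (k + 1)) to the step
  function. The oscillation within a cell adds at most 1 / (2 (k + 1)), so the whole path is in the
  ball of radius 2 / (k + 1), where f is at least c.\<close>

lemma bumps_le:
  assumes y: "y \<in> skorokhod_space" and f0: "0 \<le> f y" and N: "N > 0"
    and dvd: "\<And>j m T k c zs. j < p \<Longrightarrow> (from_nat j :: ball_index) = (m, T, k, c, zs) \<Longrightarrow> m > 0 \<Longrightarrow>
       m dvd N \<and> (\<forall>t\<in>{0..real T}. cmod (y t - y (real (nat \<lfloor>real N * t\<rfloor>) / real N)) \<le> 1 / (2 * real (Suc k)))"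
  shows "bumps f N p (\<lambda>i. y (real i / real N)) \<le> f y"
  using dvd
proof (induction p)
  case (Suc p)
  obtain m T k c zs where I: "(from_nat p :: ball_index) = (m, T, k, c, zs)" by (cases "from_nat p :: ball_index") auto
  let ?a = "\<lambda>i. y (real i / real N)"
  have "bump N (m, T, k, c, zs) ?a \<le> f y" if lb: "lower_bound f (m, T, k, c, zs)"
  proof (cases "\<forall>i\<le>N * T. cmod (?a i - grid_step m zs (real i / real N)) < 3 / (2 * real (Suc k))")
    case True
    have m: "m > 0" and c: "0 \<le> c" using lb by auto
    have D: "m dvd N" "\<forall>t\<in>{0..real T}. cmod (y t - y (real (nat \<lfloor>real N * t\<rfloor>) / real N)) \<le> 1 / (2 * real (Suc k))"
      using Suc.prems[of p m T k c zs] I m by auto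
    have "cmod (y t - grid_step m zs t) < 2 / real (Suc k)" if t: "t \<in> {0..real T}" for t
    proof -
      define i where "i = nat \<lfloor>real N * t\<rfloor>"
      have "i \<le> N * T" using floor_grid(1)[of N t T] N t by (auto simp: i_def)
      then have "cmod (?a i - grid_step m zs (real i / real N)) < 3 / (2 * real (Suc k))" using True by auto
      moreover have "grid_step m zs (real i / real N) = grid_step m zs t"
        unfolding i_def using D m N t by (intro grid_step_refine) auto
      moreover have "cmod (y t - ?a i) \<le> 1 / (2 * real (Suc k))" using D t by (auto simp: i_def)
      ultimately have "cmod (y t - grid_step m zs t) < 3 / (2 * real (Suc k)) + 1 / (2 * real (Suc k))"
        using norm_triangle_ineq[of "y t - ?a i" "?a i - grid_step m zs t"] by simp
      also have "\<dots> = 2 / real (Suc k)"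
      proof -
        have "3 / (2 * z) + 1 / (2 * z) = 2 / z" for z :: real by (cases "z = 0") (simp_all add: field_simps)
        then show ?thesis .
      qed
      finally show ?thesis .
    qed
    then have "of_rat c \<le> f y" using lb y by auto
    then show ?thesis using bump_le[OF c, of N m T k zs ?a] by linarith
  next
    case False
    then obtain i where i: "i \<le> N * T" "cmod (?a i - grid_step m zs (real i / real N)) \<ge> 3 / (2 * real (Suc k))"
      by (auto simp: not_less)
    then have "3 - 2 * real (Suc k) * cmod (?a i - grid_step m zs (real i / real N)) \<le> 0"
      by (simp add: field_simps)
    then have "(\<Prod>i\<le>N * T. max 0 (min 1 (3 - 2 * real (Suc k) * cmod (?a i - grid_step m zs (real i / real N))))) = 0"
      using i(1) by (intro prod_zero) (auto intro!: bexI[of _ i])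
    then have "bump N (m, T, k, c, zs) ?a = 0" unfolding bump.simps by (simp only: mult_zero_right)
    then show ?thesis using f0 by (simp only:)
  qed
  moreover have "bumps f N p ?a \<le> f y" by (rule Suc.IH) (use Suc.prems less_SucI in blast)
  ultimately show ?case using f0 by (simp add: I del: bump.simps lower_bound.simps)
qed (simp add: f0)

lemma ball_bounds_le:
  assumes x: "x \<in> skorokhod_space" "continuous_on {0..} x" and f0: "0 \<le> f x"
  shows "ball_bounds f p x \<le> f x"
proof (induction p)
  case (Suc p)
  obtain m T k c zs where I: "(from_nat p :: ball_index) = (m, T, k, c, zs)" by (cases "from_nat p :: ball_index") auto
  have "of_rat c \<le> f x" if lb: "lower_bound f (m, T, k, c, zs)" and b: "in_ball (m, T, k, c, zs) x"
  proof -
    have "cmod (x t - grid_step m zs t) < 2 / real (Suc k)" if t: "t \<in> {0..real T}" for t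
    proof -
      have "cmod (x t - grid_step m zs t) \<le> 1 / real (Suc k)" using lb by (intro in_ball_all[OF x(2) _ b t]) auto
      also have "\<dots> < 2 / real (Suc k)" by (intro divide_strict_right_mono) auto
      finally show ?thesis .
    qed
    then show ?thesis using lb x by auto
  qed
  then show ?case using Suc f0 by (simp add: I del: lower_bound.simps in_ball.simps)
qed (simp add: f0)

lemma ball_bounds_tendsto:
  assumes f: "continuous_map skorokhod_topology euclideanreal f" and f0: "\<And>y. y \<in> skorokhod_space \<Longrightarrow> 0 \<le> f y"
    and x: "x \<in> skorokhod_space" "continuous_on {0..} x"
  shows "(\<lambda>p. ball_bounds f p x) \<longlonglongrightarrow> f x"
proof (rule order_tendstoI)
  fix r assume "r < f x"
  from lower_bound_exists[OF f f0 x this] obtain m T k c zs where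
    b: "lower_bound f (m, T, k, c, zs)" "r < of_rat c"
    "\<And>t. t\<in>{0..real T} \<Longrightarrow> cmod (x t - grid_step m zs t) \<le> 1 / real (Suc k)" by blast
  define p where "p = to_nat (m, T, k, c, zs)"
  have I: "from_nat p = (m, T, k, c, zs)" by (simp add: p_def)
  have "in_ball (m, T, k, c, zs) x" using b(3) by auto
  then have "of_rat c \<le> ball_bounds f (Suc p) x" using b(1) by (simp add: I del: lower_bound.simps in_ball.simps)
  then have "r < ball_bounds f q x" if "q \<ge> Suc p" for q using bumps_mono_N[OF that, of f x] b(2) by linarith
  then show "\<forall>\<^sub>F q in sequentially. r < ball_bounds f q x" unfolding eventually_sequentially by blast
next
  fix r assume "f x < r"
  then show "\<forall>\<^sub>F q in sequentially. ball_bounds f q x < r"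
    using le_less_trans[OF ball_bounds_le[of x f, OF x f0[OF x(1)]]] by (intro always_eventually) auto
qed

section \<open>From minorants to integrals\<close>

lemma borel_measurable_skorokhod:
  assumes "continuous_map skorokhod_topology euclideanreal f"
  shows "f \<in> borel_measurable skorokhod_borel"
proof (rule borel_measurableI)
  fix S :: "real set" assume "open S"
  then have "openin skorokhod_topology {x \<in> topspace skorokhod_topology. f x \<in> S}"
    using assms by (intro openin_continuous_map_preimage) auto
  moreover have sp: "{U. openin skorokhod_topology U} \<subseteq> Pow (skorokhod_space :: (real \<Rightarrow> 'a) set)"
    using openin_skorokhod_topology by auto
  ultimately have "{x \<in> skorokhod_space. f x \<in> S} \<in> sets skorokhod_borel"
    unfolding skorokhod_borel_def by (intro in_measure_of) auto
  moreover have "f -` S \<inter> space skorokhod_borel = {x \<in> skorokhod_space. f x \<in> S}"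
    unfolding skorokhod_borel_def using sp by (auto simp: space_measure_of)
  ultimately show "f -` S \<inter> space skorokhod_borel \<in> sets skorokhod_borel" by simp
qed

lemma space_skorokhod_borel: "space (skorokhod_borel :: (real \<Rightarrow> 'b::metric_space) measure) = skorokhod_space"
  unfolding skorokhod_borel_def by (rule space_measure_of) (use openin_skorokhod_topology in auto)


lemma AE_eq_sample_pathD:
  assumes "skorokhod_version M Y R"
  shows "R \<in> M \<rightarrow>\<^sub>M skorokhod_borel" "AE \<omega> in M. R \<omega> = sample_path Y \<omega> \<and> R \<omega> \<in> skorokhod_space"
proof -
  show R: "R \<in> M \<rightarrow>\<^sub>M skorokhod_borel" using assms by (simp add: skorokhod_version_def)
  have "AE \<omega> in M. R \<omega> = sample_path Y \<omega>" using assms by (simp add: skorokhod_version_def)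
  then show "AE \<omega> in M. R \<omega> = sample_path Y \<omega> \<and> R \<omega> \<in> skorokhod_space"
    using AE_space
  proof eventually_elim
    case (elim \<omega>)
    then show ?case using measurable_space[OF R elim(2)] by (simp add: space_skorokhod_borel)
  qed
qed

lemma measurable_in_ball:
  assumes Y: "\<And>t. t \<ge> 0 \<Longrightarrow> Y t \<in> borel_measurable M"
  shows "Measurable.pred M (\<lambda>\<omega>. in_ball I (sample_path Y \<omega>))"
proof -
  obtain m T k c zs where I: "I = (m, T, k, c, zs)" by (cases I) auto
  have "Measurable.pred M (\<lambda>\<omega>. of_rat q \<in> {0..real T} \<longrightarrow>
    cmod (sample_path Y \<omega> (of_rat q) - grid_step m zs (of_rat q)) \<le> 1 / real (Suc k))" for q
  proof (cases "of_rat q \<in> {0..real T}")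
    case True
    then have [measurable]: "Y (of_rat q) \<in> borel_measurable M" by (intro Y) auto
    show ?thesis using True by (simp add: sample_path_def)
  next
    case False
    then have eq: "(\<lambda>\<omega>. of_rat q \<in> {0..real T} \<longrightarrow>
      cmod (sample_path Y \<omega> (of_rat q) - grid_step m zs (of_rat q)) \<le> 1 / real (Suc k)) = (\<lambda>_. True)" by blast
    show ?thesis unfolding eq by (rule measurable_const) simp
  qed
  then show ?thesis unfolding I in_ball.simps by (rule pred_intros_countable(1))
qed

lemma measurable_ball_bounds:
  assumes Y: "\<And>t. t \<ge> 0 \<Longrightarrow> Y t \<in> borel_measurable M"
  shows "(\<lambda>\<omega>. ball_bounds f p (sample_path Y \<omega>)) \<in> borel_measurable M"
proof (induction p)
  case (Suc p)
  obtain m T k c zs where I: "(from_nat p :: ball_index) = (m, T, k, c, zs)" by (cases "from_nat p :: ball_index") auto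
  note [measurable] = Suc measurable_in_ball[OF Y, where I = "(m, T, k, c, zs)"]
  show ?case by (simp add: I del: lower_bound.simps in_ball.simps)
qed simp

text \<open>One half of the portmanteau theorem. The integral of f over the limit is nearly that of
  \<open>ball_bounds f p\<close> for some fixed p, by dominated convergence; this is at most the
  integral of a bounded continuous function G of finitely many grid values, which converges; and for
  the prelimit G is below f except on the event A of large oscillation. Each of the three passages
  costs e / 3.\<close>

lemma eventually_integral_greater:
  fixes Y :: "nat \<Rightarrow> real \<Rightarrow> 'a \<Rightarrow> complex" and Y' :: "real \<Rightarrow> 'b \<Rightarrow> complex"
  assumes M: "prob_space M" and M': "prob_space M'"
    and R: "\<And>n. skorokhod_version M (Y n) (R n)" and R': "skorokhod_version M' Y' R'"
    and Y: "\<And>n t. t \<ge> 0 \<Longrightarrow> Y n t \<in> borel_measurable M"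
    and Y': "\<And>t. t \<ge> 0 \<Longrightarrow> Y' t \<in> borel_measurable M'"
    and cont: "AE \<omega> in M'. continuous_on {0..} (\<lambda>t. Y' t \<omega>)"
    and fdd: "\<And>N (G :: (nat \<Rightarrow> complex) \<Rightarrow> real) K B. N > 0 \<Longrightarrow> continuous_on UNIV G \<Longrightarrow> (\<And>a. \<bar>G a\<bar> \<le> B) \<Longrightarrow>
      (\<And>a b. (\<forall>i\<le>K. a i = b i) \<Longrightarrow> G a = G b) \<Longrightarrow>
      (\<lambda>n. \<integral>\<omega>. G (\<lambda>i. Y n (real i / real N) \<omega>) \<partial>M) \<longlonglongrightarrow> (\<integral>\<omega>. G (\<lambda>i. Y' (real i / real N) \<omega>) \<partial>M')"
    and tight: "\<And>T e \<eta>. e > 0 \<Longrightarrow> \<eta> > 0 \<Longrightarrow> \<exists>m0. \<forall>m\<ge>m0. \<forall>\<^sub>F n in sequentially. \<exists>A\<in>sets M. measure M A \<le> \<eta> \<and>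
      (AE \<omega> in M. \<omega> \<notin> A \<longrightarrow> (\<forall>t\<in>{0..real T}. cmod (Y n t \<omega> - Y n (real (nat \<lfloor>real m * t\<rfloor>) / real m) \<omega>) \<le> e))"
    and f: "continuous_map skorokhod_topology euclideanreal f"
    and f0: "\<And>y. y \<in> skorokhod_space \<Longrightarrow> 0 \<le> f y" and fB: "\<And>y. y \<in> skorokhod_space \<Longrightarrow> f y \<le> B"
    and e: "e > 0"
  shows "\<forall>\<^sub>F n in sequentially. (\<integral>\<omega>. f (R' \<omega>) \<partial>M') - e < (\<integral>\<omega>. f (R n \<omega>) \<partial>M)"
proof -
  interpret M: prob_space M by fact
  interpret M': prob_space M' by fact
  have "discretize 1 (\<lambda>_. 0::complex) \<in> skorokhod_space" by (rule discretize_in_skorokhod_space) simp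
  then have B: "B \<ge> 0" using f0 fB order_trans by blast
  note Rm = AE_eq_sample_pathD(1)[OF R] and Rae = AE_eq_sample_pathD(2)[OF R]
  note R'm = AE_eq_sample_pathD(1)[OF R'] and R'ae = AE_eq_sample_pathD(2)[OF R']
  have [measurable]: "(\<lambda>\<omega>. f (R n \<omega>)) \<in> borel_measurable M" for n
    by (rule measurable_compose[OF Rm borel_measurable_skorokhod[OF f]])
  have [measurable]: "(\<lambda>\<omega>. f (R' \<omega>)) \<in> borel_measurable M'"
    by (rule measurable_compose[OF R'm borel_measurable_skorokhod[OF f]])
  define g where "g p \<omega> = ball_bounds f p (sample_path Y' \<omega>)" for p \<omega>
  have gm[measurable]: "g p \<in> borel_measurable M'" for p
    unfolding g_def by (rule measurable_ball_bounds[OF Y'])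
  have path: "AE \<omega> in M'. R' \<omega> = sample_path Y' \<omega> \<and> R' \<omega> \<in> skorokhod_space \<and> continuous_on {0..} (R' \<omega>)"
    using R'ae cont
  proof eventually_elim
    case (elim \<omega>)
    have "continuous_on {0..} (sample_path Y' \<omega>) \<longleftrightarrow> continuous_on {0..} (\<lambda>t. Y' t \<omega>)"
      by (intro continuous_on_cong) (auto simp: sample_path_def)
    then show ?case using elim by auto
  qed
  have g_lim: "AE \<omega> in M'. (\<lambda>p. g p \<omega>) \<longlonglongrightarrow> f (R' \<omega>)" and g_le: "AE \<omega> in M'. g p \<omega> \<le> f (R' \<omega>)"
    and g_B: "AE \<omega> in M'. norm (g p \<omega>) \<le> B" for p
  proof -
    show "AE \<omega> in M'. (\<lambda>p. g p \<omega>) \<longlonglongrightarrow> f (R' \<omega>)" using path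
      by eventually_elim (auto simp: g_def intro!: ball_bounds_tendsto f f0)
    show 1: "AE \<omega> in M'. g p \<omega> \<le> f (R' \<omega>)" using path
      by eventually_elim (auto simp: g_def intro!: ball_bounds_le f0)
    show "AE \<omega> in M'. norm (g p \<omega>) \<le> B" using path 1
      by eventually_elim (use fB ball_bounds_nonneg in \<open>force simp: g_def intro: order_trans\<close>)
  qed
  have "(\<lambda>p. \<integral>\<omega>. g p \<omega> \<partial>M') \<longlonglongrightarrow> (\<integral>\<omega>. f (R' \<omega>) \<partial>M')"
    by (rule integral_dominated_convergence[where w = "\<lambda>_. B"]) (use g_lim g_B in auto)
  then have "\<forall>\<^sub>F p in sequentially. (\<integral>\<omega>. f (R' \<omega>) \<partial>M') - e / 3 < (\<integral>\<omega>. g p \<omega> \<partial>M')"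
    using e by (intro order_tendstoD) auto
  then obtain p where p: "(\<integral>\<omega>. f (R' \<omega>) \<partial>M') - e / 3 < (\<integral>\<omega>. g p \<omega> \<partial>M')"
    using eventually_happens by force
  define mm where "mm j = fst (from_nat j :: ball_index)" for j
  define TT where "TT j = fst (snd (from_nat j :: ball_index))" for j
  define kk where "kk j = fst (snd (snd (from_nat j :: ball_index)))" for j
  \<comment> \<open>Finitely many indices below p matter. Sums serve as crude upper bounds for their
    k and T, so that e' is at most every 1 / (2 (k + 1)) and T exceeds every horizon.\<close>
  define e' where "e' = 1 / (2 * real (Suc (\<Sum>j<p. kk j)))"
  define T where "T = (\<Sum>j<p. TT j)"
  \<comment> \<open>The loss on A is at most B * \<eta>, which is to be at most e / 3; the summand 1
    covers B = 0.\<close>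
  define \<eta> where "\<eta> = e / (3 * (B + 1))"
  have e': "e' > 0" by (simp add: e'_def del: of_nat_Suc of_nat_sum)
  have \<eta>: "\<eta> > 0" and B\<eta>: "B * \<eta> \<le> e / 3"
    using e B by (auto simp: \<eta>_def field_simps)
  obtain m0 where m0: "\<And>m. m \<ge> m0 \<Longrightarrow> \<forall>\<^sub>F n in sequentially. \<exists>A\<in>sets M. measure M A \<le> \<eta> \<and>
      (AE \<omega> in M. \<omega> \<notin> A \<longrightarrow> (\<forall>t\<in>{0..real T}. cmod (Y n t \<omega> - Y n (real (nat \<lfloor>real m * t\<rfloor>) / real m) \<omega>) \<le> e'))"
    using tight[OF e' \<eta>, of T] by blast
  \<comment> \<open>A common multiple of the finitely many grid sizes, as
    \<open>grid_step_refine\<close> wants, that also exceeds the threshold \<open>m0\<close> of the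
    oscillation estimate. \<open>max 1\<close> passes over indices with m = 0, which give no lower
    bound.\<close>
  define N where "N = (\<Prod>j<p. max 1 (mm j)) * Suc m0"
  have "(\<Prod>j<p. max 1 (mm j)) \<ge> 1" by (intro prod_ge_1) auto
  then have "1 * Suc m0 \<le> N" unfolding N_def by (intro mult_right_mono) auto
  then have N: "N > 0" "N \<ge> m0" by auto
  have dvd: "m dvd N" and Tle: "Tj \<le> T" and kle: "e' \<le> 1 / (2 * real (Suc k))"
    if j: "j < p" and I: "(from_nat j :: ball_index) = (m, Tj, k, c, zs)" and m: "m > 0" for j m Tj k c zs
  proof -
    have "max 1 (mm j) dvd (\<Prod>j<p. max 1 (mm j))" using j by (intro dvd_prodI) auto
    then show "m dvd N" using I m by (simp add: mm_def N_def)
    have "TT j \<le> T" unfolding T_def using j by (intro member_le_sum) auto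
    then show "Tj \<le> T" using I by (simp add: TT_def)
    have "kk j \<le> (\<Sum>j<p. kk j)" using j by (intro member_le_sum) auto
    then have "k \<le> (\<Sum>j<p. kk j)" using I by (simp add: kk_def)
    then show "e' \<le> 1 / (2 * real (Suc k))" unfolding e'_def
      by (intro divide_left_mono mult_left_mono) (auto simp del: of_nat_Suc of_nat_sum)
  qed
  \<comment> \<open>The cap at B ensures that G - B is at most 0, and so below f, on the exceptional
    event.\<close>
  define G where "G a = min B (bumps f N p a)" for a
  have Gc: "continuous_on UNIV G" unfolding G_def
    by (intro continuous_on_min continuous_on_const continuous_on_bumps)
  have GB: "\<bar>G a\<bar> \<le> B" and G0: "G a \<le> B" for a using B bumps_nonneg[of f N p a] by (auto simp: G_def)
  obtain K where K: "\<And>a b. (\<forall>i\<le>K. a i = b i) \<Longrightarrow> G a = G b"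
    using bumps_local[of f N p] unfolding G_def by metis
  have Gm: "G \<in> borel_measurable borel" by (rule borel_measurable_continuous_onI[OF Gc])
  have [measurable]: "(\<lambda>\<omega>. G (\<lambda>i. Y n (real i / real N) \<omega>)) \<in> borel_measurable M" for n
    by (rule measurable_compose[OF measurable_coordinatewise_then_product Gm]) (auto intro: Y)
  have [measurable]: "(\<lambda>\<omega>. G (\<lambda>i. Y' (real i / real N) \<omega>)) \<in> borel_measurable M'"
    by (rule measurable_compose[OF measurable_coordinatewise_then_product Gm]) (auto intro: Y')
  have "(\<integral>\<omega>. g p \<omega> \<partial>M') \<le> (\<integral>\<omega>. G (\<lambda>i. Y' (real i / real N) \<omega>) \<partial>M')"
  proof (rule integral_mono_AE)
    show "integrable M' (g p)" by (rule M'.integrable_const_bound[of _ B]) (use g_B in auto)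
    show "integrable M' (\<lambda>\<omega>. G (\<lambda>i. Y' (real i / real N) \<omega>))"
      by (rule M'.integrable_const_bound[of _ B]) (use GB in auto)
    show "AE \<omega> in M'. g p \<omega> \<le> G (\<lambda>i. Y' (real i / real N) \<omega>)"
      using path g_le[of p]
    proof eventually_elim
      case (elim \<omega>)
      have "g p \<omega> \<le> bumps f N p (\<lambda>i. sample_path Y' \<omega> (real i / real N))"
        unfolding g_def by (rule ball_bounds_le_bumps[OF N(1)])
      moreover have "g p \<omega> \<le> B" using elim fB[of "R' \<omega>"] by linarith
      ultimately show ?case by (simp add: G_def sample_path_def)
    qed
  qed
  then have "(\<integral>\<omega>. f (R' \<omega>) \<partial>M') - e / 3 < (\<integral>\<omega>. G (\<lambda>i. Y' (real i / real N) \<omega>) \<partial>M')" using p by linarith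
  moreover have "(\<lambda>n. \<integral>\<omega>. G (\<lambda>i. Y n (real i / real N) \<omega>) \<partial>M) \<longlonglongrightarrow> (\<integral>\<omega>. G (\<lambda>i. Y' (real i / real N) \<omega>) \<partial>M')"
    by (rule fdd[where B = B and K = K, OF N(1) Gc]) (blast intro: GB K)+
  ultimately have "\<forall>\<^sub>F n in sequentially. (\<integral>\<omega>. f (R' \<omega>) \<partial>M') - e / 3 < (\<integral>\<omega>. G (\<lambda>i. Y n (real i / real N) \<omega>) \<partial>M)"
    by (intro order_tendstoD)
  with m0[OF N(2)] show ?thesis
  proof eventually_elim
    case (elim n)
    then obtain A where A[measurable]: "A \<in> sets M" and PA: "measure M A \<le> \<eta>" and Aae:
      "AE \<omega> in M. \<omega> \<notin> A \<longrightarrow> (\<forall>t\<in>{0..real T}. cmod (Y n t \<omega> - Y n (real (nat \<lfloor>real N * t\<rfloor>) / real N) \<omega>) \<le> e')"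
      by blast
    have "(\<integral>\<omega>. G (\<lambda>i. Y n (real i / real N) \<omega>) - B * indicat_real A \<omega> \<partial>M) \<le> (\<integral>\<omega>. f (R n \<omega>) \<partial>M)"
    proof (rule integral_mono_AE)
      show "integrable M (\<lambda>\<omega>. f (R n \<omega>))"
      proof (rule M.integrable_const_bound[of _ B])
        show "AE \<omega> in M. norm (f (R n \<omega>)) \<le> B" using Rae[of n]
        proof eventually_elim
          case (elim \<omega>)
          then have m: "R n \<omega> \<in> skorokhod_space" by blast
          show ?case using f0[OF m] fB[OF m] by simp
        qed
      qed measurable
      show "integrable M (\<lambda>\<omega>. G (\<lambda>i. Y n (real i / real N) \<omega>) - B * indicat_real A \<omega>)"
      proof (rule M.integrable_const_bound[of _ "2 * B"])
        have "\<bar>G a - B * indicat_real A \<omega>\<bar> \<le> 2 * B" for a \<omega>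
          using GB[of a] B by (auto simp: indicator_def)
        then show "AE \<omega> in M. norm (G (\<lambda>i. Y n (real i / real N) \<omega>) - B * indicat_real A \<omega>) \<le> 2 * B" by simp
      qed measurable
      show "AE \<omega> in M. G (\<lambda>i. Y n (real i / real N) \<omega>) - B * indicat_real A \<omega> \<le> f (R n \<omega>)"
        using Rae[of n] Aae
      proof eventually_elim
        case (elim \<omega>)
        then have Req: "R n \<omega> = sample_path (Y n) \<omega>" and m: "R n \<omega> \<in> skorokhod_space" by blast+
        show ?case
        proof (cases "\<omega> \<in> A")
          case True
          then show ?thesis using G0[of "\<lambda>i. Y n (real i / real N) \<omega>"] f0[OF m] by simp
        next
          case False
          have "bumps f N p (\<lambda>i. R n \<omega> (real i / real N)) \<le> f (R n \<omega>)"
          proof (rule bumps_le[OF _ f0 N(1)])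
            fix j m Tj k c zs
            assume j: "j < p" "(from_nat j :: ball_index) = (m, Tj, k, c, zs)" "m > 0"
            show "m dvd N \<and> (\<forall>t\<in>{0..real Tj}. cmod (R n \<omega> t - R n \<omega> (real (nat \<lfloor>real N * t\<rfloor>) / real N)) \<le> 1 / (2 * real (Suc k)))"
            proof (intro conjI ballI)
              fix t assume t: "t \<in> {0..real Tj}"
              then have "t \<in> {0..real T}" using Tle[OF j] by auto
              then have "cmod (Y n t \<omega> - Y n (real (nat \<lfloor>real N * t\<rfloor>) / real N) \<omega>) \<le> e'" using elim False by blast
              then show "cmod (R n \<omega> t - R n \<omega> (real (nat \<lfloor>real N * t\<rfloor>) / real N)) \<le> 1 / (2 * real (Suc k))"
                using kle[OF j] t by (simp add: Req sample_path_def)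
            qed (rule dvd[OF j])
          qed (rule m)+
          then show ?thesis using False by (simp add: G_def Req sample_path_def)
        qed
      qed
    qed
    also have "(\<integral>\<omega>. G (\<lambda>i. Y n (real i / real N) \<omega>) - B * indicat_real A \<omega> \<partial>M) =
      (\<integral>\<omega>. G (\<lambda>i. Y n (real i / real N) \<omega>) \<partial>M) - B * measure M A"
    proof (subst Bochner_Integration.integral_diff)
      show "integrable M (\<lambda>\<omega>. G (\<lambda>i. Y n (real i / real N) \<omega>))"
        by (rule M.integrable_const_bound[of _ B]) (use GB in auto)
    qed (auto simp: less_top[symmetric])
    moreover have "B * measure M A \<le> e / 3" using PA B B\<eta> by (meson mult_left_mono order_trans)
    ultimately show ?case using elim(2) e by linarith
  qed
qed

text \<open>For \<bar>f\<bar> \<le> B the functionals f + B and B - f are nonnegative and at most 2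
  B. The lower estimate of \<open>eventually_integral_greater\<close> for both of them bounds the
  integral of f from below and from above.\<close>

theorem converges_weakly_J1I:
  fixes Y :: "nat \<Rightarrow> real \<Rightarrow> 'a \<Rightarrow> complex" and Y' :: "real \<Rightarrow> 'b \<Rightarrow> complex"
  assumes M: "prob_space M" and M': "prob_space M'"
    and Y: "\<And>n t. t \<ge> 0 \<Longrightarrow> Y n t \<in> borel_measurable M"
    and cad: "\<And>n. AE \<omega> in M. cadlag (\<lambda>t. Y n t \<omega>)"
    and Y': "\<And>t. t \<ge> 0 \<Longrightarrow> Y' t \<in> borel_measurable M'"
    and cont: "AE \<omega> in M'. continuous_on {0..} (\<lambda>t. Y' t \<omega>)"
    and fdd: "\<And>N (G :: (nat \<Rightarrow> complex) \<Rightarrow> real) K B. N > 0 \<Longrightarrow> continuous_on UNIV G \<Longrightarrow> (\<And>a. \<bar>G a\<bar> \<le> B) \<Longrightarrow>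
      (\<And>a b. (\<forall>i\<le>K. a i = b i) \<Longrightarrow> G a = G b) \<Longrightarrow>
      (\<lambda>n. \<integral>\<omega>. G (\<lambda>i. Y n (real i / real N) \<omega>) \<partial>M) \<longlonglongrightarrow> (\<integral>\<omega>. G (\<lambda>i. Y' (real i / real N) \<omega>) \<partial>M')"
    and tight: "\<And>T e \<eta>. e > 0 \<Longrightarrow> \<eta> > 0 \<Longrightarrow> \<exists>m0. \<forall>m\<ge>m0. \<forall>\<^sub>F n in sequentially. \<exists>A\<in>sets M. measure M A \<le> \<eta> \<and>
      (AE \<omega> in M. \<omega> \<notin> A \<longrightarrow> (\<forall>t\<in>{0..real T}. cmod (Y n t \<omega> - Y n (real (nat \<lfloor>real m * t\<rfloor>) / real m) \<omega>) \<le> e))"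
  shows "converges_weakly_J1 M Y M' Y'"
proof -
  interpret M: prob_space M by fact
  interpret M': prob_space M' by fact
  have "\<forall>n. \<exists>R. skorokhod_version M (Y n) R" using skorokhod_version_exists[OF Y cad] by blast
  from choice[OF this] obtain R where R: "\<And>n. skorokhod_version M (Y n) (R n)" by blast
  have "AE \<omega> in M'. cadlag (\<lambda>t. Y' t \<omega>)" using cont by eventually_elim (rule continuous_imp_cadlag)
  from skorokhod_version_exists[where Y = Y', OF Y' this] obtain R' where R': "skorokhod_version M' Y' R'"
    by (rule exE)
  have L: "\<forall>\<^sub>F n in sequentially. (\<integral>\<omega>. f (R' \<omega>) \<partial>M') - e < (\<integral>\<omega>. f (R n \<omega>) \<partial>M)"
    if f: "continuous_map skorokhod_topology euclideanreal f" "\<And>y. y \<in> skorokhod_space \<Longrightarrow> 0 \<le> f y"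
      "\<And>y. y \<in> skorokhod_space \<Longrightarrow> f y \<le> B" "e > 0" for f B e
    by (rule eventually_integral_greater[where Y = Y and Y' = Y' and B = B])
      (fact M M' R R' Y Y' cont fdd tight f)+
  have lim: "(\<lambda>n. \<integral>\<omega>. f (R n \<omega>) \<partial>M) \<longlonglongrightarrow> (\<integral>\<omega>. f (R' \<omega>) \<partial>M')"
    if f: "continuous_map skorokhod_topology euclideanreal f" and b: "bounded (f ` skorokhod_space)" for f
  proof -
    obtain B where B: "\<And>y. y \<in> skorokhod_space \<Longrightarrow> \<bar>f y\<bar> \<le> B" using b by (auto simp: bounded_iff)
    have [measurable]: "(\<lambda>\<omega>. f (R n \<omega>)) \<in> borel_measurable M" for n
      by (rule measurable_compose[OF AE_eq_sample_pathD(1)[OF R] borel_measurable_skorokhod[OF f]])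
    have [measurable]: "(\<lambda>\<omega>. f (R' \<omega>)) \<in> borel_measurable M'"
      by (rule measurable_compose[OF AE_eq_sample_pathD(1)[OF R'] borel_measurable_skorokhod[OF f]])
    have i: "integrable M (\<lambda>\<omega>. f (R n \<omega>))" for n
    proof (rule M.integrable_const_bound[of _ B])
      show "AE \<omega> in M. norm (f (R n \<omega>)) \<le> B" using AE_eq_sample_pathD(2)[OF R, of n]
      proof eventually_elim
        case (elim \<omega>)
        then have "R n \<omega> \<in> skorokhod_space" by blast
        then show ?case using B by simp
      qed
    qed measurable
    have i': "integrable M' (\<lambda>\<omega>. f (R' \<omega>))"
    proof (rule M'.integrable_const_bound[of _ B])
      show "AE \<omega> in M'. norm (f (R' \<omega>)) \<le> B" using AE_eq_sample_pathD(2)[OF R']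
      proof eventually_elim
        case (elim \<omega>)
        then have "R' \<omega> \<in> skorokhod_space" by blast
        then show ?case using B by simp
      qed
    qed measurable
    show ?thesis
    proof (rule order_tendstoI)
      fix r assume "r < (\<integral>\<omega>. f (R' \<omega>) \<partial>M')"
      then have "(\<integral>\<omega>. f (R' \<omega>) \<partial>M') - r > 0" by simp
      have "\<forall>\<^sub>F n in sequentially. (\<integral>\<omega>. f (R' \<omega>) + B \<partial>M') - ((\<integral>\<omega>. f (R' \<omega>) \<partial>M') - r) < (\<integral>\<omega>. f (R n \<omega>) + B \<partial>M)"
      proof (rule L[of "\<lambda>y. f y + B" "2 * B"])
        show "continuous_map skorokhod_topology euclideanreal (\<lambda>y. f y + B)" by (intro continuous_map_add f) simp
        show "0 \<le> f y + B" "f y + B \<le> 2 * B" if "y \<in> skorokhod_space" for y using B[OF that] by linarith+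
      qed fact
      then show "\<forall>\<^sub>F n in sequentially. r < (\<integral>\<omega>. f (R n \<omega>) \<partial>M)"
        by eventually_elim (simp add: i i' M.prob_space M'.prob_space)
    next
      fix r assume "(\<integral>\<omega>. f (R' \<omega>) \<partial>M') < r"
      then have "r - (\<integral>\<omega>. f (R' \<omega>) \<partial>M') > 0" by simp
      have "\<forall>\<^sub>F n in sequentially. (\<integral>\<omega>. B - f (R' \<omega>) \<partial>M') - (r - (\<integral>\<omega>. f (R' \<omega>) \<partial>M')) < (\<integral>\<omega>. B - f (R n \<omega>) \<partial>M)"
      proof (rule L[of "\<lambda>y. B - f y" "2 * B"])
        show "continuous_map skorokhod_topology euclideanreal (\<lambda>y. B - f y)" by (intro continuous_map_diff f) simp
        show "0 \<le> B - f y" "B - f y \<le> 2 * B" if "y \<in> skorokhod_space" for y using B[OF that] by linarith+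
      qed fact
      then show "\<forall>\<^sub>F n in sequentially. (\<integral>\<omega>. f (R n \<omega>) \<partial>M) < r"
        by eventually_elim (simp add: i i' M.prob_space M'.prob_space)
    qed
  qed
  show ?thesis unfolding converges_weakly_J1_def
    by (intro exI[of _ R] exI[of _ R'] conjI allI impI R R' lim) (erule conjE, assumption)+
qed

text \<open>Convergence is proved for a measurable version of the time-changed Brownian motion and
  carried over to \<open>time_changed\<close> itself by this lemma.\<close>

lemma converges_weakly_J1_cong_AE:
  assumes "converges_weakly_J1 M Y M' Y'" "AE \<omega> in M'. \<forall>t\<ge>0. Y' t \<omega> = Y'' t \<omega>"
  shows "converges_weakly_J1 M Y M' Y''"
proof -
  have "skorokhod_version M' Y'' R" if "skorokhod_version M' Y' R" for R
  proof -
    have "AE \<omega> in M'. R \<omega> = sample_path Y' \<omega>" using that by (simp add: skorokhod_version_def)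
    then have "AE \<omega> in M'. R \<omega> = sample_path Y'' \<omega>" using assms(2)
      by eventually_elim (auto simp: sample_path_def)
    then show ?thesis using that by (simp add: skorokhod_version_def)
  qed
  then show ?thesis using assms(1) unfolding converges_weakly_J1_def by blast
qed

section \<open>Convergence of finite-dimensional distributions from characteristic functions\<close>

text \<open>Polynomials in the coordinates, to which the Stone-Weierstrass theorem is applied.
  Substituting sin (x i / K) for the coordinates turns them into trigonometric polynomials, whose
  integrals are governed by characteristic functions.\<close>

inductive_set coordinate_algebra :: "'i set \<Rightarrow> (('i \<Rightarrow> real) \<Rightarrow> real) set" for I where
  const: "(\<lambda>_. c) \<in> coordinate_algebra I"
| coord: "i \<in> I \<Longrightarrow> (\<lambda>s. s i) \<in> coordinate_algebra I"
| add: "h \<in> coordinate_algebra I \<Longrightarrow> k \<in> coordinate_algebra I \<Longrightarrow> (\<lambda>s. h s + k s) \<in> coordinate_algebra I"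
| mult: "h \<in> coordinate_algebra I \<Longrightarrow> k \<in> coordinate_algebra I \<Longrightarrow> (\<lambda>s. h s * k s) \<in> coordinate_algebra I"

text \<open>Coordinates outside I are fixed at 0, so that the coordinates in I separate
  points.\<close>

definition cube :: "'i set \<Rightarrow> ('i \<Rightarrow> real) set" where
  "cube I = (\<Pi>\<^sub>E i\<in>UNIV. if i \<in> I then {-1..1} else {0})"

lemma coordinate_algebra_dense:
  fixes g :: "('i::countable \<Rightarrow> real) \<Rightarrow> real"
  assumes g: "continuous_on (cube I) g" and e: "e > 0"
  shows "\<exists>h\<in>coordinate_algebra I. \<forall>s\<in>cube I. \<bar>g s - h s\<bar> < e"
proof -
  have "compactin (product_topology (\<lambda>i::'i. euclidean) UNIV) (cube I)"
    unfolding cube_def compactin_PiE by (auto simp: compactin_euclidean_iff)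
  then have comp: "compact (cube I)" by (simp add: euclidean_product_topology compactin_euclidean_iff)
  interpret function_ring_on "coordinate_algebra I" "cube I"
  proof
    show "continuous_on (cube I) f" if "f \<in> coordinate_algebra I" for f
      using that
    proof induction
      case (coord i)
      show ?case by (rule continuous_on_subset[OF continuous_on_product_coordinates]) simp
    qed (auto intro!: continuous_intros)
    show "\<exists>f\<in>coordinate_algebra I. f s \<noteq> f t" if st: "s \<in> cube I" "t \<in> cube I" "s \<noteq> t" for s t
    proof -
      obtain i where i: "s i \<noteq> t i" using st by auto
      moreover have "s i = 0 \<and> t i = 0" if "i \<notin> I"
        using that st by (auto simp: cube_def PiE_iff dest: spec[of _ i])
      ultimately have "i \<in> I" by metis
      then show ?thesis using coordinate_algebra.coord[of i I] i by (intro bexI[of _ "\<lambda>s. s i"]) auto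
    qed
  qed (auto intro: coordinate_algebra.intros comp)
  show ?thesis by (rule Stone_Weierstrass_basic[OF g e])
qed

text \<open>Levy's continuity theorem in dimension one. In the multivariate case it is applied to
  cut-offs of single coordinates and thereby supplies tightness.\<close>

lemma tight_of_char:
  fixes V :: "nat \<Rightarrow> 'a \<Rightarrow> real" and V' :: "'b \<Rightarrow> real"
  assumes M: "prob_space M" and M': "prob_space M'"
    and [measurable]: "\<And>n. V n \<in> borel_measurable M" "V' \<in> borel_measurable M'"
    and char: "\<And>\<theta>. (\<lambda>n. \<integral>\<omega>. iexp (\<theta> * V n \<omega>) \<partial>M) \<longlonglongrightarrow> (\<integral>\<omega>. iexp (\<theta> * V' \<omega>) \<partial>M')"
    and G: "\<And>x. isCont G x" and GB: "\<And>x. norm (G x :: real) \<le> B"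
  shows "(\<lambda>n. \<integral>\<omega>. G (V n \<omega>) \<partial>M) \<longlonglongrightarrow> (\<integral>\<omega>. G (V' \<omega>) \<partial>M')"
proof -
  interpret M: prob_space M by fact
  interpret M': prob_space M' by fact
  have rd: "real_distribution (distr M borel (V n))" for n by (rule M.real_distribution_distr) simp
  have rd': "real_distribution (distr M' borel V')" by (rule M'.real_distribution_distr) simp
  have "weak_conv_m (\<lambda>n. distr M borel (V n)) (distr M' borel V')"
  proof (rule levy_continuity[OF rd rd'])
    show "(\<lambda>n. char (distr M borel (V n)) \<theta>) \<longlonglongrightarrow> char (distr M' borel V') \<theta>" for \<theta>
      using char[of \<theta>] by (simp add: char_def integral_distr)
  qed
  from weak_conv_imp_integral_bdd_continuous_conv[OF rd rd' this G GB]
  have "(\<lambda>n. integral\<^sup>L (distr M borel (V n)) G) \<longlonglongrightarrow> integral\<^sup>L (distr M' borel V') G" .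
  moreover have "G \<in> borel_measurable borel"
    by (intro borel_measurable_continuous_onI) (simp add: continuous_at_imp_continuous_on G)
  ultimately show ?thesis by (simp add: integral_distr)
qed

text \<open>Where all coordinates are at most K in absolute value, x i = K * arcsin (sin (x i / K)),
  so G is a continuous function of the sines and uniformly close to a polynomial in them. Such a
  polynomial is a linear combination of characters, and its integrals converge by hypothesis. The
  tails outside that region are controlled coordinate by coordinate.\<close>

theorem multivariate_levy_continuity:
  fixes V :: "nat \<Rightarrow> 'i::countable \<Rightarrow> 'a \<Rightarrow> real" and V' :: "'i \<Rightarrow> 'b \<Rightarrow> real" and G :: "('i \<Rightarrow> real) \<Rightarrow> real"
  assumes M: "prob_space M" and M': "prob_space M'" and I: "finite I"
    and V: "\<And>n i. i \<in> I \<Longrightarrow> V n i \<in> borel_measurable M" and V': "\<And>i. i \<in> I \<Longrightarrow> V' i \<in> borel_measurable M'"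
    and char: "\<And>\<theta>. (\<lambda>n. \<integral>\<omega>. iexp (\<Sum>i\<in>I. \<theta> i * V n i \<omega>) \<partial>M) \<longlonglongrightarrow> (\<integral>\<omega>. iexp (\<Sum>i\<in>I. \<theta> i * V' i \<omega>) \<partial>M')"
    and G: "continuous_on UNIV G" and GB: "\<And>x. \<bar>G x\<bar> \<le> B"
  shows "(\<lambda>n. \<integral>\<omega>. G (\<lambda>i. if i \<in> I then V n i \<omega> else 0) \<partial>M) \<longlonglongrightarrow> (\<integral>\<omega>. G (\<lambda>i. if i \<in> I then V' i \<omega> else 0) \<partial>M')"
proof -
  interpret M: prob_space M by fact
  interpret M': prob_space M' by fact
  define v where "v n \<omega> i = (if i \<in> I then V n i \<omega> else 0)" for n \<omega> i
  define v' where "v' \<omega> i = (if i \<in> I then V' i \<omega> else 0)" for \<omega> i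
  have vm[measurable]: "v n \<in> borel_measurable M" for n
  proof (rule measurable_coordinatewise_then_product)
    show "(\<lambda>\<omega>. v n \<omega> i) \<in> borel_measurable M" for i by (cases "i \<in> I") (simp_all add: v_def V)
  qed
  have v'm[measurable]: "v' \<in> borel_measurable M'"
  proof (rule measurable_coordinatewise_then_product)
    show "(\<lambda>\<omega>. v' \<omega> i) \<in> borel_measurable M'" for i by (cases "i \<in> I") (simp_all add: v'_def V')
  qed
  have [measurable]: "(\<lambda>x::'i \<Rightarrow> real. x i) \<in> borel_measurable borel" for i
    by (intro borel_measurable_continuous_onI continuous_on_product_coordinates)
  define e where "e \<theta> x = iexp (\<Sum>i\<in>I. \<theta> i * x i)" for \<theta> x :: "'i \<Rightarrow> real"
  have em[measurable]: "e \<theta> \<in> borel_measurable borel" for \<theta> unfolding e_def by measurable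
  have en: "cmod (e \<theta> x) = 1" for \<theta> x unfolding e_def by (simp add: norm_exp_i_times)
  define conv where "conv W \<longleftrightarrow> W \<in> borel_measurable borel \<and> (\<exists>C. \<forall>x. cmod (W x) \<le> C) \<and>
    (\<forall>\<theta>. (\<lambda>n. \<integral>\<omega>. W (v n \<omega>) * e \<theta> (v n \<omega>) \<partial>M) \<longlonglongrightarrow> (\<integral>\<omega>. W (v' \<omega>) * e \<theta> (v' \<omega>) \<partial>M'))" for W
  have int: "integrable M (\<lambda>\<omega>. W (v n \<omega>) * e \<theta> (v n \<omega>))" "integrable M' (\<lambda>\<omega>. W (v' \<omega>) * e \<theta> (v' \<omega>))"
    if W: "conv W" for W \<theta> n
  proof -
    obtain C where C: "\<And>x. cmod (W x) \<le> C" and [measurable]: "W \<in> borel_measurable borel"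
      using W unfolding conv_def by blast
    show "integrable M (\<lambda>\<omega>. W (v n \<omega>) * e \<theta> (v n \<omega>))"
      by (rule M.integrable_const_bound[of _ C]) (auto simp: norm_mult en C)
    show "integrable M' (\<lambda>\<omega>. W (v' \<omega>) * e \<theta> (v' \<omega>))"
      by (rule M'.integrable_const_bound[of _ C]) (auto simp: norm_mult en C)
  qed
  have step: "conv (\<lambda>x. of_real (h (\<lambda>i. if i \<in> I then sin (x i / K) else 0)) * W x)"
    if h: "h \<in> coordinate_algebra I" and W: "conv W" for h W and K :: real
    using h W
  proof (induction arbitrary: W)
    case (const c)
    have "\<exists>C. \<forall>x. cmod (of_real c * W x) \<le> C"
    proof -
      obtain C where "\<And>x. cmod (W x) \<le> C" using const unfolding conv_def by blast
      then have "cmod (of_real c * W x) \<le> \<bar>c\<bar> * C" for x by (simp add: norm_mult mult_left_mono)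
      then show ?thesis by blast
    qed
    moreover have "(\<lambda>x. of_real c * W x) \<in> borel_measurable borel" using const by (auto simp: conv_def)
    ultimately show ?case using const unfolding conv_def
      by (auto simp: mult.assoc intro!: tendsto_intros)
  next
    case (coord i)
    obtain C where C: "\<And>x. cmod (W x) \<le> C" and Wm[measurable]: "W \<in> borel_measurable borel"
      using coord.prems unfolding conv_def by blast
    define s where "s x = complex_of_real (if i \<in> I then sin (x i / K) else 0) * W x" for x :: "'i \<Rightarrow> real"
    have eq: "s x * e \<theta> x = (1 / (2 * \<i>)) * (W x * e (\<theta>(i := \<theta> i + 1 / K)) x - W x * e (\<theta>(i := \<theta> i - 1 / K)) x)" for x \<theta>
    proof -
      have shift: "e (\<theta>(i := \<theta> i + d)) x = e \<theta> x * iexp (d * x i)" for d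
      proof -
        have "(\<Sum>j\<in>I. (\<theta>(i := \<theta> i + d)) j * x j) = (\<Sum>j\<in>I. \<theta> j * x j + (if j = i then d * x i else 0))"
          by (rule sum.cong) (auto simp: algebra_simps)
        also have "\<dots> = (\<Sum>j\<in>I. \<theta> j * x j) + d * x i" using coord.hyps I by (simp add: sum.distrib)
        finally show ?thesis unfolding e_def by (simp add: exp_add distrib_left)
      qed
      have "complex_of_real (sin (x i / K)) = (iexp (x i / K) - iexp (- (x i / K))) / (2 * \<i>)"
        unfolding sin_of_real[symmetric] sin_exp_eq by (simp add: exp_minus)
      then have "s x * e \<theta> x = (iexp (x i / K) - iexp (- (x i / K))) / (2 * \<i>) * (W x * e \<theta> x)"
        using coord.hyps by (simp add: s_def)
      moreover have "e (\<theta>(i := \<theta> i + 1 / K)) x = e \<theta> x * iexp (x i / K)" using shift[of "1/K"] by simp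
      moreover have "e (\<theta>(i := \<theta> i - 1 / K)) x = e \<theta> x * iexp (- (x i / K))" using shift[of "-1/K"] by simp
      moreover have "(p - q) / c * (w * t) = (1 / c) * (w * (t * p) - w * (t * q))" for p q c w t :: complex
        by (simp add: algebra_simps diff_divide_distrib)
      ultimately show ?thesis by (simp only:)
    qed
    have "cmod (s x) \<le> 1 * C" for x
      unfolding s_def norm_mult by (intro mult_mono C) (auto simp: order_trans[OF norm_ge_zero C])
    then have "\<exists>C. \<forall>x. cmod (s x) \<le> C" by blast
    moreover have "s \<in> borel_measurable borel" unfolding s_def by measurable
    moreover have "(\<lambda>n. \<integral>\<omega>. s (v n \<omega>) * e \<theta> (v n \<omega>) \<partial>M) \<longlonglongrightarrow> (\<integral>\<omega>. s (v' \<omega>) * e \<theta> (v' \<omega>) \<partial>M')" for \<theta>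
    proof -
      have "(\<lambda>n. (1 / (2 * \<i>)) * ((\<integral>\<omega>. W (v n \<omega>) * e (\<theta>(i := \<theta> i + 1 / K)) (v n \<omega>) \<partial>M) - (\<integral>\<omega>. W (v n \<omega>) * e (\<theta>(i := \<theta> i - 1 / K)) (v n \<omega>) \<partial>M)))
        \<longlonglongrightarrow> (1 / (2 * \<i>)) * ((\<integral>\<omega>. W (v' \<omega>) * e (\<theta>(i := \<theta> i + 1 / K)) (v' \<omega>) \<partial>M') - (\<integral>\<omega>. W (v' \<omega>) * e (\<theta>(i := \<theta> i - 1 / K)) (v' \<omega>) \<partial>M'))"
        using coord.prems by (intro tendsto_intros) (auto simp: conv_def)
      then show ?thesis unfolding eq
        by (simp only: integral_mult_right_zero Bochner_Integration.integral_diff int[OF coord.prems])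
    qed
    ultimately show ?case unfolding s_def[abs_def] conv_def by blast
  next
    case (add h k)
    let ?u = "\<lambda>x::'i \<Rightarrow> real. (\<lambda>i. if i \<in> I then sin (x i / K) else 0)"
    have 1: "conv (\<lambda>x. of_real (h (?u x)) * W x)" and 2: "conv (\<lambda>x. of_real (k (?u x)) * W x)"
      using add by auto
    obtain C where C: "\<And>x. cmod (of_real (h (?u x)) * W x) \<le> C" using 1 unfolding conv_def by blast
    obtain D where D: "\<And>x. cmod (of_real (k (?u x)) * W x) \<le> D" using 2 unfolding conv_def by blast
    have "cmod (of_real (h (?u x)) * W x + of_real (k (?u x)) * W x) \<le> C + D" for x
      by (rule norm_triangle_le[OF add_mono[OF C D]])
    then have "\<exists>C. \<forall>x. cmod (of_real (h (?u x)) * W x + of_real (k (?u x)) * W x) \<le> C" by blast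
    moreover have "(\<lambda>x. of_real (h (?u x)) * W x + of_real (k (?u x)) * W x) \<in> borel_measurable borel"
      using 1 2 unfolding conv_def by (intro borel_measurable_add) auto
    moreover have "(\<lambda>n. \<integral>\<omega>. (of_real (h (?u (v n \<omega>))) * W (v n \<omega>) + of_real (k (?u (v n \<omega>))) * W (v n \<omega>)) * e \<theta> (v n \<omega>) \<partial>M)
      \<longlonglongrightarrow> (\<integral>\<omega>. (of_real (h (?u (v' \<omega>))) * W (v' \<omega>) + of_real (k (?u (v' \<omega>))) * W (v' \<omega>)) * e \<theta> (v' \<omega>) \<partial>M')" for \<theta>
      unfolding distrib_right
      by (simp only: Bochner_Integration.integral_add int[OF 1] int[OF 2])
         (use 1 2 in \<open>auto simp: conv_def intro!: tendsto_add\<close>)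
    ultimately have "conv (\<lambda>x. of_real (h (?u x)) * W x + of_real (k (?u x)) * W x)" unfolding conv_def by blast
    then show ?case by (simp add: distrib_right)
  next
    case (mult h k)
    let ?u = "\<lambda>x::'i \<Rightarrow> real. (\<lambda>i. if i \<in> I then sin (x i / K) else 0)"
    have "conv (\<lambda>x. of_real (h (?u x)) * (of_real (k (?u x)) * W x))"
      using mult.IH(1)[OF mult.IH(2)[OF mult.prems]] .
    then show ?case by (simp add: mult.assoc)
  qed
  have e0: "e (\<lambda>_. 0) x = 1" for x by (simp add: e_def)
  have e_v: "e \<theta> (v n \<omega>) = iexp (\<Sum>i\<in>I. \<theta> i * V n i \<omega>)" "e \<theta> (v' \<omega>') = iexp (\<Sum>i\<in>I. \<theta> i * V' i \<omega>')" for \<theta> n \<omega> \<omega>'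
    unfolding e_def v_def v'_def by simp_all
  have conv1: "conv (\<lambda>_. 1)" unfolding conv_def using char by (auto simp: e_v intro!: exI[of _ 1])
  \<comment> \<open>A continuous substitute for the indicator of \<bar>x\<bar> > k; it reaches 1 at
    k + 1, which is the K chosen below.\<close>
  define \<psi> :: "nat \<Rightarrow> real \<Rightarrow> real" where "\<psi> k x = min 1 (max 0 (\<bar>x\<bar> - real k))" for k x
  have \<psi>: "0 \<le> \<psi> k x" "\<psi> k x \<le> 1" "norm (\<psi> k x) \<le> 1" "isCont (\<psi> k) x" for k x
    unfolding \<psi>_def by (auto intro!: continuous_intros)
  have \<psi>m[measurable]: "\<psi> k \<in> borel_measurable borel" for k unfolding \<psi>_def by measurable
  have Gm[measurable]: "G \<in> borel_measurable borel" by (rule borel_measurable_continuous_onI[OF G])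
  have B: "B \<ge> 0" using GB[of undefined] by simp
  have \<psi>conv: "(\<lambda>n. \<Sum>i\<in>I. \<integral>\<omega>. \<psi> k (V n i \<omega>) \<partial>M) \<longlonglongrightarrow> (\<Sum>i\<in>I. \<integral>\<omega>. \<psi> k (V' i \<omega>) \<partial>M')" for k
  proof (rule tendsto_sum)
    fix i assume i: "i \<in> I"
    have single: "(\<Sum>j\<in>I. (if j = i then \<theta> else 0) * f j) = \<theta> * f i" for \<theta> and f :: "'i \<Rightarrow> real"
      using i I by (simp add: if_distrib[of "\<lambda>x. x * _"] cong: if_cong)
    show "(\<lambda>n. \<integral>\<omega>. \<psi> k (V n i \<omega>) \<partial>M) \<longlonglongrightarrow> (\<integral>\<omega>. \<psi> k (V' i \<omega>) \<partial>M')"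
    proof (rule tight_of_char[OF M M' V[OF i] V'[OF i] _ \<psi>(4,3)])
      show "(\<lambda>n. \<integral>\<omega>. iexp (\<theta> * V n i \<omega>) \<partial>M) \<longlonglongrightarrow> (\<integral>\<omega>. iexp (\<theta> * V' i \<omega>) \<partial>M')" for \<theta>
        using char[of "\<lambda>j. if j = i then \<theta> else 0"] unfolding single .
    qed
  qed
  have \<psi>0: "(\<lambda>k. \<Sum>i\<in>I. \<integral>\<omega>. \<psi> k (V' i \<omega>) \<partial>M') \<longlonglongrightarrow> (\<Sum>i\<in>I. 0)"
  proof (rule tendsto_sum)
    fix i assume i: "i \<in> I"
    note [measurable] = V'[OF i]
    have "(\<lambda>k. \<integral>\<omega>. \<psi> k (V' i \<omega>) \<partial>M') \<longlonglongrightarrow> (\<integral>\<omega>. 0 \<partial>M')"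
    proof (rule integral_dominated_convergence[where w = "\<lambda>_. 1"])
      have "(\<lambda>k. \<psi> k x) \<longlonglongrightarrow> 0" for x
      proof (rule tendsto_eventually)
        obtain k0 where "\<bar>x\<bar> \<le> real k0" using real_arch_simple by blast
        then show "\<forall>\<^sub>F k in sequentially. \<psi> k x = 0"
          unfolding eventually_sequentially \<psi>_def by (intro exI[of _ k0]) auto
      qed
      then show "AE \<omega> in M'. (\<lambda>k. \<psi> k (V' i \<omega>)) \<longlonglongrightarrow> 0" by simp
    qed (auto simp: \<psi>)
    then show "(\<lambda>k. \<integral>\<omega>. \<psi> k (V' i \<omega>) \<partial>M') \<longlonglongrightarrow> 0" by simp
  qed
  have "(\<lambda>n. \<integral>\<omega>. G (v n \<omega>) \<partial>M) \<longlonglongrightarrow> (\<integral>\<omega>. G (v' \<omega>) \<partial>M')"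
  proof (rule LIMSEQ_I)
    fix r :: real assume r: "r > 0"
    \<comment> \<open>The errors add up to (4 B + 3) \<epsilon>: a tail 2 B \<epsilon> and an
      approximation error \<epsilon> on either side, and \<epsilon> for the two integrals of the
      polynomial h.\<close>
    define \<epsilon> where "\<epsilon> = r / (4 * B + 4)"
    have \<epsilon>: "\<epsilon> > 0" "(4 * B + 3) * \<epsilon> < r" using r B by (auto simp: \<epsilon>_def field_simps)
    have "\<forall>\<^sub>F k in sequentially. (\<Sum>i\<in>I. \<integral>\<omega>. \<psi> k (V' i \<omega>) \<partial>M') < \<epsilon>" using \<psi>0 \<epsilon> by (intro order_tendstoD) auto
    then obtain k where k: "(\<Sum>i\<in>I. \<integral>\<omega>. \<psi> k (V' i \<omega>) \<partial>M') < \<epsilon>" using eventually_happens by force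
    define K where "K = real k + 1"
    have K: "K > 0" by (simp add: K_def)
    define u where "u x = (\<lambda>i. if i \<in> I then sin (x i / K) else 0)" for x :: "'i \<Rightarrow> real"
    define g where "g s = G (\<lambda>i. K * arcsin (s i))" for s
    have ucube: "u x \<in> cube I" for x by (auto simp: u_def cube_def PiE_iff)
    have "continuous_on (cube I) (\<lambda>s. \<lambda>i. K * arcsin (s i))"
    proof (rule continuous_on_coordinatewise_then_product)
      fix i
      have "continuous_on (cube I) (\<lambda>s. s i)"
        by (rule continuous_on_subset[OF continuous_on_product_coordinates]) simp
      moreover have "-1 \<le> s i \<and> s i \<le> 1" if "s \<in> cube I" for s
        using that by (cases "i \<in> I") (auto simp: cube_def PiE_iff dest: spec[of _ i])
      ultimately show "continuous_on (cube I) (\<lambda>s. K * arcsin (s i))"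
        by (intro continuous_on_mult continuous_on_const continuous_on_arcsin) auto
    qed
    then have gc: "continuous_on (cube I) g" unfolding g_def by (rule continuous_on_compose2[OF G]) auto
    obtain h where h: "h \<in> coordinate_algebra I" "\<And>s. s \<in> cube I \<Longrightarrow> \<bar>g s - h s\<bar> < \<epsilon>"
      using coordinate_algebra_dense[OF gc \<epsilon>(1)] by blast
    have cv: "conv (\<lambda>x. of_real (h (u x)) * 1)" using step[OF h(1) conv1, of K] unfolding u_def .
    then have hm[measurable]: "(\<lambda>x. h (u x)) \<in> borel_measurable borel"
      unfolding conv_def by (auto dest!: measurable_compose[OF _ borel_measurable_Re] simp: o_def)
    have "(\<lambda>n. \<integral>\<omega>. of_real (h (u (v n \<omega>))) * 1 * e (\<lambda>_. 0) (v n \<omega>) \<partial>M) \<longlonglongrightarrow> (\<integral>\<omega>. of_real (h (u (v' \<omega>))) * 1 * e (\<lambda>_. 0) (v' \<omega>) \<partial>M')"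
      using cv by (auto simp: conv_def simp del: mult_1_right)
    then have hconv: "(\<lambda>n. \<integral>\<omega>. h (u (v n \<omega>)) \<partial>M) \<longlonglongrightarrow> (\<integral>\<omega>. h (u (v' \<omega>)) \<partial>M')"
      by (simp add: e0 tendsto_of_real_iff)
    have hB: "\<bar>h (u x)\<bar> \<le> B + \<epsilon>" for x
      using h(2)[OF ucube, of x] GB[of "\<lambda>i. K * arcsin (u x i)"] unfolding g_def by linarith
    \<comment> \<open>If all coordinates are at most K, then \<bar>x i / K\<bar> \<le> 1 < pi / 2
      and arcsin undoes the sine. Otherwise some \<open>\<psi> k (x i)\<close> is 1 and pays for the
      trivial bound 2 B + \<epsilon>.\<close>
    have diff: "\<bar>G x - h (u x)\<bar> \<le> 2 * B * (\<Sum>i\<in>I. \<psi> k (x i)) + \<epsilon>" if x: "\<And>i. i \<notin> I \<Longrightarrow> x i = 0" for x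
    proof (cases "\<forall>i\<in>I. \<bar>x i\<bar> \<le> K")
      case True
      have "K * arcsin (u x i) = x i" for i
      proof (cases "i \<in> I")
        case i: True
        have "\<bar>x i / K\<bar> \<le> 1" using True i K by (simp add: field_simps)
        then have "- (pi/2) \<le> x i / K" "x i / K \<le> pi / 2" using pi_gt3 unfolding abs_le_iff by linarith+
        then show ?thesis using i K by (simp add: u_def arcsin_sin)
      qed (simp add: u_def x)
      then have "g (u x) = G x" by (simp add: g_def)
      moreover have "0 \<le> 2 * B * (\<Sum>i\<in>I. \<psi> k (x i))" using B \<psi> by (intro mult_nonneg_nonneg sum_nonneg) auto
      ultimately show ?thesis using h(2)[OF ucube, of x] by linarith
    next
      case False
      then obtain i where i: "i \<in> I" "\<bar>x i\<bar> > K" by auto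
      have "1 = \<psi> k (x i)" using i by (auto simp: \<psi>_def K_def)
      also have "\<dots> \<le> (\<Sum>i\<in>I. \<psi> k (x i))" using i I \<psi> by (intro member_le_sum) auto
      finally have "2 * B * 1 \<le> 2 * B * (\<Sum>i\<in>I. \<psi> k (x i))" using B by (intro mult_left_mono) auto
      then show ?thesis using GB[of x] hB[of x] by linarith
    qed
    have close: "\<bar>(\<integral>\<omega>. G (w \<omega>) \<partial>N) - (\<integral>\<omega>. h (u (w \<omega>)) \<partial>N)\<bar> \<le> 2 * B * (\<Sum>i\<in>I. \<integral>\<omega>. \<psi> k (w \<omega> i) \<partial>N) + \<epsilon>"
      if N: "prob_space N" and [measurable]: "w \<in> borel_measurable N" and w: "\<And>\<omega> i. i \<notin> I \<Longrightarrow> w \<omega> i = 0" for N :: "'c measure" and w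
    proof -
      interpret N: prob_space N by fact
      have [measurable]: "(\<lambda>\<omega>. w \<omega> i) \<in> borel_measurable N" for i by (rule measurable_product_then_coordinatewise) simp
      have iG: "integrable N (\<lambda>\<omega>. G (w \<omega>))" by (rule N.integrable_const_bound[of _ B]) (auto simp: GB)
      have ih: "integrable N (\<lambda>\<omega>. h (u (w \<omega>)))" by (rule N.integrable_const_bound[of _ "B + \<epsilon>"]) (auto simp: hB)
      have i\<psi>: "integrable N (\<lambda>\<omega>. \<psi> k (w \<omega> i))" for i by (rule N.integrable_const_bound[of _ 1]) (auto simp: \<psi>)
      have "(\<integral>\<omega>. G (w \<omega>) \<partial>N) - (\<integral>\<omega>. h (u (w \<omega>)) \<partial>N) = (\<integral>\<omega>. G (w \<omega>) - h (u (w \<omega>)) \<partial>N)"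
        by (simp add: iG ih)
      also have "\<bar>\<dots>\<bar> \<le> (\<integral>\<omega>. \<bar>G (w \<omega>) - h (u (w \<omega>))\<bar> \<partial>N)" by (rule integral_abs_bound)
      also have "\<dots> \<le> (\<integral>\<omega>. 2 * B * (\<Sum>i\<in>I. \<psi> k (w \<omega> i)) + \<epsilon> \<partial>N)"
        by (intro integral_mono integrable_abs Bochner_Integration.integrable_diff iG ih Bochner_Integration.integrable_add
            integrable_mult_right Bochner_Integration.integrable_sum i\<psi> N.integrable_const diff w)
      also have "\<dots> = 2 * B * (\<Sum>i\<in>I. \<integral>\<omega>. \<psi> k (w \<omega> i) \<partial>N) + \<epsilon>"
        by (simp add: i\<psi> N.prob_space Bochner_Integration.integral_sum)
      finally show ?thesis .
    qed
    have "\<forall>\<^sub>F n in sequentially. (\<Sum>i\<in>I. \<integral>\<omega>. \<psi> k (V n i \<omega>) \<partial>M) < \<epsilon>" using \<psi>conv k by (intro order_tendstoD) auto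
    moreover have "\<forall>\<^sub>F n in sequentially. \<bar>(\<integral>\<omega>. h (u (v n \<omega>)) \<partial>M) - (\<integral>\<omega>. h (u (v' \<omega>)) \<partial>M')\<bar> < \<epsilon>"
      using tendstoD[OF hconv \<epsilon>(1)] by (simp add: dist_real_def)
    ultimately have "\<forall>\<^sub>F n in sequentially. norm ((\<integral>\<omega>. G (v n \<omega>) \<partial>M) - (\<integral>\<omega>. G (v' \<omega>) \<partial>M')) < r"
    proof eventually_elim
      case (elim n)
      have a: "(\<Sum>i\<in>I. \<integral>\<omega>. \<psi> k (v n \<omega> i) \<partial>M) = (\<Sum>i\<in>I. \<integral>\<omega>. \<psi> k (V n i \<omega>) \<partial>M)"
        "(\<Sum>i\<in>I. \<integral>\<omega>. \<psi> k (v' \<omega> i) \<partial>M') = (\<Sum>i\<in>I. \<integral>\<omega>. \<psi> k (V' i \<omega>) \<partial>M')" by (simp_all add: v_def v'_def)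
      have 1: "2 * B * (\<Sum>i\<in>I. \<integral>\<omega>. \<psi> k (V n i \<omega>) \<partial>M) \<le> 2 * B * \<epsilon>" and 2: "2 * B * (\<Sum>i\<in>I. \<integral>\<omega>. \<psi> k (V' i \<omega>) \<partial>M') \<le> 2 * B * \<epsilon>"
        using elim k B by (auto intro!: mult_left_mono)
      show ?case
        using close[OF M vm, of n] close[OF M' v'm] elim(2) 1 2 \<epsilon>(2) unfolding a
        by (auto simp: v_def v'_def algebra_simps abs_le_iff abs_less_iff)
    qed
    then show "\<exists>no. \<forall>n\<ge>no. norm ((\<integral>\<omega>. G (v n \<omega>) \<partial>M) - (\<integral>\<omega>. G (v' \<omega>) \<partial>M')) < r"
      unfolding eventually_sequentially .
  qed
  then show ?thesis unfolding v_def[abs_def] v'_def[abs_def] .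
qed

section \<open>Sums of independent random variables\<close>

lemma norm_integral_le:
  fixes f :: "'a \<Rightarrow> 'b::{banach, second_countable_topology}"
  assumes "integrable M f" "integrable M g" "\<And>x. norm (f x) \<le> g x"
  shows "norm (\<integral>x. f x \<partial>M) \<le> (\<integral>x. g x \<partial>M)"
  using assms by (intro order_trans[OF integral_norm_bound integral_mono]) auto

text \<open>The upper bound for exp (- x) comes from (1 - x + x^2 / 2) (1 + x + x^2 / 2) = 1 + x^4 /
  4 \<ge> 1 and the quadratic lower bound for exp x.\<close>

lemma exp_minus_quadratic_bound:
  fixes x :: real
  assumes "0 \<le> x" shows "\<bar>(1 - x) - exp (- x)\<bar> \<le> x\<^sup>2 / 2"
proof -
  have "1 + x + x\<^sup>2 / 2 \<le> exp x" using exp_lower_Taylor_quadratic[OF assms] by simp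
  moreover have "0 < 1 + x + x\<^sup>2 / 2" using assms by (simp add: add_pos_nonneg)
  ultimately have "exp (- x) \<le> 1 / (1 + x + x\<^sup>2 / 2)" by (simp add: exp_minus field_simps)
  also have "\<dots> \<le> 1 - x + x\<^sup>2 / 2"
  proof -
    have "(1 - x + x\<^sup>2 / 2) * (1 + x + x\<^sup>2 / 2) = 1 + x ^ 4 / 4" by (simp add: algebra_simps power2_eq_square power4_eq_xxxx)
    then have "1 \<le> (1 - x + x\<^sup>2 / 2) * (1 + x + x\<^sup>2 / 2)" by simp
    then show ?thesis using \<open>0 < 1 + x + x\<^sup>2 / 2\<close> by (simp add: pos_divide_le_eq)
  qed
  finally show ?thesis using exp_ge_add_one_self[of "- x"] by (simp add: abs_le_iff)
qed

lemma (in prob_space) iexp_third_order: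
  assumes Y: "Y \<in> borel_measurable M" "integrable M Y" "expectation Y = 0"
    "integrable M (\<lambda>\<omega>. (Y \<omega>)\<^sup>2)" "expectation (\<lambda>\<omega>. (Y \<omega>)\<^sup>2) = 1"
    "integrable M (\<lambda>\<omega>. \<bar>Y \<omega>\<bar> ^ 3)" "expectation (\<lambda>\<omega>. \<bar>Y \<omega>\<bar> ^ 3) \<le> K"
  shows "cmod ((\<integral>\<omega>. iexp (w * Y \<omega>) \<partial>M) - of_real (1 - w\<^sup>2 / 2)) \<le> \<bar>w\<bar> ^ 3 * K / 6"
proof -
  note [measurable] = Y(1)
  \<comment> \<open>The Taylor polynomial of degree two; mean zero and unit second moment make its
    expectation 1 - w^2 / 2.\<close>
  define T where "T \<omega> = 1 + \<i> * of_real (w * Y \<omega>) - of_real ((w * Y \<omega>)\<^sup>2 / 2)" for \<omega>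
  have pt: "cmod (iexp (w * Y \<omega>) - T \<omega>) \<le> \<bar>w\<bar> ^ 3 * \<bar>Y \<omega>\<bar> ^ 3 / 6" for \<omega>
  proof -
    have "(\<Sum>k\<le>2. z ^ k / fact k) = 1 + z + z * z / 2" for z :: complex by (simp add: numeral_2_eq_2)
    moreover have "\<i> * c * (\<i> * c) = - (c * c)" for c
    proof -
      have "\<i> * c * (\<i> * c) = (\<i> * \<i>) * (c * c)" by (simp only: mult_ac)
      then show ?thesis by simp
    qed
    ultimately have "(\<Sum>k\<le>2. (\<i> * of_real (w * Y \<omega>)) ^ k / fact k) = T \<omega>"
      unfolding T_def by (simp add: power2_eq_square)
    moreover have "\<bar>w * Y \<omega>\<bar> ^ Suc 2 / fact (Suc 2) = \<bar>w\<bar> ^ 3 * \<bar>Y \<omega>\<bar> ^ 3 / 6"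
    proof -
      have "Suc 2 = 3" by simp
      then show ?thesis by (simp only:) (simp add: abs_mult power_mult_distrib fact_numeral)
    qed
    ultimately show ?thesis using iexp_approx1[of "w * Y \<omega>" 2] by (simp only:)
  qed
  have iT1: "integrable M (\<lambda>\<omega>. \<i> * of_real (w * Y \<omega>))" using Y(2) by (intro integrable_mult_right integrable_of_real) auto
  have iT2: "integrable M (\<lambda>\<omega>. complex_of_real ((w * Y \<omega>)\<^sup>2 / 2))"
    using Y(4) by (intro integrable_of_real) (simp add: power_mult_distrib)
  have iT: "integrable M T" unfolding T_def using iT1 iT2 by (intro Bochner_Integration.integrable_diff Bochner_Integration.integrable_add) auto
  have "(\<integral>\<omega>. T \<omega> \<partial>M) = 1 + \<i> * of_real (\<integral>\<omega>. w * Y \<omega> \<partial>M) - of_real (\<integral>\<omega>. (w * Y \<omega>)\<^sup>2 / 2 \<partial>M)"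
    unfolding T_def by (simp only: Bochner_Integration.integral_diff Bochner_Integration.integral_add iT1 iT2
        Bochner_Integration.integrable_add integrable_const integral_mult_right_zero integral_complex_of_real)
      (simp add: prob_space)
  also have "\<dots> = of_real (1 - w\<^sup>2 / 2)" using Y by (simp add: power_mult_distrib)
  finally have ET: "(\<integral>\<omega>. T \<omega> \<partial>M) = of_real (1 - w\<^sup>2 / 2)" .
  have ie: "integrable M (\<lambda>\<omega>. iexp (w * Y \<omega>))"
    by (rule integrable_const_bound[of _ 1]) (auto simp: norm_exp_i_times simp del: of_real_mult)
  have "(\<integral>\<omega>. iexp (w * Y \<omega>) \<partial>M) - of_real (1 - w\<^sup>2 / 2) = (\<integral>\<omega>. iexp (w * Y \<omega>) - T \<omega> \<partial>M)"
    unfolding ET[symmetric] using ie iT by simp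
  also have "cmod \<dots> \<le> (\<integral>\<omega>. \<bar>w\<bar> ^ 3 * \<bar>Y \<omega>\<bar> ^ 3 / 6 \<partial>M)"
    using ie iT Y(6) pt by (intro norm_integral_le) auto
  also have "\<dots> \<le> \<bar>w\<bar> ^ 3 * K / 6" using Y(7) by (simp add: mult_left_mono)
  finally show ?thesis .
qed

text \<open>Lindeberg's comparison: both quantities are products of factors of modulus at most 1, so
  their distance is at most the sum of the distances of the factors. Each of these is split at 1 -
  w^2 / 2 into the Taylor error of the variable and the error x^2 / 2 of the exponential at x = w^2
  / 2.\<close>

lemma (in prob_space) cmod_char_indep_sum:
  assumes I: "finite I" and indep: "indep_vars (\<lambda>_. borel) X I"
    and X: "\<And>i. i \<in> I \<Longrightarrow> integrable M (X i)" "\<And>i. i \<in> I \<Longrightarrow> expectation (X i) = 0"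
      "\<And>i. i \<in> I \<Longrightarrow> integrable M (\<lambda>\<omega>. (X i \<omega>)\<^sup>2)" "\<And>i. i \<in> I \<Longrightarrow> expectation (\<lambda>\<omega>. (X i \<omega>)\<^sup>2) = 1"
      "\<And>i. i \<in> I \<Longrightarrow> integrable M (\<lambda>\<omega>. \<bar>X i \<omega>\<bar> ^ 3)" "\<And>i. i \<in> I \<Longrightarrow> expectation (\<lambda>\<omega>. \<bar>X i \<omega>\<bar> ^ 3) \<le> K"
  shows "cmod ((\<integral>\<omega>. iexp (\<Sum>i\<in>I. w i * X i \<omega>) \<partial>M) - of_real (exp (- (\<Sum>i\<in>I. (w i)\<^sup>2) / 2))) \<le>
    (\<Sum>i\<in>I. \<bar>w i\<bar> ^ 3 * K / 6 + (w i) ^ 4 / 8)"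
proof -
  have Xm[measurable]: "X i \<in> borel_measurable M" if "i \<in> I" for i using X(1)[OF that] by auto
  have "indep_vars (\<lambda>_. borel) (\<lambda>i \<omega>. iexp (w i * X i \<omega>)) I"
    by (rule indep_vars_compose2[OF indep, where Y = "\<lambda>i x. iexp (w i * x)"]) auto
  moreover have ie: "integrable M (\<lambda>\<omega>. iexp (w i * X i \<omega>))" if "i \<in> I" for i
    using Xm[OF that] by (intro integrable_const_bound[of _ 1]) (auto simp: norm_exp_i_times simp del: of_real_mult)
  ultimately have "(\<integral>\<omega>. (\<Prod>i\<in>I. iexp (w i * X i \<omega>)) \<partial>M) = (\<Prod>i\<in>I. \<integral>\<omega>. iexp (w i * X i \<omega>) \<partial>M)"
    by (intro indep_vars_lebesgue_integral[OF I]) auto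
  moreover have "iexp (\<Sum>i\<in>I. w i * X i \<omega>) = (\<Prod>i\<in>I. iexp (w i * X i \<omega>))" for \<omega>
    using I by (simp add: sum_distrib_left exp_sum)
  moreover have "complex_of_real (exp (- (\<Sum>i\<in>I. (w i)\<^sup>2) / 2)) = (\<Prod>i\<in>I. of_real (exp (- ((w i)\<^sup>2 / 2))))"
  proof -
    have "exp (- (\<Sum>i\<in>I. (w i)\<^sup>2) / 2) = exp (\<Sum>i\<in>I. - ((w i)\<^sup>2 / 2))"
      by (simp add: sum_divide_distrib sum_negf)
    also have "\<dots> = (\<Prod>i\<in>I. exp (- ((w i)\<^sup>2 / 2)))" by (rule exp_sum[OF I])
    finally show ?thesis by simp
  qed
  ultimately have "cmod ((\<integral>\<omega>. iexp (\<Sum>i\<in>I. w i * X i \<omega>) \<partial>M) - of_real (exp (- (\<Sum>i\<in>I. (w i)\<^sup>2) / 2))) =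
    cmod ((\<Prod>i\<in>I. \<integral>\<omega>. iexp (w i * X i \<omega>) \<partial>M) - (\<Prod>i\<in>I. of_real (exp (- ((w i)\<^sup>2 / 2)))))" by simp
  also have "\<dots> \<le> (\<Sum>i\<in>I. cmod ((\<integral>\<omega>. iexp (w i * X i \<omega>) \<partial>M) - of_real (exp (- ((w i)\<^sup>2 / 2)))))"
  proof (rule norm_prod_diff)
    fix i assume i: "i \<in> I"
    have "cmod (\<integral>\<omega>. iexp (w i * X i \<omega>) \<partial>M) \<le> (\<integral>\<omega>. cmod (iexp (w i * X i \<omega>)) \<partial>M)"
      by (rule integral_norm_bound)
    also have "\<dots> = (\<integral>\<omega>. 1 \<partial>M)" by (simp add: norm_exp_i_times del: of_real_mult)
    finally show "cmod (\<integral>\<omega>. iexp (w i * X i \<omega>) \<partial>M) \<le> 1" by (simp add: prob_space)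
  qed simp
  also have "\<dots> \<le> (\<Sum>i\<in>I. \<bar>w i\<bar> ^ 3 * K / 6 + (w i) ^ 4 / 8)"
  proof (rule sum_mono)
    fix i assume i: "i \<in> I"
    have 1: "cmod ((\<integral>\<omega>. iexp (w i * X i \<omega>) \<partial>M) - of_real (1 - (w i)\<^sup>2 / 2)) \<le> \<bar>w i\<bar> ^ 3 * K / 6"
      using X i by (intro iexp_third_order) auto
    have "cmod (of_real (1 - (w i)\<^sup>2 / 2) - of_real (exp (- ((w i)\<^sup>2 / 2)))) = \<bar>(1 - (w i)\<^sup>2 / 2) - exp (- ((w i)\<^sup>2 / 2))\<bar>"
      by (simp flip: of_real_diff)
    also have "\<dots> \<le> ((w i)\<^sup>2 / 2)\<^sup>2 / 2" by (rule exp_minus_quadratic_bound) simp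
    also have "\<dots> = (w i) ^ 4 / 8" by (simp add: power2_eq_square power4_eq_xxxx)
    finally have 2: "cmod (of_real (1 - (w i)\<^sup>2 / 2) - of_real (exp (- ((w i)\<^sup>2 / 2)))) \<le> (w i) ^ 4 / 8" .
    show "cmod ((\<integral>\<omega>. iexp (w i * X i \<omega>) \<partial>M) - of_real (exp (- ((w i)\<^sup>2 / 2)))) \<le> \<bar>w i\<bar> ^ 3 * K / 6 + (w i) ^ 4 / 8"
      using norm_triangle_mono[OF 1 2] by simp
  qed
  finally show ?thesis .
qed

section \<open>Fourth moments and a maximal inequality\<close>

lemma abs_power_le_fourth:
  fixes y :: real assumes "k \<le> 4" shows "\<bar>y ^ k\<bar> \<le> 1 + y ^ 4"
proof (cases "\<bar>y\<bar> \<le> 1")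
  case True
  then have "\<bar>y\<bar> ^ k \<le> 1" by (simp add: power_le_one)
  then show ?thesis by (simp add: power_abs add_increasing2)
next
  case False
  then have "\<bar>y\<bar> ^ k \<le> \<bar>y\<bar> ^ 4" using assms by (intro power_increasing) auto
  then show ?thesis by (simp add: power_abs)
qed

lemma (in prob_space) integrable_power_of_fourth:
  fixes Y :: "'a \<Rightarrow> real"
  assumes "Y \<in> borel_measurable M" "integrable M (\<lambda>\<omega>. Y \<omega> ^ 4)" "k \<le> 4"
  shows "integrable M (\<lambda>\<omega>. Y \<omega> ^ k)"
proof (rule Bochner_Integration.integrable_bound[of _ "\<lambda>\<omega>. 1 + Y \<omega> ^ 4"])
  show "AE \<omega> in M. norm (Y \<omega> ^ k) \<le> norm (1 + Y \<omega> ^ 4)"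
    using abs_power_le_fourth[OF assms(3)] by (intro AE_I2) (auto intro: order_trans[OF _ abs_ge_self])
qed (use assms in auto)

text \<open>In the fourth power of Y + S the terms with an odd exponent have expectation zero, so
  one more summand adds at most K + 6 m to the fourth moment, where m is the number of summands so
  far. The constant 3 is what absorbs 6 m into the growth from m^2 to (m + 1)^2.\<close>

lemma (in prob_space) fourth_moment_indep_sum:
  fixes K :: real
  assumes I: "finite I" and indep: "indep_vars (\<lambda>_. borel) X I"
    and X: "\<And>i. i \<in> I \<Longrightarrow> integrable M (\<lambda>\<omega>. X i \<omega> ^ 4)" "\<And>i. i \<in> I \<Longrightarrow> expectation (X i) = 0"
      "\<And>i. i \<in> I \<Longrightarrow> expectation (\<lambda>\<omega>. (X i \<omega>)\<^sup>2) \<le> 1" "\<And>i. i \<in> I \<Longrightarrow> expectation (\<lambda>\<omega>. X i \<omega> ^ 4) \<le> K"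
    and K: "0 \<le> K"
  shows "integrable M (\<lambda>\<omega>. (\<Sum>i\<in>I. X i \<omega>) ^ 4) \<and> expectation (\<lambda>\<omega>. \<Sum>i\<in>I. X i \<omega>) = 0 \<and>
    expectation (\<lambda>\<omega>. (\<Sum>i\<in>I. X i \<omega>)\<^sup>2) \<le> card I \<and> expectation (\<lambda>\<omega>. (\<Sum>i\<in>I. X i \<omega>) ^ 4) \<le> (3 + K) * (real (card I))\<^sup>2"
  using I indep X
proof (induction I)
  case (insert i I)
  define S where "S \<omega> = (\<Sum>j\<in>I. X j \<omega>)" for \<omega>
  define Y where "Y = X i"
  have IH: "integrable M (\<lambda>\<omega>. S \<omega> ^ 4)" "expectation S = 0"
    "expectation (\<lambda>\<omega>. (S \<omega>)\<^sup>2) \<le> card I" "expectation (\<lambda>\<omega>. S \<omega> ^ 4) \<le> (3 + K) * (real (card I))\<^sup>2"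
    using insert.IH indep_vars_subset[OF insert.prems(1)] insert.prems unfolding S_def[abs_def] by auto
  have Xm: "X j \<in> borel_measurable M" if "j \<in> insert i I" for j
    using insert.prems(1) that by (auto simp: indep_vars_def)
  have Ym[measurable]: "Y \<in> borel_measurable M" using Xm by (simp add: Y_def)
  have Sm[measurable]: "S \<in> borel_measurable M" unfolding S_def by (intro borel_measurable_sum Xm) auto
  have ind: "indep_var borel Y borel S"
    unfolding Y_def S_def by (rule indep_vars_sum[OF insert.hyps insert.prems(1)])
  have Y4: "integrable M (\<lambda>\<omega>. Y \<omega> ^ 4)" using insert.prems by (simp add: Y_def)
  have iY: "integrable M (\<lambda>\<omega>. Y \<omega> ^ a)" and iS: "integrable M (\<lambda>\<omega>. S \<omega> ^ a)" if "a \<le> 4" for a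
    using integrable_power_of_fourth[OF Ym Y4 that] integrable_power_of_fourth[OF Sm IH(1) that] by auto
  have E: "integrable M (\<lambda>\<omega>. Y \<omega> ^ a * S \<omega> ^ b)"
    "expectation (\<lambda>\<omega>. Y \<omega> ^ a * S \<omega> ^ b) = expectation (\<lambda>\<omega>. Y \<omega> ^ a) * expectation (\<lambda>\<omega>. S \<omega> ^ b)"
    if "a \<le> 4" "b \<le> 4" for a b
  proof -
    have "indep_var borel ((\<lambda>x. x ^ a) \<circ> Y) borel ((\<lambda>x. x ^ b) \<circ> S)" by (rule indep_var_compose[OF ind]) auto
    then have iv: "indep_var borel (\<lambda>\<omega>. Y \<omega> ^ a) borel (\<lambda>\<omega>. S \<omega> ^ b)" by (simp add: comp_def)
    show "integrable M (\<lambda>\<omega>. Y \<omega> ^ a * S \<omega> ^ b)" by (rule indep_var_integrable[OF iv iY[OF that(1)] iS[OF that(2)]])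
    show "expectation (\<lambda>\<omega>. Y \<omega> ^ a * S \<omega> ^ b) = expectation (\<lambda>\<omega>. Y \<omega> ^ a) * expectation (\<lambda>\<omega>. S \<omega> ^ b)"
      by (rule indep_var_lebesgue_integral[OF iv iY[OF that(1)] iS[OF that(2)]])
  qed
  have EY: "expectation Y = 0" "expectation (\<lambda>\<omega>. (Y \<omega>)\<^sup>2) \<le> 1" "expectation (\<lambda>\<omega>. Y \<omega> ^ 4) \<le> K"
    using insert.prems by (auto simp: Y_def)
  have sum: "(\<Sum>j\<in>insert i I. X j \<omega>) = Y \<omega> + S \<omega>" for \<omega> using insert.hyps by (simp add: Y_def S_def)
  have c: "card (insert i I) = card I + 1" using insert.hyps by simp
  have x4: "(Y \<omega> + S \<omega>) ^ 4 = Y \<omega> ^ 4 * S \<omega> ^ 0 + 4 * (Y \<omega> ^ 3 * S \<omega> ^ 1) + 6 * (Y \<omega> ^ 2 * S \<omega> ^ 2) + 4 * (Y \<omega> ^ 1 * S \<omega> ^ 3) + Y \<omega> ^ 0 * S \<omega> ^ 4" for \<omega>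
    by (simp add: power4_eq_xxxx power3_eq_cube power2_eq_square algebra_simps)
  have x2: "(Y \<omega> + S \<omega>)\<^sup>2 = Y \<omega> ^ 2 * S \<omega> ^ 0 + 2 * (Y \<omega> ^ 1 * S \<omega> ^ 1) + Y \<omega> ^ 0 * S \<omega> ^ 2" for \<omega>
    by (simp add: power2_eq_square algebra_simps)
  have i4: "integrable M (\<lambda>\<omega>. (Y \<omega> + S \<omega>) ^ 4)"
    unfolding x4 by (intro Bochner_Integration.integrable_add integrable_mult_right E) auto
  have e1: "expectation (\<lambda>\<omega>. Y \<omega> + S \<omega>) = 0"
    using iY[of 1] iS[of 1] EY IH by simp
  have EYS: "expectation (\<lambda>\<omega>. (Y \<omega>)\<^sup>2) * expectation (\<lambda>\<omega>. (S \<omega>)\<^sup>2) \<le> 1 * real (card I)"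
    by (intro mult_mono EY IH) auto
  have "expectation (\<lambda>\<omega>. (Y \<omega> + S \<omega>)\<^sup>2) = expectation (\<lambda>\<omega>. (Y \<omega>)\<^sup>2) + expectation (\<lambda>\<omega>. (S \<omega>)\<^sup>2)"
    unfolding x2 using iY[of 1] iS[of 1] EY IH
    by (simp only: Bochner_Integration.integral_add E integrable_mult_right Bochner_Integration.integrable_add integral_mult_right_zero)
       (simp add: prob_space)
  also have "\<dots> \<le> card I + 1" using EY IH by linarith
  finally have e2: "expectation (\<lambda>\<omega>. (Y \<omega> + S \<omega>)\<^sup>2) \<le> card I + 1" .
  have "expectation (\<lambda>\<omega>. (Y \<omega> + S \<omega>) ^ 4) = expectation (\<lambda>\<omega>. Y \<omega> ^ 4) +
      6 * (expectation (\<lambda>\<omega>. (Y \<omega>)\<^sup>2) * expectation (\<lambda>\<omega>. (S \<omega>)\<^sup>2)) + expectation (\<lambda>\<omega>. S \<omega> ^ 4)"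
  proof -
    have ints: "integrable M (\<lambda>\<omega>. Y \<omega> ^ 4 * S \<omega> ^ 0)" "integrable M (\<lambda>\<omega>. Y \<omega> ^ 3 * S \<omega> ^ 1)"
      "integrable M (\<lambda>\<omega>. Y \<omega> ^ 2 * S \<omega> ^ 2)" "integrable M (\<lambda>\<omega>. Y \<omega> ^ 1 * S \<omega> ^ 3)" "integrable M (\<lambda>\<omega>. Y \<omega> ^ 0 * S \<omega> ^ 4)"
      by (rule E(1); simp)+
    have "expectation (\<lambda>\<omega>. (Y \<omega> + S \<omega>) ^ 4) = expectation (\<lambda>\<omega>. Y \<omega> ^ 4 * S \<omega> ^ 0) + 4 * expectation (\<lambda>\<omega>. Y \<omega> ^ 3 * S \<omega> ^ 1)
      + 6 * expectation (\<lambda>\<omega>. Y \<omega> ^ 2 * S \<omega> ^ 2) + 4 * expectation (\<lambda>\<omega>. Y \<omega> ^ 1 * S \<omega> ^ 3) + expectation (\<lambda>\<omega>. Y \<omega> ^ 0 * S \<omega> ^ 4)"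
      unfolding x4 using ints
      by (simp only: Bochner_Integration.integral_add Bochner_Integration.integrable_add integrable_mult_right integral_mult_right_zero)
    then show ?thesis
      using E(2)[of 4 0] E(2)[of 3 1] E(2)[of 2 2] E(2)[of 1 3] E(2)[of 0 4] by (simp add: EY IH prob_space)
  qed
  also have "\<dots> \<le> K + 6 * (1 * card I) + (3 + K) * (real (card I))\<^sup>2" using EY IH EYS by linarith
  also have "\<dots> \<le> (3 + K) * (real (card I + 1))\<^sup>2" using K by (simp add: power2_eq_square algebra_simps)
  finally have e4: "expectation (\<lambda>\<omega>. (Y \<omega> + S \<omega>) ^ 4) \<le> (3 + K) * (real (card I + 1))\<^sup>2" .
  show ?case unfolding sum c using i4 e1 e2 e4 by simp
qed simp

text \<open>Kolmogorov's argument with fourth powers. The event is split by the first passage index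
  l; there (s + d)^4 \<ge> s^4 + 4 s^3 d, with s the sum up to l and d the rest. The rest is centred
  and independent of everything up to l, so the mixed term integrates to zero over the first passage
  event.\<close>

lemma (in prob_space) fourth_moment_maximal_inequality:
  fixes \<eta> :: "nat \<Rightarrow> 'a \<Rightarrow> real"
  assumes indep: "indep_vars (\<lambda>_. borel) \<eta> {..<L}"
    and i4: "\<And>k. k < L \<Longrightarrow> integrable M (\<lambda>\<omega>. \<eta> k \<omega> ^ 4)" and mean: "\<And>k. k < L \<Longrightarrow> expectation (\<eta> k) = 0"
    and iS: "\<And>l. l \<le> L \<Longrightarrow> integrable M (\<lambda>\<omega>. (\<Sum>k<l. \<eta> k \<omega>) ^ 4)" and x: "x > 0"
  shows "prob {\<omega> \<in> space M. \<exists>l\<le>L. x \<le> \<bar>\<Sum>k<l. \<eta> k \<omega>\<bar>} \<le> expectation (\<lambda>\<omega>. (\<Sum>k<L. \<eta> k \<omega>) ^ 4) / x ^ 4"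
proof -
  define S where "S l \<omega> = (\<Sum>k<l. \<eta> k \<omega>)" for l \<omega>
  have \<eta>m[measurable]: "\<eta> k \<in> borel_measurable M" if "k < L" for k
    using indep that by (auto simp: indep_vars_def)
  have Sm[measurable]: "S l \<in> borel_measurable M" if "l \<le> L" for l
    unfolding S_def using that by (intro borel_measurable_sum \<eta>m) auto
  define A where "A l = {\<omega> \<in> space M. x \<le> \<bar>S l \<omega>\<bar> \<and> (\<forall>j<l. \<bar>S j \<omega>\<bar> < x)}" for l
  have Am[measurable]: "A l \<in> sets M" if "l \<le> L" for l
  proof -
    have "{\<omega> \<in> space M. \<bar>S j \<omega>\<bar> < x} \<in> sets M" if "j < l" for j
    proof -
      have "j \<le> L" using that \<open>l \<le> L\<close> by simp
      note [measurable] = Sm[OF this]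
      show ?thesis by measurable
    qed
    moreover have "{\<omega> \<in> space M. x \<le> \<bar>S l \<omega>\<bar>} \<in> sets M" using Sm[OF that] by measurable
    ultimately have "{\<omega> \<in> space M. x \<le> \<bar>S l \<omega>\<bar> \<and> (\<forall>j\<in>{..<l}. \<bar>S j \<omega>\<bar> < x)} \<in> sets M"
      by (intro sets.sets_Collect_conj sets.sets_Collect_finite_All) auto
    then show ?thesis unfolding A_def by (simp add: Ball_def)
  qed
  have disj: "disjoint_family_on A {..L}"
    unfolding disjoint_family_on_def
  proof (intro ballI impI)
    fix i j :: nat assume "i \<noteq> j"
    then consider "i < j" | "j < i" by linarith
    then show "A i \<inter> A j = {}" by cases (force simp: A_def)+
  qed
  have union: "{\<omega> \<in> space M. \<exists>l\<le>L. x \<le> \<bar>S l \<omega>\<bar>} = (\<Union>l\<in>{..L}. A l)"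
  proof (intro Set.set_eqI iffI)
    fix \<omega> assume "\<omega> \<in> {\<omega> \<in> space M. \<exists>l\<le>L. x \<le> \<bar>S l \<omega>\<bar>}"
    then have w: "\<omega> \<in> space M" and ex: "\<exists>l. l \<le> L \<and> x \<le> \<bar>S l \<omega>\<bar>" by auto
    define l where "l = (LEAST l. l \<le> L \<and> x \<le> \<bar>S l \<omega>\<bar>)"
    have "l \<le> L \<and> x \<le> \<bar>S l \<omega>\<bar>" unfolding l_def using ex by (rule LeastI_ex)
    moreover have "\<bar>S j \<omega>\<bar> < x" if "j < l" for j
      using not_less_Least[OF that[unfolded l_def]] that calculation by auto
    ultimately show "\<omega> \<in> (\<Union>l\<in>{..L}. A l)" using w by (auto simp: A_def)
  qed (auto simp: A_def)
  have i3: "integrable M (\<lambda>\<omega>. S l \<omega> ^ 3)" if "l \<le> L" for l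
    by (rule integrable_power_of_fourth[OF Sm[OF that] iS[OF that, folded S_def]]) simp
  have key: "x ^ 4 * prob (A l) \<le> expectation (\<lambda>\<omega>. S L \<omega> ^ 4 * indicat_real (A l) \<omega>)" if l: "l \<le> L" for l
  proof -
    \<comment> \<open>Both s^3 and the first passage event are written as one function of the first
      l variables, so that independence of disjoint groups of variables applies.\<close>
    define f where "f y = (if x \<le> \<bar>\<Sum>k<l. y k\<bar> \<and> (\<forall>j<l. \<bar>\<Sum>k<j. y k\<bar> < x) then (\<Sum>k<l. y k) ^ 3 else (0::real))" for y :: "nat \<Rightarrow> real"
    define D where "D \<omega> = (\<Sum>k\<in>{l..<L}. \<eta> k \<omega>)" for \<omega>
    have fm: "f \<in> borel_measurable (Pi\<^sub>M {..<l} (\<lambda>_. borel))"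
    proof -
      have s[measurable]: "(\<lambda>y. \<Sum>k<j. y k) \<in> borel_measurable (Pi\<^sub>M {..<l} (\<lambda>_. borel :: real measure))" if "j \<le> l" for j
        using that by (intro borel_measurable_sum measurable_component_singleton) auto
      let ?P = "Pi\<^sub>M {..<l} (\<lambda>_. borel :: real measure)"
      have "{y \<in> space ?P. \<bar>\<Sum>k<j. y k\<bar> < x} \<in> sets ?P" if "j < l" for j
      proof -
        note [measurable] = s[OF less_imp_le[OF that]]
        show ?thesis by measurable
      qed
      moreover have "{y \<in> space ?P. x \<le> \<bar>\<Sum>k<l. y k\<bar>} \<in> sets ?P" using s[of l] by measurable
      ultimately have "{y \<in> space ?P. x \<le> \<bar>\<Sum>k<l. y k\<bar> \<and> (\<forall>j\<in>{..<l}. \<bar>\<Sum>k<j. y k\<bar> < x)} \<in> sets ?P"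
        by (intro sets.sets_Collect_conj sets.sets_Collect_finite_All) auto
      then show ?thesis using s[of l] unfolding f_def by (intro measurable_If) (auto simp: Ball_def)
    qed
    have "indep_var borel (f \<circ> (\<lambda>\<omega>. restrict (\<lambda>k. \<eta> k \<omega>) {..<l})) borel ((\<lambda>y. \<Sum>k\<in>{l..<L}. y k) \<circ> (\<lambda>\<omega>. restrict (\<lambda>k. \<eta> k \<omega>) {l..<L}))"
      by (rule indep_var_compose[OF indep_var_restrict[OF indep]])
         (use l fm in \<open>auto intro!: borel_measurable_sum measurable_component_singleton\<close>)
    moreover have "f \<circ> (\<lambda>\<omega>. restrict (\<lambda>k. \<eta> k \<omega>) {..<l}) = (\<lambda>\<omega>. f (\<lambda>k. \<eta> k \<omega>))"
      unfolding f_def by (auto simp: fun_eq_iff intro!: sum.cong)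
    moreover have "(\<lambda>y. \<Sum>k\<in>{l..<L}. y k) \<circ> (\<lambda>\<omega>. restrict (\<lambda>k. \<eta> k \<omega>) {l..<L}) = D"
      by (auto simp: fun_eq_iff D_def)
    ultimately have ind: "indep_var borel (\<lambda>\<omega>. f (\<lambda>k. \<eta> k \<omega>)) borel D" by simp
    have feq: "f (\<lambda>k. \<eta> k \<omega>) = S l \<omega> ^ 3 * indicat_real (A l) \<omega>" if "\<omega> \<in> space M" for \<omega>
      using that by (auto simp: f_def A_def S_def indicator_def)
    have i\<eta>: "integrable M (\<eta> k)" if "k < L" for k
      using integrable_power_of_fourth[OF \<eta>m[OF that] i4[OF that], of 1] by simp
    have iD: "integrable M D" unfolding D_def by (intro Bochner_Integration.integrable_sum i\<eta>) auto
    have ED: "expectation D = 0" unfolding D_def using i\<eta> mean by (subst Bochner_Integration.integral_sum) auto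
    have if0: "integrable M (\<lambda>\<omega>. S l \<omega> ^ 3 * indicat_real (A l) \<omega>)"
      using l by (intro integrable_mult_indicator[where 'b=real, simplified] integrable_real_mult_indicator i3 Am) auto
    have if1: "integrable M (\<lambda>\<omega>. f (\<lambda>k. \<eta> k \<omega>))"
      using if0 by (rule Bochner_Integration.integrable_cong[THEN iffD1, rotated -1]) (auto simp: feq)
    have "expectation (\<lambda>\<omega>. f (\<lambda>k. \<eta> k \<omega>) * D \<omega>) = 0"
      using indep_var_lebesgue_integral[OF ind if1 iD] ED by simp
    moreover have i5: "integrable M (\<lambda>\<omega>. f (\<lambda>k. \<eta> k \<omega>) * D \<omega>)" by (rule indep_var_integrable[OF ind if1 iD])
    moreover have "expectation (\<lambda>\<omega>. f (\<lambda>k. \<eta> k \<omega>) * D \<omega>) = expectation (\<lambda>\<omega>. S l \<omega> ^ 3 * indicat_real (A l) \<omega> * D \<omega>)"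
      by (intro Bochner_Integration.integral_cong) (auto simp: feq)
    moreover have "integrable M (\<lambda>\<omega>. f (\<lambda>k. \<eta> k \<omega>) * D \<omega>) \<longleftrightarrow> integrable M (\<lambda>\<omega>. S l \<omega> ^ 3 * indicat_real (A l) \<omega> * D \<omega>)"
      by (intro Bochner_Integration.integrable_cong) (auto simp: feq)
    ultimately have cross: "expectation (\<lambda>\<omega>. S l \<omega> ^ 3 * indicat_real (A l) \<omega> * D \<omega>) = 0"
      and icross: "integrable M (\<lambda>\<omega>. S l \<omega> ^ 3 * indicat_real (A l) \<omega> * D \<omega>)" by auto
    have SL: "S L \<omega> = S l \<omega> + D \<omega>" for \<omega>
    proof -
      have "{..<L} = {..<l} \<union> {l..<L}" using l by auto
      then show ?thesis unfolding S_def D_def by (simp add: sum.union_disjoint ivl_disj_int)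
    qed
    have ineq: "s ^ 4 + 4 * (s ^ 3 * d) \<le> (s + d) ^ 4" for s d :: real
    proof -
      have "(s + d) ^ 4 - s ^ 4 - 4 * (s ^ 3 * d) = d\<^sup>2 * (2 * s\<^sup>2 + (2 * s + d)\<^sup>2)"
        by (simp add: power4_eq_xxxx power3_eq_cube power2_eq_square algebra_simps)
      also have "\<dots> \<ge> 0" by simp
      finally show ?thesis by simp
    qed
    have "x ^ 4 * prob (A l) = expectation (\<lambda>\<omega>. x ^ 4 * indicat_real (A l) \<omega> + 4 * (S l \<omega> ^ 3 * indicat_real (A l) \<omega> * D \<omega>))"
      using l icross cross by (simp add: integrable_real_indicator less_top[symmetric])
    also have "\<dots> \<le> expectation (\<lambda>\<omega>. S L \<omega> ^ 4 * indicat_real (A l) \<omega>)"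
    proof (rule integral_mono)
      show "integrable M (\<lambda>\<omega>. x ^ 4 * indicat_real (A l) \<omega> + 4 * (S l \<omega> ^ 3 * indicat_real (A l) \<omega> * D \<omega>))"
        using l icross by (simp add: integrable_real_indicator less_top[symmetric])
      show "integrable M (\<lambda>\<omega>. S L \<omega> ^ 4 * indicat_real (A l) \<omega>)"
        using l iS[of L] by (intro integrable_real_mult_indicator) (auto simp: S_def)
      fix \<omega> assume "\<omega> \<in> space M"
      show "x ^ 4 * indicat_real (A l) \<omega> + 4 * (S l \<omega> ^ 3 * indicat_real (A l) \<omega> * D \<omega>) \<le> S L \<omega> ^ 4 * indicat_real (A l) \<omega>"
      proof (cases "\<omega> \<in> A l")
        case True
        then have "x ^ 4 \<le> \<bar>S l \<omega>\<bar> ^ 4" using x by (intro power_mono) (auto simp: A_def)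
        then show ?thesis using True ineq[of "S l \<omega>" "D \<omega>"] unfolding SL by simp
      qed simp
    qed
    finally show ?thesis .
  qed
  have "x ^ 4 * prob (\<Union>l\<in>{..L}. A l) = (\<Sum>l\<le>L. x ^ 4 * prob (A l))"
    by (subst finite_measure_finite_Union[OF _ _ disj]) (auto simp: sum_distrib_left)
  also have "\<dots> \<le> (\<Sum>l\<le>L. expectation (\<lambda>\<omega>. S L \<omega> ^ 4 * indicat_real (A l) \<omega>))" by (intro sum_mono key) auto
  also have "\<dots> = expectation (\<lambda>\<omega>. \<Sum>l\<le>L. S L \<omega> ^ 4 * indicat_real (A l) \<omega>)"
    using iS[of L] by (intro Bochner_Integration.integral_sum[symmetric] integrable_real_mult_indicator) (auto simp: S_def)
  also have "\<dots> \<le> expectation (\<lambda>\<omega>. S L \<omega> ^ 4)"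
  proof (rule integral_mono)
    show "integrable M (\<lambda>\<omega>. \<Sum>l\<le>L. S L \<omega> ^ 4 * indicat_real (A l) \<omega>)"
      using iS[of L] by (intro Bochner_Integration.integrable_sum integrable_real_mult_indicator) (auto simp: S_def)
    fix \<omega>
    have "(\<Sum>l\<le>L. indicat_real (A l) \<omega>) = indicat_real (\<Union>l\<in>{..L}. A l) \<omega>"
      by (rule indicator_UN_disjoint[symmetric]) (use disj in auto)
    then have "(\<Sum>l\<le>L. S L \<omega> ^ 4 * indicat_real (A l) \<omega>) = S L \<omega> ^ 4 * indicat_real (\<Union>l\<in>{..L}. A l) \<omega>"
      by (simp flip: sum_distrib_left)
    also have "\<dots> \<le> S L \<omega> ^ 4 * 1" by (intro mult_left_mono) (auto simp: indicator_def)
    finally show "(\<Sum>l\<le>L. S L \<omega> ^ 4 * indicat_real (A l) \<omega>) \<le> S L \<omega> ^ 4" by simp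
  qed (use iS[of L] in \<open>simp add: S_def\<close>)
  finally show ?thesis using x unfolding union[symmetric] S_def by (simp add: pos_le_divide_eq mult.commute)
qed

section \<open>Conditioning on an independent discrete variable\<close>

lemma independent_elementsD:
  assumes "prob_space M" "independent_elements M K A K' B"
  shows "A \<in> M \<rightarrow>\<^sub>M K" "B \<in> M \<rightarrow>\<^sub>M K'"
    "\<And>S T. S \<in> sets K \<Longrightarrow> T \<in> sets K' \<Longrightarrow> measure M (A -` S \<inter> space M \<inter> (B -` T \<inter> space M)) =
      measure M (A -` S \<inter> space M) * measure M (B -` T \<inter> space M)"
proof -
  interpret prob_space M by fact
  show "A \<in> M \<rightarrow>\<^sub>M K" "B \<in> M \<rightarrow>\<^sub>M K'" using assms(2) by (auto simp: independent_elements_def)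
  fix S T assume "S \<in> sets K" "T \<in> sets K'"
  then show "measure M (A -` S \<inter> space M \<inter> (B -` T \<inter> space M)) =
      measure M (A -` S \<inter> space M) * measure M (B -` T \<inter> space M)"
    using assms(2) unfolding independent_elements_def by (intro indep_setD) auto
qed

lemma independent_elementsI:
  assumes "prob_space M" "A \<in> M \<rightarrow>\<^sub>M K" "B \<in> M \<rightarrow>\<^sub>M K'"
    "\<And>S T. S \<in> sets K \<Longrightarrow> T \<in> sets K' \<Longrightarrow> measure M (A -` S \<inter> space M \<inter> (B -` T \<inter> space M)) =
      measure M (A -` S \<inter> space M) * measure M (B -` T \<inter> space M)"
  shows "independent_elements M K A K' B"
proof -
  interpret prob_space M by fact
  show ?thesis unfolding independent_elements_def indep_sets2_eq using assms(2-) by auto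
qed

lemma independent_elements_compose:
  assumes M: "prob_space M" and i: "independent_elements M K A K' B"
    and f: "f \<in> K \<rightarrow>\<^sub>M K1" and g: "g \<in> K' \<rightarrow>\<^sub>M K1'"
  shows "independent_elements M K1 (\<lambda>\<omega>. f (A \<omega>)) K1' (\<lambda>\<omega>. g (B \<omega>))"
proof (rule independent_elementsI[OF M])
  note D = independent_elementsD[OF M i]
  show "(\<lambda>\<omega>. f (A \<omega>)) \<in> M \<rightarrow>\<^sub>M K1" "(\<lambda>\<omega>. g (B \<omega>)) \<in> M \<rightarrow>\<^sub>M K1'"
    using measurable_compose[OF D(1) f] measurable_compose[OF D(2) g] .
  fix S T assume S: "S \<in> sets K1" and T: "T \<in> sets K1'"
  have "(\<lambda>\<omega>. f (A \<omega>)) -` S \<inter> space M = A -` (f -` S \<inter> space K) \<inter> space M"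
    "(\<lambda>\<omega>. g (B \<omega>)) -` T \<inter> space M = B -` (g -` T \<inter> space K') \<inter> space M"
    using measurable_space[OF D(1)] measurable_space[OF D(2)] by auto
  then show "measure M ((\<lambda>\<omega>. f (A \<omega>)) -` S \<inter> space M \<inter> ((\<lambda>\<omega>. g (B \<omega>)) -` T \<inter> space M)) =
    measure M ((\<lambda>\<omega>. f (A \<omega>)) -` S \<inter> space M) * measure M ((\<lambda>\<omega>. g (B \<omega>)) -` T \<inter> space M)"
    using D(3)[OF measurable_sets[OF f S] measurable_sets[OF g T]] by simp
qed

lemma independent_elements_distr:
  assumes M: "prob_space M" and i: "independent_elements M K A K' B"
  shows "distr M (K \<Otimes>\<^sub>M K') (\<lambda>\<omega>. (A \<omega>, B \<omega>)) = distr M K A \<Otimes>\<^sub>M distr M K' B"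
proof -
  interpret prob_space M by fact
  note D = independent_elementsD[OF M i]
  note [measurable] = D(1,2)
  interpret A: prob_space "distr M K A" by (rule prob_space_distr) fact
  interpret B: prob_space "distr M K' B" by (rule prob_space_distr) fact
  show ?thesis
  proof (rule pair_measure_eqI[symmetric])
    fix S T assume "S \<in> sets (distr M K A)" "T \<in> sets (distr M K' B)"
    then have ST[measurable]: "S \<in> sets K" "T \<in> sets K'" by auto
    have "emeasure (distr M (K \<Otimes>\<^sub>M K') (\<lambda>\<omega>. (A \<omega>, B \<omega>))) (S \<times> T) =
      emeasure M ((\<lambda>\<omega>. (A \<omega>, B \<omega>)) -` (S \<times> T) \<inter> space M)" by (rule emeasure_distr) auto
    also have "(\<lambda>\<omega>. (A \<omega>, B \<omega>)) -` (S \<times> T) \<inter> space M = A -` S \<inter> space M \<inter> (B -` T \<inter> space M)" by auto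
    also have "emeasure M \<dots> = emeasure M (A -` S \<inter> space M) * emeasure M (B -` T \<inter> space M)"
      unfolding emeasure_eq_measure by (simp add: D(3)[OF ST] ennreal_mult)
    finally show "emeasure (distr M K A) S * emeasure (distr M K' B) T =
      emeasure (distr M (K \<Otimes>\<^sub>M K') (\<lambda>\<omega>. (A \<omega>, B \<omega>))) (S \<times> T)" by (simp add: emeasure_distr)
  qed (auto intro: A.sigma_finite_measure_axioms B.sigma_finite_measure_axioms)
qed

text \<open>The two hypotheses amount to mutual independence of U, A and B, so the roles can be
  exchanged. For events T that are not rectangles this is Fubini: the slice at u of the event in
  question is S times the slice of T. It brings the random index to the side of the clock, on which
  conditioning takes place.\<close>

lemma independent_elements_rotate:
  assumes M: "prob_space M" and i1: "independent_elements M K2 U (K \<Otimes>\<^sub>M K') (\<lambda>\<omega>. (A \<omega>, B \<omega>))"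
    and i2: "independent_elements M K A K' B"
  shows "independent_elements M K A (K2 \<Otimes>\<^sub>M K') (\<lambda>\<omega>. (U \<omega>, B \<omega>))"
proof (rule independent_elementsI[OF M])
  interpret prob_space M by fact
  note D1 = independent_elementsD[OF M i1] and D2 = independent_elementsD[OF M i2]
  have [measurable]: "A \<in> M \<rightarrow>\<^sub>M K" "B \<in> M \<rightarrow>\<^sub>M K'" "U \<in> M \<rightarrow>\<^sub>M K2" using D2(1,2) D1(1) by simp_all
  show "A \<in> M \<rightarrow>\<^sub>M K" "(\<lambda>\<omega>. (U \<omega>, B \<omega>)) \<in> M \<rightarrow>\<^sub>M K2 \<Otimes>\<^sub>M K'" by measurable
  let ?A = "distr M K A" and ?B = "distr M K' B" and ?U = "distr M K2 U"
  interpret A: prob_space ?A by (rule prob_space_distr) measurable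
  interpret B: prob_space ?B by (rule prob_space_distr) measurable
  interpret U: prob_space ?U by (rule prob_space_distr) measurable
  interpret AB: pair_prob_space ?A ?B ..
  interpret UAB: pair_prob_space ?U "?A \<Otimes>\<^sub>M ?B" ..
  interpret UB: pair_prob_space ?U ?B ..
  have law: "distr M (K2 \<Otimes>\<^sub>M (K \<Otimes>\<^sub>M K')) (\<lambda>\<omega>. (U \<omega>, (A \<omega>, B \<omega>))) = ?U \<Otimes>\<^sub>M (?A \<Otimes>\<^sub>M ?B)"
    using independent_elements_distr[OF M i1] independent_elements_distr[OF M i2] by simp
  have key: "emeasure M (A -` S \<inter> space M \<inter> ((\<lambda>\<omega>. (U \<omega>, B \<omega>)) -` T \<inter> space M)) = emeasure ?A S * emeasure (?U \<Otimes>\<^sub>M ?B) T"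
    if S[measurable]: "S \<in> sets K" and T[measurable]: "T \<in> sets (K2 \<Otimes>\<^sub>M K')" for S T
  proof -
    define Q where "Q = {z \<in> space (K2 \<Otimes>\<^sub>M (K \<Otimes>\<^sub>M K')). fst (snd z) \<in> S \<and> (fst z, snd (snd z)) \<in> T}"
    have Q: "Q \<in> sets (K2 \<Otimes>\<^sub>M (K \<Otimes>\<^sub>M K'))" unfolding Q_def by measurable
    have Tsp: "T \<subseteq> space K2 \<times> space K'" using sets.sets_into_space[OF T] by (simp add: space_pair_measure)
    have Ssp: "S \<subseteq> space K" using sets.sets_into_space[OF S] .
    have "A -` S \<inter> space M \<inter> ((\<lambda>\<omega>. (U \<omega>, B \<omega>)) -` T \<inter> space M) = (\<lambda>\<omega>. (U \<omega>, (A \<omega>, B \<omega>))) -` Q \<inter> space M"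
      using measurable_space[OF D1(1)] measurable_space[OF D2(1)] measurable_space[OF D2(2)]
      by (auto simp: Q_def space_pair_measure)
    then have "emeasure M (A -` S \<inter> space M \<inter> ((\<lambda>\<omega>. (U \<omega>, B \<omega>)) -` T \<inter> space M)) =
      emeasure (distr M (K2 \<Otimes>\<^sub>M (K \<Otimes>\<^sub>M K')) (\<lambda>\<omega>. (U \<omega>, (A \<omega>, B \<omega>)))) Q"
      using Q by (simp add: emeasure_distr)
    also have "\<dots> = (\<integral>\<^sup>+u. emeasure (?A \<Otimes>\<^sub>M ?B) (Pair u -` Q) \<partial>?U)"
      unfolding law by (rule sigma_finite_measure.emeasure_pair_measure_alt[OF prob_space_imp_sigma_finite[OF
            prob_space_pair[OF A.prob_space_axioms B.prob_space_axioms]]]) (use Q in simp)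
    also have "\<dots> = (\<integral>\<^sup>+u. emeasure ?A S * emeasure ?B (Pair u -` T) \<partial>?U)"
    proof (rule nn_integral_cong)
      fix u assume "u \<in> space ?U"
      then have "Pair u -` Q = S \<times> (Pair u -` T)"
        using Tsp Ssp by (auto simp: Q_def space_pair_measure)
      moreover have "Pair u -` T \<in> sets ?B" using sets_Pair1[OF T] by simp
      ultimately show "emeasure (?A \<Otimes>\<^sub>M ?B) (Pair u -` Q) = emeasure ?A S * emeasure ?B (Pair u -` T)"
        using S by (simp add: B.emeasure_pair_measure_Times)
    qed
    also have "\<dots> = emeasure ?A S * (\<integral>\<^sup>+u. emeasure ?B (Pair u -` T) \<partial>?U)"
      using T by (intro nn_integral_cmult B.measurable_emeasure_Pair) simp
    also have "(\<integral>\<^sup>+u. emeasure ?B (Pair u -` T) \<partial>?U) = emeasure (?U \<Otimes>\<^sub>M ?B) T"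
      using T by (intro B.emeasure_pair_measure_alt[symmetric]) simp
    finally show ?thesis .
  qed
  fix S T assume S: "S \<in> sets K" and T: "T \<in> sets (K2 \<Otimes>\<^sub>M K')"
  have "emeasure ?A (space K) = 1" using A.emeasure_space_1 by simp
  then have "emeasure M (A -` space K \<inter> space M \<inter> ((\<lambda>\<omega>. (U \<omega>, B \<omega>)) -` T \<inter> space M)) = emeasure (?U \<Otimes>\<^sub>M ?B) T"
    using key[OF sets.top T] by simp
  moreover have "A -` space K \<inter> space M \<inter> ((\<lambda>\<omega>. (U \<omega>, B \<omega>)) -` T \<inter> space M) = (\<lambda>\<omega>. (U \<omega>, B \<omega>)) -` T \<inter> space M"
    using measurable_space[OF D2(1)] by auto
  ultimately have "emeasure M (A -` S \<inter> space M \<inter> ((\<lambda>\<omega>. (U \<omega>, B \<omega>)) -` T \<inter> space M)) =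
    emeasure M (A -` S \<inter> space M) * emeasure M ((\<lambda>\<omega>. (U \<omega>, B \<omega>)) -` T \<inter> space M)"
    using key[OF S T] S by (simp add: emeasure_distr)
  then show "measure M (A -` S \<inter> space M \<inter> ((\<lambda>\<omega>. (U \<omega>, B \<omega>)) -` T \<inter> space M)) =
    measure M (A -` S \<inter> space M) * measure M ((\<lambda>\<omega>. (U \<omega>, B \<omega>)) -` T \<inter> space M)"
    unfolding emeasure_eq_measure by (simp flip: ennreal_mult)
qed

text \<open>Replaces conditional expectation given D: by Fubini under the product law, D may be
  frozen while A is integrated out. As D has countably many values, g needs to be measurable only
  for each frozen d.\<close>

lemma conditional_bound:
  fixes g :: "'c \<Rightarrow> 'd::countable \<Rightarrow> complex"
  assumes M: "prob_space M" and i: "independent_elements M K A (count_space UNIV) D"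
    and g: "\<And>d. (\<lambda>x. g x d) \<in> borel_measurable K" and gb: "\<And>x d. cmod (g x d) \<le> C1"
    and h: "\<And>d. cmod (h d) \<le> C2" and b: "\<And>d. 0 \<le> b d" "\<And>d. b d \<le> C3"
    and bound: "AE \<omega> in M. cmod ((\<integral>\<omega>'. g (A \<omega>') (D \<omega>) \<partial>M) - h (D \<omega>)) \<le> b (D \<omega>)"
  shows "cmod ((\<integral>\<omega>. g (A \<omega>) (D \<omega>) \<partial>M) - (\<integral>\<omega>. h (D \<omega>) \<partial>M)) \<le> (\<integral>\<omega>. b (D \<omega>) \<partial>M)"
proof -
  interpret prob_space M by fact
  note [measurable] = independent_elementsD(1,2)[OF M i]
  let ?A = "distr M K A" and ?D = "distr M (count_space UNIV) D"
  interpret A: prob_space ?A by (rule prob_space_distr) measurable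
  interpret D: prob_space ?D by (rule prob_space_distr) measurable
  interpret AD: pair_prob_space ?A ?D ..
  have gm: "(\<lambda>p. g (fst p) (snd p)) \<in> borel_measurable (K \<Otimes>\<^sub>M count_space UNIV)"
    by (rule measurable_compose_countable[where f = "\<lambda>d p. g (fst p) d"])
       (auto intro: measurable_compose[OF measurable_fst g])
  define \<phi> where "\<phi> d = (\<integral>\<omega>. g (A \<omega>) d \<partial>M)" for d
  have \<phi>D: "\<phi> d = (\<integral>x. g x d \<partial>?A)" for d unfolding \<phi>_def using g by (simp add: integral_distr)
  have \<phi>b: "cmod (\<phi> d) \<le> C1" for d
  proof -
    have "cmod (\<phi> d) \<le> (\<integral>\<omega>. cmod (g (A \<omega>) d) \<partial>M)" unfolding \<phi>_def by (rule integral_norm_bound)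
    also have "\<dots> \<le> (\<integral>\<omega>. C1 \<partial>M)"
    proof (rule integral_mono)
      show "integrable M (\<lambda>\<omega>. cmod (g (A \<omega>) d))"
        by (rule integrable_const_bound[of _ C1])
           (use gb measurable_compose[OF independent_elementsD(1)[OF M i] g] in auto)
    qed (use gb in auto)
    finally show ?thesis by (simp add: prob_space)
  qed
  have "(\<integral>\<omega>. g (A \<omega>) (D \<omega>) \<partial>M) = (\<integral>p. g (fst p) (snd p) \<partial>distr M (K \<Otimes>\<^sub>M count_space UNIV) (\<lambda>\<omega>. (A \<omega>, D \<omega>)))"
    using gm by (simp add: integral_distr)
  also have "\<dots> = (\<integral>(x, d). g x d \<partial>(?A \<Otimes>\<^sub>M ?D))"
    unfolding independent_elements_distr[OF M i] by (simp add: case_prod_unfold)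
  also have "\<dots> = (\<integral>d. (\<integral>x. g x d \<partial>?A) \<partial>?D)"
  proof (rule AD.integral_snd[symmetric])
    show "integrable (?A \<Otimes>\<^sub>M ?D) (\<lambda>(x, d). g x d)"
    proof (rule AD.integrable_const_bound[of _ C1])
      show "(\<lambda>(x, d). g x d) \<in> borel_measurable (?A \<Otimes>\<^sub>M ?D)"
        using gm by (simp add: case_prod_beta cong: measurable_cong_sets)
    qed (use gb in auto)
  qed
  also have "\<dots> = (\<integral>\<omega>. \<phi> (D \<omega>) \<partial>M)" unfolding \<phi>D[symmetric] by (simp add: integral_distr)
  finally have eq: "(\<integral>\<omega>. g (A \<omega>) (D \<omega>) \<partial>M) = (\<integral>\<omega>. \<phi> (D \<omega>) \<partial>M)" .
  have "cmod ((\<integral>\<omega>. g (A \<omega>) (D \<omega>) \<partial>M) - (\<integral>\<omega>. h (D \<omega>) \<partial>M)) = cmod (\<integral>\<omega>. \<phi> (D \<omega>) - h (D \<omega>) \<partial>M)"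
  proof -
    have "integrable M (\<lambda>\<omega>. \<phi> (D \<omega>))" by (rule integrable_const_bound[of _ C1]) (use \<phi>b in auto)
    moreover have "integrable M (\<lambda>\<omega>. h (D \<omega>))" by (rule integrable_const_bound[of _ C2]) (use h in auto)
    ultimately show ?thesis using eq by simp
  qed
  also have "\<dots> \<le> (\<integral>\<omega>. cmod (\<phi> (D \<omega>) - h (D \<omega>)) \<partial>M)" by (rule integral_norm_bound)
  also have "\<dots> \<le> (\<integral>\<omega>. b (D \<omega>) \<partial>M)"
  proof (rule integral_mono_AE)
    show "integrable M (\<lambda>\<omega>. cmod (\<phi> (D \<omega>) - h (D \<omega>)))"
      by (rule integrable_const_bound[of _ "C1 + C2"])
         (use \<phi>b h in \<open>auto intro!: AE_I2 order_trans[OF norm_triangle_ineq4 add_mono]\<close>)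
    show "integrable M (\<lambda>\<omega>. b (D \<omega>))" by (rule integrable_const_bound[of _ C3]) (use b in auto)
    show "AE \<omega> in M. cmod (\<phi> (D \<omega>) - h (D \<omega>)) \<le> b (D \<omega>)" using bound by (simp add: \<phi>_def)
  qed
  finally show ?thesis .
qed

section \<open>Discrete Fourier coefficients of random walks\<close>

text \<open>Double angles: both \<Sum> (cos^2 - sin^2) and \<Sum> 2 sin cos vanish, being the real
  and imaginary parts of the sum of the squares of cis (x j). That sum is the orthogonality relation
  between the characters r and n - r, which differ because 2 r \<noteq> n.\<close>

lemma circulant_trig:
  assumes r: "0 < r" "r < n" "2 * r \<noteq> n"
  shows "(\<Sum>j<n. (a * cos (2 * pi * real r * real j / real n) + b * sin (2 * pi * real r * real j / real n))\<^sup>2) =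
    real n * (a\<^sup>2 + b\<^sup>2) / 2"
proof -
  define x where "x j = 2 * pi * real r * real j / real n" for j
  have n: "real n > 0" using r by simp
  have cis_eq: "cis (- (2 * pi * real (n - r) * real j / real n)) = cis (x j)" for j
  proof -
    have "- (2 * pi * real (n - r) * real j / real n) = x j - 2 * pi * real j"
      using r n by (simp add: x_def of_nat_diff field_simps)
    also have "cis \<dots> = cis (x j)" by (simp add: cis_multiple_2pi flip: cis_divide)
    finally show ?thesis .
  qed
  have "r \<noteq> n - r" using r by auto
  then have cis0: "(\<Sum>j<n. cis (x j) * cis (x j)) = 0"
    using sum_cis_orthogonal[of r n "n - r"] r unfolding cis_eq x_def[symmetric] by auto
  have c: "(\<Sum>j<n. (cos (x j))\<^sup>2 - (sin (x j))\<^sup>2) = 0"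
    using arg_cong[OF cis0, of Re] by (simp add: power2_eq_square)
  have s: "(\<Sum>j<n. 2 * (sin (x j) * cos (x j))) = 0"
    using arg_cong[OF cis0, of Im] by (simp add: algebra_simps)
  have "(a * cos y + b * sin y)\<^sup>2 = (a\<^sup>2 + b\<^sup>2) / 2 + (a\<^sup>2 - b\<^sup>2) / 2 * ((cos y)\<^sup>2 - (sin y)\<^sup>2) + a * b * (2 * (sin y * cos y))" for y
  proof -
    have s2: "(sin y)\<^sup>2 = 1 - (cos y)\<^sup>2" by (rule sin_squared_eq)
    show ?thesis by (simp add: s2 power2_sum power_mult_distrib field_simps)
  qed
  then have "(\<Sum>j<n. (a * cos (x j) + b * sin (x j))\<^sup>2) =
    (\<Sum>j<n. (a\<^sup>2 + b\<^sup>2) / 2) + (a\<^sup>2 - b\<^sup>2) / 2 * (\<Sum>j<n. (cos (x j))\<^sup>2 - (sin (x j))\<^sup>2) +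
      a * b * (\<Sum>j<n. 2 * (sin (x j) * cos (x j)))"
    by (simp only: sum.distrib sum_distrib_left)
  then show ?thesis unfolding x_def[symmetric] c s by simp
qed

text \<open>For l in (p k, p (k + 1)] this is k, even when other blocks are empty. It turns weights
  that depend on the block into weights on single variables, so that sums over all blocks become one
  sum of independent terms.\<close>

definition block_index :: "(nat \<Rightarrow> nat) \<Rightarrow> nat \<Rightarrow> nat" where
  "block_index p l = (LEAST k. l \<le> p (Suc k))"

lemma sum_blocks:
  fixes F :: "nat \<Rightarrow> nat \<Rightarrow> 'b::comm_monoid_add"
  assumes p: "mono p"
  shows "(\<Sum>k<K. \<Sum>l\<in>{p k<..p (Suc k)}. F k l) = (\<Sum>l\<in>{p 0<..p K}. F (block_index p l) l)"
proof (induction K)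
  case (Suc K)
  have "block_index p l = K" if l: "l \<in> {p K<..p (Suc K)}" for l
    unfolding block_index_def
  proof (rule Least_equality)
    fix k assume k: "l \<le> p (Suc k)"
    show "K \<le> k"
    proof (rule ccontr)
      assume "\<not> K \<le> k"
      then have "p (Suc k) \<le> p K" using monoD[OF p] by simp
      then show False using k l by simp
    qed
  qed (use l in simp)
  then have "(\<Sum>l\<in>{p K<..p (Suc K)}. F K l) = (\<Sum>l\<in>{p K<..p (Suc K)}. F (block_index p l) l)" by simp
  moreover have "{p 0<..p (Suc K)} = {p 0<..p K} \<union> {p K<..p (Suc K)}"
    using monoD[OF p, of 0 K] monoD[OF p, of K "Suc K"] by auto
  ultimately show ?case using Suc by (simp add: sum.union_disjoint ivl_disj_int)
qed simp

text \<open>The r-th discrete Fourier coefficient of the increments over (p, q]. The array is an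
  argument, which makes this a measurable function on \<open>array_space\<close> for fixed integers,
  as conditioning requires.\<close>

definition block_sum :: "nat \<Rightarrow> nat \<Rightarrow> nat \<Rightarrow> nat \<Rightarrow> (nat \<times> nat \<Rightarrow> real) \<Rightarrow> complex" where
  "block_sum n r p q x = (\<Sum>j<n. \<Sum>l\<in>{p<..q}. of_real (x (j, l)) * cis (2 * pi * real r * real j / real n))"

lemma Re_block_sum: "Re (block_sum n r p q x) = (\<Sum>j<n. \<Sum>l\<in>{p<..q}. cos (2 * pi * real r * real j / real n) * x (j, l))"
  and Im_block_sum: "Im (block_sum n r p q x) = (\<Sum>j<n. \<Sum>l\<in>{p<..q}. sin (2 * pi * real r * real j / real n) * x (j, l))"
  by (simp_all add: block_sum_def mult.commute)

lemma block_sum_add: "p \<le> q \<Longrightarrow> q \<le> q' \<Longrightarrow> block_sum n r p q x + block_sum n r q q' x = block_sum n r p q' x"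
proof -
  assume a: "p \<le> q" "q \<le> q'"
  then have "{p<..q'} = {p<..q} \<union> {q<..q'}" by auto
  then show ?thesis unfolding block_sum_def by (simp add: sum.union_disjoint ivl_disj_int sum.distrib)
qed

lemma circulant_eigenvalue_walk:
  "circulant_eigenvalue n (\<lambda>j. walk X j m \<omega>) r = block_sum n r 0 m (\<lambda>(j, l). X j l \<omega>)"
proof -
  have "{1..m} = {0<..m}" by auto
  then show ?thesis unfolding circulant_eigenvalue_cis block_sum_def walk_def
    by (simp add: sum_distrib_right)
qed

section \<open>Estimates for an array of independent standardized variables\<close>

locale standardized_array = prob_space M for M :: "'a measure" +
  fixes X :: "nat \<Rightarrow> nat \<Rightarrow> 'a \<Rightarrow> real" and K3 K4 :: real
  assumes indep: "indep_vars (\<lambda>_. borel) (\<lambda>(i, k). X i k) (UNIV \<times> {1..})"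
    and mean: "\<And>i k. k \<ge> 1 \<Longrightarrow> expectation (X i k) = 0"
    and second_moment: "\<And>i k. k \<ge> 1 \<Longrightarrow> expectation (\<lambda>\<omega>. (X i k \<omega>)\<^sup>2) = 1"
    and third_moment: "\<And>i k. k \<ge> 1 \<Longrightarrow> expectation (\<lambda>\<omega>. \<bar>X i k \<omega>\<bar> ^ 3) \<le> K3"
    and fourth_moment: "\<And>i k. k \<ge> 1 \<Longrightarrow> expectation (\<lambda>\<omega>. X i k \<omega> ^ 4) \<le> K4"
    and integrable_fourth: "\<And>i k. k \<ge> 1 \<Longrightarrow> integrable M (\<lambda>\<omega>. X i k \<omega> ^ 4)"
begin

lemma X_measurable [measurable (raw)]: "k \<ge> 1 \<Longrightarrow> X i k \<in> borel_measurable M"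
  using indep unfolding indep_vars_def by (auto dest!: bspec[of _ _ "(i, k)"])

lemma integrable_X_power: "k \<ge> 1 \<Longrightarrow> a \<le> 4 \<Longrightarrow> integrable M (\<lambda>\<omega>. X i k \<omega> ^ a)"
  by (rule integrable_power_of_fourth) (auto intro: X_measurable integrable_fourth)

lemma K4_nonneg: "0 \<le> K4"
proof -
  have "0 \<le> expectation (\<lambda>\<omega>. X 0 1 \<omega> ^ 4)" by (rule integral_nonneg_AE) simp
  also have "\<dots> \<le> K4" by (rule fourth_moment) simp
  finally show ?thesis .
qed

lemma K3_nonneg: "0 \<le> K3"
proof -
  have "0 \<le> expectation (\<lambda>\<omega>. \<bar>X 0 1 \<omega>\<bar> ^ 3)" by (rule integral_nonneg_AE) simp
  also have "\<dots> \<le> K3" by (rule third_moment) simp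
  finally show ?thesis .
qed

text \<open>All blocks together are a single weighted sum of independent variables with weights at
  most s * W. By \<open>circulant_trig\<close> the squares of the weights in one time column of
  block k add up to s^2 n (\<theta>^2 + \<phi>^2) / 2; the Gaussian exponent halves this once more,
  hence the 4. No mixed terms \<theta> \<phi> survive, so the two coordinates become
  independent.\<close>

lemma char_block_sums:
  assumes r: "0 < r" "r < n" "2 * r \<noteq> n" and p: "mono p" and s: "s \<ge> 0" and W: "\<And>k. \<bar>\<theta> k\<bar> + \<bar>\<phi> k\<bar> \<le> W"
  shows "cmod ((\<integral>\<omega>. iexp (\<Sum>k<K. \<theta> k * Re (s *\<^sub>R block_sum n r (p k) (p (Suc k)) (\<lambda>(j, l). X j l \<omega>)) +
        \<phi> k * Im (s *\<^sub>R block_sum n r (p k) (p (Suc k)) (\<lambda>(j, l). X j l \<omega>))) \<partial>M) -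
      of_real (exp (- (\<Sum>k<K. ((\<theta> k)\<^sup>2 + (\<phi> k)\<^sup>2) / 4 * (s\<^sup>2 * real n * real (p (Suc k) - p k))))))
    \<le> real n * real (p K) * ((s * W) ^ 3 * K3 / 6 + (s * W) ^ 4 / 8)"
proof -
  define x where "x j = 2 * pi * real r * real j / real n" for j
  define v where "v k j = s * (\<theta> k * cos (x j) + \<phi> k * sin (x j))" for k j
  define w where "w i = v (block_index p (snd i)) (fst i)" for i :: "nat \<times> nat"
  define I where "I = {..<n} \<times> {p 0<..p K}"
  have fin: "finite I" and sub: "I \<subseteq> UNIV \<times> {1..}" by (auto simp: I_def)
  have WI: "\<bar>w i\<bar> \<le> s * W" for i
  proof -
    have "\<bar>\<theta> k * cos y + \<phi> k * sin y\<bar> \<le> \<bar>\<theta> k\<bar> + \<bar>\<phi> k\<bar>" for k y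
      by (intro order_trans[OF abs_triangle_ineq] add_mono) (simp_all add: abs_mult mult_left_le)
    then have "\<bar>\<theta> k * cos y + \<phi> k * sin y\<bar> \<le> W" for k y using W[of k] by (rule order_trans)
    then show ?thesis using s by (simp add: w_def v_def abs_mult mult_left_mono)
  qed
  have blocks: "(\<Sum>k<K. \<Sum>j<n. \<Sum>l\<in>{p k<..p (Suc k)}. f k j l) = (\<Sum>i\<in>I. f (block_index p (snd i)) (fst i) (snd i))"
    for f :: "nat \<Rightarrow> nat \<Rightarrow> nat \<Rightarrow> real"
  proof -
    have "(\<Sum>k<K. \<Sum>j<n. \<Sum>l\<in>{p k<..p (Suc k)}. f k j l) = (\<Sum>j<n. \<Sum>k<K. \<Sum>l\<in>{p k<..p (Suc k)}. f k j l)"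
      by (rule sum.swap)
    also have "\<dots> = (\<Sum>j<n. \<Sum>l\<in>{p 0<..p K}. f (block_index p l) j l)" by (simp add: sum_blocks[OF p])
    finally show ?thesis by (simp add: I_def sum.cartesian_product case_prod_unfold)
  qed
  have eq1: "(\<Sum>k<K. \<theta> k * Re (s *\<^sub>R block_sum n r (p k) (p (Suc k)) (\<lambda>(j, l). X j l \<omega>)) +
        \<phi> k * Im (s *\<^sub>R block_sum n r (p k) (p (Suc k)) (\<lambda>(j, l). X j l \<omega>))) =
      (\<Sum>i\<in>I. w i * (case i of (j, l) \<Rightarrow> X j l) \<omega>)" for \<omega>
  proof -
    have "\<theta> k * Re (s *\<^sub>R block_sum n r (p k) (p (Suc k)) (\<lambda>(j, l). X j l \<omega>)) +
        \<phi> k * Im (s *\<^sub>R block_sum n r (p k) (p (Suc k)) (\<lambda>(j, l). X j l \<omega>)) =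
      (\<Sum>j<n. \<Sum>l\<in>{p k<..p (Suc k)}. v k j * X j l \<omega>)" for k
      by (simp add: Re_block_sum Im_block_sum sum_distrib_left v_def x_def algebra_simps flip: sum.distrib)
    then show ?thesis by (simp add: blocks w_def case_prod_unfold)
  qed
  have eq2: "(\<Sum>i\<in>I. (w i)\<^sup>2) / 2 = (\<Sum>k<K. ((\<theta> k)\<^sup>2 + (\<phi> k)\<^sup>2) / 4 * (s\<^sup>2 * real n * real (p (Suc k) - p k)))"
  proof -
    have "(\<Sum>i\<in>I. (w i)\<^sup>2) = (\<Sum>k<K. \<Sum>j<n. \<Sum>l\<in>{p k<..p (Suc k)}. (v k j)\<^sup>2)"
      by (simp only: blocks w_def)
    also have "\<dots> = (\<Sum>k<K. ((\<theta> k)\<^sup>2 + (\<phi> k)\<^sup>2) / 2 * (s\<^sup>2 * real n * real (p (Suc k) - p k)))"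
    proof (rule sum.cong[OF HOL.refl])
      fix k
      have "(\<Sum>j<n. \<Sum>l\<in>{p k<..p (Suc k)}. (v k j)\<^sup>2) = real (p (Suc k) - p k) * (s\<^sup>2 * (\<Sum>j<n. (\<theta> k * cos (x j) + \<phi> k * sin (x j))\<^sup>2))"
        by (simp add: v_def power_mult_distrib sum_distrib_left)
      also have "(\<Sum>j<n. (\<theta> k * cos (x j) + \<phi> k * sin (x j))\<^sup>2) = real n * ((\<theta> k)\<^sup>2 + (\<phi> k)\<^sup>2) / 2"
        unfolding x_def by (rule circulant_trig[OF r])
      finally show "(\<Sum>j<n. \<Sum>l\<in>{p k<..p (Suc k)}. (v k j)\<^sup>2) =
        ((\<theta> k)\<^sup>2 + (\<phi> k)\<^sup>2) / 2 * (s\<^sup>2 * real n * real (p (Suc k) - p k))" by simp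
    qed
    finally show ?thesis by (simp add: sum_divide_distrib)
  qed
  have "cmod ((\<integral>\<omega>. iexp (\<Sum>i\<in>I. w i * (case i of (j, l) \<Rightarrow> X j l) \<omega>) \<partial>M) - of_real (exp (- (\<Sum>i\<in>I. (w i)\<^sup>2) / 2)))
    \<le> (\<Sum>i\<in>I. \<bar>w i\<bar> ^ 3 * K3 / 6 + (w i) ^ 4 / 8)"
  proof (rule cmod_char_indep_sum[OF fin])
    show "indep_vars (\<lambda>_. borel) (\<lambda>(j, l). X j l) I" by (rule indep_vars_subset[OF indep sub])
    fix i assume "i \<in> I"
    then obtain j l where i: "i = (j, l)" "l \<ge> 1" by (cases i) (auto simp: I_def)
    show "integrable M (case i of (j, l) \<Rightarrow> X j l)" using integrable_X_power[of l 1 j] i by simp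
    show "expectation (case i of (j, l) \<Rightarrow> X j l) = 0" using mean i by simp
    show "integrable M (\<lambda>\<omega>. ((case i of (j, l) \<Rightarrow> X j l) \<omega>)\<^sup>2)" using integrable_X_power[of l 2 j] i by simp
    show "expectation (\<lambda>\<omega>. ((case i of (j, l) \<Rightarrow> X j l) \<omega>)\<^sup>2) = 1" using second_moment i by simp
    show "integrable M (\<lambda>\<omega>. \<bar>(case i of (j, l) \<Rightarrow> X j l) \<omega>\<bar> ^ 3)"
      using integrable_abs[OF integrable_X_power[of l 3 j]] i by (simp add: power_abs)
    show "expectation (\<lambda>\<omega>. \<bar>(case i of (j, l) \<Rightarrow> X j l) \<omega>\<bar> ^ 3) \<le> K3" using third_moment i by simp
  qed
  also have "\<dots> \<le> (\<Sum>i\<in>I. (s * W) ^ 3 * K3 / 6 + (s * W) ^ 4 / 8)"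
  proof (rule sum_mono)
    fix i
    have "\<bar>w i\<bar> ^ 3 * K3 / 6 \<le> (s * W) ^ 3 * K3 / 6"
      using K3_nonneg power_mono[OF WI abs_ge_zero, of i 3] by (intro divide_right_mono mult_right_mono) auto
    moreover have "(w i) ^ 4 \<le> (s * W) ^ 4" using power_mono[OF WI abs_ge_zero, of i 4] by simp
    ultimately show "\<bar>w i\<bar> ^ 3 * K3 / 6 + (w i) ^ 4 / 8 \<le> (s * W) ^ 3 * K3 / 6 + (s * W) ^ 4 / 8"
      by simp
  qed
  also have "\<dots> = real n * real (p K - p 0) * ((s * W) ^ 3 * K3 / 6 + (s * W) ^ 4 / 8)"
    by (simp add: I_def card_cartesian_product)
  also have "\<dots> \<le> real n * real (p K) * ((s * W) ^ 3 * K3 / 6 + (s * W) ^ 4 / 8)"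
  proof (intro mult_right_mono mult_left_mono)
    have "0 \<le> s * W" using WI[of undefined] by linarith
    then show "0 \<le> (s * W) ^ 3 * K3 / 6 + (s * W) ^ 4 / 8" using K3_nonneg by simp
  qed auto
  finally show ?thesis unfolding eq1 eq2[symmetric] by simp
qed

text \<open>Summing over the n rows first leaves one variable per time column. Columns are disjoint,
  hence independent, and the maximal inequality applies to their partial sums; the last of these has
  n * L terms, and weights of modulus at most 1 keep the moment bounds of the array.\<close>

lemma weighted_maximal_inequality:
  assumes v: "\<And>j. \<bar>v j\<bar> \<le> 1" and s: "s \<ge> 0" and x: "x > 0"
  shows "prob {\<omega> \<in> space M. \<exists>m\<le>L. x \<le> \<bar>s * (\<Sum>j<n. \<Sum>l\<in>{a<..a+m}. v j * X j l \<omega>)\<bar>} \<le>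
    (3 + K4) * (s\<^sup>2 * real n * real L)\<^sup>2 / x ^ 4"
proof -
  define T where "T m \<omega> = (\<Sum>j<n. \<Sum>l\<in>{a<..a+m}. v j * X j l \<omega>)" for m \<omega>
  define \<eta> where "\<eta> k \<omega> = s * (\<Sum>j<n. v j * X j (Suc (a + k)) \<omega>)" for k \<omega>
  have moments: "integrable M (\<lambda>\<omega>. (\<Sum>i\<in>I. v (fst i) * X (fst i) (snd i) \<omega>) ^ 4) \<and>
      expectation (\<lambda>\<omega>. \<Sum>i\<in>I. v (fst i) * X (fst i) (snd i) \<omega>) = 0 \<and>
      expectation (\<lambda>\<omega>. (\<Sum>i\<in>I. v (fst i) * X (fst i) (snd i) \<omega>)\<^sup>2) \<le> card I \<and>
      expectation (\<lambda>\<omega>. (\<Sum>i\<in>I. v (fst i) * X (fst i) (snd i) \<omega>) ^ 4) \<le> (3 + K4) * (real (card I))\<^sup>2"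
    if I: "finite I" "I \<subseteq> UNIV \<times> {1..}" for I
  proof (rule fourth_moment_indep_sum[OF I(1) _ _ _ _ _ K4_nonneg])
    have "indep_vars (\<lambda>_. borel) (\<lambda>i \<omega>. v (fst i) * (case i of (j, l) \<Rightarrow> X j l) \<omega>) I"
      by (rule indep_vars_compose2[OF indep_vars_subset[OF indep I(2)], where Y = "\<lambda>i x. v (fst i) * x"]) auto
    then show "indep_vars (\<lambda>_. borel) (\<lambda>i \<omega>. v (fst i) * X (fst i) (snd i) \<omega>) I" by (simp add: case_prod_unfold)
    fix i assume "i \<in> I"
    then have i: "snd i \<ge> 1" using I by auto
    have v2: "(v (fst i))\<^sup>2 \<le> 1" using v by (simp add: abs_square_le_1)
    then have v4: "v (fst i) ^ 4 \<le> 1" using power_mono[OF v2, of 2] by (simp flip: power_mult)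
    show "integrable M (\<lambda>\<omega>. (v (fst i) * X (fst i) (snd i) \<omega>) ^ 4)"
      using integrable_fourth[OF i] by (simp add: power_mult_distrib)
    show "expectation (\<lambda>\<omega>. v (fst i) * X (fst i) (snd i) \<omega>) = 0" using mean[OF i] by simp
    show "expectation (\<lambda>\<omega>. (v (fst i) * X (fst i) (snd i) \<omega>)\<^sup>2) \<le> 1"
      using second_moment[OF i] v2 by (simp add: power_mult_distrib)
    have "v (fst i) ^ 4 * expectation (\<lambda>\<omega>. X (fst i) (snd i) \<omega> ^ 4) \<le> 1 * K4"
      using fourth_moment[OF i] v4 by (intro mult_mono integral_nonneg_AE) auto
    then show "expectation (\<lambda>\<omega>. (v (fst i) * X (fst i) (snd i) \<omega>) ^ 4) \<le> K4"
      by (simp add: power_mult_distrib)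
  qed
  have Teq: "T m \<omega> = (\<Sum>i\<in>{..<n} \<times> {a<..a+m}. v (fst i) * X (fst i) (snd i) \<omega>)" for m \<omega>
    by (simp add: T_def sum.cartesian_product case_prod_unfold)
  have T4: "integrable M (\<lambda>\<omega>. T m \<omega> ^ 4)" "expectation (\<lambda>\<omega>. T m \<omega> ^ 4) \<le> (3 + K4) * (real n * real m)\<^sup>2" for m
  proof -
    have "{..<n} \<times> {a<..a+m} \<subseteq> UNIV \<times> {1..}" by auto
    from moments[OF _ this] show "integrable M (\<lambda>\<omega>. T m \<omega> ^ 4)" "expectation (\<lambda>\<omega>. T m \<omega> ^ 4) \<le> (3 + K4) * (real n * real m)\<^sup>2"
      unfolding Teq by (auto simp: card_cartesian_product)
  qed
  have sum\<eta>: "(\<Sum>k<m. \<eta> k \<omega>) = s * T m \<omega>" for m \<omega>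
  proof (induction m)
    case (Suc m)
    have "{a<..a + Suc m} = insert (Suc (a + m)) {a<..a+m}" by auto
    then have "T (Suc m) \<omega> = T m \<omega> + (\<Sum>j<n. v j * X j (Suc (a + m)) \<omega>)" by (simp add: T_def sum.distrib)
    then show ?case using Suc by (simp add: \<eta>_def distrib_left)
  qed (simp add: T_def)
  have "indep_vars (\<lambda>k. Pi\<^sub>M ({..<n} \<times> {Suc (a + k)}) (\<lambda>_. borel))
      (\<lambda>k \<omega>. restrict (\<lambda>i. (case i of (j, l) \<Rightarrow> X j l) \<omega>) ({..<n} \<times> {Suc (a + k)})) {..<L}"
    by (rule indep_vars_restrict[OF indep]) (auto simp: disjoint_family_on_def)
  then have "indep_vars (\<lambda>_. borel)
      (\<lambda>k \<omega>. (\<lambda>y. s * (\<Sum>j<n. v j * y (j, Suc (a + k)))) (restrict (\<lambda>i. (case i of (j, l) \<Rightarrow> X j l) \<omega>) ({..<n} \<times> {Suc (a + k)}))) {..<L}"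
    by (rule indep_vars_compose2[where Y = "\<lambda>k y. s * (\<Sum>j<n. v j * y (j, Suc (a + k)))"])
       (intro borel_measurable_times borel_measurable_const borel_measurable_sum measurable_component_singleton; simp)
  then have ind\<eta>: "indep_vars (\<lambda>_. borel) \<eta> {..<L}"
    by (rule indep_vars_cong[THEN iffD1, rotated -1]) (auto simp: \<eta>_def fun_eq_iff intro!: sum.cong)
  have i\<eta>: "integrable M (\<lambda>\<omega>. \<eta> k \<omega> ^ 4)" "expectation (\<eta> k) = 0" for k
  proof -
    have e: "\<eta> k \<omega> = s * (\<Sum>i\<in>{..<n} \<times> {Suc (a + k)}. v (fst i) * X (fst i) (snd i) \<omega>)" for \<omega>
    proof -
      have "(\<Sum>i\<in>{..<n} \<times> {Suc (a + k)}. v (fst i) * X (fst i) (snd i) \<omega>) = (\<Sum>j<n. \<Sum>l\<in>{Suc (a + k)}. v j * X j l \<omega>)"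
        by (simp only: sum.cartesian_product case_prod_unfold)
      then show ?thesis by (simp add: \<eta>_def)
    qed
    have m: "integrable M (\<lambda>\<omega>. (\<Sum>i\<in>{..<n} \<times> {Suc (a + k)}. v (fst i) * X (fst i) (snd i) \<omega>) ^ 4)"
      "expectation (\<lambda>\<omega>. \<Sum>i\<in>{..<n} \<times> {Suc (a + k)}. v (fst i) * X (fst i) (snd i) \<omega>) = 0"
      using moments[of "{..<n} \<times> {Suc (a + k)}"] by auto
    show "integrable M (\<lambda>\<omega>. \<eta> k \<omega> ^ 4)" unfolding e power_mult_distrib by (intro integrable_mult_right m)
    show "expectation (\<eta> k) = 0" using m(2) by (simp add: e[abs_def])
  qed
  have "prob {\<omega> \<in> space M. \<exists>m\<le>L. x \<le> \<bar>\<Sum>k<m. \<eta> k \<omega>\<bar>} \<le> expectation (\<lambda>\<omega>. (\<Sum>k<L. \<eta> k \<omega>) ^ 4) / x ^ 4"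
    by (rule fourth_moment_maximal_inequality[OF ind\<eta>]) (auto simp: i\<eta> sum\<eta> power_mult_distrib T4 x)
  also have "\<dots> = s ^ 4 * expectation (\<lambda>\<omega>. T L \<omega> ^ 4) / x ^ 4" by (simp add: sum\<eta> power_mult_distrib)
  also have "\<dots> \<le> s ^ 4 * ((3 + K4) * (real n * real L)\<^sup>2) / x ^ 4"
    using T4 s x by (intro divide_right_mono mult_left_mono) auto
  also have "\<dots> = (3 + K4) * (s\<^sup>2 * real n * real L)\<^sup>2 / x ^ 4"
    by (simp add: power_mult_distrib flip: power_mult)
  finally show ?thesis unfolding sum\<eta> T_def .
qed

text \<open>32 is 2 * 2^4: a modulus above e forces the cosine sum or the sine sum to reach e / 2,
  and for each of them the halved threshold costs a factor 16.\<close>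

lemma block_sum_maximal_inequality:
  assumes s: "s \<ge> 0" and e: "e > 0" and ab: "a \<le> b"
  shows "prob {\<omega> \<in> space M. \<exists>l\<in>{a..b}. e < cmod (s *\<^sub>R block_sum n r a l (\<lambda>(j, l). X j l \<omega>))} \<le>
    32 * (3 + K4) / e ^ 4 * (s\<^sup>2 * real n * real (b - a))\<^sup>2"
proof -
  define E where "E v = {\<omega> \<in> space M. \<exists>m\<le>b - a. e / 2 \<le> \<bar>s * (\<Sum>j<n. \<Sum>l\<in>{a<..a+m}. v j * X j l \<omega>)\<bar>}" for v :: "nat \<Rightarrow> real"
  define c where "c j = cos (2 * pi * real r * real j / real n)" for j
  define d where "d j = sin (2 * pi * real r * real j / real n)" for j
  have cm: "E v \<in> events" for v
  proof -
    have "{\<omega> \<in> space M. e / 2 \<le> \<bar>s * (\<Sum>j<n. \<Sum>l\<in>{a<..a+m}. v j * X j l \<omega>)\<bar>} \<in> events" for m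
    proof -
      have "(\<lambda>\<omega>. \<Sum>j<n. \<Sum>l\<in>{a<..a+m}. v j * X j l \<omega>) \<in> borel_measurable M"
        by (intro borel_measurable_sum borel_measurable_times borel_measurable_const X_measurable) auto
      then show ?thesis by measurable
    qed
    then have "{\<omega> \<in> space M. \<exists>m\<in>{..b-a}. e / 2 \<le> \<bar>s * (\<Sum>j<n. \<Sum>l\<in>{a<..a+m}. v j * X j l \<omega>)\<bar>} \<in> events"
      by (intro sets.sets_Collect_finite_Ex) auto
    then show ?thesis by (simp add: E_def Bex_def)
  qed
  have sub: "{\<omega> \<in> space M. \<exists>l\<in>{a..b}. e < cmod (s *\<^sub>R block_sum n r a l (\<lambda>(j, l). X j l \<omega>))} \<subseteq> E c \<union> E d"
  proof safe
    fix \<omega> l assume w: "\<omega> \<in> space M" "l \<in> {a..b}" "e < cmod (s *\<^sub>R block_sum n r a l (\<lambda>(j, l). X j l \<omega>))" "\<omega> \<notin> E d"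
    define m where "m = l - a"
    have m: "m \<le> b - a" "l = a + m" using w ab by (auto simp: m_def)
    have "e < \<bar>Re (s *\<^sub>R block_sum n r a l (\<lambda>(j, l). X j l \<omega>))\<bar> + \<bar>Im (s *\<^sub>R block_sum n r a l (\<lambda>(j, l). X j l \<omega>))\<bar>"
      using w(3) cmod_le by (rule less_le_trans)
    then have "e < \<bar>s * (\<Sum>j<n. \<Sum>l\<in>{a<..a+m}. c j * X j l \<omega>)\<bar> + \<bar>s * (\<Sum>j<n. \<Sum>l\<in>{a<..a+m}. d j * X j l \<omega>)\<bar>"
      by (simp add: Re_block_sum Im_block_sum m c_def d_def)
    moreover have "\<bar>s * (\<Sum>j<n. \<Sum>l\<in>{a<..a+m}. d j * X j l \<omega>)\<bar> < e / 2"
    proof (rule ccontr)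
      assume "\<not> ?thesis"
      then have "\<omega> \<in> E d" using w(1) m(1) unfolding E_def by (auto simp: not_less)
      then show False using w(4) by simp
    qed
    ultimately have "e / 2 \<le> \<bar>s * (\<Sum>j<n. \<Sum>l\<in>{a<..a+m}. c j * X j l \<omega>)\<bar>" by linarith
    then show "\<omega> \<in> E c" using w m by (auto simp: E_def)
  qed
  define B where "B = 16 * (3 + K4) / e ^ 4 * (s\<^sup>2 * real n * real (b - a))\<^sup>2"
  have bound: "prob (E v) \<le> B" if "\<And>j. \<bar>v j\<bar> \<le> 1" for v
  proof -
    have "prob (E v) \<le> (3 + K4) * (s\<^sup>2 * real n * real (b - a))\<^sup>2 / (e / 2) ^ 4"
      unfolding E_def by (rule weighted_maximal_inequality) (use that s e in auto)
    also have "\<dots> = B" unfolding B_def by (simp add: power_divide)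
    finally show ?thesis .
  qed
  have "prob {\<omega> \<in> space M. \<exists>l\<in>{a..b}. e < cmod (s *\<^sub>R block_sum n r a l (\<lambda>(j, l). X j l \<omega>))} \<le> prob (E c \<union> E d)"
    by (rule finite_measure_mono[OF sub]) (use cm in auto)
  also have "\<dots> \<le> prob (E c) + prob (E d)" by (rule measure_Un_le) (use cm in auto)
  also have "\<dots> \<le> 32 * (3 + K4) / e ^ 4 * (s\<^sup>2 * real n * real (b - a))\<^sup>2"
  proof -
    have "prob (E c) \<le> B" "prob (E d) \<le> B" by (rule bound; simp add: c_def d_def)+
    moreover have "32 * (3 + K4) / e ^ 4 * (s\<^sup>2 * real n * real (b - a))\<^sup>2 = 2 * B" by (simp add: B_def)
    ultimately show ?thesis by linarith
  qed
  finally show ?thesis .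
qed

end

section \<open>Circulant eigenvalues run by an independent clock\<close>

text \<open>The test functions through which the clocks converge. They tolerate a uniformly small
  change of the clock, which is how the Poisson process is replaced by its time argument, and they
  include the three functionals needed later: characteristic function, error term and squared
  increments.\<close>

definition lipschitz_upto :: "nat \<Rightarrow> ((nat \<Rightarrow> real) \<Rightarrow> real) \<Rightarrow> bool" where
  "lipschitz_upto K G \<longleftrightarrow> (\<exists>L B. \<forall>x y. \<bar>G x\<bar> \<le> B \<and> \<bar>G x - G y\<bar> \<le> L * (\<Sum>k\<le>K. \<bar>x k - y k\<bar>))"

lemma exp_minus_lipschitz:
  fixes u v :: real
  assumes "0 \<le> u" "0 \<le> v" shows "\<bar>exp (- u) - exp (- v)\<bar> \<le> \<bar>u - v\<bar>"
proof -
  have *: "exp (- a) - exp (- b) \<le> b - a" if "0 \<le> a" "a \<le> b" for a b :: real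
  proof -
    have "exp (- a) - exp (- b) = exp (- a) * (1 - exp (- (b - a)))"
      by (simp add: right_diff_distrib flip: exp_add)
    also have "\<dots> \<le> 1 * (1 - exp (- (b - a)))" using that by (intro mult_right_mono) auto
    also have "1 * (1 - exp (- (b - a))) = 1 - exp (- (b - a))" by (rule mult_1)
    also have "\<dots> \<le> b - a" using exp_ge_add_one_self[of "- (b - a)"] by linarith
    finally show ?thesis .
  qed
  show ?thesis
  proof (cases "u \<le> v")
    case True
    then show ?thesis using *[of u v] assms by (simp add: abs_of_nonneg abs_of_nonpos)
  next
    case False
    then show ?thesis using *[of v u] assms by (simp add: abs_of_nonneg abs_of_nonpos)
  qed
qed

lemma increments_le:
  fixes x y :: "nat \<Rightarrow> real"
  shows "(\<Sum>k<K. \<bar>(x (Suc k) - x k) - (y (Suc k) - y k)\<bar>) \<le> 2 * (\<Sum>k\<le>K. \<bar>x k - y k\<bar>)"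
proof -
  have "(\<Sum>k<K. \<bar>(x (Suc k) - x k) - (y (Suc k) - y k)\<bar>) \<le> (\<Sum>k<K. \<bar>x (Suc k) - y (Suc k)\<bar> + \<bar>x k - y k\<bar>)"
    by (intro sum_mono) auto
  also have "\<dots> = (\<Sum>k<K. \<bar>x (Suc k) - y (Suc k)\<bar>) + (\<Sum>k<K. \<bar>x k - y k\<bar>)" by (rule sum.distrib)
  also have "(\<Sum>k<K. \<bar>x (Suc k) - y (Suc k)\<bar>) = (\<Sum>k\<in>Suc ` {..<K}. \<bar>x k - y k\<bar>)"
    by (simp add: sum.reindex)
  also have "\<dots> \<le> (\<Sum>k\<le>K. \<bar>x k - y k\<bar>)" by (intro sum_mono2) auto
  also have "(\<Sum>k<K. \<bar>x k - y k\<bar>) \<le> (\<Sum>k\<le>K. \<bar>x k - y k\<bar>)" by (intro sum_mono2) auto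
  finally show ?thesis by simp
qed

text \<open>This is the conditional characteristic function as a function of the clock. On monotone
  clocks \<open>max 0\<close> changes nothing; on other sequences it keeps the exponent nonpositive,
  where exp is Lipschitz.\<close>

lemma lipschitz_upto_exp:
  assumes a: "\<And>k. 0 \<le> a k"
  shows "lipschitz_upto K (\<lambda>x. exp (- (\<Sum>k<K. a k * max 0 (x (Suc k) - x k))))"
  unfolding lipschitz_upto_def
proof (intro exI allI conjI)
  fix x y :: "nat \<Rightarrow> real"
  let ?f = "\<lambda>x. \<Sum>k<K. a k * max 0 (x (Suc k) - x k)"
  have nn: "0 \<le> ?f x" for x using a by (intro sum_nonneg) auto
  show "\<bar>exp (- ?f x)\<bar> \<le> 1" using nn by simp
  have "\<bar>exp (- ?f x) - exp (- ?f y)\<bar> \<le> \<bar>?f x - ?f y\<bar>" by (rule exp_minus_lipschitz[OF nn nn])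
  also have "\<dots> = \<bar>\<Sum>k<K. a k * (max 0 (x (Suc k) - x k) - max 0 (y (Suc k) - y k))\<bar>"
    by (simp add: sum_subtractf right_diff_distrib)
  also have "\<dots> \<le> (\<Sum>k<K. \<bar>a k * (max 0 (x (Suc k) - x k) - max 0 (y (Suc k) - y k))\<bar>)" by (rule sum_abs)
  also have "\<dots> \<le> (\<Sum>k<K. (\<Sum>k<K. a k) * \<bar>(x (Suc k) - x k) - (y (Suc k) - y k)\<bar>)"
  proof (rule sum_mono)
    fix k assume k: "k \<in> {..<K}"
    have "\<bar>max 0 (x (Suc k) - x k) - max 0 (y (Suc k) - y k)\<bar> \<le> \<bar>(x (Suc k) - x k) - (y (Suc k) - y k)\<bar>" by auto
    moreover have "a k \<le> (\<Sum>k<K. a k)" using k a by (intro member_le_sum) auto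
    ultimately show "\<bar>a k * (max 0 (x (Suc k) - x k) - max 0 (y (Suc k) - y k))\<bar> \<le>
      (\<Sum>k<K. a k) * \<bar>(x (Suc k) - x k) - (y (Suc k) - y k)\<bar>"
      unfolding abs_mult using a by (intro mult_mono) (auto intro: sum_nonneg)
  qed
  also have "\<dots> = (\<Sum>k<K. a k) * (\<Sum>k<K. \<bar>(x (Suc k) - x k) - (y (Suc k) - y k)\<bar>)" by (simp add: sum_distrib_left)
  also have "\<dots> \<le> (\<Sum>k<K. a k) * (2 * (\<Sum>k\<le>K. \<bar>x k - y k\<bar>))"
    using a by (intro mult_left_mono increments_le sum_nonneg) auto
  finally show "\<bar>exp (- ?f x) - exp (- ?f y)\<bar> \<le> (2 * (\<Sum>k<K. a k)) * (\<Sum>k\<le>K. \<bar>x k - y k\<bar>)" by (simp add: mult_ac)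
qed

text \<open>The shape of the error in \<open>char_increments_bound\<close>. The cap 2 is the trivial
  distance of two numbers of modulus at most 1.\<close>

lemma lipschitz_upto_min:
  assumes "0 \<le> e" shows "lipschitz_upto K (\<lambda>x. min 2 (e * max 0 (x K)))"
  unfolding lipschitz_upto_def
proof (intro exI allI conjI)
  fix x y :: "nat \<Rightarrow> real"
  show "\<bar>min 2 (e * max 0 (x K))\<bar> \<le> 2" using assms by auto
  have "\<bar>min 2 u - min 2 v\<bar> \<le> \<bar>u - v\<bar>" for u v :: real by (auto simp: min_def)
  then have "\<bar>min 2 (e * max 0 (x K)) - min 2 (e * max 0 (y K))\<bar> \<le> \<bar>e * max 0 (x K) - e * max 0 (y K)\<bar>" .
  also have "\<dots> = e * \<bar>max 0 (x K) - max 0 (y K)\<bar>" using assms by (simp add: abs_mult flip: right_diff_distrib)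
  also have "\<dots> \<le> e * \<bar>x K - y K\<bar>" using assms by (intro mult_left_mono) auto
  also have "\<dots> \<le> e * (\<Sum>k\<le>K. \<bar>x k - y k\<bar>)" using assms by (intro mult_left_mono member_le_sum) auto
  finally show "\<bar>min 2 (e * max 0 (x K)) - min 2 (e * max 0 (y K))\<bar> \<le> e * (\<Sum>k\<le>K. \<bar>x k - y k\<bar>)" .
qed

text \<open>Squares are not Lipschitz, but the cap makes them so: min 1 (a^2) has Lipschitz constant
  2 in a \<ge> 0. Here a is sqrt c times the Euclidean norm of the increments, and the norm is
  controlled by the triangle inequality.\<close>

lemma lipschitz_upto_quadratic:
  assumes "0 \<le> c" shows "lipschitz_upto K (\<lambda>x. min 1 (c * (\<Sum>k<K. (x (Suc k) - x k)\<^sup>2)))"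
  unfolding lipschitz_upto_def
proof (intro exI allI conjI)
  fix x y :: "nat \<Rightarrow> real"
  define q where "q x = L2_set (\<lambda>k. x (Suc k) - x k) {..<K}" for x :: "nat \<Rightarrow> real"
  have qq: "(\<Sum>k<K. (x (Suc k) - x k)\<^sup>2) = (q x)\<^sup>2" for x
    by (simp add: q_def L2_set_def sum_nonneg)
  have q0: "0 \<le> q x" for x by (simp add: q_def)
  have tri: "q x - q y \<le> L2_set (\<lambda>k. (x (Suc k) - x k) - (y (Suc k) - y k)) {..<K}" for x y
    using L2_set_triangle_ineq[of "\<lambda>k. (x (Suc k) - x k) - (y (Suc k) - y k)" "\<lambda>k. y (Suc k) - y k" "{..<K}"]
    by (simp add: q_def)
  have le: "q x - q y \<le> 2 * (\<Sum>k\<le>K. \<bar>x k - y k\<bar>)" for x y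
    using tri[of x y] L2_set_le_sum_abs[of "\<lambda>k. (x (Suc k) - x k) - (y (Suc k) - y k)" "{..<K}"] increments_le[where x=x and y=y and K=K]
    by linarith
  have qxy: "\<bar>q x - q y\<bar> \<le> 2 * (\<Sum>k\<le>K. \<bar>x k - y k\<bar>)"
    using le[of x y] le[of y x] by (simp add: abs_le_iff abs_minus_commute)
  have sq: "\<bar>min 1 (a\<^sup>2) - min 1 (b\<^sup>2)\<bar> \<le> 2 * \<bar>a - b\<bar>" if "0 \<le> a" "0 \<le> b" for a b :: real
  proof -
    have *: "min 1 (b\<^sup>2) - min 1 (a\<^sup>2) \<le> 2 * (b - a)" if "0 \<le> a" "a \<le> b" for a b :: real
    proof (cases "b \<le> 1")
      case True
      then have "(b - a) * (b + a) \<le> (b - a) * 2" using that by (intro mult_left_mono) auto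
      moreover have "(b - a) * (b + a) = b\<^sup>2 - a\<^sup>2" by (simp add: power2_eq_square algebra_simps)
      moreover have "b\<^sup>2 \<le> 1" "a\<^sup>2 \<le> 1" using True that by (simp_all add: abs_square_le_1)
      ultimately show ?thesis by simp
    next
      case False
      show ?thesis
      proof (cases "a \<le> 1")
        case True
        then have "(1 - a) * (1 + a) \<le> (1 - a) * 2" by (intro mult_left_mono) auto
        moreover have "(1 - a) * (1 + a) = 1 - a\<^sup>2" by (simp add: power2_eq_square algebra_simps)
        moreover have "a\<^sup>2 \<le> 1" using True that by (simp add: abs_square_le_1)
        ultimately show ?thesis using False by (simp add: min_def)
      next
        case False
        then have "1 \<le> a\<^sup>2" by (simp add: one_le_power)
        then show ?thesis using that by simp
      qed
    qed
    have m: "min 1 (a\<^sup>2) \<le> min 1 (b\<^sup>2)" if "0 \<le> a" "a \<le> b" for a b :: real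
      using power_mono[OF that(2,1), of 2] by simp
    show ?thesis
    proof (cases "a \<le> b")
      case True
      then show ?thesis using *[of a b] m[of a b] that by simp
    next
      case False
      then show ?thesis using *[of b a] m[of b a] that by simp
    qed
  qed
  show "\<bar>min 1 (c * (\<Sum>k<K. (x (Suc k) - x k)\<^sup>2))\<bar> \<le> 1" using assms by (auto simp: sum_nonneg)
  have cq: "c * (\<Sum>k<K. (x (Suc k) - x k)\<^sup>2) = (sqrt c * q x)\<^sup>2" for x
    unfolding qq using assms by (simp add: power_mult_distrib)
  have "\<bar>min 1 (c * (\<Sum>k<K. (x (Suc k) - x k)\<^sup>2)) - min 1 (c * (\<Sum>k<K. (y (Suc k) - y k)\<^sup>2))\<bar> \<le> 2 * \<bar>sqrt c * q x - sqrt c * q y\<bar>"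
    unfolding cq using assms q0 by (intro sq) auto
  also have "\<dots> = 2 * (sqrt c * \<bar>q x - q y\<bar>)" using assms by (simp add: abs_mult flip: right_diff_distrib)
  also have "\<dots> \<le> 2 * (sqrt c * (2 * (\<Sum>k\<le>K. \<bar>x k - y k\<bar>)))" using assms qxy by (intro mult_left_mono) auto
  finally show "\<bar>min 1 (c * (\<Sum>k<K. (x (Suc k) - x k)\<^sup>2)) - min 1 (c * (\<Sum>k<K. (y (Suc k) - y k)\<^sup>2))\<bar>
    \<le> (4 * sqrt c) * (\<Sum>k\<le>K. \<bar>x k - y k\<bar>)" by simp
qed

lemma block_sum_cong:
  "(\<And>j l. l \<ge> 1 \<Longrightarrow> x (j, l) = y (j, l)) \<Longrightarrow> block_sum n r p q x = block_sum n r p q y"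
  unfolding block_sum_def by (intro sum.cong HOL.refl) simp

section \<open>Prelimit processes driven by integer clocks\<close>

text \<open>Before t a monotone clock takes finitely many values, so it is constant from the moment
  when it reaches the largest of them. This gives left limits for every function g of the
  clock.\<close>

lemma nat_clock_cadlag:
  fixes m :: "real \<Rightarrow> nat" and g :: "nat \<Rightarrow> 'b::metric_space"
  assumes mono: "mono_on {0..} m" and right: "\<And>t. t \<ge> 0 \<Longrightarrow> \<forall>\<^sub>F s in at_right t. m s = m t"
  shows "cadlag (\<lambda>t. g (m t))"
  unfolding cadlag_def
proof (intro conjI allI impI)
  fix t :: real assume t: "0 \<le> t"
  show "((\<lambda>t. g (m t)) \<longlongrightarrow> g (m t)) (at_right t)"
    by (rule tendsto_eventually, rule eventually_mono[OF right[OF t]]) simp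
next
  fix t :: real assume t: "0 < t"
  have fin: "finite (m ` {0..<t})"
    by (rule finite_subset[of _ "{..m t}"]) (use mono t in \<open>auto simp: mono_on_def\<close>)
  have "Max (m ` {0..<t}) \<in> m ` {0..<t}" by (rule Max_in[OF fin]) (use t in auto)
  then obtain u where u: "u \<in> {0..<t}" "m u = Max (m ` {0..<t})" by auto
  have "m s = m u" if "u < s" "s < t" for s
  proof (rule antisym)
    show "m s \<le> m u" unfolding u(2) using fin that u(1) by (intro Max_ge) auto
    show "m u \<le> m s" using mono that u(1) by (auto simp: mono_on_def)
  qed
  then have "\<forall>\<^sub>F s in at_left t. g (m s) = g (m u)"
    using u(1) by (auto simp: eventually_at_left_field intro!: exI[of _ u])
  then show "\<exists>l. ((\<lambda>t. g (m t)) \<longlongrightarrow> l) (at_left t)" by (blast intro: tendsto_eventually)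
qed

lemma measurable_borel_nat: "f \<in> M \<rightarrow>\<^sub>M (borel :: nat measure) \<longleftrightarrow> f \<in> M \<rightarrow>\<^sub>M count_space UNIV"
  by (simp only: measurable_cong_sets[OF HOL.refl sets_borel_eq_count_space])

abbreviation array_space :: "(nat \<times> nat \<Rightarrow> real) measure" where
  "array_space \<equiv> Pi\<^sub>M (UNIV \<times> {1..}) (\<lambda>_. borel)"

text \<open>Covers the deterministic clock \<lfloor>n t\<rfloor> with c n = n and the fractional
  Poisson clock with c n = n^\<alpha>.\<close>

locale circulant_clock = standardized_array M X K3 K4
  for M :: "'a measure" and X K3 K4 +
  fixes U :: "nat \<Rightarrow> 'a \<Rightarrow> nat" and C :: "nat \<Rightarrow> real \<Rightarrow> 'a \<Rightarrow> nat" and c :: "nat \<Rightarrow> real"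
  assumes U_uniform: "\<And>n. n \<ge> 1 \<Longrightarrow> distr M (count_space UNIV) (U n) = measure_pmf (pmf_of_set {..<n})"
    and indep_clock: "\<And>n. n \<ge> 1 \<Longrightarrow> independent_elements M array_space (\<lambda>\<omega>. \<lambda>(i, k)\<in>UNIV \<times> {1..}. X i k \<omega>)
       (count_space UNIV \<Otimes>\<^sub>M path_algebra) (\<lambda>\<omega>. (U n \<omega>, sample_path (C n) \<omega>))"
    and clock: "\<And>n. n \<ge> 1 \<Longrightarrow> AE \<omega> in M. C n 0 \<omega> = 0 \<and> mono_on {0..} (\<lambda>t. C n t \<omega>) \<and>
       (\<forall>t\<ge>0. \<forall>\<^sub>F s in at_right t. C n s \<omega> = C n t \<omega>)"
    and c_pos: "\<And>n. n \<ge> 1 \<Longrightarrow> c n > 0"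
    and c_top: "filterlim c at_top sequentially"
begin

text \<open>About c n columns of n variables each have been summed when the rescaled clock is of
  order 1, so n c n is the order of the variance.\<close>

definition scale :: "nat \<Rightarrow> real" where "scale n = 1 / sqrt (real n * c n)"

definition Z :: "nat \<Rightarrow> real \<Rightarrow> 'a \<Rightarrow> complex" where
  "Z n t \<omega> = scale n *\<^sub>R circulant_eigenvalue n (\<lambda>j. walk X j (C n t \<omega>) \<omega>) (U n \<omega>)"

definition array :: "'a \<Rightarrow> nat \<times> nat \<Rightarrow> real" where
  "array \<omega> = (\<lambda>(i, k)\<in>UNIV \<times> {1..}. X i k \<omega>)"

lemma Z_eq: "Z n t \<omega> = scale n *\<^sub>R block_sum n (U n \<omega>) 0 (C n t \<omega>) (array \<omega>)"
  unfolding Z_def circulant_eigenvalue_walk by (subst block_sum_cong[of _ "array \<omega>"]) (auto simp: array_def)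

text \<open>Weak convergence asks for a version of every member of the sequence, including n = 0, to
  which the assumptions on U and the clock do not extend.\<close>

lemma Z_0: "Z 0 t \<omega> = 0"
  by (simp add: Z_eq block_sum_def)

lemma scale_sq: "n \<ge> 1 \<Longrightarrow> (scale n)\<^sup>2 * real n = 1 / c n"
  using c_pos[of n] by (simp add: scale_def power_divide)

lemma scale_nonneg: "0 \<le> scale n" if "n \<ge> 1"
  using c_pos[OF that] by (simp add: scale_def)

lemma scale_0: "scale \<longlonglongrightarrow> 0"
proof -
  have "filterlim (\<lambda>n. real n * c n) at_top sequentially"
    by (rule filterlim_at_top_mult_at_top[OF filterlim_real_sequentially c_top])
  then have "filterlim (\<lambda>n. sqrt (real n * c n)) at_top sequentially"
    by (rule filterlim_compose[OF sqrt_at_top])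
  then have "(\<lambda>n. inverse (sqrt (real n * c n))) \<longlonglongrightarrow> 0" by (rule tendsto_inverse_0_at_top)
  then show ?thesis by (simp add: scale_def[abs_def] inverse_eq_divide)
qed

lemma U_measurable: "n \<ge> 1 \<Longrightarrow> U n \<in> M \<rightarrow>\<^sub>M count_space UNIV"
  using measurable_compose[OF independent_elementsD(2)[OF prob_space_axioms indep_clock[of n]] measurable_fst] by simp

lemma C_measurable: "n \<ge> 1 \<Longrightarrow> t \<ge> 0 \<Longrightarrow> C n t \<in> M \<rightarrow>\<^sub>M count_space UNIV"
proof -
  assume n: "n \<ge> 1" and t: "t \<ge> 0"
  have "(\<lambda>\<omega>. sample_path (C n) \<omega> t) \<in> M \<rightarrow>\<^sub>M borel"
    using measurable_compose[OF measurable_compose[OF independent_elementsD(2)[OF prob_space_axioms indep_clock[OF n]] measurable_snd]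
        measurable_component_singleton[of t "{0..}"]] t by simp
  moreover have "(\<lambda>\<omega>. sample_path (C n) \<omega> t) = C n t" using t by (simp add: sample_path_def fun_eq_iff)
  ultimately show ?thesis by (simp only: measurable_borel_nat)
qed

lemma array_measurable: "array \<in> M \<rightarrow>\<^sub>M array_space"
  unfolding array_def[abs_def] by (rule independent_elementsD(1)[OF prob_space_axioms indep_clock[of 1]]) simp

lemma block_sum_measurable: "block_sum n r p q \<in> borel_measurable array_space"
  unfolding block_sum_def[abs_def]
  by (intro borel_measurable_sum borel_measurable_times borel_measurable_const borel_measurable_of_real
      measurable_component_singleton) auto

lemma Z_measurable:
  assumes t: "t \<ge> 0" shows "Z n t \<in> borel_measurable M"
proof (cases "n = 0")
  case True
  then have "Z n t = (\<lambda>_. 0)" by (simp add: Z_0 fun_eq_iff)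
  then show ?thesis by simp
next
  case False
  then have n: "n \<ge> 1" by simp
  have "(\<lambda>\<omega>. block_sum n (U n \<omega>) 0 (C n t \<omega>) (array \<omega>)) \<in> borel_measurable M"
    by (rule measurable_compose_countable[OF measurable_compose_countable[OF _ C_measurable[OF n t]] U_measurable[OF n]])
       (rule measurable_compose[OF array_measurable block_sum_measurable])
  then show ?thesis unfolding Z_eq[abs_def] by measurable
qed

lemma Z_cadlag: "AE \<omega> in M. cadlag (\<lambda>t. Z n t \<omega>)"
proof (cases "n = 0")
  case True
  then show ?thesis by (simp add: Z_0 cadlag_def) (blast intro: tendsto_const)
next
  case False
  then have "n \<ge> 1" by simp
  from clock[OF this] show ?thesis
  proof eventually_elim
    case (elim \<omega>)
    show ?case unfolding Z_eq
      by (rule nat_clock_cadlag[where g = "\<lambda>m. scale n *\<^sub>R block_sum n (U n \<omega>) 0 m (array \<omega>)"]) (use elim in auto)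
  qed
qed

text \<open>Everything that is conditioned upon, in a countable type, so that
  \<open>conditional_bound\<close> applies.\<close>

definition grid_data :: "nat \<Rightarrow> nat \<Rightarrow> nat \<Rightarrow> 'a \<Rightarrow> nat \<times> nat list" where
  "grid_data n N K \<omega> = (U n \<omega>, map (\<lambda>k. C n (real k / real N) \<omega>) [0..<Suc K])"

text \<open>Constant after index K, so that the values form a monotone sequence on all of the
  naturals, as \<open>char_block_sums\<close> requires.\<close>

definition clock_values :: "nat \<Rightarrow> nat \<times> nat list \<Rightarrow> nat \<Rightarrow> nat" where
  "clock_values K d k = snd d ! min k K"

lemma clock_values_grid_data: "clock_values K (grid_data n N K \<omega>) k = C n (real (min k K) / real N) \<omega>"
proof -
  have "[0..<Suc K] ! min k K = min k K" by (subst nth_upt) auto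
  then show ?thesis by (simp add: clock_values_def grid_data_def del: upt_Suc)
qed

lemma fst_grid_data: "fst (grid_data n N K \<omega>) = U n \<omega>"
  by (simp add: grid_data_def)

lemma independent_grid_data:
  assumes n: "n \<ge> 1"
  shows "independent_elements M array_space array (count_space UNIV) (grid_data n N K)"
proof -
  define f :: "nat \<times> (real \<Rightarrow> nat) \<Rightarrow> nat \<times> nat list" where
    "f z = (fst z, map (\<lambda>k. snd z (real k / real N)) [0..<Suc K])" for z
  have "f \<in> (count_space UNIV \<Otimes>\<^sub>M path_algebra) \<rightarrow>\<^sub>M count_space UNIV"
  proof (rule measurable_count_space_eq2_countable[THEN iffD2], intro conjI ballI)
    fix d :: "nat \<times> nat list"
    let ?P = "count_space (UNIV :: nat set) \<Otimes>\<^sub>M (path_algebra :: (real \<Rightarrow> nat) measure)"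
    have m: "(\<lambda>z. snd z (real k / real N)) \<in> ?P \<rightarrow>\<^sub>M count_space UNIV" for k
    proof -
      have "(\<lambda>z. snd z (real k / real N)) \<in> ?P \<rightarrow>\<^sub>M borel"
        by (rule measurable_compose[OF measurable_snd measurable_component_singleton]) simp
      then show ?thesis by (simp only: measurable_borel_nat)
    qed
    have "f -` {d} \<inter> space ?P = {z \<in> space ?P. fst z = fst d \<and> length (snd d) = Suc K \<and>
      (\<forall>k\<in>{..K}. snd z (real k / real N) = snd d ! k)}"
      by (cases d) (auto simp: f_def list_eq_iff_nth_eq less_Suc_eq_le simp del: upt_Suc)
    also have "\<dots> \<in> sets ?P"
    proof (intro sets.sets_Collect_conj sets.sets_Collect_finite_All sets.sets_Collect_const)
      show "{z \<in> space ?P. fst z = fst d} \<in> sets ?P" by measurable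
      show "{z \<in> space ?P. snd z (real k / real N) = snd d ! k} \<in> sets ?P" for k
        using m[of k] by measurable
    qed auto
    finally show "f -` {d} \<inter> space ?P \<in> sets ?P" .
  qed auto
  from independent_elements_compose[OF prob_space_axioms indep_clock[OF n] measurable_ident this]
  have "independent_elements M array_space array (count_space UNIV) (\<lambda>\<omega>. f (U n \<omega>, sample_path (C n) \<omega>))"
    by (simp add: array_def[abs_def])
  moreover have "(\<lambda>\<omega>. f (U n \<omega>, sample_path (C n) \<omega>)) = grid_data n N K"
    by (auto simp: fun_eq_iff f_def grid_data_def sample_path_def)
  ultimately show ?thesis by simp
qed

lemma AE_U_less: "n \<ge> 1 \<Longrightarrow> AE \<omega> in M. U n \<omega> < n"
proof -
  assume n: "n \<ge> 1"
  have "AE r in distr M (count_space UNIV) (U n). r < n"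
    unfolding U_uniform[OF n] using n by (simp add: AE_measure_pmf_iff set_pmf_of_set lessThan_empty_iff)
  then show ?thesis using U_measurable[OF n] by (simp add: AE_distr_iff)
qed

lemma prob_U_exceptional: "n \<ge> 1 \<Longrightarrow> prob {\<omega> \<in> space M. U n \<omega> = 0 \<or> 2 * U n \<omega> = n} \<le> 2 / real n"
proof -
  assume n: "n \<ge> 1"
  let ?S = "{r. r = 0 \<or> 2 * r = n}"
  have "prob {\<omega> \<in> space M. U n \<omega> = 0 \<or> 2 * U n \<omega> = n} = measure (distr M (count_space UNIV) (U n)) ?S"
    using U_measurable[OF n] by (subst measure_distr) (auto intro!: arg_cong[where f = "measure M"])
  also have "\<dots> = real (card ({..<n} \<inter> ?S)) / real (card {..<n})"
    unfolding U_uniform[OF n] using n by (subst measure_pmf_of_set) (auto simp: lessThan_empty_iff)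
  also have "\<dots> \<le> 2 / real n"
  proof -
    have "card ({..<n} \<inter> ?S) \<le> card {0, n div 2}" by (intro card_mono) auto
    also have "\<dots> \<le> 2" by (simp add: card_insert_if)
    finally have "real (card ({..<n} \<inter> ?S)) \<le> 2" by linarith
    then show ?thesis by (simp add: divide_right_mono)
  qed
  finally show ?thesis .
qed

end

context circulant_clock
begin

abbreviation "increment n N k \<omega> \<equiv> Z n (real (Suc k) / real N) \<omega> - Z n (real k / real N) \<omega>"

text \<open>The error of \<open>char_block_sums\<close> per unit of rescaled clock: two of the
  powers of \<open>scale n\<close>, together with n, make up 1 / c n and rescale the clock; one or
  two powers remain.\<close>

definition error_rate :: "real \<Rightarrow> nat \<Rightarrow> real" where
  "error_rate W n = W ^ 3 * K3 / 6 * scale n + W ^ 4 / 8 * (scale n)\<^sup>2"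

lemma Z_increment:
  assumes "C n s \<omega> \<le> C n t \<omega>"
  shows "Z n t \<omega> - Z n s \<omega> = scale n *\<^sub>R block_sum n (U n \<omega>) (C n s \<omega>) (C n t \<omega>) (array \<omega>)"
  using block_sum_add[of 0 "C n s \<omega>" "C n t \<omega>" n "U n \<omega>" "array \<omega>", symmetric] assms
  by (simp add: Z_eq scaleR_add_right)

lemma block_sum_array: "block_sum n r p q (array \<omega>) = block_sum n r p q (\<lambda>(j, l). X j l \<omega>)"
  by (rule block_sum_cong) (simp add: array_def)

lemma AE_clock_mono:
  assumes n: "n \<ge> 1" and N: "N > 0"
  shows "AE \<omega> in M. \<forall>j k. j \<le> k \<longrightarrow> C n (real j / real N) \<omega> \<le> C n (real k / real N) \<omega>"
  using clock[OF n]
proof eventually_elim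
  case (elim \<omega>)
  then show ?case using N by (auto simp: mono_on_def divide_right_mono)
qed

text \<open>Given grid data with U n outside {0, n / 2}, \<open>char_block_sums\<close> compares
  with the Gaussian value. Otherwise the trivial bound 2 is used, on an event of probability at most
  2 / n; this is the term 4 / n.\<close>

lemma char_increments_bound:
  assumes n: "n \<ge> 1" and N: "N > 0" and W: "\<And>k. \<bar>\<theta> k\<bar> + \<bar>\<phi> k\<bar> \<le> W"
  shows "cmod ((\<integral>\<omega>. iexp (\<Sum>k<K. \<theta> k * Re (increment n N k \<omega>) + \<phi> k * Im (increment n N k \<omega>)) \<partial>M) -
      of_real (\<integral>\<omega>. exp (- (\<Sum>k<K. ((\<theta> k)\<^sup>2 + (\<phi> k)\<^sup>2) / 4 *
        max 0 (C n (real (Suc k) / real N) \<omega> / c n - C n (real k / real N) \<omega> / c n))) \<partial>M))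
    \<le> (\<integral>\<omega>. min 2 (error_rate W n * max 0 (C n (real K / real N) \<omega> / c n)) \<partial>M) + 4 / real n"
proof -
  define D where "D = grid_data n N K"
  define p where "p d = clock_values K d" for d
  define g where "g x d = iexp (\<Sum>k<K. \<theta> k * Re (scale n *\<^sub>R block_sum n (fst d) (p d k) (p d (Suc k)) x) +
    \<phi> k * Im (scale n *\<^sub>R block_sum n (fst d) (p d k) (p d (Suc k)) x))" for x d
  define h where "h d = exp (- (\<Sum>k<K. ((\<theta> k)\<^sup>2 + (\<phi> k)\<^sup>2) / 4 * max 0 (p d (Suc k) / c n - p d k / c n)))" for d
  define exc where "exc d \<longleftrightarrow> fst d = 0 \<or> 2 * fst d = n" for d :: "nat \<times> nat list"
  define b where "b d = min 2 (error_rate W n * max 0 (p d K / c n)) + (if exc d then 2 else 0)" for d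
  have W0: "0 \<le> W" using W[of 0] by (meson abs_ge_zero add_nonneg_nonneg order_trans)
  have er0: "0 \<le> error_rate W n"
    unfolding error_rate_def using W0 K3_nonneg scale_nonneg[OF n] by (intro add_nonneg_nonneg mult_nonneg_nonneg) auto
  have cn: "c n > 0" using c_pos[OF n] .
  have gn: "cmod (g x d) = 1" for x d unfolding g_def by (simp add: norm_exp_i_times del: of_real_sum of_real_add of_real_mult)
  have h01: "0 \<le> h d" "h d \<le> 1" for d
    unfolding h_def by (auto intro!: sum_nonneg)
  have gm: "(\<lambda>x. g x d) \<in> borel_measurable array_space" for d
  proof -
    note [measurable] = block_sum_measurable
    show ?thesis unfolding g_def by measurable
  qed
  have Dm[measurable]: "D \<in> M \<rightarrow>\<^sub>M count_space UNIV"
    using independent_elementsD(2)[OF prob_space_axioms independent_grid_data[OF n]] by (simp add: D_def)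
  have pD: "p (D \<omega>) k = C n (real k / real N) \<omega>" if "k \<le> K" for k \<omega>
    using that by (simp add: p_def D_def clock_values_grid_data)
  have fD: "fst (D \<omega>) = U n \<omega>" for \<omega> by (simp add: D_def fst_grid_data)
  have pmono: "AE \<omega> in M. mono (p (D \<omega>))"
    using AE_clock_mono[OF n N]
  proof eventually_elim
    case (elim \<omega>)
    show ?case unfolding p_def D_def clock_values_grid_data
      by (intro monoI elim[rule_format] min.mono order_refl)
  qed
  have "cmod ((\<integral>\<omega>. g (array \<omega>) (D \<omega>) \<partial>M) - (\<integral>\<omega>. of_real (h (D \<omega>)) \<partial>M)) \<le> (\<integral>\<omega>. b (D \<omega>) \<partial>M)"
  proof (rule conditional_bound[OF prob_space_axioms, where A = array and D = D and g = g and b = b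
        and h = "\<lambda>d. of_real (h d)" and ?C1.0 = 1 and ?C2.0 = 1 and ?C3.0 = 4])
    show "independent_elements M array_space array (count_space UNIV) D"
      unfolding D_def by (rule independent_grid_data[OF n])
    show "(\<lambda>x. g x d) \<in> borel_measurable array_space" for d by (rule gm)
    show "cmod (g x d) \<le> 1" for x d by (simp add: gn)
    show "cmod (of_real (h d)) \<le> 1" for d using h01 by simp
    show "0 \<le> b d" "b d \<le> 4" for d
      unfolding b_def using er0 by (auto intro: add_increasing2)
    have le2: "cmod ((\<integral>\<omega>'. g (array \<omega>') d \<partial>M) - of_real (h d)) \<le> 2" for d
    proof -
      have "cmod (\<integral>\<omega>'. g (array \<omega>') d \<partial>M) \<le> (\<integral>\<omega>'. cmod (g (array \<omega>') d) \<partial>M)" by (rule integral_norm_bound)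
      also have "\<dots> = 1" by (simp add: gn prob_space)
      finally have "cmod (\<integral>\<omega>'. g (array \<omega>') d \<partial>M) \<le> 1" .
      moreover have "cmod (complex_of_real (h d)) \<le> 1" using h01 by simp
      ultimately show ?thesis using norm_triangle_ineq4[of "\<integral>\<omega>'. g (array \<omega>') d \<partial>M" "complex_of_real (h d)"] by linarith
    qed
    show "AE \<omega> in M. cmod ((\<integral>\<omega>'. g (array \<omega>') (D \<omega>) \<partial>M) - of_real (h (D \<omega>))) \<le> b (D \<omega>)"
      using pmono AE_U_less[OF n]
    proof eventually_elim
      case (elim \<omega>)
      let ?d = "D \<omega>"
      have fd: "fst ?d = U n \<omega>" by (simp add: D_def fst_grid_data)
      show ?case
      proof (cases "exc ?d")
        case True
        have "2 \<le> b ?d" using True er0 cn by (simp add: b_def)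
        then show ?thesis using le2[of ?d] by linarith
      next
        case False
        have r: "0 < fst ?d" "fst ?d < n" "2 * fst ?d \<noteq> n" using False elim fd by (auto simp: exc_def)
        have sn: "(scale n)\<^sup>2 * real n = 1 / c n" by (rule scale_sq[OF n])
        have heq: "h ?d = exp (- (\<Sum>k<K. ((\<theta> k)\<^sup>2 + (\<phi> k)\<^sup>2) / 4 * ((scale n)\<^sup>2 * real n * real (p ?d (Suc k) - p ?d k))))"
        proof -
          have "max 0 (p ?d (Suc k) / c n - p ?d k / c n) = (scale n)\<^sup>2 * real n * real (p ?d (Suc k) - p ?d k)" for k
          proof -
            have "p ?d k \<le> p ?d (Suc k)" using elim(1) by (rule monoD) simp
            then show ?thesis unfolding sn using cn by (simp add: of_nat_diff diff_divide_distrib divide_right_mono)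
          qed
          then show ?thesis unfolding h_def by simp
        qed
        have geq: "g (array \<omega>') ?d = iexp (\<Sum>k<K. \<theta> k * Re (scale n *\<^sub>R block_sum n (fst ?d) (p ?d k) (p ?d (Suc k)) (\<lambda>(j, l). X j l \<omega>')) +
          \<phi> k * Im (scale n *\<^sub>R block_sum n (fst ?d) (p ?d k) (p ?d (Suc k)) (\<lambda>(j, l). X j l \<omega>')))" for \<omega>'
          unfolding g_def block_sum_array ..
        have "cmod ((\<integral>\<omega>'. g (array \<omega>') ?d \<partial>M) - of_real (h ?d)) \<le>
          real n * real (p ?d K) * ((scale n * W) ^ 3 * K3 / 6 + (scale n * W) ^ 4 / 8)"
          unfolding geq heq by (rule char_block_sums[OF r elim(1) scale_nonneg[OF n] W])
        also have "\<dots> = ((scale n)\<^sup>2 * real n) * real (p ?d K) * error_rate W n"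
          unfolding error_rate_def by (simp add: power2_eq_square power3_eq_cube power4_eq_xxxx algebra_simps)
        also have "\<dots> = error_rate W n * max 0 (p ?d K / c n)" unfolding sn using cn by simp
        finally have "cmod ((\<integral>\<omega>'. g (array \<omega>') ?d \<partial>M) - of_real (h ?d)) \<le> error_rate W n * max 0 (p ?d K / c n)" .
        then show ?thesis using False le2[of ?d] by (simp add: b_def)
      qed
    qed
  qed
  moreover have "(\<integral>\<omega>. g (array \<omega>) (D \<omega>) \<partial>M) =
    (\<integral>\<omega>. iexp (\<Sum>k<K. \<theta> k * Re (increment n N k \<omega>) + \<phi> k * Im (increment n N k \<omega>)) \<partial>M)"
  proof (rule integral_cong_AE)
    show "(\<lambda>\<omega>. g (array \<omega>) (D \<omega>)) \<in> borel_measurable M"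
      by (rule measurable_compose_countable[OF measurable_compose[OF array_measurable gm] Dm])
    have [measurable]: "Z n (real k / real N) \<in> borel_measurable M" for k by (rule Z_measurable) simp
    show "(\<lambda>\<omega>. iexp (\<Sum>k<K. \<theta> k * Re (increment n N k \<omega>) + \<phi> k * Im (increment n N k \<omega>))) \<in> borel_measurable M"
      by measurable
    show "AE \<omega> in M. g (array \<omega>) (D \<omega>) = iexp (\<Sum>k<K. \<theta> k * Re (increment n N k \<omega>) + \<phi> k * Im (increment n N k \<omega>))"
      using AE_clock_mono[OF n N]
    proof eventually_elim
      case (elim \<omega>)
      have "scale n *\<^sub>R block_sum n (fst (D \<omega>)) (p (D \<omega>) k) (p (D \<omega>) (Suc k)) (array \<omega>) = increment n N k \<omega>" if "k < K" for k
        using Z_increment[of n "real k / real N" \<omega> "real (Suc k) / real N"] elim[rule_format, of k "Suc k"] that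
        by (simp add: pD fD del: of_nat_Suc)
      then show ?case unfolding g_def by (intro arg_cong[where f = iexp] sum.cong) auto
    qed
  qed
  moreover have "h (D \<omega>) = exp (- (\<Sum>k<K. ((\<theta> k)\<^sup>2 + (\<phi> k)\<^sup>2) / 4 *
        max 0 (C n (real (Suc k) / real N) \<omega> / c n - C n (real k / real N) \<omega> / c n)))" for \<omega>
    unfolding h_def by (intro arg_cong[where f = exp] arg_cong[where f = uminus] sum.cong) (simp_all add: pD del: of_nat_Suc)
  moreover have "(\<integral>\<omega>. b (D \<omega>) \<partial>M) \<le> (\<integral>\<omega>. min 2 (error_rate W n * max 0 (C n (real K / real N) \<omega> / c n)) \<partial>M) + 4 / real n"
  proof -
    let ?E = "{\<omega> \<in> space M. exc (D \<omega>)}"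
    have E: "?E \<in> events" by measurable
    have beq: "b (D \<omega>) = min 2 (error_rate W n * max 0 (C n (real K / real N) \<omega> / c n)) + 2 * indicat_real ?E \<omega>"
      if "\<omega> \<in> space M" for \<omega> using that by (simp add: b_def pD indicator_def)
    have i1: "integrable M (\<lambda>\<omega>. min 2 (error_rate W n * max 0 (C n (real K / real N) \<omega> / c n)))"
    proof (rule integrable_const_bound[of _ 2])
      note [measurable] = C_measurable[OF n]
      have "C n (real K / real N) \<in> M \<rightarrow>\<^sub>M count_space UNIV" by (rule C_measurable[OF n]) simp
      then show "(\<lambda>\<omega>. min 2 (error_rate W n * max 0 (C n (real K / real N) \<omega> / c n))) \<in> borel_measurable M"
        by measurable
    qed (use er0 in auto)
    have "(\<integral>\<omega>. b (D \<omega>) \<partial>M) = (\<integral>\<omega>. min 2 (error_rate W n * max 0 (C n (real K / real N) \<omega> / c n)) + 2 * indicat_real ?E \<omega> \<partial>M)"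
      by (rule Bochner_Integration.integral_cong) (use beq in auto)
    also have "\<dots> = (\<integral>\<omega>. min 2 (error_rate W n * max 0 (C n (real K / real N) \<omega> / c n)) \<partial>M) + 2 * prob ?E"
      using i1 E by (simp add: integrable_real_indicator less_top[symmetric])
    also have "prob ?E \<le> 2 / real n"
      using prob_U_exceptional[OF n] by (simp add: exc_def D_def fst_grid_data)
    finally show ?thesis by simp
  qed
  ultimately show ?thesis by simp
qed

end

section \<open>Convergence of finite-dimensional distributions\<close>

text \<open>The limit enters through its continuous paths and the characteristic function of its
  grid increments, an average of Gaussian ones over \<Lambda>. So \<open>Y'\<close> may be a version
  of the time-changed Brownian motion.\<close>

locale circulant_clock_limit = circulant_clock M X K3 K4 U C c + M': prob_space M'
  for M :: "'a measure" and X K3 K4 U C c and M' :: "'b measure" +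
  fixes \<Lambda> :: "real \<Rightarrow> 'b \<Rightarrow> real" and Y' :: "real \<Rightarrow> 'b \<Rightarrow> complex"
  assumes Y'_measurable: "\<And>t. t \<ge> 0 \<Longrightarrow> Y' t \<in> borel_measurable M'"
    and Y'_continuous: "AE \<omega> in M'. continuous_on {0..} (\<lambda>t. Y' t \<omega>)"
    and Y'_0: "AE \<omega> in M'. Y' 0 \<omega> = 0"
    and \<Lambda>_measurable: "\<And>t. t \<ge> 0 \<Longrightarrow> \<Lambda> t \<in> borel_measurable M'"
    and \<Lambda>_paths: "AE \<omega> in M'. \<Lambda> 0 \<omega> = 0 \<and> mono_on {0..} (\<lambda>t. \<Lambda> t \<omega>) \<and> continuous_on {0..} (\<lambda>t. \<Lambda> t \<omega>)"
    and Y'_char: "\<And>N K \<theta> \<phi>. N > 0 \<Longrightarrow>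
      (\<integral>\<omega>. iexp (\<Sum>k<K. \<theta> k * Re (Y' (real (Suc k) / real N) \<omega> - Y' (real k / real N) \<omega>) +
         \<phi> k * Im (Y' (real (Suc k) / real N) \<omega> - Y' (real k / real N) \<omega>)) \<partial>M') =
      of_real (\<integral>\<omega>. exp (- (\<Sum>k<K. ((\<theta> k)\<^sup>2 + (\<phi> k)\<^sup>2) / 4 *
         (\<Lambda> (real (Suc k) / real N) \<omega> - \<Lambda> (real k / real N) \<omega>))) \<partial>M')"
    and clock_tendsto: "\<And>N K G. N > 0 \<Longrightarrow> lipschitz_upto K G \<Longrightarrow>
      (\<lambda>n. \<integral>\<omega>. G (\<lambda>k. C n (real k / real N) \<omega> / c n) \<partial>M) \<longlonglongrightarrow> (\<integral>\<omega>. G (\<lambda>k. \<Lambda> (real k / real N) \<omega>) \<partial>M')"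
begin

lemma error_rate_tendsto: "error_rate W \<longlonglongrightarrow> 0"
proof -
  have "(\<lambda>n. W ^ 3 * K3 / 6 * scale n + W ^ 4 / 8 * (scale n)\<^sup>2) \<longlonglongrightarrow> W ^ 3 * K3 / 6 * 0 + W ^ 4 / 8 * 0\<^sup>2"
    by (intro tendsto_intros scale_0)
  then show ?thesis by (simp add: error_rate_def[abs_def])
qed

text \<open>The integrand changes with n in the rate as well as in the clock. The rate is eventually
  below any fixed \<delta>; for fixed \<delta> the integral converges to that for \<Lambda>, which
  is small for small \<delta> by dominated convergence.\<close>

lemma error_integral_tendsto:
  assumes N: "N > 0" and W: "0 \<le> W"
  shows "(\<lambda>n. \<integral>\<omega>. min 2 (error_rate W n * max 0 (C n (real K / real N) \<omega> / c n)) \<partial>M) \<longlonglongrightarrow> 0"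
proof (rule order_tendstoI)
  fix r :: real assume r: "r < 0"
  have "\<forall>\<^sub>F n in sequentially. n \<ge> 1" by (rule eventually_ge_at_top)
  then show "\<forall>\<^sub>F n in sequentially. r < (\<integral>\<omega>. min 2 (error_rate W n * max 0 (C n (real K / real N) \<omega> / c n)) \<partial>M)"
  proof eventually_elim
    case (elim n)
    have "0 \<le> error_rate W n"
      unfolding error_rate_def using W K3_nonneg scale_nonneg[OF elim] by (intro add_nonneg_nonneg mult_nonneg_nonneg) auto
    then have "0 \<le> (\<integral>\<omega>. min 2 (error_rate W n * max 0 (C n (real K / real N) \<omega> / c n)) \<partial>M)"
      by (intro integral_nonneg_AE) auto
    then show ?case using r by linarith
  qed
next
  fix r :: real assume r: "0 < r"
  have [measurable]: "\<Lambda> (real K / real N) \<in> borel_measurable M'" by (rule \<Lambda>_measurable) simp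
  have "(\<lambda>m. \<integral>\<omega>. min 2 (1 / real (Suc m) * max 0 (\<Lambda> (real K / real N) \<omega>)) \<partial>M') \<longlonglongrightarrow> (\<integral>\<omega>. 0 \<partial>M')"
  proof (rule integral_dominated_convergence[where w = "\<lambda>_. 2"])
    have "(\<lambda>m. min 2 (1 / real (Suc m) * y)) \<longlonglongrightarrow> 0" for y :: real
    proof -
      have "(\<lambda>m. min 2 (1 / real (Suc m) * y)) \<longlonglongrightarrow> min 2 (0 * y)"
        by (intro tendsto_intros LIMSEQ_Suc[OF lim_1_over_n])
      then show ?thesis by simp
    qed
    then show "AE \<omega> in M'. (\<lambda>m. min 2 (1 / real (Suc m) * max 0 (\<Lambda> (real K / real N) \<omega>))) \<longlonglongrightarrow> 0" by simp
  qed (auto simp del: of_nat_Suc)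
  then have "\<forall>\<^sub>F m in sequentially. (\<integral>\<omega>. min 2 (1 / real (Suc m) * max 0 (\<Lambda> (real K / real N) \<omega>)) \<partial>M') < r"
    using r by (intro order_tendstoD) auto
  then obtain m where m: "(\<integral>\<omega>. min 2 (1 / real (Suc m) * max 0 (\<Lambda> (real K / real N) \<omega>)) \<partial>M') < r"
    using eventually_happens by force
  define \<delta> where "\<delta> = 1 / real (Suc m)"
  have \<delta>: "\<delta> > 0" by (simp add: \<delta>_def)
  have "(\<lambda>n. \<integral>\<omega>. min 2 (\<delta> * max 0 (C n (real K / real N) \<omega> / c n)) \<partial>M) \<longlonglongrightarrow> (\<integral>\<omega>. min 2 (\<delta> * max 0 (\<Lambda> (real K / real N) \<omega>)) \<partial>M')"
    using clock_tendsto[OF N lipschitz_upto_min[of \<delta> K]] \<delta> by simp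
  then have "\<forall>\<^sub>F n in sequentially. (\<integral>\<omega>. min 2 (\<delta> * max 0 (C n (real K / real N) \<omega> / c n)) \<partial>M) < r"
    using m by (intro order_tendstoD) (auto simp: \<delta>_def)
  moreover have "\<forall>\<^sub>F n in sequentially. error_rate W n < \<delta>"
    using error_rate_tendsto \<delta> by (rule order_tendstoD)
  moreover have "\<forall>\<^sub>F n in sequentially. n \<ge> 1" by (rule eventually_ge_at_top)
  ultimately show "\<forall>\<^sub>F n in sequentially. (\<integral>\<omega>. min 2 (error_rate W n * max 0 (C n (real K / real N) \<omega> / c n)) \<partial>M) < r"
  proof eventually_elim
    case (elim n)
    have er: "0 \<le> error_rate W n"
      unfolding error_rate_def using W K3_nonneg scale_nonneg[OF elim(3)] by (intro add_nonneg_nonneg mult_nonneg_nonneg) auto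
    have [measurable]: "C n (real K / real N) \<in> M \<rightarrow>\<^sub>M count_space UNIV" by (rule C_measurable[OF elim(3)]) simp
    have "(\<integral>\<omega>. min 2 (error_rate W n * max 0 (C n (real K / real N) \<omega> / c n)) \<partial>M) \<le>
      (\<integral>\<omega>. min 2 (\<delta> * max 0 (C n (real K / real N) \<omega> / c n)) \<partial>M)"
    proof (rule integral_mono)
      show "integrable M (\<lambda>\<omega>. min 2 (error_rate W n * max 0 (C n (real K / real N) \<omega> / c n)))"
        by (rule integrable_const_bound[of _ 2]) (use er in auto)
      show "integrable M (\<lambda>\<omega>. min 2 (\<delta> * max 0 (C n (real K / real N) \<omega> / c n)))"
        by (rule integrable_const_bound[of _ 2]) (use \<delta> in auto)
      show "min 2 (error_rate W n * max 0 (C n (real K / real N) \<omega> / c n)) \<le> min 2 (\<delta> * max 0 (C n (real K / real N) \<omega> / c n))" for \<omega>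
        using elim(2) by (intro min.mono mult_right_mono) auto
    qed
    then show ?case using elim(1) by linarith
  qed
qed

lemma char_tendsto:
  assumes N: "N > 0"
  shows "(\<lambda>n. \<integral>\<omega>. iexp (\<Sum>k<K. \<theta> k * Re (increment n N k \<omega>) + \<phi> k * Im (increment n N k \<omega>)) \<partial>M) \<longlonglongrightarrow>
    (\<integral>\<omega>. iexp (\<Sum>k<K. \<theta> k * Re (Y' (real (Suc k) / real N) \<omega> - Y' (real k / real N) \<omega>) +
         \<phi> k * Im (Y' (real (Suc k) / real N) \<omega> - Y' (real k / real N) \<omega>)) \<partial>M')"
proof -
  \<comment> \<open>Only indices below K occur in the sums, but \<open>char_increments_bound\<close>
    wants a bound W for all k; truncation makes the coefficients bounded.\<close>
  define \<theta>' where "\<theta>' k = (if k < K then \<theta> k else 0)" for k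
  define \<phi>' where "\<phi>' k = (if k < K then \<phi> k else 0)" for k
  define W where "W = (\<Sum>k<K. \<bar>\<theta> k\<bar> + \<bar>\<phi> k\<bar>)"
  have W0: "0 \<le> W" unfolding W_def by (intro sum_nonneg) auto
  have W: "\<bar>\<theta>' k\<bar> + \<bar>\<phi>' k\<bar> \<le> W" for k
  proof (cases "k < K")
    case True
    then have "\<bar>\<theta> k\<bar> + \<bar>\<phi> k\<bar> \<le> W" unfolding W_def by (intro member_le_sum) auto
    then show ?thesis using True by (simp add: \<theta>'_def \<phi>'_def)
  qed (use W0 in \<open>simp add: \<theta>'_def \<phi>'_def\<close>)
  have cutoff: "(\<Sum>k<K. \<theta>' k * A k + \<phi>' k * B k) = (\<Sum>k<K. \<theta> k * A k + \<phi> k * B k)" for A B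
    by (rule sum.cong) (auto simp: \<theta>'_def \<phi>'_def)
  define a where "a k = ((\<theta>' k)\<^sup>2 + (\<phi>' k)\<^sup>2) / 4" for k
  have a0: "0 \<le> a k" for k by (simp add: a_def)
  let ?f = "\<lambda>n. \<integral>\<omega>. iexp (\<Sum>k<K. \<theta>' k * Re (increment n N k \<omega>) + \<phi>' k * Im (increment n N k \<omega>)) \<partial>M"
  let ?h = "\<lambda>n. \<integral>\<omega>. exp (- (\<Sum>k<K. a k * max 0 (C n (real (Suc k) / real N) \<omega> / c n - C n (real k / real N) \<omega> / c n))) \<partial>M"
  have "?h \<longlonglongrightarrow> (\<integral>\<omega>. exp (- (\<Sum>k<K. a k * max 0 (\<Lambda> (real (Suc k) / real N) \<omega> - \<Lambda> (real k / real N) \<omega>))) \<partial>M')"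
    using clock_tendsto[OF N lipschitz_upto_exp[OF a0, where K = K]] by simp
  also have "(\<integral>\<omega>. exp (- (\<Sum>k<K. a k * max 0 (\<Lambda> (real (Suc k) / real N) \<omega> - \<Lambda> (real k / real N) \<omega>))) \<partial>M') =
    (\<integral>\<omega>. exp (- (\<Sum>k<K. a k * (\<Lambda> (real (Suc k) / real N) \<omega> - \<Lambda> (real k / real N) \<omega>))) \<partial>M')"
  proof (rule integral_cong_AE)
    have [measurable]: "\<Lambda> (real k / real N) \<in> borel_measurable M'" for k by (rule \<Lambda>_measurable) simp
    show "(\<lambda>\<omega>. exp (- (\<Sum>k<K. a k * max 0 (\<Lambda> (real (Suc k) / real N) \<omega> - \<Lambda> (real k / real N) \<omega>)))) \<in> borel_measurable M'"
      "(\<lambda>\<omega>. exp (- (\<Sum>k<K. a k * (\<Lambda> (real (Suc k) / real N) \<omega> - \<Lambda> (real k / real N) \<omega>)))) \<in> borel_measurable M'"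
      by measurable
    show "AE \<omega> in M'. exp (- (\<Sum>k<K. a k * max 0 (\<Lambda> (real (Suc k) / real N) \<omega> - \<Lambda> (real k / real N) \<omega>))) =
      exp (- (\<Sum>k<K. a k * (\<Lambda> (real (Suc k) / real N) \<omega> - \<Lambda> (real k / real N) \<omega>)))"
      using \<Lambda>_paths
    proof eventually_elim
      case (elim \<omega>)
      have "\<Lambda> (real k / real N) \<omega> \<le> \<Lambda> (real (Suc k) / real N) \<omega>" for k
        using elim N by (auto simp: mono_on_def divide_right_mono)
      then show ?case by (simp del: of_nat_Suc)
    qed
  qed
  finally have h: "(\<lambda>n. complex_of_real (?h n)) \<longlonglongrightarrow> of_real (\<integral>\<omega>. exp (- (\<Sum>k<K. a k * (\<Lambda> (real (Suc k) / real N) \<omega> - \<Lambda> (real k / real N) \<omega>))) \<partial>M')"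
    by (rule tendsto_of_real)
  have "(\<lambda>n. ?f n - of_real (?h n)) \<longlonglongrightarrow> 0"
  proof (rule Lim_null_comparison)
    show "\<forall>\<^sub>F n in sequentially. norm (?f n - of_real (?h n)) \<le>
      (\<integral>\<omega>. min 2 (error_rate W n * max 0 (C n (real K / real N) \<omega> / c n)) \<partial>M) + 4 / real n"
      using eventually_ge_at_top[of 1]
      by eventually_elim (use char_increments_bound[OF _ N W, where K = K] in \<open>simp add: a_def del: of_nat_Suc\<close>)
    have "(\<lambda>n. (\<integral>\<omega>. min 2 (error_rate W n * max 0 (C n (real K / real N) \<omega> / c n)) \<partial>M) + 4 / real n) \<longlonglongrightarrow> 0 + 0"
      by (intro tendsto_add error_integral_tendsto N W0 lim_const_over_n)
    then show "(\<lambda>n. (\<integral>\<omega>. min 2 (error_rate W n * max 0 (C n (real K / real N) \<omega> / c n)) \<partial>M) + 4 / real n) \<longlonglongrightarrow> 0" by simp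
  qed
  from tendsto_add[OF this h] have "?f \<longlonglongrightarrow> of_real (\<integral>\<omega>. exp (- (\<Sum>k<K. a k * (\<Lambda> (real (Suc k) / real N) \<omega> - \<Lambda> (real k / real N) \<omega>))) \<partial>M')"
    by simp
  also have "of_real (\<integral>\<omega>. exp (- (\<Sum>k<K. a k * (\<Lambda> (real (Suc k) / real N) \<omega> - \<Lambda> (real k / real N) \<omega>))) \<partial>M') =
    (\<integral>\<omega>. iexp (\<Sum>k<K. \<theta>' k * Re (Y' (real (Suc k) / real N) \<omega> - Y' (real k / real N) \<omega>) +
         \<phi>' k * Im (Y' (real (Suc k) / real N) \<omega> - Y' (real k / real N) \<omega>)) \<partial>M')"
    unfolding a_def by (rule Y'_char[OF N, symmetric])
  finally show ?thesis unfolding cutoff .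
qed

lemma AE_Z_at_0: "n \<ge> 1 \<Longrightarrow> AE \<omega> in M. Z n 0 \<omega> = 0"
proof -
  assume "n \<ge> 1"
  from clock[OF this] show ?thesis by eventually_elim (simp add: Z_eq block_sum_def)
qed

text \<open>Both processes start at 0, so their grid values are partial sums of increments, and a
  function of grid values is a continuous function of increments. Real and imaginary parts are
  indexed by a Boolean to fit the real multivariate theorem.\<close>

lemma fdd_tendsto:
  fixes G :: "(nat \<Rightarrow> complex) \<Rightarrow> real"
  assumes N: "N > 0" and G: "continuous_on UNIV G" and GB: "\<And>a. \<bar>G a\<bar> \<le> B"
    and loc: "\<And>a b. (\<forall>i\<le>K. a i = b i) \<Longrightarrow> G a = G b"
  shows "(\<lambda>n. \<integral>\<omega>. G (\<lambda>i. Z n (real i / real N) \<omega>) \<partial>M) \<longlonglongrightarrow> (\<integral>\<omega>. G (\<lambda>i. Y' (real i / real N) \<omega>) \<partial>M')"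
proof -
  define I where "I = {..<K} \<times> (UNIV :: bool set)"
  define V where "V n i \<omega> = (if snd i then Re (increment n N (fst i) \<omega>) else Im (increment n N (fst i) \<omega>))" for n and i :: "nat \<times> bool" and \<omega>
  define V' where "V' i \<omega> = (if snd i then Re (Y' (real (Suc (fst i)) / real N) \<omega> - Y' (real (fst i) / real N) \<omega>)
    else Im (Y' (real (Suc (fst i)) / real N) \<omega> - Y' (real (fst i) / real N) \<omega>))" for i :: "nat \<times> bool" and \<omega>
  \<comment> \<open>Stopping at K keeps the path a function of the coordinates in I; by
    \<open>loc\<close> the values of G do not see beyond K.\<close>
  define path where "path x i = (\<Sum>k<min i K. of_real (x (k, True)) + \<i> * of_real (x (k, False)))"
    for x :: "nat \<times> bool \<Rightarrow> real" and i
  define H where "H x = G (path x)" for x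
  have pathc: "continuous_on UNIV path"
    unfolding path_def[abs_def]
    by (intro continuous_on_coordinatewise_then_product continuous_on_sum continuous_on_add continuous_on_mult
        continuous_on_const continuous_on_of_real continuous_on_product_coordinates)
  have Hc: "continuous_on UNIV H" unfolding H_def by (rule continuous_on_compose2[OF G pathc]) auto
  have [measurable]: "Z n (real k / real N) \<in> borel_measurable M" for n k by (rule Z_measurable) simp
  have [measurable]: "Y' (real k / real N) \<in> borel_measurable M'" for k by (rule Y'_measurable) simp
  have Vm[measurable]: "V n i \<in> borel_measurable M" for n i unfolding V_def by measurable
  have V'm[measurable]: "V' i \<in> borel_measurable M'" for i unfolding V'_def by measurable
  have sumI: "(\<Sum>i\<in>I. \<tau> i * f i) = (\<Sum>k<K. \<tau> (k, True) * f (k, True) + \<tau> (k, False) * f (k, False))" for \<tau> f :: "nat \<times> bool \<Rightarrow> real"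
  proof -
    have "(\<Sum>i\<in>I. \<tau> i * f i) = (\<Sum>k<K. \<Sum>b\<in>UNIV. \<tau> (k, b) * f (k, b))"
      unfolding I_def by (simp only: sum.cartesian_product case_prod_unfold prod.collapse)
    then show ?thesis by (simp add: UNIV_bool add.commute)
  qed
  have "(\<lambda>n. \<integral>\<omega>. H (\<lambda>i. if i \<in> I then V n i \<omega> else 0) \<partial>M) \<longlonglongrightarrow> (\<integral>\<omega>. H (\<lambda>i. if i \<in> I then V' i \<omega> else 0) \<partial>M')"
  proof (rule multivariate_levy_continuity)
    show "(\<lambda>n. \<integral>\<omega>. iexp (\<Sum>i\<in>I. \<tau> i * V n i \<omega>) \<partial>M) \<longlonglongrightarrow> (\<integral>\<omega>. iexp (\<Sum>i\<in>I. \<tau> i * V' i \<omega>) \<partial>M')" for \<tau>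
      unfolding sumI using char_tendsto[OF N, where K = K and \<theta> = "\<lambda>k. \<tau> (k, True)" and \<phi> = "\<lambda>k. \<tau> (k, False)"]
      by (simp add: V_def V'_def del: of_nat_Suc)
    show "\<bar>H x\<bar> \<le> B" for x by (simp add: H_def GB)
  qed (auto simp: prob_space_axioms M'.prob_space_axioms I_def Hc)
  moreover have "\<forall>\<^sub>F n in sequentially. (\<integral>\<omega>. H (\<lambda>i. if i \<in> I then V n i \<omega> else 0) \<partial>M) = (\<integral>\<omega>. G (\<lambda>i. Z n (real i / real N) \<omega>) \<partial>M)"
    using eventually_ge_at_top[of 1]
  proof eventually_elim
    case (elim n)
    show ?case
    proof (rule integral_cong_AE)
      show "(\<lambda>\<omega>. H (\<lambda>i. if i \<in> I then V n i \<omega> else 0)) \<in> borel_measurable M"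
        by (rule measurable_compose[OF measurable_coordinatewise_then_product borel_measurable_continuous_onI[OF Hc]]) measurable
      show "(\<lambda>\<omega>. G (\<lambda>i. Z n (real i / real N) \<omega>)) \<in> borel_measurable M"
        by (rule measurable_compose[OF measurable_coordinatewise_then_product borel_measurable_continuous_onI[OF G]]) measurable
      show "AE \<omega> in M. H (\<lambda>i. if i \<in> I then V n i \<omega> else 0) = G (\<lambda>i. Z n (real i / real N) \<omega>)"
        using AE_Z_at_0[OF elim]
      proof eventually_elim
        case (elim \<omega>)
        have "path (\<lambda>i. if i \<in> I then V n i \<omega> else 0) i = Z n (real i / real N) \<omega>" if "i \<le> K" for i
        proof -
          have "path (\<lambda>i. if i \<in> I then V n i \<omega> else 0) i = (\<Sum>k<i. increment n N k \<omega>)"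
            unfolding path_def using that
            by (intro sum.cong) (auto simp: I_def V_def complex_eq_iff simp del: of_nat_Suc)
          then show ?thesis using elim sum_lessThan_telescope[of "\<lambda>k. Z n (real k / real N) \<omega>" i] by simp
        qed
        then show ?case unfolding H_def by (intro loc) auto
      qed
    qed
  qed
  moreover have "(\<integral>\<omega>. H (\<lambda>i. if i \<in> I then V' i \<omega> else 0) \<partial>M') = (\<integral>\<omega>. G (\<lambda>i. Y' (real i / real N) \<omega>) \<partial>M')"
  proof (rule integral_cong_AE)
    show "(\<lambda>\<omega>. H (\<lambda>i. if i \<in> I then V' i \<omega> else 0)) \<in> borel_measurable M'"
      by (rule measurable_compose[OF measurable_coordinatewise_then_product borel_measurable_continuous_onI[OF Hc]]) measurable
    show "(\<lambda>\<omega>. G (\<lambda>i. Y' (real i / real N) \<omega>)) \<in> borel_measurable M'"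
      by (rule measurable_compose[OF measurable_coordinatewise_then_product borel_measurable_continuous_onI[OF G]]) measurable
    show "AE \<omega> in M'. H (\<lambda>i. if i \<in> I then V' i \<omega> else 0) = G (\<lambda>i. Y' (real i / real N) \<omega>)"
      using Y'_0
    proof eventually_elim
      case (elim \<omega>)
      have "path (\<lambda>i. if i \<in> I then V' i \<omega> else 0) i = Y' (real i / real N) \<omega>" if "i \<le> K" for i
      proof -
        have "path (\<lambda>i. if i \<in> I then V' i \<omega> else 0) i = (\<Sum>k<i. Y' (real (Suc k) / real N) \<omega> - Y' (real k / real N) \<omega>)"
          unfolding path_def using that
          by (intro sum.cong) (auto simp: I_def V'_def complex_eq_iff simp del: of_nat_Suc)
        then show ?thesis using elim sum_lessThan_telescope[of "\<lambda>k. Y' (real k / real N) \<omega>" i] by simp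
      qed
      then show ?case unfolding H_def by (intro loc) auto
    qed
  qed
  ultimately show ?thesis by (simp cong: filterlim_cong)
qed

section \<open>Tightness\<close>

text \<open>The sum of squares is at most the largest increment times the total increase of
  \<Lambda> on [0, T], and the largest increment tends to 0 by uniform continuity.\<close>

lemma quadratic_variation_tendsto:
  assumes \<kappa>: "0 \<le> \<kappa>"
  shows "(\<lambda>m. \<integral>\<omega>. min 1 (\<kappa> * (\<Sum>k<Suc m * T. (\<Lambda> (real (Suc k) / real (Suc m)) \<omega> - \<Lambda> (real k / real (Suc m)) \<omega>)\<^sup>2)) \<partial>M') \<longlonglongrightarrow> 0"
proof -
  have [measurable]: "\<Lambda> (real k / real m) \<in> borel_measurable M'" for k m by (rule \<Lambda>_measurable) simp
  have "(\<lambda>m. \<integral>\<omega>. min 1 (\<kappa> * (\<Sum>k<Suc m * T. (\<Lambda> (real (Suc k) / real (Suc m)) \<omega> - \<Lambda> (real k / real (Suc m)) \<omega>)\<^sup>2)) \<partial>M') \<longlonglongrightarrow> (\<integral>\<omega>. 0 \<partial>M')"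
  proof (rule integral_dominated_convergence[where w = "\<lambda>_. 1"])
    show "AE \<omega> in M'. (\<lambda>m. min 1 (\<kappa> * (\<Sum>k<Suc m * T. (\<Lambda> (real (Suc k) / real (Suc m)) \<omega> - \<Lambda> (real k / real (Suc m)) \<omega>)\<^sup>2))) \<longlonglongrightarrow> 0"
      using \<Lambda>_paths
    proof eventually_elim
      case (elim \<omega>)
      let ?\<Lambda> = "\<lambda>t. \<Lambda> t \<omega>"
      let ?S = "\<lambda>m. \<Sum>k<Suc m * T. (?\<Lambda> (real (Suc k) / real (Suc m)) - ?\<Lambda> (real k / real (Suc m)))\<^sup>2"
      have mono: "?\<Lambda> s \<le> ?\<Lambda> t" if "0 \<le> s" "s \<le> t" for s t using elim that by (auto simp: mono_on_def)
      have "?S \<longlonglongrightarrow> 0"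
      proof (rule order_tendstoI)
        fix r :: real assume "r < 0"
        then have "r < ?S m" for m by (rule less_le_trans) (intro sum_nonneg zero_le_power2)
        then show "\<forall>\<^sub>F m in sequentially. r < ?S m" by simp
      next
        fix r :: real assume r: "0 < r"
        \<comment> \<open>The summand 1 keeps the divisor positive when the clock does not
          move.\<close>
        define L where "L = ?\<Lambda> (real T) - ?\<Lambda> 0 + 1"
        have L: "L > 0" using mono[of 0 "real T"] by (simp add: L_def)
        have cont: "continuous_on {0..} ?\<Lambda>" using elim by blast
        have uc: "uniformly_continuous_on {0..real T} ?\<Lambda>"
          by (intro compact_uniformly_continuous continuous_on_subset[OF cont]) auto
        have "r / L > 0" using r L by simp
        from uc[unfolded uniformly_continuous_on_def, rule_format, OF this] obtain d where d: "d > 0" "\<And>s t. s \<in> {0..real T} \<Longrightarrow> t \<in> {0..real T} \<Longrightarrow> dist s t < d \<Longrightarrow> dist (?\<Lambda> s) (?\<Lambda> t) < r / L"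
          by blast
        obtain m0 where m0: "1 / real (Suc m0) < d" using nat_approx_posE[OF d(1)] by auto
        have "?S m < r" if m: "m \<ge> m0" for m
        proof -
          have "1 / real (Suc m) \<le> 1 / real (Suc m0)" using m by (intro divide_left_mono) auto
          then have md: "1 / real (Suc m) < d" using m0 by linarith
          have inc: "0 \<le> ?\<Lambda> (real (Suc k) / real (Suc m)) - ?\<Lambda> (real k / real (Suc m))" for k
            using mono[of "real k / real (Suc m)" "real (Suc k) / real (Suc m)"] by (simp add: divide_right_mono)
          have small: "?\<Lambda> (real (Suc k) / real (Suc m)) - ?\<Lambda> (real k / real (Suc m)) \<le> r / L" if k: "k < Suc m * T" for k
          proof -
            have "real (Suc k) \<le> real (Suc m) * real T" using k by (metis Suc_leI of_nat_le_iff of_nat_mult)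
            then have a: "real (Suc k) / real (Suc m) \<le> real T" by (simp add: pos_divide_le_eq mult.commute)
            have b: "real k / real (Suc m) \<le> real (Suc k) / real (Suc m)" by (intro divide_right_mono) auto
            have "real (Suc k) / real (Suc m) - real k / real (Suc m) = 1 / real (Suc m)" by (simp flip: diff_divide_distrib)
            then have "dist (real (Suc k) / real (Suc m)) (real k / real (Suc m)) < d" using md by (simp add: dist_real_def)
            then have "dist (?\<Lambda> (real (Suc k) / real (Suc m))) (?\<Lambda> (real k / real (Suc m))) < r / L"
              using a b by (intro d(2)) auto
            then show ?thesis by (simp add: dist_real_def)
          qed
          have "?S m \<le> (\<Sum>k<Suc m * T. r / L * (?\<Lambda> (real (Suc k) / real (Suc m)) - ?\<Lambda> (real k / real (Suc m))))"
            unfolding power2_eq_square using small inc by (intro sum_mono mult_right_mono) auto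
          also have "\<dots> = r / L * (?\<Lambda> (real (Suc m * T) / real (Suc m)) - ?\<Lambda> 0)"
            unfolding sum_distrib_left[symmetric] using sum_lessThan_telescope[of "\<lambda>k. ?\<Lambda> (real k / real (Suc m))" "Suc m * T"] by simp
          also have "real (Suc m * T) / real (Suc m) = real T" by (simp only: of_nat_mult) simp
          also have "r / L * (?\<Lambda> (real T) - ?\<Lambda> 0) < r / L * L" using r L by (intro mult_strict_left_mono) (auto simp: L_def)
          also have "\<dots> = r" using L by simp
          finally show ?thesis .
        qed
        then show "\<forall>\<^sub>F m in sequentially. ?S m < r" unfolding eventually_sequentially by blast
      qed
      then have "(\<lambda>m. min 1 (\<kappa> * ?S m)) \<longlonglongrightarrow> min 1 (\<kappa> * 0)" by (intro tendsto_intros)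
      then show ?case by simp
    qed
    show "AE \<omega> in M'. norm (min 1 (\<kappa> * (\<Sum>k<Suc m * T. (\<Lambda> (real (Suc k) / real (Suc m)) \<omega> - \<Lambda> (real k / real (Suc m)) \<omega>)\<^sup>2))) \<le> 1" for m
    proof (rule AE_I2)
      fix \<omega>
      have nb: "norm (min 1 y) \<le> 1" if "0 \<le> y" for y :: real using that by auto
      show "norm (min 1 (\<kappa> * (\<Sum>k<Suc m * T. (\<Lambda> (real (Suc k) / real (Suc m)) \<omega> - \<Lambda> (real k / real (Suc m)) \<omega>)\<^sup>2))) \<le> 1"
        by (rule nb) (intro mult_nonneg_nonneg \<kappa> sum_nonneg zero_le_power2)
    qed
  qed (auto simp del: of_nat_Suc)
  then show ?thesis by simp
qed

text \<open>Given the clock, the chance of a large oscillation in block k is at most \<kappa> times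
  the squared clock increment. Summed over blocks this is a \<open>lipschitz_upto\<close> functional
  of the clock, so its expectation converges to the same functional of \<Lambda>, which is below
  \<eta> on fine grids.\<close>

lemma tightness:
  assumes e: "e > 0" and \<eta>: "\<eta> > 0"
  shows "\<exists>m0. \<forall>m\<ge>m0. \<forall>\<^sub>F n in sequentially. \<exists>A\<in>events. prob A \<le> \<eta> \<and>
    (AE \<omega> in M. \<omega> \<notin> A \<longrightarrow> (\<forall>t\<in>{0..real T}. cmod (Z n t \<omega> - Z n (real (nat \<lfloor>real m * t\<rfloor>) / real m) \<omega>) \<le> e))"
proof -
  define \<kappa> where "\<kappa> = 32 * (3 + K4) / e ^ 4"
  have \<kappa>: "0 \<le> \<kappa>" using K4_nonneg e by (simp add: \<kappa>_def)
  define qv where "qv m = (\<integral>\<omega>. min 1 (\<kappa> * (\<Sum>k<m * T. (\<Lambda> (real (Suc k) / real m) \<omega> - \<Lambda> (real k / real m) \<omega>)\<^sup>2)) \<partial>M')" for m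
  have "\<forall>\<^sub>F m in sequentially. qv (Suc m) < \<eta>"
    unfolding qv_def using quadratic_variation_tendsto[OF \<kappa>, of T] \<eta> by (rule order_tendstoD)
  then obtain m1 where m1: "\<And>m. m \<ge> m1 \<Longrightarrow> qv (Suc m) < \<eta>" unfolding eventually_sequentially by blast
  have main: "\<forall>\<^sub>F n in sequentially. \<exists>A\<in>events. prob A \<le> \<eta> \<and>
    (AE \<omega> in M. \<omega> \<notin> A \<longrightarrow> (\<forall>t\<in>{0..real T}. cmod (Z n t \<omega> - Z n (real (nat \<lfloor>real m * t\<rfloor>) / real m) \<omega>) \<le> e))"
    if m: "m \<ge> Suc m1" for m
  proof -
    define K where "K = m * T"
    obtain m' where "m = Suc m'" "m' \<ge> m1" using m by (cases m) auto
    then have m0: "m > 0" and "qv m < \<eta>" using m1 by auto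
    have "(\<lambda>n. \<integral>\<omega>. min 1 (\<kappa> * (\<Sum>k<K. (C n (real (Suc k) / real m) \<omega> / c n - C n (real k / real m) \<omega> / c n)\<^sup>2)) \<partial>M) \<longlonglongrightarrow> qv m"
      using clock_tendsto[OF m0 lipschitz_upto_quadratic[OF \<kappa>, of K]] unfolding qv_def K_def .
    then have "\<forall>\<^sub>F n in sequentially. (\<integral>\<omega>. min 1 (\<kappa> * (\<Sum>k<K. (C n (real (Suc k) / real m) \<omega> / c n - C n (real k / real m) \<omega> / c n)\<^sup>2)) \<partial>M) < \<eta>"
      using \<open>qv m < \<eta>\<close> by (rule order_tendstoD)
    moreover have "\<forall>\<^sub>F n in sequentially. n \<ge> 1" by (rule eventually_ge_at_top)
    ultimately show ?thesis
    proof eventually_elim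
      case (elim n)
      note n = elim(2)
      define D where "D = grid_data n m K"
      define p where "p d = clock_values K d" for d
      have pD: "p (D \<omega>) k = C n (real k / real m) \<omega>" if "k \<le> K" for k \<omega>
        using that by (simp add: p_def D_def clock_values_grid_data)
      have fD: "fst (D \<omega>) = U n \<omega>" for \<omega> by (simp add: D_def fst_grid_data)
      \<comment> \<open>The process changes only with the clock, so the uncountably many times of a
        block reduce to the finitely many integers between its two clock values.\<close>
      define F where "F d k x \<longleftrightarrow> (\<exists>l\<in>{p d k..p d (Suc k)}. e < cmod (scale n *\<^sub>R block_sum n (fst d) (p d k) l x))" for d k x
      define g where "g x d = (if \<exists>k\<in>{..<K}. F d k x then 1 else 0 :: complex)" for x d
      define b where "b d = min 1 (\<kappa> * (\<Sum>k<K. (p d (Suc k) / c n - p d k / c n)\<^sup>2))" for d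
      define A where "A = {\<omega> \<in> space M. \<exists>k\<in>{..<K}. F (D \<omega>) k (array \<omega>)}"
      have iD: "independent_elements M array_space array (count_space UNIV) D"
        unfolding D_def by (rule independent_grid_data[OF n])
      have Dm[measurable]: "D \<in> M \<rightarrow>\<^sub>M count_space UNIV" by (rule independent_elementsD(2)[OF prob_space_axioms iD])
      note [measurable] = block_sum_measurable array_measurable
      have Fs: "{x \<in> space array_space. F d k x} \<in> sets array_space" for d k
        unfolding F_def
      proof (rule sets.sets_Collect_finite_Ex)
        fix l
        have [measurable]: "block_sum n (fst d) (p d k) l \<in> borel_measurable array_space" by (rule block_sum_measurable)
        show "{x \<in> space array_space. e < cmod (scale n *\<^sub>R block_sum n (fst d) (p d k) l x)} \<in> sets array_space" by measurable
      qed simp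
      have Fm: "{\<omega> \<in> space M. F d k (array \<omega>)} \<in> events" for d k
      proof -
        have "{\<omega> \<in> space M. F d k (array \<omega>)} = array -` {x \<in> space array_space. F d k x} \<inter> space M"
          using measurable_space[OF array_measurable] by auto
        then show ?thesis using measurable_sets[OF array_measurable Fs] by simp
      qed
      have gm: "(\<lambda>x. g x d) \<in> borel_measurable array_space" for d
      proof -
        have "{x \<in> space array_space. \<exists>k\<in>{..<K}. F d k x} \<in> sets array_space"
          by (intro sets.sets_Collect_finite_Ex Fs) auto
        then show ?thesis unfolding g_def by (intro measurable_If) auto
      qed
      have gA: "(\<lambda>\<omega>. g (array \<omega>) (D \<omega>)) \<in> borel_measurable M"
        by (rule measurable_compose_countable[OF measurable_compose[OF array_measurable gm] Dm])
      have "A = (\<lambda>\<omega>. g (array \<omega>) (D \<omega>)) -` {1} \<inter> space M" by (auto simp: A_def g_def split: if_splits)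
      then have Am[measurable]: "A \<in> events" using measurable_sets[OF gA, of "{1}"] by simp
      have "(\<integral>\<omega>. g (array \<omega>) (D \<omega>) \<partial>M) = (\<integral>\<omega>. of_real (indicat_real A \<omega>) \<partial>M)"
        by (rule Bochner_Integration.integral_cong) (auto simp: g_def A_def indicator_def)
      then have gprob: "(\<integral>\<omega>. g (array \<omega>) (D \<omega>) \<partial>M) = of_real (prob A)"
        by (simp add: integral_complex_of_real)
      have "cmod ((\<integral>\<omega>. g (array \<omega>) (D \<omega>) \<partial>M) - (\<integral>\<omega>. (\<lambda>_. 0) (D \<omega>) \<partial>M)) \<le> (\<integral>\<omega>. b (D \<omega>) \<partial>M)"
      proof (rule conditional_bound[OF prob_space_axioms iD, where g = g and b = b and h = "\<lambda>_. 0"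
            and ?C1.0 = 1 and ?C2.0 = 0 and ?C3.0 = 1])
        show "(\<lambda>x. g x d) \<in> borel_measurable array_space" for d by (rule gm)
        show "cmod (g x d) \<le> 1" for x d by (simp add: g_def)
        show "0 \<le> b d" "b d \<le> 1" for d using \<kappa> by (auto simp: b_def intro!: mult_nonneg_nonneg sum_nonneg)
        show "AE \<omega> in M. cmod ((\<integral>\<omega>'. g (array \<omega>') (D \<omega>) \<partial>M) - 0) \<le> b (D \<omega>)"
          using AE_clock_mono[OF n m0]
        proof eventually_elim
          case (elim \<omega>)
          let ?d = "D \<omega>"
          have pm: "p ?d k \<le> p ?d (Suc k)" if "k < K" for k using elim that by (simp add: pD del: of_nat_Suc)
          have "(\<integral>\<omega>'. g (array \<omega>') ?d \<partial>M) = (\<integral>\<omega>'. of_real (indicat_real (\<Union>k\<in>{..<K}. {\<omega> \<in> space M. F ?d k (array \<omega>)}) \<omega>') \<partial>M)"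
            by (rule Bochner_Integration.integral_cong) (auto simp: g_def indicator_def)
          also have "\<dots> = of_real (prob (\<Union>k\<in>{..<K}. {\<omega> \<in> space M. F ?d k (array \<omega>)}))"
          proof -
            have "(\<Union>k\<in>{..<K}. {\<omega> \<in> space M. F ?d k (array \<omega>)}) \<in> events" by (rule sets.finite_UN) (auto intro!: Fm)
            then show ?thesis by (simp add: integral_complex_of_real)
          qed
          finally have "cmod ((\<integral>\<omega>'. g (array \<omega>') ?d \<partial>M) - 0) = prob (\<Union>k\<in>{..<K}. {\<omega> \<in> space M. F ?d k (array \<omega>)})" by simp
          moreover have "prob (\<Union>k\<in>{..<K}. {\<omega> \<in> space M. F ?d k (array \<omega>)}) \<le> \<kappa> * (\<Sum>k<K. (p ?d (Suc k) / c n - p ?d k / c n)\<^sup>2)"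
          proof -
            have "prob (\<Union>k\<in>{..<K}. {\<omega> \<in> space M. F ?d k (array \<omega>)}) \<le> (\<Sum>k<K. prob {\<omega> \<in> space M. F ?d k (array \<omega>)})"
              by (rule finite_measure_subadditive_finite) (auto intro!: Fm)
            also have "\<dots> \<le> (\<Sum>k<K. \<kappa> * (p ?d (Suc k) / c n - p ?d k / c n)\<^sup>2)"
            proof (rule sum_mono)
              fix k assume "k \<in> {..<K}"
              then have le: "p ?d k \<le> p ?d (Suc k)" using pm by simp
              have "prob {\<omega> \<in> space M. F ?d k (array \<omega>)} \<le> \<kappa> * ((scale n)\<^sup>2 * real n * real (p ?d (Suc k) - p ?d k))\<^sup>2"
                unfolding F_def block_sum_array \<kappa>_def
                by (rule block_sum_maximal_inequality[OF scale_nonneg[OF n] e le])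
              also have "(scale n)\<^sup>2 * real n * real (p ?d (Suc k) - p ?d k) = p ?d (Suc k) / c n - p ?d k / c n"
                unfolding scale_sq[OF n] using le by (simp add: of_nat_diff diff_divide_distrib)
              finally show "prob {\<omega> \<in> space M. F ?d k (array \<omega>)} \<le> \<kappa> * (p ?d (Suc k) / c n - p ?d k / c n)\<^sup>2" .
            qed
            finally show ?thesis by (simp add: sum_distrib_left)
          qed
          ultimately show ?case by (simp add: b_def)
        qed
      qed simp
      then have "prob A \<le> (\<integral>\<omega>. b (D \<omega>) \<partial>M)" by (simp add: gprob)
      moreover have "b (D \<omega>) = min 1 (\<kappa> * (\<Sum>k<K. (C n (real (Suc k) / real m) \<omega> / c n - C n (real k / real m) \<omega> / c n)\<^sup>2))" for \<omega>
        unfolding b_def by (simp add: pD del: of_nat_Suc)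
      ultimately have "prob A \<le> \<eta>" using elim(1) by (simp only:)
      moreover have "AE \<omega> in M. \<omega> \<notin> A \<longrightarrow> (\<forall>t\<in>{0..real T}. cmod (Z n t \<omega> - Z n (real (nat \<lfloor>real m * t\<rfloor>) / real m) \<omega>) \<le> e)"
        using clock[OF n] AE_space
      proof eventually_elim
        case (elim \<omega>)
        have mono: "C n s \<omega> \<le> C n t \<omega>" if "0 \<le> s" "s \<le> t" for s t
          using elim that by (intro mono_onD[of "{0..}" "\<lambda>t. C n t \<omega>"]) auto
        show ?case
        proof (intro impI ballI)
          fix t assume nA: "\<omega> \<notin> A" and t: "t \<in> {0..real T}"
          define k where "k = nat \<lfloor>real m * t\<rfloor>"
          have k: "k \<le> K" "real k / real m \<le> t" "t < real k / real m + 1 / real m"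
            using floor_grid[of m t T] t m0 by (auto simp: k_def K_def)
          show "cmod (Z n t \<omega> - Z n (real (nat \<lfloor>real m * t\<rfloor>) / real m) \<omega>) \<le> e"
          \<comment> \<open>Index K = m * T occurs only for t = T, which is a grid point, and the
            difference is 0.\<close>
          proof (cases "k = K")
            case True
            then have "real k / real m = real T" using m0 by (simp add: K_def)
            then have "t = real k / real m" using k t by simp
            then show ?thesis using e unfolding k_def[symmetric] by simp
          next
            case False
            then have kK: "k < K" using k by simp
            have le1: "C n (real k / real m) \<omega> \<le> C n t \<omega>" using k by (intro mono) auto
            have "t \<le> real (Suc k) / real m" using k(3) by (simp add: add_divide_distrib)
            then have le2: "C n t \<omega> \<le> C n (real (Suc k) / real m) \<omega>" using t by (intro mono) auto
            have "\<not> F (D \<omega>) k (array \<omega>)" using nA elim kK by (auto simp: A_def)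
            then have "cmod (scale n *\<^sub>R block_sum n (U n \<omega>) (C n (real k / real m) \<omega>) (C n t \<omega>) (array \<omega>)) \<le> e"
              using le1 le2 kK by (auto simp: F_def pD fD not_less simp del: of_nat_Suc)
            then show ?thesis unfolding k_def[symmetric] Z_increment[OF le1] .
          qed
        qed
      qed
      ultimately show ?case using Am by blast
    qed
  qed
  then show ?thesis by blast
qed

theorem Z_converges_weakly: "converges_weakly_J1 M Z M' Y'"
proof (rule converges_weakly_J1I[OF prob_space_axioms M'.prob_space_axioms Z_measurable Z_cadlag Y'_measurable Y'_continuous])
  show "(\<lambda>n. \<integral>\<omega>. G (\<lambda>i. Z n (real i / real N) \<omega>) \<partial>M) \<longlonglongrightarrow> (\<integral>\<omega>. G (\<lambda>i. Y' (real i / real N) \<omega>) \<partial>M')"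
    if "N > 0" "continuous_on UNIV G" "\<And>a. \<bar>G a\<bar> \<le> B" "\<And>a b. (\<forall>i\<le>K. a i = b i) \<Longrightarrow> G a = G b"
    for N and G :: "(nat \<Rightarrow> complex) \<Rightarrow> real" and K B
    using that by (rule fdd_tendsto)
  show "\<exists>m0. \<forall>m\<ge>m0. \<forall>\<^sub>F n in sequentially. \<exists>A\<in>events. prob A \<le> \<eta> \<and>
      (AE \<omega> in M. \<omega> \<notin> A \<longrightarrow> (\<forall>t\<in>{0..real T}. cmod (Z n t \<omega> - Z n (real (nat \<lfloor>real m * t\<rfloor>) / real m) \<omega>) \<le> e))"
    if "e > 0" "\<eta> > 0" for T e \<eta>
    using that by (rule tightness)
qed

end

section \<open>Complex Brownian motion run by an independent clock\<close>

lemma levy_processD: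
  assumes "levy_process M Y"
  shows "\<And>t. t \<ge> 0 \<Longrightarrow> Y t \<in> borel_measurable M" "AE \<omega> in M. Y 0 \<omega> = 0"
    "\<And>m t. 0 \<le> t 0 \<Longrightarrow> (\<And>i. i < m \<Longrightarrow> t i \<le> t (Suc i)) \<Longrightarrow>
      prob_space.indep_vars M (\<lambda>_. borel) (\<lambda>i \<omega>. Y (t (Suc i)) \<omega> - Y (t i) \<omega>) {..<m}"
    "\<And>s h. s \<ge> 0 \<Longrightarrow> h \<ge> 0 \<Longrightarrow> distr M borel (\<lambda>\<omega>. Y (s + h) \<omega> - Y s \<omega>) = distr M borel (Y h)"
    "AE \<omega> in M. cadlag (\<lambda>t. Y t \<omega>)"
  using assms unfolding levy_process_def by blast+

lemma (in prob_space) brownian_increment_char: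
  assumes B: "standard_brownian_motion M B" and sh: "s \<ge> 0" "h \<ge> 0"
  shows "(\<integral>\<omega>. iexp (w * (B (s + h) \<omega> - B s \<omega>)) \<partial>M) = of_real (exp (- (w\<^sup>2 * h / 2)))"
proof -
  have L: "levy_process M B" using B by (simp add: standard_brownian_motion_def)
  have [measurable]: "B t \<in> borel_measurable M" if "t \<ge> 0" for t using levy_processD(1)[OF L that] .
  have [measurable]: "B (s + h) \<in> borel_measurable M" "B s \<in> borel_measurable M" "B h \<in> borel_measurable M"
    using sh by (auto intro!: levy_processD(1)[OF L])
  have "(\<integral>\<omega>. iexp (w * (B (s + h) \<omega> - B s \<omega>)) \<partial>M) = (\<integral>x. iexp (w * x) \<partial>distr M borel (\<lambda>\<omega>. B (s + h) \<omega> - B s \<omega>))"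
    by (subst integral_distr) auto
  also have "\<dots> = (\<integral>x. iexp (w * x) \<partial>distr M borel (B h))" unfolding levy_processD(4)[OF L sh] ..
  also have "\<dots> = (\<integral>\<omega>. iexp (w * B h \<omega>) \<partial>M)" by (subst integral_distr) auto
  also have "\<dots> = of_real (exp (- (w\<^sup>2 * h / 2)))"
  proof (cases "h = 0")
    case True
    have "(\<integral>\<omega>. iexp (w * B h \<omega>) \<partial>M) = (\<integral>\<omega>. 1 \<partial>M)"
      by (rule integral_cong_AE) (use levy_processD(2)[OF L] True in \<open>auto elim!: eventually_mono\<close>)
    then show ?thesis using True by (simp add: prob_space)
  next
    case False
    then have h: "sqrt h > 0" "h > 0" using sh by auto
    have "distributed M lborel (B h) (normal_density 0 (sqrt h))"
      using B h unfolding standard_brownian_motion_def by auto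
    then have "distributed M lborel (\<lambda>x. (B h x - 0) / sqrt h) std_normal_density"
      using normal_standard_normal_convert[OF h(1)] by blast
    then have d: "distr M lborel (\<lambda>x. B h x / sqrt h) = std_normal_distribution"
      using distributed_distr_eq_density by fastforce
    have "(\<integral>\<omega>. iexp (w * B h \<omega>) \<partial>M) = (\<integral>\<omega>. iexp (w * sqrt h * (B h \<omega> / sqrt h)) \<partial>M)" using h by simp
    also have "\<dots> = (\<integral>x. iexp (w * sqrt h * x) \<partial>distr M lborel (\<lambda>x. B h x / sqrt h))"
      by (subst integral_distr) auto
    also have "\<dots> = char std_normal_distribution (w * sqrt h)" unfolding d char_def by simp
    also have "\<dots> = of_real (exp (- (w\<^sup>2 * h / 2)))"
      unfolding char_std_normal_distribution using sh by (simp add: power_mult_distrib)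
    finally show ?thesis .
  qed
  finally show ?thesis .
qed

lemma (in prob_space) brownian_char:
  assumes B: "standard_brownian_motion M B" and l: "0 \<le> l 0" "\<And>k. l k \<le> l (Suc k)"
  shows "(\<integral>\<omega>. iexp (\<Sum>k<K. w k * (B (l (Suc k)) \<omega> - B (l k) \<omega>)) \<partial>M) =
    of_real (exp (- (\<Sum>k<K. (w k)\<^sup>2 * (l (Suc k) - l k) / 2)))"
proof -
  have L: "levy_process M B" using B by (simp add: standard_brownian_motion_def)
  have l0: "0 \<le> l k" for k using lift_Suc_mono_le[of l 0 k] l by fastforce
  have [measurable]: "B (l k) \<in> borel_measurable M" for k by (rule levy_processD(1)[OF L l0])
  have "indep_vars (\<lambda>_. borel) (\<lambda>i \<omega>. B (l (Suc i)) \<omega> - B (l i) \<omega>) {..<K}"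
    by (rule levy_processD(3)[OF L]) (use l in auto)
  then have "indep_vars (\<lambda>_. borel) (\<lambda>i \<omega>. iexp (w i * (B (l (Suc i)) \<omega> - B (l i) \<omega>))) {..<K}"
    by (rule indep_vars_compose2[where Y = "\<lambda>i x. iexp (w i * x)"]) auto
  then have "(\<integral>\<omega>. (\<Prod>k<K. iexp (w k * (B (l (Suc k)) \<omega> - B (l k) \<omega>))) \<partial>M) =
    (\<Prod>k<K. \<integral>\<omega>. iexp (w k * (B (l (Suc k)) \<omega> - B (l k) \<omega>)) \<partial>M)"
    by (intro indep_vars_lebesgue_integral)
       (auto intro!: integrable_const_bound[of _ 1] simp: norm_exp_i_times simp del: of_real_mult of_real_diff)
  also have "\<dots> = (\<Prod>k<K. of_real (exp (- ((w k)\<^sup>2 * (l (Suc k) - l k) / 2))))"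
  proof (rule prod.cong[OF HOL.refl])
    fix k
    show "(\<integral>\<omega>. iexp (w k * (B (l (Suc k)) \<omega> - B (l k) \<omega>)) \<partial>M) = of_real (exp (- ((w k)\<^sup>2 * (l (Suc k) - l k) / 2)))"
      using brownian_increment_char[OF B l0[of k], of "l (Suc k) - l k" "w k"] l by simp
  qed
  also have "\<dots> = of_real (exp (\<Sum>k<K. - ((w k)\<^sup>2 * (l (Suc k) - l k) / 2)))"
    by (subst exp_sum) simp_all
  finally show ?thesis by (simp add: sum_distrib_left exp_sum sum_negf)
qed

lemma independent_elements_integral_mult:
  fixes f :: "'c \<Rightarrow> complex" and g :: "'d \<Rightarrow> complex"
  assumes M: "prob_space M" and i: "independent_elements M K A K' B"
    and f: "f \<in> borel_measurable K" "\<And>x. cmod (f x) \<le> C1" and g: "g \<in> borel_measurable K'" "\<And>x. cmod (g x) \<le> C2"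
  shows "(\<integral>\<omega>. f (A \<omega>) * g (B \<omega>) \<partial>M) = (\<integral>\<omega>. f (A \<omega>) \<partial>M) * (\<integral>\<omega>. g (B \<omega>) \<partial>M)"
proof -
  interpret prob_space M by fact
  note fg = independent_elements_compose[OF M i f(1) g(1)]
  have "indep_var borel (\<lambda>\<omega>. f (A \<omega>)) borel (\<lambda>\<omega>. g (B \<omega>))"
    unfolding indep_var_distribution_eq
    using independent_elementsD(1,2)[OF M fg] independent_elements_distr[OF M fg] by simp
  then show ?thesis
    by (rule indep_var_lebesgue_integral)
       (use independent_elementsD(1,2)[OF M fg] f g in \<open>auto intro!: integrable_const_bound\<close>)
qed

lemma Re_cbm: "Re (cbm B1 B2 t \<omega>) = B1 t \<omega> / sqrt 2" and Im_cbm: "Im (cbm B1 B2 t \<omega>) = B2 t \<omega> / sqrt 2"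
  by (simp_all add: cbm_def)

text \<open>Division by sqrt 2 turns the Gaussian exponent \<theta>^2 / 2 into \<theta>^2 / 4, the
  constant produced by \<open>char_block_sums\<close>.\<close>

lemma cbm_char:
  assumes M: "prob_space M" and B: "standard_brownian_motion M B1" "standard_brownian_motion M B2"
    and i: "independent_elements M path_algebra (sample_path B1) path_algebra (sample_path B2)"
    and l: "0 \<le> l 0" "\<And>k. l k \<le> l (Suc k)"
  shows "(\<integral>\<omega>. iexp (\<Sum>k<K. \<theta> k * Re (cbm B1 B2 (l (Suc k)) \<omega> - cbm B1 B2 (l k) \<omega>) +
      \<phi> k * Im (cbm B1 B2 (l (Suc k)) \<omega> - cbm B1 B2 (l k) \<omega>)) \<partial>M) =
    of_real (exp (- (\<Sum>k<K. ((\<theta> k)\<^sup>2 + (\<phi> k)\<^sup>2) / 4 * (l (Suc k) - l k))))"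
proof -
  interpret prob_space M by fact
  have l0: "0 \<le> l k" for k using lift_Suc_mono_le[of l 0 k] l by fastforce
  define F where "F w x = iexp (\<Sum>k<K. w k / sqrt 2 * (x (l (Suc k)) - x (l k)))" for w :: "nat \<Rightarrow> real" and x :: "real \<Rightarrow> real"
  have Fm: "F w \<in> borel_measurable path_algebra" for w
  proof -
    have [measurable]: "(\<lambda>x. x (l k)) \<in> borel_measurable (path_algebra :: (real \<Rightarrow> real) measure)" for k
      by (rule measurable_component_singleton) (simp add: l0)
    show ?thesis unfolding F_def by measurable
  qed
  have Fn: "cmod (F w x) \<le> 1" for w x unfolding F_def by (simp add: norm_exp_i_times del: of_real_sum of_real_mult of_real_diff)
  have FE: "(\<integral>\<omega>. F w (sample_path B \<omega>) \<partial>M) = of_real (exp (- (\<Sum>k<K. (w k / sqrt 2)\<^sup>2 * (l (Suc k) - l k) / 2)))"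
    if "standard_brownian_motion M B" for w B
    using brownian_char[where K = K and l = l and w = "\<lambda>k. w k / sqrt 2", OF that l]
    by (simp add: F_def sample_path_def l0)
  have "iexp (\<Sum>k<K. \<theta> k * Re (cbm B1 B2 (l (Suc k)) \<omega> - cbm B1 B2 (l k) \<omega>) +
      \<phi> k * Im (cbm B1 B2 (l (Suc k)) \<omega> - cbm B1 B2 (l k) \<omega>)) = F \<theta> (sample_path B1 \<omega>) * F \<phi> (sample_path B2 \<omega>)" for \<omega>
  proof -
    have "(\<Sum>k<K. \<theta> k * Re (cbm B1 B2 (l (Suc k)) \<omega> - cbm B1 B2 (l k) \<omega>) +
      \<phi> k * Im (cbm B1 B2 (l (Suc k)) \<omega> - cbm B1 B2 (l k) \<omega>)) =
      (\<Sum>k<K. \<theta> k / sqrt 2 * (B1 (l (Suc k)) \<omega> - B1 (l k) \<omega>)) + (\<Sum>k<K. \<phi> k / sqrt 2 * (B2 (l (Suc k)) \<omega> - B2 (l k) \<omega>))"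
      unfolding sum.distrib[symmetric] by (rule sum.cong) (simp_all add: Re_cbm Im_cbm diff_divide_distrib algebra_simps)
    then show ?thesis unfolding F_def by (simp add: sample_path_def l0 exp_add distrib_left)
  qed
  then have "(\<integral>\<omega>. iexp (\<Sum>k<K. \<theta> k * Re (cbm B1 B2 (l (Suc k)) \<omega> - cbm B1 B2 (l k) \<omega>) +
      \<phi> k * Im (cbm B1 B2 (l (Suc k)) \<omega> - cbm B1 B2 (l k) \<omega>)) \<partial>M) = (\<integral>\<omega>. F \<theta> (sample_path B1 \<omega>) * F \<phi> (sample_path B2 \<omega>) \<partial>M)"
    by (simp only:)
  also have "\<dots> = (\<integral>\<omega>. F \<theta> (sample_path B1 \<omega>) \<partial>M) * (\<integral>\<omega>. F \<phi> (sample_path B2 \<omega>) \<partial>M)"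
    by (rule independent_elements_integral_mult[OF M i Fm Fn Fm Fn])
  also have "\<dots> = of_real (exp (- (\<Sum>k<K. (\<theta> k / sqrt 2)\<^sup>2 * (l (Suc k) - l k) / 2) + - (\<Sum>k<K. (\<phi> k / sqrt 2)\<^sup>2 * (l (Suc k) - l k) / 2)))"
    unfolding FE[OF B(1)] FE[OF B(2)] by (simp only: exp_add of_real_mult)
  also have "- (\<Sum>k<K. (\<theta> k / sqrt 2)\<^sup>2 * (l (Suc k) - l k) / 2) + - (\<Sum>k<K. (\<phi> k / sqrt 2)\<^sup>2 * (l (Suc k) - l k) / 2) =
    - (\<Sum>k<K. ((\<theta> k)\<^sup>2 + (\<phi> k)\<^sup>2) / 4 * (l (Suc k) - l k))"
  proof -
    have "((\<theta> k)\<^sup>2 + (\<phi> k)\<^sup>2) / 4 * (l (Suc k) - l k) =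
      (\<theta> k / sqrt 2)\<^sup>2 * (l (Suc k) - l k) / 2 + (\<phi> k / sqrt 2)\<^sup>2 * (l (Suc k) - l k) / 2" for k
      by (simp add: power_divide algebra_simps add_divide_distrib)
    then show ?thesis unfolding sum.distrib minus_add_distrib by (simp only: sum.distrib minus_add_distrib)
  qed
  finally show ?thesis .
qed

section \<open>Rounding a real-valued clock\<close>

text \<open>The numerator of x rounded up to a multiple of 1 / (q + 1). A clock rounded this way has
  countably many values, so \<open>conditional_bound\<close> applies to it; rounding is monotone,
  and it disappears in the limit along continuous paths.\<close>

definition round_up :: "nat \<Rightarrow> real \<Rightarrow> nat" where
  "round_up q x = nat \<lceil>real (Suc q) * x\<rceil>"

lemma round_up_tendsto:
  assumes "0 \<le> x" shows "(\<lambda>q. real (round_up q x) / real (Suc q)) \<longlonglongrightarrow> x"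
proof (rule tendsto_sandwich)
  have *: "x \<le> real (round_up q x) / real (Suc q) \<and> real (round_up q x) / real (Suc q) \<le> x + 1 / real (Suc q)" for q
  proof -
    have "0 \<le> real (Suc q) * x" using assms by simp
    then have r: "real (round_up q x) = \<lceil>real (Suc q) * x\<rceil>" unfolding round_up_def by simp
    have "real (Suc q) * x \<le> real (round_up q x)" "real (round_up q x) \<le> real (Suc q) * x + 1"
      unfolding r by linarith+
    then show ?thesis by (simp add: pos_le_divide_eq pos_divide_le_eq field_simps del: of_nat_Suc)
  qed
  show "\<forall>\<^sub>F q in sequentially. x \<le> real (round_up q x) / real (Suc q)"
    "\<forall>\<^sub>F q in sequentially. real (round_up q x) / real (Suc q) \<le> x + 1 / real (Suc q)" using * by auto
  have "(\<lambda>q. x + 1 / real (Suc q)) \<longlonglongrightarrow> x + 0" by (intro tendsto_intros LIMSEQ_Suc[OF lim_1_over_n])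
  then show "(\<lambda>q. x + 1 / real (Suc q)) \<longlonglongrightarrow> x" by simp
qed simp

lemma round_up_mono: "x \<le> y \<Longrightarrow> round_up q x \<le> round_up q y"
  unfolding round_up_def by (intro nat_mono ceiling_mono mult_left_mono) auto

lemma round_up_measurable: "round_up q \<in> borel \<rightarrow>\<^sub>M count_space UNIV"
  unfolding round_up_def[abs_def] by measurable

lemma continuous_round_up_tendsto:
  assumes "continuous_on {0..} w" "0 \<le> x"
  shows "(\<lambda>q. w (real (round_up q x) / real (Suc q))) \<longlonglongrightarrow> w x"
  by (rule continuous_on_tendsto_compose[OF assms(1) round_up_tendsto[OF assms(2)]]) (use assms(2) in auto)

text \<open>W at a rounded clock is a countable composition of measurable maps, and by continuity of
  paths W (L t) is the limit of these. On the null set of bad paths the version is 0.\<close>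

lemma time_changed_version:
  fixes W :: "real \<Rightarrow> 'a \<Rightarrow> complex"
  assumes W: "\<And>t. t \<ge> 0 \<Longrightarrow> W t \<in> borel_measurable M" and Wc: "AE \<omega> in M. continuous_on {0..} (\<lambda>t. W t \<omega>)"
    and L: "\<And>t. t \<ge> 0 \<Longrightarrow> L t \<in> borel_measurable M" and L0: "AE \<omega> in M. \<forall>t\<ge>0. 0 \<le> L t \<omega>"
  obtains Y where "\<And>t. t \<ge> 0 \<Longrightarrow> Y t \<in> borel_measurable M" "AE \<omega> in M. \<forall>t\<ge>0. Y t \<omega> = W (L t \<omega>) \<omega>"
proof -
  have "AE \<omega> in M. continuous_on {0..} (\<lambda>t. W t \<omega>) \<and> (\<forall>t\<ge>0. 0 \<le> L t \<omega>)" using Wc L0 by eventually_elim blast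
  from this[unfolded eventually_ae_filter] obtain N where
    N: "N \<in> null_sets M" "{\<omega> \<in> space M. \<not> (continuous_on {0..} (\<lambda>t. W t \<omega>) \<and> (\<forall>t\<ge>0. 0 \<le> L t \<omega>))} \<subseteq> N"
    by (rule bexE)
  define Y where "Y t \<omega> = (if \<omega> \<in> N then 0 else W (L t \<omega>) \<omega>)" for t \<omega>
  have [measurable]: "N \<in> sets M" using N by auto
  have "Y t \<in> borel_measurable M" if t: "t \<ge> 0" for t
  proof (rule borel_measurable_LIMSEQ_metric)
    fix q
    have "(\<lambda>\<omega>. round_up q (L t \<omega>)) \<in> M \<rightarrow>\<^sub>M count_space UNIV"
      by (rule measurable_compose[OF L[OF t] round_up_measurable])
    then have "(\<lambda>\<omega>. W (real (round_up q (L t \<omega>)) / real (Suc q)) \<omega>) \<in> borel_measurable M"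
      by (rule measurable_compose_countable[rotated, where f = "\<lambda>n \<omega>. W (real n / real (Suc q)) \<omega>"]) (intro W, simp)
    then show "(\<lambda>\<omega>. if \<omega> \<in> N then 0 else W (real (round_up q (L t \<omega>)) / real (Suc q)) \<omega>) \<in> borel_measurable M"
      by measurable
  next
    fix \<omega> assume w: "\<omega> \<in> space M"
    show "(\<lambda>q. if \<omega> \<in> N then 0 else W (real (round_up q (L t \<omega>)) / real (Suc q)) \<omega>) \<longlonglongrightarrow> Y t \<omega>"
    proof (cases "\<omega> \<in> N")
      case False
      then have "continuous_on {0..} (\<lambda>t. W t \<omega>)" "0 \<le> L t \<omega>" using N(2) w t by blast+
      from continuous_round_up_tendsto[OF this] show ?thesis using False by (simp add: Y_def)
    qed (simp add: Y_def)
  qed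
  moreover have "AE \<omega> in M. \<forall>t\<ge>0. Y t \<omega> = W (L t \<omega>) \<omega>"
    using AE_not_in[OF N(1)] by eventually_elim (simp add: Y_def)
  ultimately show ?thesis by (rule that)
qed

text \<open>For the rounded clock the identity is exact: \<open>conditional_bound\<close> applies
  with error 0 because \<open>cbm_char\<close> holds for each frozen sequence of times. Dominated
  convergence then removes the rounding on both sides.\<close>

lemma cbm_clock_char:
  assumes M: "prob_space M" and B: "standard_brownian_motion M B1" "standard_brownian_motion M B2"
    and i: "independent_elements M path_algebra (sample_path B1) path_algebra (sample_path B2)"
    and iL: "independent_elements M path_algebra (sample_path (cbm B1 B2)) path_algebra (sample_path L)"
    and Lp: "AE \<omega> in M. L 0 \<omega> = 0 \<and> mono_on {0..} (\<lambda>t. L t \<omega>)"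
    and Y: "\<And>t. t \<ge> 0 \<Longrightarrow> Y t \<in> borel_measurable M" "AE \<omega> in M. \<forall>t\<ge>0. Y t \<omega> = cbm B1 B2 (L t \<omega>) \<omega>"
    and t: "0 \<le> t 0" "\<And>k. t k \<le> t (Suc k)"
  shows "(\<integral>\<omega>. iexp (\<Sum>k<K. \<theta> k * Re (Y (t (Suc k)) \<omega> - Y (t k) \<omega>) + \<phi> k * Im (Y (t (Suc k)) \<omega> - Y (t k) \<omega>)) \<partial>M) =
    of_real (\<integral>\<omega>. exp (- (\<Sum>k<K. ((\<theta> k)\<^sup>2 + (\<phi> k)\<^sup>2) / 4 * (L (t (Suc k)) \<omega> - L (t k) \<omega>))) \<partial>M)"
proof -
  interpret prob_space M by fact
  let ?W = "cbm B1 B2"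
  have tm: "t j \<le> t k" if "j \<le> k" for j k using lift_Suc_mono_le[of t j k] t that by blast
  have t0: "0 \<le> t k" for k using tm[of 0 k] t by simp
  have Lm[measurable]: "L (t k) \<in> borel_measurable M" for k
  proof -
    have "(\<lambda>\<omega>. sample_path L \<omega> (t k)) \<in> borel_measurable M"
      by (rule measurable_compose[OF independent_elementsD(2)[OF M iL] measurable_component_singleton]) (simp add: t0)
    then show ?thesis by (simp add: sample_path_def t0)
  qed
  have [measurable]: "Y (t k) \<in> borel_measurable M" for k by (rule Y(1)[OF t0])
  have Lpos: "AE \<omega> in M. (\<forall>k. 0 \<le> L (t k) \<omega>) \<and> (\<forall>j k. j \<le> k \<longrightarrow> L (t j) \<omega> \<le> L (t k) \<omega>)"
    using Lp
  proof eventually_elim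
    case (elim \<omega>)
    have "L (t j) \<omega> \<le> L (t k) \<omega>" if "j \<le> k" for j k
      using elim tm[OF that] t0 by (auto simp: mono_on_def)
    moreover have "L 0 \<omega> \<le> L (t k) \<omega>" for k
      using elim t0[of k] by (intro mono_onD[of "{0..}" "\<lambda>t. L t \<omega>"]) auto
    ultimately show ?case using elim by simp
  qed
  have Wc: "AE \<omega> in M. continuous_on {0..} (\<lambda>t. ?W t \<omega>)"
    using B unfolding standard_brownian_motion_def
    by (auto simp: cbm_def[abs_def] elim!: eventually_elim2 intro!: continuous_intros)
  define a where "a k = ((\<theta> k)\<^sup>2 + (\<phi> k)\<^sup>2) / 4" for k
  have a0: "0 \<le> a k" for k by (simp add: a_def)
  define D where "D q \<omega> = map (\<lambda>k. round_up q (L (t k) \<omega>)) [0..<Suc K]" for q \<omega>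
  \<comment> \<open>Held constant after index K so that the times increase for all k; the list
    \<open>d\<close> has K + 1 entries.\<close>
  define l where "l q d k = real (d ! min k K) / real (Suc q)" for q and d :: "nat list" and k
  define g where "g q x d = iexp (\<Sum>k<K. \<theta> k * Re (x (l q d (Suc k)) - x (l q d k)) + \<phi> k * Im (x (l q d (Suc k)) - x (l q d k)))"
    for q and x :: "real \<Rightarrow> complex" and d
  define h where "h q d = exp (- (\<Sum>k<K. a k * max 0 (l q d (Suc k) - l q d k)))" for q d
  have lD: "l q (D q \<omega>) k = real (round_up q (L (t (min k K)) \<omega>)) / real (Suc q)" for q k \<omega>
  proof -
    have "[0..<Suc K] ! min k K = min k K" by (subst nth_upt) auto
    then show ?thesis by (simp add: l_def D_def del: upt_Suc)
  qed
  have l0: "0 \<le> l q d k" for q d k by (simp add: l_def)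
  have iD: "independent_elements M path_algebra (sample_path ?W) (count_space UNIV) (D q)" for q
  proof -
    define f where "f x = map (\<lambda>k. round_up q (x (t k))) [0..<Suc K]" for x :: "real \<Rightarrow> real"
    have "f \<in> path_algebra \<rightarrow>\<^sub>M count_space UNIV"
    proof (rule measurable_count_space_eq2_countable[THEN iffD2], intro conjI ballI)
      fix d :: "nat list"
      let ?P = "path_algebra :: (real \<Rightarrow> real) measure"
      have m: "(\<lambda>x. round_up q (x (t k))) \<in> ?P \<rightarrow>\<^sub>M count_space UNIV" for k
      proof -
        have c: "(\<lambda>x. x (t k)) \<in> ?P \<rightarrow>\<^sub>M borel" by (rule measurable_component_singleton) (simp add: t0)
        show ?thesis by (rule measurable_compose[OF c round_up_measurable])
      qed
      have "f -` {d} \<inter> space ?P = {x \<in> space ?P. length d = Suc K \<and> (\<forall>k\<in>{..K}. round_up q (x (t k)) = d ! k)}"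
        by (auto simp: f_def list_eq_iff_nth_eq less_Suc_eq_le simp del: upt_Suc)
      also have "\<dots> \<in> sets ?P"
      proof (intro sets.sets_Collect_conj sets.sets_Collect_finite_All sets.sets_Collect_const)
        show "{x \<in> space ?P. round_up q (x (t k)) = d ! k} \<in> sets ?P" for k using m[of k] by measurable
      qed auto
      finally show "f -` {d} \<inter> space ?P \<in> sets ?P" .
    qed auto
    from independent_elements_compose[OF M iL measurable_ident this]
    have "independent_elements M path_algebra (sample_path ?W) (count_space UNIV) (\<lambda>\<omega>. f (sample_path L \<omega>))" by simp
    moreover have "(\<lambda>\<omega>. f (sample_path L \<omega>)) = D q" by (auto simp: fun_eq_iff f_def D_def sample_path_def t0)
    ultimately show ?thesis by simp
  qed
  have Dm[measurable]: "D q \<in> M \<rightarrow>\<^sub>M count_space UNIV" for q by (rule independent_elementsD(2)[OF M iD])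
  have gm: "(\<lambda>x. g q x d) \<in> borel_measurable path_algebra" for q d
  proof -
    have [measurable]: "(\<lambda>x. x (l q d k)) \<in> borel_measurable (path_algebra :: (real \<Rightarrow> complex) measure)" for k
      by (rule measurable_component_singleton) (simp add: l0)
    show ?thesis unfolding g_def by measurable
  qed
  have gn: "cmod (g q x d) = 1" for q x d
    unfolding g_def by (simp add: norm_exp_i_times del: of_real_sum of_real_add of_real_mult)
  have h01: "0 \<le> h q d" "h q d \<le> 1" for q d unfolding h_def using a0 by (auto intro!: sum_nonneg)
  have eq: "(\<integral>\<omega>. g q (sample_path ?W \<omega>) (D q \<omega>) \<partial>M) = (\<integral>\<omega>. of_real (h q (D q \<omega>)) \<partial>M)" for q
  proof -
    have "cmod ((\<integral>\<omega>. g q (sample_path ?W \<omega>) (D q \<omega>) \<partial>M) - (\<integral>\<omega>. of_real (h q (D q \<omega>)) \<partial>M)) \<le> (\<integral>\<omega>. (\<lambda>_. 0) (D q \<omega>) \<partial>M)"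
    proof (rule conditional_bound[OF M iD, where g = "g q" and b = "\<lambda>_. 0" and h = "\<lambda>d. of_real (h q d)"
          and ?C1.0 = 1 and ?C2.0 = 1 and ?C3.0 = 0])
      show "(\<lambda>x. g q x d) \<in> borel_measurable path_algebra" for d by (rule gm)
      show "cmod (g q x d) \<le> 1" for x d by (simp add: gn)
      show "cmod (of_real (h q d)) \<le> 1" for d using h01 by simp
      show "AE \<omega> in M. cmod ((\<integral>\<omega>'. g q (sample_path ?W \<omega>') (D q \<omega>) \<partial>M) - of_real (h q (D q \<omega>))) \<le> 0"
        using Lpos
      proof eventually_elim
        case (elim \<omega>)
        let ?l = "l q (D q \<omega>)"
        have lm: "?l k \<le> ?l (Suc k)" for k
          unfolding lD using elim by (intro divide_right_mono of_nat_mono round_up_mono) auto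
        have "g q (sample_path ?W \<omega>') (D q \<omega>) = iexp (\<Sum>k<K. \<theta> k * Re (?W (?l (Suc k)) \<omega>' - ?W (?l k) \<omega>') + \<phi> k * Im (?W (?l (Suc k)) \<omega>' - ?W (?l k) \<omega>'))" for \<omega>'
          unfolding g_def by (simp add: sample_path_def l0)
        then have "(\<integral>\<omega>'. g q (sample_path ?W \<omega>') (D q \<omega>) \<partial>M) = of_real (exp (- (\<Sum>k<K. ((\<theta> k)\<^sup>2 + (\<phi> k)\<^sup>2) / 4 * (?l (Suc k) - ?l k))))"
          using cbm_char[where l = ?l and K = K and \<theta> = \<theta> and \<phi> = \<phi>, OF M B i l0 lm] by simp
        also have "\<dots> = of_real (h q (D q \<omega>))"
          unfolding h_def a_def using lm by simp
        finally show ?case by simp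
      qed
    qed auto
    then show ?thesis by simp
  qed
  have "(\<lambda>q. \<integral>\<omega>. g q (sample_path ?W \<omega>) (D q \<omega>) \<partial>M) \<longlonglongrightarrow>
    (\<integral>\<omega>. iexp (\<Sum>k<K. \<theta> k * Re (Y (t (Suc k)) \<omega> - Y (t k) \<omega>) + \<phi> k * Im (Y (t (Suc k)) \<omega> - Y (t k) \<omega>)) \<partial>M)"
  proof (rule integral_dominated_convergence[where w = "\<lambda>_. 1"])
    show "(\<lambda>\<omega>. g q (sample_path ?W \<omega>) (D q \<omega>)) \<in> borel_measurable M" for q
      by (rule measurable_compose_countable[OF measurable_compose[OF independent_elementsD(1)[OF M iL] gm] Dm])
    show "AE \<omega> in M. (\<lambda>q. g q (sample_path ?W \<omega>) (D q \<omega>)) \<longlonglongrightarrow>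
      iexp (\<Sum>k<K. \<theta> k * Re (Y (t (Suc k)) \<omega> - Y (t k) \<omega>) + \<phi> k * Im (Y (t (Suc k)) \<omega> - Y (t k) \<omega>))"
      using Lpos Wc Y(2)
    proof eventually_elim
      case (elim \<omega>)
      have conv: "(\<lambda>q. sample_path ?W \<omega> (l q (D q \<omega>) k)) \<longlonglongrightarrow> Y (t k) \<omega>" if "k \<le> K" for k
      proof -
        have "(\<lambda>q. ?W (real (round_up q (L (t k) \<omega>)) / real (Suc q)) \<omega>) \<longlonglongrightarrow> ?W (L (t k) \<omega>) \<omega>"
          by (rule continuous_round_up_tendsto) (use elim in auto)
        then show ?thesis using elim that t0 by (simp add: lD sample_path_def del: of_nat_Suc)
      qed
      show ?case unfolding g_def
        by (intro tendsto_intros conv) auto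
    qed
  qed (auto simp: gn)
  moreover have "(\<lambda>q. \<integral>\<omega>. complex_of_real (h q (D q \<omega>)) \<partial>M) \<longlonglongrightarrow>
    (\<integral>\<omega>. of_real (exp (- (\<Sum>k<K. a k * max 0 (L (t (Suc k)) \<omega> - L (t k) \<omega>)))) \<partial>M)"
  proof (rule integral_dominated_convergence[where w = "\<lambda>_. 1"])
    show "AE \<omega> in M. (\<lambda>q. complex_of_real (h q (D q \<omega>))) \<longlonglongrightarrow> of_real (exp (- (\<Sum>k<K. a k * max 0 (L (t (Suc k)) \<omega> - L (t k) \<omega>))))"
      using Lpos
    proof eventually_elim
      case (elim \<omega>)
      have conv: "(\<lambda>q. l q (D q \<omega>) k) \<longlonglongrightarrow> L (t k) \<omega>" if "k \<le> K" for k
        using round_up_tendsto[of "L (t k) \<omega>"] elim that by (simp add: lD del: of_nat_Suc)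
      show ?case unfolding h_def by (intro tendsto_intros conv) auto
    qed
  qed (use h01 in auto)
  ultimately have "(\<integral>\<omega>. iexp (\<Sum>k<K. \<theta> k * Re (Y (t (Suc k)) \<omega> - Y (t k) \<omega>) + \<phi> k * Im (Y (t (Suc k)) \<omega> - Y (t k) \<omega>)) \<partial>M) =
    (\<integral>\<omega>. of_real (exp (- (\<Sum>k<K. a k * max 0 (L (t (Suc k)) \<omega> - L (t k) \<omega>)))) \<partial>M)"
    unfolding eq using LIMSEQ_unique by blast
  also have "\<dots> = of_real (\<integral>\<omega>. exp (- (\<Sum>k<K. a k * max 0 (L (t (Suc k)) \<omega> - L (t k) \<omega>))) \<partial>M)"
    by (rule integral_complex_of_real)
  also have "(\<integral>\<omega>. exp (- (\<Sum>k<K. a k * max 0 (L (t (Suc k)) \<omega> - L (t k) \<omega>))) \<partial>M) =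
    (\<integral>\<omega>. exp (- (\<Sum>k<K. a k * (L (t (Suc k)) \<omega> - L (t k) \<omega>))) \<partial>M)"
  proof (rule integral_cong_AE)
    show "AE \<omega> in M. exp (- (\<Sum>k<K. a k * max 0 (L (t (Suc k)) \<omega> - L (t k) \<omega>))) =
      exp (- (\<Sum>k<K. a k * (L (t (Suc k)) \<omega> - L (t k) \<omega>)))"
      using Lpos
    proof eventually_elim
      case (elim \<omega>)
      then have "L (t k) \<omega> \<le> L (t (Suc k)) \<omega>" for k by simp
      then show ?case by simp
    qed
  qed measurable
  finally show ?thesis by (simp add: a_def)
qed

section \<open>Stable subordinators and their inverses\<close>

text \<open>The Laplace transform at integers gives the moments of exp (- X), a variable in [0, 1].
  By Weierstrass approximation these determine the integrals of continuous functions, in particular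
  of cos and sin, hence the law of exp (- X); the logarithm brings back X.\<close>

lemma laplace_uniqueness:
  fixes X :: "'a \<Rightarrow> real" and X' :: "'b \<Rightarrow> real"
  assumes M: "prob_space M" and M': "prob_space M'"
    and [measurable]: "X \<in> borel_measurable M" "X' \<in> borel_measurable M'"
    and pos: "AE \<omega> in M. 0 \<le> X \<omega>" "AE \<omega> in M'. 0 \<le> X' \<omega>"
    and laplace: "\<And>u. u > 0 \<Longrightarrow> (\<integral>\<omega>. exp (- u * X \<omega>) \<partial>M) = (\<integral>\<omega>. exp (- u * X' \<omega>) \<partial>M')"
  shows "distr M borel X = distr M' borel X'"
proof -
  interpret M: prob_space M by fact
  interpret M': prob_space M' by fact
  define Y where "Y \<omega> = exp (- X \<omega>)" for \<omega>
  define Y' where "Y' \<omega> = exp (- X' \<omega>)" for \<omega>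
  have [measurable]: "Y \<in> borel_measurable M" "Y' \<in> borel_measurable M'" unfolding Y_def Y'_def by measurable
  have Y01: "AE \<omega> in M. Y \<omega> \<in> {0..1}" using pos(1) by eventually_elim (simp add: Y_def)
  have Y'01: "AE \<omega> in M'. Y' \<omega> \<in> {0..1}" using pos(2) by eventually_elim (simp add: Y'_def)
  have iY: "integrable M (\<lambda>\<omega>. Y \<omega> ^ i)" and iY': "integrable M' (\<lambda>\<omega>. Y' \<omega> ^ i)" for i
  proof -
    have "AE \<omega> in M. norm (Y \<omega> ^ i) \<le> 1" using Y01 by eventually_elim (simp add: power_le_one)
    then show "integrable M (\<lambda>\<omega>. Y \<omega> ^ i)" by (intro M.integrable_const_bound[of _ 1]) auto
    have "AE \<omega> in M'. norm (Y' \<omega> ^ i) \<le> 1" using Y'01 by eventually_elim (simp add: power_le_one)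
    then show "integrable M' (\<lambda>\<omega>. Y' \<omega> ^ i)" by (intro M'.integrable_const_bound[of _ 1]) auto
  qed
  have pow: "(\<integral>\<omega>. Y \<omega> ^ i \<partial>M) = (\<integral>\<omega>. Y' \<omega> ^ i \<partial>M')" for i
  proof (cases "i = 0")
    case False
    have "Y \<omega> ^ i = exp (- real i * X \<omega>)" "Y' \<omega>' ^ i = exp (- real i * X' \<omega>')" for \<omega> \<omega>'
      by (simp_all add: Y_def Y'_def flip: exp_of_nat_mult)
    then show ?thesis using laplace[of "real i"] False by simp
  qed (simp add: M.prob_space M'.prob_space)
  have cont: "(\<integral>\<omega>. g (Y \<omega>) \<partial>M) = (\<integral>\<omega>. g (Y' \<omega>) \<partial>M')"
    if g: "continuous_on UNIV g" and gB: "\<And>y. \<bar>g y\<bar> \<le> 1" for g :: "real \<Rightarrow> real"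
  proof -
    have [measurable]: "g \<in> borel_measurable borel" by (rule borel_measurable_continuous_onI[OF g])
    have "\<bar>(\<integral>\<omega>. g (Y \<omega>) \<partial>M) - (\<integral>\<omega>. g (Y' \<omega>) \<partial>M')\<bar> \<le> 2 * e" if e: "e > 0" for e
    proof -
      obtain p where p: "real_polynomial_function p" "\<And>x. x \<in> {0..1} \<Longrightarrow> \<bar>g x - p x\<bar> < e"
        using Stone_Weierstrass_real_polynomial_function[of "{0..1::real}" g e] g e
        by (auto intro: continuous_on_subset)
      then obtain a m where am: "p = (\<lambda>x. \<Sum>i\<le>m. a i * x ^ i)" unfolding real_polynomial_function_iff_sum by blast
      have ip: "integrable M (\<lambda>\<omega>. p (Y \<omega>))" "integrable M' (\<lambda>\<omega>. p (Y' \<omega>))"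
        unfolding am using iY iY' by (auto intro!: Bochner_Integration.integrable_sum)
      have ep: "(\<integral>\<omega>. p (Y \<omega>) \<partial>M) = (\<integral>\<omega>. p (Y' \<omega>) \<partial>M')"
        unfolding am using iY iY' pow by (simp add: Bochner_Integration.integral_sum)
      have ig: "integrable M (\<lambda>\<omega>. g (Y \<omega>))" "integrable M' (\<lambda>\<omega>. g (Y' \<omega>))"
        by (auto intro!: M.integrable_const_bound[of _ 1] M'.integrable_const_bound[of _ 1] simp: gB)
      have "\<bar>(\<integral>\<omega>. g (Y \<omega>) \<partial>M) - (\<integral>\<omega>. p (Y \<omega>) \<partial>M)\<bar> = \<bar>\<integral>\<omega>. g (Y \<omega>) - p (Y \<omega>) \<partial>M\<bar>" using ig ip by simp
      also have "\<dots> \<le> (\<integral>\<omega>. \<bar>g (Y \<omega>) - p (Y \<omega>)\<bar> \<partial>M)" by (rule integral_abs_bound)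
      also have "\<dots> \<le> (\<integral>\<omega>. e \<partial>M)"
      proof (rule integral_mono_AE)
        show "AE \<omega> in M. \<bar>g (Y \<omega>) - p (Y \<omega>)\<bar> \<le> e" using Y01 by eventually_elim (rule less_imp_le[OF p(2)])
      qed (use ig ip in auto)
      finally have 1: "\<bar>(\<integral>\<omega>. g (Y \<omega>) \<partial>M) - (\<integral>\<omega>. p (Y \<omega>) \<partial>M)\<bar> \<le> e" by (simp add: M.prob_space)
      have "\<bar>(\<integral>\<omega>. g (Y' \<omega>) \<partial>M') - (\<integral>\<omega>. p (Y' \<omega>) \<partial>M')\<bar> = \<bar>\<integral>\<omega>. g (Y' \<omega>) - p (Y' \<omega>) \<partial>M'\<bar>" using ig ip by simp
      also have "\<dots> \<le> (\<integral>\<omega>. \<bar>g (Y' \<omega>) - p (Y' \<omega>)\<bar> \<partial>M')" by (rule integral_abs_bound)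
      also have "\<dots> \<le> (\<integral>\<omega>. e \<partial>M')"
      proof (rule integral_mono_AE)
        show "AE \<omega> in M'. \<bar>g (Y' \<omega>) - p (Y' \<omega>)\<bar> \<le> e" using Y'01 by eventually_elim (rule less_imp_le[OF p(2)])
      qed (use ig ip in auto)
      finally have "\<bar>(\<integral>\<omega>. g (Y' \<omega>) \<partial>M') - (\<integral>\<omega>. p (Y' \<omega>) \<partial>M')\<bar> \<le> e" by (simp add: M'.prob_space)
      then show ?thesis using 1 ep by linarith
    qed
    then have close: "\<bar>(\<integral>\<omega>. g (Y \<omega>) \<partial>M) - (\<integral>\<omega>. g (Y' \<omega>) \<partial>M')\<bar> \<le> 2 * (e / 2)" if "e > 0" for e
      using that half_gt_zero by blast
    show ?thesis
    proof (rule ccontr)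
      assume "(\<integral>\<omega>. g (Y \<omega>) \<partial>M) \<noteq> (\<integral>\<omega>. g (Y' \<omega>) \<partial>M')"
      then show False using close[of "\<bar>(\<integral>\<omega>. g (Y \<omega>) \<partial>M) - (\<integral>\<omega>. g (Y' \<omega>) \<partial>M')\<bar> / 2"] by argo
    qed
  qed
  have "distr M borel Y = distr M' borel Y'"
  proof (rule Levy_uniqueness)
    show "real_distribution (distr M borel Y)" by (rule M.real_distribution_distr) measurable
    show "real_distribution (distr M' borel Y')" by (rule M'.real_distribution_distr) measurable
    show "char (distr M borel Y) = char (distr M' borel Y')"
    proof
      fix \<theta>
      have "(\<integral>\<omega>. cos (\<theta> * Y \<omega>) \<partial>M) = (\<integral>\<omega>. cos (\<theta> * Y' \<omega>) \<partial>M')" "(\<integral>\<omega>. sin (\<theta> * Y \<omega>) \<partial>M) = (\<integral>\<omega>. sin (\<theta> * Y' \<omega>) \<partial>M')"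
        by (rule cont[of "\<lambda>y. cos (\<theta> * y)"] cont[of "\<lambda>y. sin (\<theta> * y)"]; auto intro!: continuous_intros)+
      moreover have "(\<integral>\<omega>. iexp (\<theta> * Z \<omega>) \<partial>P) = of_real (\<integral>\<omega>. cos (\<theta> * Z \<omega>) \<partial>P) + \<i> * of_real (\<integral>\<omega>. sin (\<theta> * Z \<omega>) \<partial>P)"
        if P: "prob_space P" and [measurable]: "Z \<in> borel_measurable P" for P :: "'c measure" and Z
      proof -
        interpret P: prob_space P by fact
        have "integrable P (\<lambda>\<omega>. cos (\<theta> * Z \<omega>))" "integrable P (\<lambda>\<omega>. sin (\<theta> * Z \<omega>))"
          by (rule P.integrable_const_bound[of _ 1]; auto)+
        then have "integrable P (\<lambda>\<omega>. complex_of_real (cos (\<theta> * Z \<omega>)))" "integrable P (\<lambda>\<omega>. complex_of_real (sin (\<theta> * Z \<omega>)))"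
          by auto
        moreover have "iexp (\<theta> * Z \<omega>) = of_real (cos (\<theta> * Z \<omega>)) + \<i> * of_real (sin (\<theta> * Z \<omega>))" for \<omega>
          by (simp add: complex_eq_iff Re_exp Im_exp)
        ultimately show ?thesis by (simp only: Bochner_Integration.integral_add integrable_mult_right integral_mult_right_zero integral_complex_of_real)
      qed
      note this[OF M, of Y] this[OF M', of Y']
      ultimately show "char (distr M borel Y) \<theta> = char (distr M' borel Y') \<theta>"
        by (simp add: char_def integral_distr)
    qed
  qed
  then have "distr (distr M borel Y) borel (\<lambda>y. - ln y) = distr (distr M' borel Y') borel (\<lambda>y. - ln y)" by simp
  then show ?thesis by (simp add: distr_distr comp_def Y_def Y'_def)
qed

text \<open>Exponential Markov inequality: where H t is at most y, the product exp (u y) exp (- u H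
  t) is at least 1. The free parameter u is later sent to infinity or set to 1.\<close>

lemma (in prob_space) stable_subordinator_bound:
  assumes H: "stable_subordinator M \<alpha> H" and t: "t \<ge> 0" and u: "u > 0"
  shows "prob {\<omega> \<in> space M. H t \<omega> \<le> y} \<le> exp (u * y - t * u powr \<alpha>)"
    "AE \<omega> in M. 0 \<le> H t \<omega>"
proof -
  have L: "levy_process M H" using H by (simp add: stable_subordinator_def)
  have [measurable]: "H t \<in> borel_measurable M" by (rule levy_processD(1)[OF L t])
  have mono: "AE \<omega> in M. mono_on {0..} (\<lambda>t. H t \<omega>)" using H by (simp add: stable_subordinator_def)
  show pos: "AE \<omega> in M. 0 \<le> H t \<omega>"
    using mono levy_processD(2)[OF L]
  proof eventually_elim
    case (elim \<omega>)
    have "H 0 \<omega> \<le> H t \<omega>" using elim(1) t by (intro mono_onD[of "{0..}" "\<lambda>t. H t \<omega>"]) auto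
    then show ?case using elim by simp
  qed
  have i: "integrable M (\<lambda>\<omega>. exp (- u * H t \<omega>))"
    by (rule integrable_const_bound[of _ 1]) (use pos u in \<open>auto elim!: eventually_mono\<close>)
  have "prob {\<omega> \<in> space M. H t \<omega> \<le> y} = expectation (indicat_real {\<omega> \<in> space M. H t \<omega> \<le> y})" by simp
  also have "\<dots> \<le> expectation (\<lambda>\<omega>. exp (u * y) * exp (- u * H t \<omega>))"
  proof (rule integral_mono)
    show "integrable M (indicat_real {\<omega> \<in> space M. H t \<omega> \<le> y})" by (simp add: integrable_real_indicator less_top[symmetric])
    show "integrable M (\<lambda>\<omega>. exp (u * y) * exp (- u * H t \<omega>))" using i by simp
    show "indicat_real {\<omega> \<in> space M. H t \<omega> \<le> y} \<omega> \<le> exp (u * y) * exp (- u * H t \<omega>)" if "\<omega> \<in> space M" for \<omega>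
    proof (cases "H t \<omega> \<le> y")
      case True
      then have "1 \<le> exp (u * y + - u * H t \<omega>)" using u by simp
      then have "1 \<le> exp (u * y) * exp (- u * H t \<omega>)" by (simp only: exp_add)
      then show ?thesis using that True by (simp add: indicator_def)
    qed simp
  qed
  also have "\<dots> = exp (u * y) * exp (- t * u powr \<alpha>)"
    using H t u unfolding stable_subordinator_def by simp
  finally show "prob {\<omega> \<in> space M. H t \<omega> \<le> y} \<le> exp (u * y - t * u powr \<alpha>)" by (simp add: exp_diff exp_minus divide_inverse)
qed

section \<open>Inverses of increasing paths\<close>

definition inverse_path :: "(real \<Rightarrow> real) \<Rightarrow> real \<Rightarrow> real" where
  "inverse_path h t = Inf {s. 0 \<le> s \<and> t \<le> h s}"

definition subordinator_path :: "(real \<Rightarrow> real) \<Rightarrow> bool" where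
  "subordinator_path h \<longleftrightarrow> h 0 = 0 \<and> strict_mono_on {0..} h \<and> (\<forall>s\<ge>0. (h \<longlongrightarrow> h s) (at_right s)) \<and>
    (\<forall>t. \<exists>s\<ge>0. t \<le> h s)"

text \<open>The set under the infimum is closed upwards by monotonicity and contains its infimum by
  right continuity. Joint laws of the inverse are computed from those of the subordinator through
  this equivalence.\<close>

lemma inverse_path_le_iff:
  assumes h: "subordinator_path h" and s: "s \<ge> 0"
  shows "inverse_path h t \<le> s \<longleftrightarrow> t \<le> h s"
proof
  assume "t \<le> h s"
  then show "inverse_path h t \<le> s" unfolding inverse_path_def using s by (intro cInf_lower) (auto intro: bdd_belowI[of _ 0])
next
  assume le: "inverse_path h t \<le> s"
  show "t \<le> h s"
  proof (rule ccontr)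
    assume "\<not> t \<le> h s"
    then have "\<forall>\<^sub>F r in at_right s. h r < t" using h s unfolding subordinator_path_def by (intro order_tendstoD) auto
    then obtain b where b: "b > s" "\<And>r. s < r \<Longrightarrow> r < b \<Longrightarrow> h r < t" by (auto simp: eventually_at_right_field)
    \<comment> \<open>h is below t on (s, b), so nothing to the left of the midpoint belongs to the
      set, and the infimum exceeds s.\<close>
    have "(s + b) / 2 \<le> inverse_path h t" unfolding inverse_path_def
    proof (rule cInf_greatest)
      show "{s. 0 \<le> s \<and> t \<le> h s} \<noteq> {}" using h by (auto simp: subordinator_path_def)
      fix r assume r: "r \<in> {s. 0 \<le> s \<and> t \<le> h s}"
      show "(s + b) / 2 \<le> r"
      proof (rule ccontr)
        assume "\<not> (s + b) / 2 \<le> r"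
        then have "r < (s + b) / 2" by simp
        then have "h r < h ((s + b) / 2)" using h r s b by (auto simp: subordinator_path_def strict_mono_on_def)
        moreover have "h ((s + b) / 2) < t" using b by (intro b(2)) auto
        ultimately show False using r by auto
      qed
    qed
    then show False using le b by simp
  qed
qed

lemma inverse_path_nonneg:
  assumes h: "subordinator_path h" shows "0 \<le> inverse_path h t"
  unfolding inverse_path_def using h by (intro cInf_greatest) (auto simp: subordinator_path_def)

lemma inverse_path_mono:
  assumes h: "subordinator_path h" and "s \<le> t" shows "inverse_path h s \<le> inverse_path h t"
  using inverse_path_le_iff[OF h inverse_path_nonneg[OF h]] assms(2) by (meson order_refl order_trans)

text \<open>Strict growth makes the inverse hit every level s. This surjectivity is what yields
  continuity of the inverse, whatever jumps h has.\<close>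

lemma inverse_path_h:
  assumes h: "subordinator_path h" and s: "s \<ge> 0" shows "inverse_path h (h s) = s"
proof (rule antisym)
  show "inverse_path h (h s) \<le> s" using inverse_path_le_iff[OF h s] by simp
  have le: "h s \<le> h (inverse_path h (h s))" using inverse_path_le_iff[OF h inverse_path_nonneg[OF h]] by blast
  show "s \<le> inverse_path h (h s)"
  proof (rule ccontr)
    assume "\<not> s \<le> inverse_path h (h s)"
    then have "h (inverse_path h (h s)) < h s"
      using h s inverse_path_nonneg[OF h, of "h s"] by (auto simp: subordinator_path_def strict_mono_on_def)
    then show False using le by simp
  qed
qed

text \<open>A monotone function with range an open set is continuous, so the inverse is extended by the identity.\<close>

lemma inverse_path_continuous:
  assumes h: "subordinator_path h" shows "continuous_on {0..} (inverse_path h)"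
proof -
  define k where "k t = (if t < 0 then t else inverse_path h t)" for t
  have hpos: "0 \<le> h s" if "0 \<le> s" for s
  proof (cases "s = 0")
    case False
    then have "h 0 < h s" using h that by (intro strict_mono_onD[of "{0..}" h]) (auto simp: subordinator_path_def)
    then show ?thesis using h by (simp add: subordinator_path_def)
  qed (use h in \<open>simp add: subordinator_path_def\<close>)
  have "y \<in> range k" for y
  proof (cases "y < 0")
    case True
    then show ?thesis by (intro image_eqI[of _ _ y]) (auto simp: k_def)
  next
    case False
    then show ?thesis using inverse_path_h[OF h, of y] hpos[of y] by (intro image_eqI[of _ _ "h y"]) (auto simp: k_def)
  qed
  then have "range k = UNIV" by auto
  then have "continuous_on UNIV k"
  proof (intro continuous_onI_mono)
    fix x y :: real assume "x \<le> y"
    then show "k x \<le> k y" using inverse_path_mono[OF h, of x y] inverse_path_nonneg[OF h, of y]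
      by (auto simp: k_def)
  qed simp
  then have "continuous_on {0..} k" by (rule continuous_on_subset) simp
  then show ?thesis by (rule continuous_on_cong[THEN iffD1, rotated -1]) (auto simp: k_def)
qed

text \<open>Two uses of the exponential bound. P (H h \<le> 0) \<le> exp (- h u^\<alpha>) tends to 0
  as u grows, so increments are positive; this holds along rationals off one null set and extends to
  real times by monotonicity. With u = 1, P (H m \<le> n) \<le> exp (n - m) tends to 0 in m, so
  paths are unbounded.\<close>

lemma (in prob_space) stable_subordinator_path:
  assumes H: "stable_subordinator M \<alpha> H" and \<alpha>: "0 < \<alpha>"
  shows "AE \<omega> in M. subordinator_path (\<lambda>t. H t \<omega>)"
proof -
  have L: "levy_process M H" using H by (simp add: stable_subordinator_def)
  note Hm = levy_processD(1)[OF L]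
  have mono: "AE \<omega> in M. mono_on {0..} (\<lambda>t. H t \<omega>)" using H by (simp add: stable_subordinator_def)
  have strict: "AE \<omega> in M. H s \<omega> < H (s + h) \<omega>" if s: "s \<ge> 0" and h: "h > 0" for s h
  proof -
    have [measurable]: "H h \<in> borel_measurable M" "H s \<in> borel_measurable M" "H (s + h) \<in> borel_measurable M"
      using Hm s h by auto
    have "(\<lambda>m. exp (real m * 0 - h * real m powr \<alpha>)) \<longlonglongrightarrow> 0"
      using h \<alpha> by real_asymp
    moreover have "\<forall>\<^sub>F m in sequentially. prob {\<omega> \<in> space M. H h \<omega> \<le> 0} \<le> exp (real m * 0 - h * real m powr \<alpha>)"
      using eventually_gt_at_top[of 0]
      by eventually_elim (rule stable_subordinator_bound[OF H], use h in auto)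
    ultimately have "prob {\<omega> \<in> space M. H h \<omega> \<le> 0} \<le> 0"
      by (rule tendsto_lowerbound) simp
    then have "prob {\<omega> \<in> space M. H h \<omega> \<le> 0} = 0" by (simp add: measure_le_0_iff)
    then have "AE \<omega> in M. \<not> H h \<omega> \<le> 0" by (subst (asm) prob_eq_0) auto
    then have "AE x in distr M borel (H h). 0 < x" by (simp add: AE_distr_iff not_le)
    then have "AE x in distr M borel (\<lambda>\<omega>. H (s + h) \<omega> - H s \<omega>). 0 < x"
      by (simp only: levy_processD(4)[OF L s less_imp_le[OF h]])
    then show ?thesis by (simp add: AE_distr_iff)
  qed
  have "AE \<omega> in M. \<forall>q r::rat. 0 \<le> q \<and> 0 < r \<longrightarrow> H (of_rat q) \<omega> < H (of_rat q + of_rat r) \<omega>"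
    unfolding AE_all_countable using strict by auto
  moreover have "AE \<omega> in M. \<forall>n::nat. \<exists>m::nat. real n < H (real m) \<omega>"
    unfolding AE_all_countable
  proof
    fix n :: nat
    have [measurable]: "H (real m) \<in> borel_measurable M" for m :: nat by (rule Hm) simp
    define A where "A = {\<omega> \<in> space M. \<forall>m::nat. H (real m) \<omega> \<le> real n}"
    have A: "A \<in> events" unfolding A_def by measurable
    have "(\<lambda>m. exp (1 * real n - real m * 1 powr \<alpha>)) \<longlonglongrightarrow> 0" by real_asymp
    moreover have "prob A \<le> exp (1 * real n - real m * 1 powr \<alpha>)" for m
      by (rule order_trans[OF finite_measure_mono stable_subordinator_bound(1)[OF H]]) (auto simp: A_def)
    ultimately have "prob A \<le> 0" by (intro tendsto_lowerbound[of _ 0 sequentially]) auto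
    then have "prob A = 0" by (simp add: measure_le_0_iff)
    then have "AE \<omega> in M. \<omega> \<notin> A" using A by (simp add: prob_eq_0)
    then show "AE \<omega> in M. \<exists>m::nat. real n < H (real m) \<omega>"
      using AE_space by eventually_elim (auto simp: A_def not_le)
  qed
  ultimately show ?thesis using mono levy_processD(2)[OF L] levy_processD(5)[OF L]
  proof eventually_elim
    case (elim \<omega>)
    show ?case unfolding subordinator_path_def
    proof (intro conjI allI impI strict_mono_onI)
      show "H 0 \<omega> = 0" using elim by simp
      show "((\<lambda>t. H t \<omega>) \<longlongrightarrow> H s \<omega>) (at_right s)" if "0 \<le> s" for s using elim(5) that by (simp add: cadlag_def)
      show "\<exists>s\<ge>0. t \<le> H s \<omega>" for t
      proof -
        obtain n where "t \<le> real n" using real_arch_simple by blast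
        moreover obtain m where "real n < H (real m) \<omega>" using elim(2) by blast
        ultimately show ?thesis by (intro exI[of _ "real m"]) auto
      qed
      fix s t :: real assume st: "s \<in> {0..}" "t \<in> {0..}" "s < t"
      obtain q where q: "s < of_rat q" "of_rat q < t" using of_rat_dense[OF st(3)] by auto
      obtain q' where q': "of_rat q < real_of_rat q'" "of_rat q' < t" using of_rat_dense[OF q(2)] by auto
      have "0 < real_of_rat q" using q(1) st(1) by (simp del: zero_less_of_rat_iff)
      then have q0: "0 \<le> q" by simp
      have r0: "0 < q' - q" using q' by (simp add: of_rat_less)
      have q'0: "0 \<le> q'" using q0 r0 by simp
      have "H s \<omega> \<le> H (of_rat q) \<omega>" using elim(3) q q0 st by (intro mono_onD[of "{0..}" "\<lambda>t. H t \<omega>"]) auto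
      also have "H (of_rat q) \<omega> < H (of_rat q + of_rat (q' - q)) \<omega>" using elim(1) q0 r0 by blast
      also have "of_rat q + of_rat (q' - q) = real_of_rat q'" by (simp add: of_rat_diff)
      also have "H (of_rat q') \<omega> \<le> H t \<omega>" using elim(3) q' q'0 st by (intro mono_onD[of "{0..}" "\<lambda>t. H t \<omega>"]) auto
      finally show "H s \<omega> < H t \<omega>" .
    qed
  qed
qed

lemma (in prob_space) inverse_stable_subordinator_paths:
  assumes L: "inverse_stable_subordinator M \<alpha> L" and \<alpha>: "0 < \<alpha>"
  shows "AE \<omega> in M. L 0 \<omega> = 0 \<and> mono_on {0..} (\<lambda>t. L t \<omega>) \<and> continuous_on {0..} (\<lambda>t. L t \<omega>)"
proof (cases "\<alpha> = 1")
  case True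
  show ?thesis
  proof (rule AE_I2)
    fix \<omega> assume "\<omega> \<in> space M"
    then have e: "L t \<omega> = t" if "t \<ge> 0" for t using L True that by (simp add: inverse_stable_subordinator_def)
    have "continuous_on {0..} (\<lambda>t. L t \<omega>)" by (rule continuous_on_eq[of _ "\<lambda>t. t"]) (auto simp: e continuous_on_id)
    then show "L 0 \<omega> = 0 \<and> mono_on {0..} (\<lambda>t. L t \<omega>) \<and> continuous_on {0..} (\<lambda>t. L t \<omega>)" by (simp add: e mono_on_def)
  qed
next
  case False
  then obtain H where H: "stable_subordinator M \<alpha> H" "\<And>t \<omega>. t \<ge> 0 \<Longrightarrow> \<omega> \<in> space M \<Longrightarrow> L t \<omega> = inverse_path (\<lambda>s. H s \<omega>) t"
    using L unfolding inverse_stable_subordinator_def inverse_path_def by auto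
  from stable_subordinator_path[OF H(1) \<alpha>] AE_space show ?thesis
  proof eventually_elim
    case (elim \<omega>)
    have e: "L t \<omega> = inverse_path (\<lambda>s. H s \<omega>) t" if "t \<ge> 0" for t using H(2) that elim by simp
    have "L 0 \<omega> = 0" using inverse_path_h[OF elim(1), of 0] elim(1) by (simp add: e subordinator_path_def)
    moreover have "continuous_on {0..} (\<lambda>t. L t \<omega>)"
      by (rule continuous_on_eq[OF inverse_path_continuous[OF elim(1)]]) (auto simp: e)
    ultimately show ?case using inverse_path_mono[OF elim(1)]
      by (auto simp: mono_on_def e)
  qed
qed

section \<open>Self-similarity of the inverse subordinator\<close>

lemma distr_increments:
  fixes Y :: "real \<Rightarrow> 'a \<Rightarrow> real"
  assumes M: "prob_space M" and Y: "levy_process M Y" and u: "0 \<le> u 0" "\<And>k. u k \<le> u (Suc k)" and m: "m > 0"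
  shows "distr M (Pi\<^sub>M {..<m} (\<lambda>_. borel)) (\<lambda>\<omega>. \<lambda>k\<in>{..<m}. a * (Y (u (Suc k)) \<omega> - Y (u k) \<omega>)) =
    Pi\<^sub>M {..<m} (\<lambda>k. distr M borel (\<lambda>\<omega>. a * Y (u (Suc k) - u k) \<omega>))"
proof -
  interpret prob_space M by fact
  have u0: "0 \<le> u k" for k using lift_Suc_mono_le[of u 0 k] u by fastforce
  have [measurable]: "Y (u k) \<in> borel_measurable M" for k by (rule levy_processD(1)[OF Y u0])
  have "indep_vars (\<lambda>_. borel) (\<lambda>i \<omega>. Y (u (Suc i)) \<omega> - Y (u i) \<omega>) {..<m}"
    by (rule levy_processD(3)[OF Y]) (use u in auto)
  then have ind: "indep_vars (\<lambda>_. borel) (\<lambda>k \<omega>. a * (Y (u (Suc k)) \<omega> - Y (u k) \<omega>)) {..<m}"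
    by (rule indep_vars_compose2[where Y = "\<lambda>i x. a * x"]) auto
  have "distr M borel (\<lambda>\<omega>. a * (Y (u (Suc k)) \<omega> - Y (u k) \<omega>)) = distr M borel (\<lambda>\<omega>. a * Y (u (Suc k) - u k) \<omega>)" for k
  proof -
    have [measurable]: "Y (u (Suc k) - u k) \<in> borel_measurable M" using u by (intro levy_processD(1)[OF Y]) simp
    have "distr M borel (\<lambda>\<omega>. Y (u k + (u (Suc k) - u k)) \<omega> - Y (u k) \<omega>) = distr M borel (Y (u (Suc k) - u k))"
      using u u0 by (intro levy_processD(4)[OF Y]) auto
    then have "distr (distr M borel (\<lambda>\<omega>. Y (u (Suc k)) \<omega> - Y (u k) \<omega>)) borel (\<lambda>x. a * x) =
      distr (distr M borel (Y (u (Suc k) - u k))) borel (\<lambda>x. a * x)" by simp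
    then show ?thesis by (simp add: distr_distr comp_def)
  qed
  then show ?thesis using ind m by (simp add: indep_vars_iff_distr_eq_PiM' lessThan_empty_iff)
qed

text \<open>The boxes are a pi-system that generates the product sigma-algebra, and [..n] boxes
  exhaust the space. So joint distribution functions, which are accessible for the inverse,
  determine its finite-dimensional laws.\<close>

lemma measure_eqI_atMost_boxes:
  fixes P Q :: "('i \<Rightarrow> real) measure"
  assumes I: "finite I" and sP: "sets P = sets (Pi\<^sub>M I (\<lambda>_. borel))" and sQ: "sets Q = sets (Pi\<^sub>M I (\<lambda>_. borel))"
    and fin: "finite_measure P" and eq: "\<And>x. emeasure P (\<Pi>\<^sub>E i\<in>I. {..x i}) = emeasure Q (\<Pi>\<^sub>E i\<in>I. {..x i})"
  shows "P = Q"
proof -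
  define E where "E = range (\<lambda>x. \<Pi>\<^sub>E i\<in>I. {..x i :: real})"
  have "sets (Pi\<^sub>M I (\<lambda>_. borel :: real measure)) = sets (Pi\<^sub>M I (\<lambda>_. sigma UNIV (range atMost)))"
    by (intro sets_PiM_cong HOL.refl) (simp add: borel_eq_atMost)
  also have "\<dots> = sets (sigma (\<Pi>\<^sub>E i\<in>I. UNIV) {{f\<in>(\<Pi>\<^sub>E i\<in>I. UNIV). \<forall>i\<in>j. f i \<in> A i} | A j. j \<in> {I} \<and> A \<in> Pi j (\<lambda>_. range atMost)})"
  proof (rule sets_PiM_sigma)
    show "\<exists>S\<subseteq>range atMost. countable S \<and> (UNIV :: real set) = \<Union>S" for i
      by (intro exI[of _ "range (\<lambda>n. {..real n})"]) (auto intro: real_arch_simple)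
  qed (use I in auto)
  also have "{{f\<in>(\<Pi>\<^sub>E i\<in>I. UNIV). \<forall>i\<in>j. f i \<in> A i} | A j. j \<in> {I} \<and> A \<in> Pi j (\<lambda>_. range atMost)} = E"
  proof (intro equalityI subsetI)
    fix S assume "S \<in> {{f\<in>(\<Pi>\<^sub>E i\<in>I. UNIV). \<forall>i\<in>j. f i \<in> A i} | A j. j \<in> {I} \<and> A \<in> Pi j (\<lambda>_. range (atMost :: real \<Rightarrow> _))}"
    then obtain A where A: "S = {f\<in>(\<Pi>\<^sub>E i\<in>I. UNIV). \<forall>i\<in>I. f i \<in> A i}" "A \<in> Pi I (\<lambda>_. range atMost)" by auto
    then have "\<forall>i\<in>I. \<exists>y. A i = {..y}" by auto
    from bchoice[OF this] obtain x where "\<forall>i\<in>I. A i = {..x i}" by (rule exE)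
    then have "S = (\<Pi>\<^sub>E i\<in>I. {..x i})" using A(1) by (auto simp: PiE_iff extensional_def)
    then show "S \<in> E" by (auto simp: E_def)
  next
    fix S assume "S \<in> E"
    then obtain x where "S = (\<Pi>\<^sub>E i\<in>I. {..x i})" by (auto simp: E_def)
    then show "S \<in> {{f\<in>(\<Pi>\<^sub>E i\<in>I. UNIV). \<forall>i\<in>j. f i \<in> A i} | A j. j \<in> {I} \<and> A \<in> Pi j (\<lambda>_. range atMost)}"
      by (intro CollectI exI[of _ "\<lambda>i. {..x i}"] exI[of _ I]) (auto simp: PiE_iff extensional_def)
  qed
  also have "sets (sigma (\<Pi>\<^sub>E i\<in>I. UNIV) E) = sigma_sets (\<Pi>\<^sub>E i\<in>I. UNIV) E"
    by (rule sets_measure_of) (auto simp: E_def PiE_iff extensional_def)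
  finally have S: "sets (Pi\<^sub>M I (\<lambda>_. borel)) = sigma_sets (\<Pi>\<^sub>E i\<in>I. UNIV) E" .
  show ?thesis
  proof (rule measure_eqI_generator_eq[where E = E and \<Omega> = "\<Pi>\<^sub>E i\<in>I. UNIV" and A = "\<lambda>n. \<Pi>\<^sub>E i\<in>I. {..real n}"])
    show "Int_stable E"
    proof (rule Int_stableI)
      fix a b assume "a \<in> E" "b \<in> E"
      then obtain x y where "a = (\<Pi>\<^sub>E i\<in>I. {..x i})" "b = (\<Pi>\<^sub>E i\<in>I. {..y i})" by (auto simp: E_def)
      then have "a \<inter> b = (\<Pi>\<^sub>E i\<in>I. {..min (x i) (y i)})" by (auto simp: PiE_iff extensional_def)
      then show "a \<inter> b \<in> E" by (auto simp: E_def)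
    qed
    show "E \<subseteq> Pow (\<Pi>\<^sub>E i\<in>I. UNIV)" by (auto simp: E_def PiE_iff extensional_def)
    show "emeasure P X = emeasure Q X" if "X \<in> E" for X using that eq by (auto simp: E_def)
    show "range (\<lambda>n. \<Pi>\<^sub>E i\<in>I. {..real n}) \<subseteq> E" by (auto simp: E_def)
    show "(\<Union>n. \<Pi>\<^sub>E i\<in>I. {..real n}) = (\<Pi>\<^sub>E i\<in>I. UNIV)"
    proof (intro equalityI subsetI)
      fix f assume f: "f \<in> (\<Pi>\<^sub>E i\<in>I. (UNIV :: real set))"
      obtain n where n: "sum (\<lambda>i. \<bar>f i\<bar>) I \<le> real n" using real_arch_simple by blast
      have "f i \<le> real n" if "i \<in> I" for i
        using n member_le_sum[of i I "\<lambda>i. \<bar>f i\<bar>"] I that by fastforce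
      then show "f \<in> (\<Union>n. \<Pi>\<^sub>E i\<in>I. {..real n})" using f by (auto simp: PiE_iff extensional_def)
    qed (auto simp: PiE_iff extensional_def)
    show "emeasure P (\<Pi>\<^sub>E i\<in>I. {..real n}) \<noteq> \<infinity>" for n using finite_measure.emeasure_finite[OF fin] by simp
  qed (use sP sQ S in auto)
qed


text \<open>For a nondecreasing L the conditions L (t k) \<le> x k are equivalent to those with x k
  replaced by the minimum over later indices. These bounds increase with k and can serve as times of
  the subordinator. Index 0 is the starting time 0, and \<open>min j (m - 1)\<close> keeps the set
  nonempty for indices past the end.\<close>

definition running_min :: "nat \<Rightarrow> (nat \<Rightarrow> real) \<Rightarrow> nat \<Rightarrow> real" where
  "running_min m x = case_nat 0 (\<lambda>j. Min (x ` {min j (m - 1)..<m}))"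

lemma running_min_mono:
  assumes m: "m > 0" and x: "\<And>k. k < m \<Longrightarrow> 0 \<le> x k"
  shows "running_min m x k \<le> running_min m x (Suc k)"
proof (cases k)
  case 0
  then show ?thesis using m x unfolding running_min_def by (simp add: Min_ge_iff)
next
  case (Suc j)
  have "{min (Suc j) (m - 1)..<m} \<noteq> {}" using m by auto
  then show ?thesis unfolding Suc running_min_def by (auto intro!: Min_antimono)
qed

text \<open>By \<open>inverse_path_le_iff\<close> the event becomes a t k \<le> H (w (k + 1)) with w
  = a^\<alpha> u. The times w are sorted thanks to \<open>running_min\<close>, so H at them is a
  partial sum of independent increments, and the probability depends only on the laws of the
  increments divided by a.\<close>

lemma inverse_stable_cdf:
  assumes M: "prob_space M" and L: "inverse_stable_subordinator M \<alpha> L" and \<alpha>: "0 < \<alpha>" "\<alpha> \<noteq> 1"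
    and Lm: "\<And>t. t \<ge> 0 \<Longrightarrow> L t \<in> borel_measurable M"
    and t: "\<And>k. 0 \<le> t k" "\<And>k. t k \<le> t (Suc k)" and a: "a > 0" and m: "m > 0" and x: "\<And>k. k < m \<Longrightarrow> 0 \<le> x k"
  defines "u \<equiv> running_min m x"
  obtains H where "stable_subordinator M \<alpha> H"
    "measure M {\<omega> \<in> space M. \<forall>k<m. L (a * t k) \<omega> / a powr \<alpha> \<le> x k} =
      measure (Pi\<^sub>M {..<m} (\<lambda>k. distr M borel (\<lambda>\<omega>. (1 / a) * H (a powr \<alpha> * u (Suc k) - a powr \<alpha> * u k) \<omega>)))
        {z \<in> space (Pi\<^sub>M {..<m} (\<lambda>_. borel)). \<forall>k<m. t k \<le> (\<Sum>j<Suc k. z j)}"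
proof -
  interpret prob_space M by fact
  obtain H where H: "stable_subordinator M \<alpha> H" "\<And>t \<omega>. t \<ge> 0 \<Longrightarrow> \<omega> \<in> space M \<Longrightarrow> L t \<omega> = inverse_path (\<lambda>s. H s \<omega>) t"
    using L \<alpha> unfolding inverse_stable_subordinator_def inverse_path_def by auto
  have Y: "levy_process M H" using H(1) by (simp add: stable_subordinator_def)
  have ne: "{min k (m - 1)..<m} \<noteq> {}" for k using m by auto
  have u0: "u 0 = 0" by (simp add: u_def running_min_def)
  have uS: "u (Suc k) = Min (x ` {min k (m - 1)..<m})" for k by (simp add: u_def running_min_def)
  have umono: "u k \<le> u (Suc k)" for k unfolding u_def by (rule running_min_mono[OF m x])
  have tmono: "t j \<le> t k" if "j \<le> k" for j k using lift_Suc_mono_le[of t j k] t that by blast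
  have upos: "0 \<le> u k" for k by (induction k) (use u0 umono order_trans in auto)
  have u_le: "u (Suc k) \<le> x k" if "k < m" for k unfolding uS using that by (intro Min_le) auto
  have u_attained: "\<exists>j. k \<le> j \<and> j < m \<and> u (Suc k) = x j" if "k < m" for k
  proof -
    have "u (Suc k) \<in> x ` {min k (m - 1)..<m}" unfolding uS using ne[of k] by (intro Min_in) auto
    then show ?thesis using that by auto
  qed
  define w where "w k = a powr \<alpha> * u k" for k
  have w: "0 \<le> w 0" "\<And>k. w k \<le> w (Suc k)" "\<And>k. 0 \<le> w k" by (simp_all add: w_def upos umono mult_left_mono)
  have Hm[measurable]: "H (w k) \<in> borel_measurable M" for k by (rule levy_processD(1)[OF Y w(3)])
  have [measurable]: "L (a * t k) \<in> borel_measurable M" for k using a t by (intro Lm) simp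
  define S where "S = {z \<in> space (Pi\<^sub>M {..<m} (\<lambda>_. borel :: real measure)). \<forall>k<m. t k \<le> (\<Sum>j<Suc k. z j)}"
  define V where "V \<omega> = (\<lambda>k\<in>{..<m}. (1 / a) * (H (w (Suc k)) \<omega> - H (w k) \<omega>))" for \<omega>
  have S: "S \<in> sets (Pi\<^sub>M {..<m} (\<lambda>_. borel))" unfolding S_def by measurable
  have V: "V \<in> M \<rightarrow>\<^sub>M Pi\<^sub>M {..<m} (\<lambda>_. borel)" unfolding V_def by measurable
  have "measure M {\<omega> \<in> space M. \<forall>k<m. L (a * t k) \<omega> / a powr \<alpha> \<le> x k} = measure M (V -` S \<inter> space M)"
  proof (rule finite_measure_eq_AE)
    show "AE \<omega> in M. (\<omega> \<in> {\<omega> \<in> space M. \<forall>k<m. L (a * t k) \<omega> / a powr \<alpha> \<le> x k}) = (\<omega> \<in> V -` S \<inter> space M)"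
      using stable_subordinator_path[OF H(1) \<alpha>(1)] AE_space
    proof eventually_elim
      case (elim \<omega>)
      have Lk: "L (a * t k) \<omega> = inverse_path (\<lambda>s. H s \<omega>) (a * t k)" for k using elim(2) a t by (intro H(2)) auto
      have H0: "H (w 0) \<omega> = 0" using elim(1) by (simp add: w_def u0 subordinator_path_def)
      have tel: "(\<Sum>j<Suc k. V \<omega> j) = (1 / a) * H (w (Suc k)) \<omega>" if "k < m" for k
      proof -
        have "(\<Sum>j<Suc k. V \<omega> j) = (\<Sum>j<Suc k. (1 / a) * (H (w (Suc j)) \<omega> - H (w j) \<omega>))"
          using that by (intro sum.cong) (auto simp: V_def)
        also have "\<dots> = (1 / a) * (\<Sum>j<Suc k. H (w (Suc j)) \<omega> - H (w j) \<omega>)" by (simp only: sum_distrib_left)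
        also have "\<dots> = (1 / a) * H (w (Suc k)) \<omega>" by (simp only: sum_lessThan_telescope[of "\<lambda>j. H (w j) \<omega>" "Suc k"] H0 diff_zero)
        finally show ?thesis .
      qed
      have iff: "L (a * t k) \<omega> \<le> w (Suc k) \<longleftrightarrow> t k \<le> (\<Sum>j<Suc k. V \<omega> j)" if "k < m" for k
      proof -
        have "L (a * t k) \<omega> \<le> w (Suc k) \<longleftrightarrow> a * t k \<le> H (w (Suc k)) \<omega>"
          unfolding Lk by (rule inverse_path_le_iff[OF elim(1) w(3)])
        also have "\<dots> \<longleftrightarrow> t k \<le> (1 / a) * H (w (Suc k)) \<omega>" using a by (simp add: field_simps)
        finally show ?thesis by (simp only: tel[OF that])
      qed
      have ap: "a powr \<alpha> > 0" using a by simp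
      have Lmono: "L (a * t j) \<omega> \<le> L (a * t k) \<omega>" if "j \<le> k" for j k
        unfolding Lk using tmono[OF that] a by (intro inverse_path_mono[OF elim(1)]) simp
      have "(\<forall>k<m. L (a * t k) \<omega> / a powr \<alpha> \<le> x k) \<longleftrightarrow> (\<forall>k<m. L (a * t k) \<omega> \<le> w (Suc k))"
      proof (intro iffI allI impI)
        fix k assume A: "\<forall>k<m. L (a * t k) \<omega> / a powr \<alpha> \<le> x k" and k: "k < m"
        obtain j where j: "k \<le> j" "j < m" "u (Suc k) = x j" using u_attained[OF k] by auto
        have "L (a * t k) \<omega> \<le> L (a * t j) \<omega>" by (rule Lmono[OF j(1)])
        also have "\<dots> \<le> x j * a powr \<alpha>" using A j(2) ap by (simp add: pos_divide_le_eq)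
        finally show "L (a * t k) \<omega> \<le> w (Suc k)" by (simp add: w_def j(3) mult.commute)
      next
        fix k assume A: "\<forall>k<m. L (a * t k) \<omega> \<le> w (Suc k)" and k: "k < m"
        then have "L (a * t k) \<omega> \<le> a powr \<alpha> * u (Suc k)" by (simp add: w_def)
        also have "\<dots> \<le> a powr \<alpha> * x k" using u_le[OF k] ap by (intro mult_left_mono) auto
        finally show "L (a * t k) \<omega> / a powr \<alpha> \<le> x k" using ap by (simp add: pos_divide_le_eq mult.commute)
      qed
      also have "\<dots> \<longleftrightarrow> V \<omega> \<in> S" using iff measurable_space[OF V elim(2)] by (auto simp: S_def simp del: sum.lessThan_Suc)
      finally show ?case using elim(2) by auto
    qed
  qed (use V S in measurable)
  also have "\<dots> = measure (distr M (Pi\<^sub>M {..<m} (\<lambda>_. borel)) V) S" using V S by (simp add: measure_distr)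
  also have "distr M (Pi\<^sub>M {..<m} (\<lambda>_. borel)) V = Pi\<^sub>M {..<m} (\<lambda>k. distr M borel (\<lambda>\<omega>. (1 / a) * H (w (Suc k) - w k) \<omega>))"
    unfolding V_def by (rule distr_increments[OF M Y w(1,2) m])
  finally show thesis by (intro that[OF H(1)]) (simp only: S_def w_def)
qed

lemma vimage_atMost_box:
  fixes f :: "nat \<Rightarrow> 'a \<Rightarrow> real"
  shows "(\<lambda>\<omega>. \<lambda>k\<in>{..<m}. f k \<omega>) -` (\<Pi>\<^sub>E i\<in>{..<m}. {..x i}) \<inter> A = {\<omega> \<in> A. \<forall>k<m. f k \<omega> \<le> x k}"
proof -
  have "(\<lambda>k\<in>{..<m}. f k \<omega>) \<in> (\<Pi>\<^sub>E i\<in>{..<m}. {..x i}) \<longleftrightarrow> (\<forall>k<m. f k \<omega> \<le> x k)" for \<omega>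
    by (simp only: restrict_PiE_iff Ball_def lessThan_iff atMost_iff)
  then show ?thesis by blast
qed

text \<open>H (a^\<alpha> h) / a has Laplace transform exp (- a^\<alpha> h (v / a)^\<alpha>) = exp
  (- h v^\<alpha>), free of a. Hence \<open>inverse_stable_cdf\<close> with a on one space and with
  1 on the other gives the same distribution function. For \<alpha> = 1 both sides are
  deterministic, and boxes with a negative bound are null for both.\<close>

lemma inverse_stable_scaling:
  assumes M: "prob_space M" and M': "prob_space M'" and L: "inverse_stable_subordinator M \<alpha> L"
    and L': "inverse_stable_subordinator M' \<alpha> L'" and \<alpha>: "0 < \<alpha>"
    and Lm: "\<And>t. t \<ge> 0 \<Longrightarrow> L t \<in> borel_measurable M" and L'm: "\<And>t. t \<ge> 0 \<Longrightarrow> L' t \<in> borel_measurable M'"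
    and t: "\<And>k. 0 \<le> t k" "\<And>k. t k \<le> t (Suc k)" and a: "a > 0" and m: "m > 0"
  shows "distr M (Pi\<^sub>M {..<m} (\<lambda>_. borel)) (\<lambda>\<omega>. \<lambda>k\<in>{..<m}. L (a * t k) \<omega> / a powr \<alpha>) =
    distr M' (Pi\<^sub>M {..<m} (\<lambda>_. borel)) (\<lambda>\<omega>. \<lambda>k\<in>{..<m}. L' (t k) \<omega>)"
proof -
  interpret M: prob_space M by fact
  interpret M': prob_space M' by fact
  have [measurable]: "L (a * t k) \<in> borel_measurable M" "L' (t k) \<in> borel_measurable M'" for k
    using a t by (auto intro!: Lm L'm)
  show ?thesis
  proof (cases "\<alpha> = 1")
    case True
    have z: "(\<lambda>k\<in>{..<m}. t k) \<in> space (Pi\<^sub>M {..<m} (\<lambda>_. borel))" by (simp add: space_PiM)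
    have "distr M (Pi\<^sub>M {..<m} (\<lambda>_. borel)) (\<lambda>\<omega>. \<lambda>k\<in>{..<m}. L (a * t k) \<omega> / a powr \<alpha>) =
      distr M (Pi\<^sub>M {..<m} (\<lambda>_. borel)) (\<lambda>_. \<lambda>k\<in>{..<m}. t k)"
      using L True a t by (intro distr_cong) (auto simp: inverse_stable_subordinator_def restrict_def)
    moreover have "distr M' (Pi\<^sub>M {..<m} (\<lambda>_. borel)) (\<lambda>\<omega>. \<lambda>k\<in>{..<m}. L' (t k) \<omega>) =
      distr M' (Pi\<^sub>M {..<m} (\<lambda>_. borel)) (\<lambda>_. \<lambda>k\<in>{..<m}. t k)"
      using L' True t by (intro distr_cong) (auto simp: inverse_stable_subordinator_def restrict_def)
    ultimately show ?thesis using z by (simp add: M.distr_const M'.distr_const)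
  next
    case False
    let ?F = "\<lambda>\<omega>. \<lambda>k\<in>{..<m}. L (a * t k) \<omega> / a powr \<alpha>" and ?F' = "\<lambda>\<omega>. \<lambda>k\<in>{..<m}. L' (t k) \<omega>"
    show ?thesis
    proof (rule measure_eqI_atMost_boxes[where I = "{..<m}"])
      show "finite_measure (distr M (Pi\<^sub>M {..<m} (\<lambda>_. borel)) ?F)"
        by (rule M.finite_measure_distr) measurable
      fix x :: "nat \<Rightarrow> real"
      have box: "(\<Pi>\<^sub>E i\<in>{..<m}. {..x i}) \<in> sets (Pi\<^sub>M {..<m} (\<lambda>_. borel))"
        by (intro sets_PiM_I_finite) auto
      have "?F \<in> M \<rightarrow>\<^sub>M Pi\<^sub>M {..<m} (\<lambda>_. borel)" by measurable
      moreover have "?F -` (\<Pi>\<^sub>E i\<in>{..<m}. {..x i}) \<inter> space M = {\<omega> \<in> space M. \<forall>k<m. L (a * t k) \<omega> / a powr \<alpha> \<le> x k}"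
        by (rule vimage_atMost_box)
      ultimately have F: "emeasure (distr M (Pi\<^sub>M {..<m} (\<lambda>_. borel)) ?F) (\<Pi>\<^sub>E i\<in>{..<m}. {..x i}) =
          measure M {\<omega> \<in> space M. \<forall>k<m. L (a * t k) \<omega> / a powr \<alpha> \<le> x k}"
        by (simp only: emeasure_distr[OF _ box] M.emeasure_eq_measure)
      have "?F' \<in> M' \<rightarrow>\<^sub>M Pi\<^sub>M {..<m} (\<lambda>_. borel)" by measurable
      moreover have "?F' -` (\<Pi>\<^sub>E i\<in>{..<m}. {..x i}) \<inter> space M' = {\<omega> \<in> space M'. \<forall>k<m. L' (t k) \<omega> \<le> x k}"
        by (rule vimage_atMost_box)
      ultimately have F': "emeasure (distr M' (Pi\<^sub>M {..<m} (\<lambda>_. borel)) ?F') (\<Pi>\<^sub>E i\<in>{..<m}. {..x i}) =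
          measure M' {\<omega> \<in> space M'. \<forall>k<m. L' (t k) \<omega> \<le> x k}"
        by (simp only: emeasure_distr[OF _ box] M'.emeasure_eq_measure)
      show "emeasure (distr M (Pi\<^sub>M {..<m} (\<lambda>_. borel)) ?F) (\<Pi>\<^sub>E i\<in>{..<m}. {..x i}) =
          emeasure (distr M' (Pi\<^sub>M {..<m} (\<lambda>_. borel)) ?F') (\<Pi>\<^sub>E i\<in>{..<m}. {..x i})"
      proof (cases "\<forall>k<m. 0 \<le> x k")
        case True
        let ?u = "running_min m x"
        let ?S = "{z \<in> space (Pi\<^sub>M {..<m} (\<lambda>_. borel)). \<forall>k<m. t k \<le> (\<Sum>j<Suc k. z j)}"
        obtain H where H: "stable_subordinator M \<alpha> H" and HL:
          "measure M {\<omega> \<in> space M. \<forall>k<m. L (a * t k) \<omega> / a powr \<alpha> \<le> x k} =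
           measure (Pi\<^sub>M {..<m} (\<lambda>k. distr M borel (\<lambda>\<omega>. (1 / a) * H (a powr \<alpha> * ?u (Suc k) - a powr \<alpha> * ?u k) \<omega>))) ?S"
          by (rule inverse_stable_cdf[where t = t and x = x, OF M L \<alpha> False Lm t a m]) (use True in auto)
        obtain H' where H': "stable_subordinator M' \<alpha> H'" and HL':
          "measure M' {\<omega> \<in> space M'. \<forall>k<m. L' (1 * t k) \<omega> / 1 powr \<alpha> \<le> x k} =
           measure (Pi\<^sub>M {..<m} (\<lambda>k. distr M' borel (\<lambda>\<omega>. (1 / 1) * H' (1 powr \<alpha> * ?u (Suc k) - 1 powr \<alpha> * ?u k) \<omega>))) ?S"
          by (rule inverse_stable_cdf[where t = t and a = 1 and x = x, OF M' L' \<alpha> False L'm t _ m]) (use True in auto)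
        have Y: "levy_process M H" "levy_process M' H'" using H H' by (simp_all add: stable_subordinator_def)
        have "distr M borel (\<lambda>\<omega>. (1 / a) * H (a powr \<alpha> * ?u (Suc k) - a powr \<alpha> * ?u k) \<omega>) =
          distr M' borel (\<lambda>\<omega>. (1 / 1) * H' (1 powr \<alpha> * ?u (Suc k) - 1 powr \<alpha> * ?u k) \<omega>)" for k
        proof (rule laplace_uniqueness[OF M M'])
          define h where "h = ?u (Suc k) - ?u k"
          have h: "0 \<le> h" unfolding h_def using running_min_mono[OF m, of x k] True by auto
          have e: "a powr \<alpha> * ?u (Suc k) - a powr \<alpha> * ?u k = a powr \<alpha> * h" "1 powr \<alpha> * ?u (Suc k) - 1 powr \<alpha> * ?u k = h"
            by (simp_all add: h_def algebra_simps)
          have ah: "0 \<le> a powr \<alpha> * h" using h by simp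
          have [measurable]: "H (a powr \<alpha> * h) \<in> borel_measurable M" "H' h \<in> borel_measurable M'"
            by (rule levy_processD(1)[OF Y(1) ah] levy_processD(1)[OF Y(2) h])+
          show "(\<lambda>\<omega>. (1 / a) * H (a powr \<alpha> * ?u (Suc k) - a powr \<alpha> * ?u k) \<omega>) \<in> borel_measurable M"
            "(\<lambda>\<omega>. (1 / 1) * H' (1 powr \<alpha> * ?u (Suc k) - 1 powr \<alpha> * ?u k) \<omega>) \<in> borel_measurable M'"
            unfolding e by measurable
          show "AE \<omega> in M. 0 \<le> (1 / a) * H (a powr \<alpha> * ?u (Suc k) - a powr \<alpha> * ?u k) \<omega>"
            unfolding e using M.stable_subordinator_bound(2)[OF H ah, of 1] a by (auto elim!: eventually_mono)
          show "AE \<omega> in M'. 0 \<le> (1 / 1) * H' (1 powr \<alpha> * ?u (Suc k) - 1 powr \<alpha> * ?u k) \<omega>"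
            unfolding e using M'.stable_subordinator_bound(2)[OF H' h, of 1] by simp
          fix v :: real assume v: "v > 0"
          have "(\<integral>\<omega>. exp (- v * ((1 / a) * H (a powr \<alpha> * h) \<omega>)) \<partial>M) = (\<integral>\<omega>. exp (- (v / a) * H (a powr \<alpha> * h) \<omega>) \<partial>M)"
            by (simp add: field_simps)
          also have "\<dots> = exp (- (a powr \<alpha> * h) * (v / a) powr \<alpha>)"
            using H ah divide_pos_pos[OF v a] unfolding stable_subordinator_def by blast
          also have "\<dots> = exp (- h * v powr \<alpha>)" using v a by (simp add: powr_divide)
          also have "\<dots> = (\<integral>\<omega>. exp (- v * H' h \<omega>) \<partial>M')"
            using H' h v unfolding stable_subordinator_def by metis
          finally show "(\<integral>\<omega>. exp (- v * ((1 / a) * H (a powr \<alpha> * ?u (Suc k) - a powr \<alpha> * ?u k) \<omega>)) \<partial>M) =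
            (\<integral>\<omega>. exp (- v * ((1 / 1) * H' (1 powr \<alpha> * ?u (Suc k) - 1 powr \<alpha> * ?u k) \<omega>)) \<partial>M')"
            unfolding e by simp
        qed
        then show ?thesis unfolding F F' using HL HL' by simp
      next
        case False
        then obtain k where k: "k < m" "x k < 0" by (auto simp: not_le)
        have "AE \<omega> in M. \<not> (\<forall>k<m. L (a * t k) \<omega> / a powr \<alpha> \<le> x k)"
          using M.inverse_stable_subordinator_paths[OF L \<alpha>]
        proof eventually_elim
          case (elim \<omega>)
          have "L 0 \<omega> \<le> L (a * t k) \<omega>" using elim a t by (intro mono_onD[of "{0..}" "\<lambda>t. L t \<omega>"]) auto
          then have "0 \<le> L (a * t k) \<omega> / a powr \<alpha>" using elim by simp
          then show ?case using k by (meson not_le order_trans)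
        qed
        then have 1: "measure M {\<omega> \<in> space M. \<forall>k<m. L (a * t k) \<omega> / a powr \<alpha> \<le> x k} = 0"
          by (subst M.prob_eq_0) auto
        have "AE \<omega> in M'. \<not> (\<forall>k<m. L' (t k) \<omega> \<le> x k)"
          using M'.inverse_stable_subordinator_paths[OF L' \<alpha>]
        proof eventually_elim
          case (elim \<omega>)
          have "L' 0 \<omega> \<le> L' (t k) \<omega>" using elim t by (intro mono_onD[of "{0..}" "\<lambda>t. L' t \<omega>"]) auto
          then have "0 \<le> L' (t k) \<omega>" using elim by simp
          then show ?case using k by (meson not_le order_trans)
        qed
        then have "measure M' {\<omega> \<in> space M'. \<forall>k<m. L' (t k) \<omega> \<le> x k} = 0"
          by (subst M'.prob_eq_0) auto
        then show ?thesis using 1 F F' by simp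
      qed
    qed auto
  qed
qed

section \<open>The Poisson clock\<close>

text \<open>With e k = s^k / k! one has (k + 1) e (k + 1) = s e k, so a factor k shifts the
  exponential series; two shifts give the series of k e k and of k^2 e k.\<close>

lemma poisson_second_moment:
  assumes s: "0 < s"
  shows "(\<integral>\<^sup>+k. ennreal ((real k - s)\<^sup>2) \<partial>measure_pmf (poisson_pmf s)) = ennreal s"
proof -
  define e where "e k = s ^ k / fact k" for k
  have e0: "e sums exp s" using exp_converges[of s] by (simp add: e_def[abs_def] divide_inverse_commute)
  have "(\<lambda>k. real k * e k) sums (s * exp s)"
  proof (rule sums_Suc_imp)
    have "(\<lambda>k. s * e k) sums (s * exp s)" by (rule sums_mult[OF e0])
    moreover have "s * e k = real (Suc k) * e (Suc k)" for k by (simp add: e_def field_simps del: of_nat_Suc)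
    ultimately show "(\<lambda>k. real (Suc k) * e (Suc k)) sums (s * exp s)" by simp
  qed simp
  note e1 = this
  have "(\<lambda>k. real k * (real k * e k)) sums (s * (s * exp s) + s * exp s)"
  proof (rule sums_Suc_imp)
    have "(\<lambda>k. s * (real k * e k) + s * e k) sums (s * (s * exp s) + s * exp s)"
      by (intro sums_add sums_mult e0 e1)
    moreover have "s * (real k * e k) + s * e k = real (Suc k) * (real (Suc k) * e (Suc k))" for k
    proof -
      have "real (Suc k) * e (Suc k) = s * e k" by (simp add: e_def field_simps del: of_nat_Suc)
      then show ?thesis by (simp add: algebra_simps)
    qed
    ultimately show "(\<lambda>k. real (Suc k) * (real (Suc k) * e (Suc k))) sums (s * (s * exp s) + s * exp s)" by simp
  qed simp
  note e2 = this
  have "(\<lambda>k. exp (- s) * (real k * (real k * e k) - 2 * s * (real k * e k) + s\<^sup>2 * e k)) sums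
    (exp (- s) * ((s * (s * exp s) + s * exp s) - 2 * s * (s * exp s) + s\<^sup>2 * exp s))"
    by (intro sums_mult sums_add sums_diff e0 e1 e2)
  also have "exp (- s) * ((s * (s * exp s) + s * exp s) - 2 * s * (s * exp s) + s\<^sup>2 * exp s) = s * (exp (- s) * exp s)"
    by (simp add: algebra_simps power2_eq_square)
  also have "\<dots> = s" by (simp flip: exp_add)
  finally have sums: "(\<lambda>k. pmf (poisson_pmf s) k * (real k - s)\<^sup>2) sums s"
    using s by (simp add: e_def power2_eq_square algebra_simps add_divide_distrib diff_divide_distrib)
  have "(\<integral>\<^sup>+k. ennreal ((real k - s)\<^sup>2) \<partial>measure_pmf (poisson_pmf s)) =
    (\<integral>\<^sup>+k. ennreal (pmf (poisson_pmf s) k * (real k - s)\<^sup>2) \<partial>count_space UNIV)"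
    by (subst nn_integral_measure_pmf) (simp add: ennreal_mult')
  also have "\<dots> = (\<Sum>k. ennreal (pmf (poisson_pmf s) k * (real k - s)\<^sup>2))" by (rule nn_integral_count_space_nat)
  also have "\<dots> = ennreal s" by (rule suminf_ennreal_eq[OF _ sums]) simp
  finally show ?thesis .
qed

context prob_space
begin

lemma poisson_deviation:
  assumes N: "unit_poisson_process M N" and s: "0 \<le> s" and x: "0 < x"
  shows "prob {\<omega> \<in> space M. x \<le> \<bar>real (N s \<omega>) - s\<bar>} \<le> s / x\<^sup>2"
proof -
  have Nm[measurable]: "N s \<in> M \<rightarrow>\<^sub>M count_space UNIV"
    using N s by (auto simp: unit_poisson_process_def)
  show ?thesis
  proof (cases "s = 0")
    case True
    have "AE \<omega> in M. real (N 0 \<omega>) = 0"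
      using N levy_processD(2)[of M "\<lambda>t \<omega>. real (N t \<omega>)"] by (simp add: unit_poisson_process_def)
    then have "AE \<omega> in M. \<not> x \<le> \<bar>real (N s \<omega>) - s\<bar>" using x True by (auto elim!: eventually_mono)
    then have "prob {\<omega> \<in> space M. x \<le> \<bar>real (N s \<omega>) - s\<bar>} = 0" by (subst prob_eq_0) auto
    then show ?thesis using s by simp
  next
    case False
    then have pos: "0 < s" using s by simp
    have d: "distr M (count_space UNIV) (N s) = measure_pmf (poisson_pmf s)"
      using N s by (auto simp: unit_poisson_process_def)
    have "emeasure M {\<omega> \<in> space M. x \<le> \<bar>real (N s \<omega>) - s\<bar>} \<le>
      emeasure M ({\<omega> \<in> space M. 1 \<le> ennreal (1 / x\<^sup>2) * ennreal ((real (N s \<omega>) - s)\<^sup>2)})"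
    proof (rule emeasure_mono, safe)
      fix \<omega> assume "x \<le> \<bar>real (N s \<omega>) - s\<bar>"
      then have "x\<^sup>2 \<le> (real (N s \<omega>) - s)\<^sup>2" using x by (metis abs_le_square_iff abs_of_pos)
      then have "1 \<le> 1 / x\<^sup>2 * (real (N s \<omega>) - s)\<^sup>2" using x by (simp add: field_simps)
      then show "1 \<le> ennreal (1 / x\<^sup>2) * ennreal ((real (N s \<omega>) - s)\<^sup>2)"
        by (simp flip: ennreal_mult' ennreal_1 add: ennreal_leI)
    qed measurable
    also have "\<dots> \<le> ennreal (1 / x\<^sup>2) * (\<integral>\<^sup>+\<omega>. ennreal ((real (N s \<omega>) - s)\<^sup>2) * indicator (space M) \<omega> \<partial>M)"
      by (rule order_trans[OF emeasure_mono nn_integral_Markov_inequality[where A = "space M"]]) auto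
    also have "(\<integral>\<^sup>+\<omega>. ennreal ((real (N s \<omega>) - s)\<^sup>2) * indicator (space M) \<omega> \<partial>M) = (\<integral>\<^sup>+\<omega>. ennreal ((real (N s \<omega>) - s)\<^sup>2) \<partial>M)"
      by (intro nn_integral_cong) simp
    also have "\<dots> = (\<integral>\<^sup>+k. ennreal ((real k - s)\<^sup>2) \<partial>distr M (count_space UNIV) (N s))"
      by (subst nn_integral_distr) auto
    also have "\<dots> = ennreal s" unfolding d by (rule poisson_second_moment[OF pos])
    also have "ennreal (1 / x\<^sup>2) * ennreal s = ennreal (s / x\<^sup>2)" using s by (simp flip: ennreal_mult')
    finally show ?thesis using s by (simp add: emeasure_eq_measure)
  qed
qed

text \<open>Increments have the law of a natural-valued variable, so the path increases along
  rationals off one null set. A right-continuous path with natural values is constant just after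
  every time, and so monotonicity carries over from rationals to reals.\<close>

lemma poisson_path:
  assumes N: "unit_poisson_process M N"
  shows "AE \<omega> in M. N 0 \<omega> = 0 \<and> mono_on {0..} (\<lambda>t. N t \<omega>) \<and> (\<forall>t\<ge>0. \<forall>\<^sub>F s in at_right t. N s \<omega> = N t \<omega>)"
proof -
  have Y: "levy_process M (\<lambda>t \<omega>. real (N t \<omega>))" using N by (simp add: unit_poisson_process_def)
  have inc: "AE \<omega> in M. real (N s \<omega>) \<le> real (N (s + h) \<omega>)" if s: "s \<ge> 0" and h: "h \<ge> 0" for s h
  proof -
    have sh: "s + h \<ge> 0" using s h by simp
    note [measurable] = levy_processD(1)[OF Y s] levy_processD(1)[OF Y h] levy_processD(1)[OF Y sh]
    have "AE x in distr M borel (\<lambda>\<omega>. real (N h \<omega>)). 0 \<le> x" by (simp add: AE_distr_iff)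
    then have "AE x in distr M borel (\<lambda>\<omega>. real (N (s + h) \<omega>) - real (N s \<omega>)). 0 \<le> x"
      by (simp only: levy_processD(4)[OF Y s h])
    then show ?thesis by (simp add: AE_distr_iff)
  qed
  have "AE \<omega> in M. \<forall>q r::rat. 0 \<le> q \<and> 0 \<le> r \<longrightarrow> real (N (of_rat q) \<omega>) \<le> real (N (of_rat q + of_rat r) \<omega>)"
    unfolding AE_all_countable using inc by auto
  then show ?thesis using levy_processD(2)[OF Y] levy_processD(5)[OF Y]
  proof eventually_elim
    case (elim \<omega>)
    have right: "\<forall>\<^sub>F s in at_right t. N s \<omega> = N t \<omega>" if "t \<ge> 0" for t
    proof -
      have "((\<lambda>t. real (N t \<omega>)) \<longlongrightarrow> real (N t \<omega>)) (at_right t)" using elim(3) that by (simp add: cadlag_def)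
      then have "\<forall>\<^sub>F s in at_right t. dist (real (N s \<omega>)) (real (N t \<omega>)) < 1" by (rule tendstoD) simp
      then show ?thesis by eventually_elim (simp add: dist_real_def)
    qed
    have "N s \<omega> \<le> N t \<omega>" if st: "0 \<le> s" "s < t" for s t
    proof -
      obtain b where b: "b > s" "\<And>r. s < r \<Longrightarrow> r < b \<Longrightarrow> N r \<omega> = N s \<omega>"
        using right[OF st(1)] by (auto simp: eventually_at_right_field)
      obtain b' where b': "b' > t" "\<And>r. t < r \<Longrightarrow> r < b' \<Longrightarrow> N r \<omega> = N t \<omega>"
        using right[of t] st by (auto simp: eventually_at_right_field)
      obtain q where q: "s < of_rat q" "of_rat q < min b t" using of_rat_dense[of s "min b t"] b st by auto
      obtain r where r: "t < of_rat r" "of_rat r < b'" using of_rat_dense[OF b'(1)] by auto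
      have "0 < real_of_rat q" using q(1) st(1) by (simp del: zero_less_of_rat_iff)
      then have q0: "0 \<le> q" by simp
      have "real_of_rat q < of_rat r" using q r by simp
      then have r0: "0 \<le> r - q" by (simp add: of_rat_less)
      have "real (N (of_rat q) \<omega>) \<le> real (N (of_rat q + of_rat (r - q)) \<omega>)" using elim(1) q0 r0 by blast
      also have "of_rat q + of_rat (r - q) = real_of_rat r" by (simp add: of_rat_diff)
      finally show ?thesis using b(2)[of "of_rat q"] b'(2)[of "of_rat r"] q r by simp
    qed
    then have "mono_on {0..} (\<lambda>t. N t \<omega>)" by (auto simp: mono_on_def le_less)
    then show ?case using elim(2) right by simp
  qed
qed

end

section \<open>Uniform comparison of the Poisson process with time\<close>

text \<open>Monotonicity puts f s between its values at the neighbouring grid points: d for the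
  deviation there and d for the spacing.\<close>

lemma grid_sandwich:
  fixes f :: "real \<Rightarrow> nat"
  assumes f: "mono_on {0..} f" and d: "0 < d" and grid: "\<And>j. j \<le> J \<Longrightarrow> \<bar>real (f (real j * d)) - real j * d\<bar> \<le> d"
    and s: "0 \<le> s" "s < real J * d"
  shows "\<bar>real (f s) - s\<bar> \<le> 2 * d"
proof -
  define j where "j = nat \<lfloor>s / d\<rfloor>"
  have j: "real j * d \<le> s" "s < real (Suc j) * d"
  proof -
    have "real j = of_int \<lfloor>s / d\<rfloor>" using s d by (simp add: j_def)
    then have "real j \<le> s / d" "s / d < real j + 1" by linarith+
    then show "real j * d \<le> s" "s < real (Suc j) * d" using d by (simp_all add: field_simps)
  qed
  have "real j * d < real J * d" using j s by linarith
  then have J: "Suc j \<le> J" using d by simp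
  have 1: "real (f (real j * d)) \<le> real (f s)" using f j s d by (auto simp: mono_on_def)
  have 2: "real (f s) \<le> real (f (real (Suc j) * d))" using f j s d by (auto simp: mono_on_def)
  have 3: "real (Suc j) * d = real j * d + d" by (simp add: algebra_simps)
  show ?thesis using 1 2 3 j grid[of j] grid[of "Suc j"] J by linarith
qed

text \<open>Chebyshev at each grid point, where the variance j d over d^2 is j / d, and a union
  bound. For a fixed number J of points the bound vanishes as the spacing d grows.\<close>

lemma (in prob_space) poisson_grid:
  assumes N: "unit_poisson_process M N" and d: "0 < d"
  shows "prob {\<omega> \<in> space M. \<exists>j\<le>J. d < \<bar>real (N (real j * d) \<omega>) - real j * d\<bar>} \<le> (\<Sum>j\<le>J. real j) / d"
proof -
  have [measurable]: "N (real j * d) \<in> M \<rightarrow>\<^sub>M count_space UNIV" for j :: nat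
    using N d by (auto simp: unit_poisson_process_def)
  have "prob {\<omega> \<in> space M. \<exists>j\<le>J. d < \<bar>real (N (real j * d) \<omega>) - real j * d\<bar>} \<le>
    prob (\<Union>j\<in>{..J}. {\<omega> \<in> space M. d \<le> \<bar>real (N (real j * d) \<omega>) - real j * d\<bar>})"
    by (rule finite_measure_mono) auto
  also have "\<dots> \<le> (\<Sum>j\<le>J. prob {\<omega> \<in> space M. d \<le> \<bar>real (N (real j * d) \<omega>) - real j * d\<bar>})"
    by (rule finite_measure_subadditive_finite) auto
  also have "\<dots> \<le> (\<Sum>j\<le>J. real j * d / d\<^sup>2)"
    using d by (intro sum_mono poisson_deviation[OF N]) auto
  also have "\<dots> = (\<Sum>j\<le>J. real j) / d" using d by (simp add: power2_eq_square sum_divide_distrib)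
  finally show ?thesis .
qed

lemma lipschitz_upto_continuous:
  assumes G: "lipschitz_upto K G" shows "continuous_on UNIV G"
proof -
  obtain L B where LB: "\<And>x y. \<bar>G x - G y\<bar> \<le> L * (\<Sum>k\<le>K. \<bar>x k - y k\<bar>)"
    using G unfolding lipschitz_upto_def by blast
  have "(G \<longlongrightarrow> G x) (at x)" for x
  proof (rule Lim_null_comparison[THEN Lim_null[THEN iffD2]])
    show "\<forall>\<^sub>F y in at x. norm (G y - G x) \<le> L * (\<Sum>k\<le>K. \<bar>y k - x k\<bar>)" using LB by simp
    have "continuous_on UNIV (\<lambda>y::nat \<Rightarrow> real. L * (\<Sum>k\<le>K. \<bar>y k - x k\<bar>))"
      by (intro continuous_intros continuous_on_product_coordinates)
    then have "((\<lambda>y. L * (\<Sum>k\<le>K. \<bar>y k - x k\<bar>)) \<longlongrightarrow> L * (\<Sum>k\<le>K. \<bar>x k - x k\<bar>)) (at x)"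
      unfolding continuous_on_def by blast
    then show "((\<lambda>y. L * (\<Sum>k\<le>K. \<bar>y k - x k\<bar>)) \<longlongrightarrow> 0) (at x)" by simp
  qed
  then show ?thesis by (simp add: continuous_on_def)
qed

lemma lipschitz_upto_measurable:
  assumes G: "lipschitz_upto K G" and f: "\<And>k. (\<lambda>\<omega>. f k \<omega>) \<in> borel_measurable M"
  shows "(\<lambda>\<omega>. G (\<lambda>k. f k \<omega>)) \<in> borel_measurable M"
  by (rule measurable_compose[OF measurable_coordinatewise_then_product borel_measurable_continuous_onI[OF lipschitz_upto_continuous[OF G]]])
    (rule f)

text \<open>N is constant on some interval to the right of L (a t). Continuity and monotonicity keep
  L (a s) in that interval, or equal to its left end, for s shortly after t.\<close>

lemma (in prob_space) subordinated_poisson_path: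
  assumes N: "unit_poisson_process M N" and L: "inverse_stable_subordinator M \<alpha> L" and \<alpha>: "0 < \<alpha>" and a: "0 < a"
  shows "AE \<omega> in M. time_changed N L (a * 0) \<omega> = 0 \<and> mono_on {0..} (\<lambda>t. time_changed N L (a * t) \<omega>) \<and>
    (\<forall>t\<ge>0. \<forall>\<^sub>F s in at_right t. time_changed N L (a * s) \<omega> = time_changed N L (a * t) \<omega>)"
  using poisson_path[OF N] inverse_stable_subordinator_paths[OF L \<alpha>]
proof eventually_elim
  case (elim \<omega>)
  have L: "L 0 \<omega> = 0" "mono_on {0..} (\<lambda>t. L t \<omega>)" "continuous_on {0..} (\<lambda>t. L t \<omega>)" using elim(2) by auto
  have N: "N 0 \<omega> = 0" "mono_on {0..} (\<lambda>t. N t \<omega>)" "\<And>t. t \<ge> 0 \<Longrightarrow> \<forall>\<^sub>F s in at_right t. N s \<omega> = N t \<omega>" using elim(1) by auto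
  have Lmono: "L (a * s) \<omega> \<le> L (a * t) \<omega>" if "0 \<le> s" "s \<le> t" for s t
    using a that by (intro mono_onD[OF L(2)]) auto
  have Lpos: "0 \<le> L (a * t) \<omega>" if "0 \<le> t" for t using Lmono[of 0 t] that L(1) by simp
  have "\<forall>\<^sub>F s in at_right t. N (L (a * s) \<omega>) \<omega> = N (L (a * t) \<omega>) \<omega>" if t: "t \<ge> 0" for t
  proof -
    obtain b where b: "b > L (a * t) \<omega>" "\<And>r. L (a * t) \<omega> < r \<Longrightarrow> r < b \<Longrightarrow> N r \<omega> = N (L (a * t) \<omega>) \<omega>"
      using N(3)[OF Lpos[OF t]] by (auto simp: eventually_at_right_field)
    have "continuous_on {0..} (\<lambda>s. L (a * s) \<omega>)"
      by (rule continuous_on_compose2[OF L(3)]) (use a in \<open>auto intro!: continuous_intros\<close>)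
    then have "((\<lambda>s. L (a * s) \<omega>) \<longlongrightarrow> L (a * t) \<omega>) (at t within {0..})" using t by (auto simp: continuous_on_def)
    then have "((\<lambda>s. L (a * s) \<omega>) \<longlongrightarrow> L (a * t) \<omega>) (at_right t)"
      by (rule tendsto_mono[rotated]) (use t in \<open>intro at_le; auto\<close>)
    then have "\<forall>\<^sub>F s in at_right t. L (a * s) \<omega> < b" using b(1) by (rule order_tendstoD)
    then show ?thesis using eventually_at_right_less[of t]
    proof eventually_elim
      case (elim s)
      then show ?case using Lmono[of t s] t b(2)[of "L (a * s) \<omega>"] by (cases "L (a * s) \<omega> = L (a * t) \<omega>") auto
    qed
  qed
  moreover have "mono_on {0..} (\<lambda>t. N (L (a * t) \<omega>) \<omega>)"
    using N(2) Lmono Lpos by (auto simp: mono_on_def)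
  ultimately show ?case using L(1) N(1) by (simp add: time_changed_def)
qed

lemma (in prob_space) tail_prob_small:
  fixes e :: real and X :: "'a \<Rightarrow> real"
  assumes X: "X \<in> borel_measurable M" and e: "e > 0"
  obtains A where "A > 0" "prob {\<omega> \<in> space M. A < X \<omega>} < e"
proof -
  note [measurable] = X
  interpret D: real_distribution "distr M borel X" by (rule real_distribution_distr) (rule X)
  have "\<forall>\<^sub>F A in at_top. 1 - e < cdf (distr M borel X) A"
    using D.cdf_lim_at_top_prob e by (intro order_tendstoD(1)) auto
  from eventually_happens[OF eventually_conj[OF this eventually_gt_at_top[of 0]]]
  obtain A where A: "1 - e < cdf (distr M borel X) A" "A > 0" by (auto simp: trivial_limit_at_top_linorder)
  have "cdf (distr M borel X) A = prob {\<omega> \<in> space M. X \<omega> \<le> A}"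
    unfolding cdf_def by (subst measure_distr) (auto intro!: arg_cong[of _ _ prob])
  moreover have "prob {\<omega> \<in> space M. A < X \<omega>} = 1 - prob {\<omega> \<in> space M. X \<omega> \<le> A}"
    by (subst prob_neg[symmetric]) (auto simp: not_le)
  ultimately show thesis using A by (intro that[of A]) auto
qed

lemma inverse_stable_scaling_integral:
  assumes M: "prob_space M" and M': "prob_space M'" and L: "inverse_stable_subordinator M \<alpha> L"
    and L': "inverse_stable_subordinator M' \<alpha> L'" and \<alpha>: "0 < \<alpha>"
    and Lm: "\<And>t. t \<ge> 0 \<Longrightarrow> L t \<in> borel_measurable M" and L'm: "\<And>t. t \<ge> 0 \<Longrightarrow> L' t \<in> borel_measurable M'"
    and t: "\<And>k. 0 \<le> t k" "\<And>k. t k \<le> t (Suc k)" and a: "a > 0"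
  shows "lipschitz_upto K G \<Longrightarrow> (\<integral>\<omega>. G (\<lambda>k. L (a * t k) \<omega> / a powr \<alpha>) \<partial>M) = (\<integral>\<omega>. G (\<lambda>k. L' (t k) \<omega>) \<partial>M')"
    and "measure M {\<omega> \<in> space M. A < L (a * t K) \<omega> / a powr \<alpha>} = measure M' {\<omega> \<in> space M'. A < L' (t K) \<omega>}"
proof -
  let ?P = "Pi\<^sub>M {..<Suc K} (\<lambda>_. borel :: real measure)"
  let ?F = "\<lambda>\<omega>. \<lambda>k\<in>{..<Suc K}. L (a * t k) \<omega> / a powr \<alpha>" and ?F' = "\<lambda>\<omega>. \<lambda>k\<in>{..<Suc K}. L' (t k) \<omega>"
  have [measurable]: "L (a * t k) \<in> borel_measurable M" "L' (t k) \<in> borel_measurable M'" for k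
    using a t by (auto intro!: Lm L'm)
  have F[measurable]: "?F \<in> M \<rightarrow>\<^sub>M ?P" "?F' \<in> M' \<rightarrow>\<^sub>M ?P" by measurable
  have eq: "distr M ?P ?F = distr M' ?P ?F'" by (rule inverse_stable_scaling[where t = t, OF M M' L L' \<alpha> Lm L'm t a]) auto
  {
    assume G: "lipschitz_upto K G"
    define g where "g z = G (\<lambda>k. if k < Suc K then z k else 0)" for z
    have loc: "G x = G y" if "\<forall>k\<le>K. x k = y k" for x y
    proof -
      obtain l B where "\<And>x y. \<bar>G x - G y\<bar> \<le> l * (\<Sum>k\<le>K. \<bar>x k - y k\<bar>)"
        using G unfolding lipschitz_upto_def by blast
      from this[of x y] show ?thesis using that by simp
    qed
    have "(\<lambda>z. if k < Suc K then z k else 0) \<in> borel_measurable ?P" for k by (cases "k < Suc K") auto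
    then have g: "g \<in> borel_measurable ?P" unfolding g_def by (rule lipschitz_upto_measurable[OF G])
    have "(\<integral>\<omega>. G (\<lambda>k. L (a * t k) \<omega> / a powr \<alpha>) \<partial>M) = (\<integral>\<omega>. g (?F \<omega>) \<partial>M)"
      unfolding g_def by (intro Bochner_Integration.integral_cong HOL.refl loc) auto
    also have "\<dots> = (\<integral>z. g z \<partial>distr M ?P ?F)" by (rule integral_distr[OF F(1) g, symmetric])
    also have "\<dots> = (\<integral>\<omega>. g (?F' \<omega>) \<partial>M')" unfolding eq by (rule integral_distr[OF F(2) g])
    also have "\<dots> = (\<integral>\<omega>. G (\<lambda>k. L' (t k) \<omega>) \<partial>M')"
      unfolding g_def by (intro Bochner_Integration.integral_cong HOL.refl loc) auto
    finally show "(\<integral>\<omega>. G (\<lambda>k. L (a * t k) \<omega> / a powr \<alpha>) \<partial>M) = (\<integral>\<omega>. G (\<lambda>k. L' (t k) \<omega>) \<partial>M')" .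
  }
  let ?S = "{z \<in> space ?P. A < z K}"
  have S: "?S \<in> sets ?P" by measurable
  have "measure M {\<omega> \<in> space M. A < L (a * t K) \<omega> / a powr \<alpha>} = measure (distr M ?P ?F) ?S"
    using S by (subst measure_distr[OF F(1) S]) (auto intro!: arg_cong[of _ _ "measure M"] simp: space_PiM)
  also have "\<dots> = measure M' {\<omega> \<in> space M'. A < L' (t K) \<omega>}"
    unfolding eq using S by (subst measure_distr[OF F(2) S]) (auto intro!: arg_cong[of _ _ "measure M'"] simp: space_PiM)
  finally show "measure M {\<omega> \<in> space M. A < L (a * t K) \<omega> / a powr \<alpha>} = measure M' {\<omega> \<in> space M'. A < L' (t K) \<omega>}" .
qed

text \<open>The rescaled clock \<open>D\<close> is compared with \<open>E\<close>, the rescaled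
  inverse, whose functional has the same integral as that of L' for every n > 0 by
  \<open>inverse_stable_scaling_integral\<close>. \<open>S1\<close> is the event that the Poisson
  process strays at a grid point, and \<open>S2\<close> that \<open>E\<close> exceeds the range
  covered by the grid; off both, \<open>D\<close> and \<open>E\<close> differ by at most \<epsilon>
  in each coordinate, almost surely.\<close>

lemma subordinated_poisson_tendsto:
  assumes M: "prob_space M" and M': "prob_space M'" and N: "unit_poisson_process M N"
    and L: "inverse_stable_subordinator M \<alpha> L" and L': "inverse_stable_subordinator M' \<alpha> L'" and \<alpha>: "0 < \<alpha>"
    and Lm: "\<And>t. t \<ge> 0 \<Longrightarrow> L t \<in> borel_measurable M" and L'm: "\<And>t. t \<ge> 0 \<Longrightarrow> L' t \<in> borel_measurable M'"
    and NLm: "\<And>t. t \<ge> 0 \<Longrightarrow> time_changed N L t \<in> M \<rightarrow>\<^sub>M count_space UNIV"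
    and t: "\<And>k. 0 \<le> t k" "\<And>k. t k \<le> t (Suc k)" and G: "lipschitz_upto K G"
  shows "(\<lambda>n. \<integral>\<omega>. G (\<lambda>k. real (time_changed N L (real n * t k) \<omega>) / real n powr \<alpha>) \<partial>M)
    \<longlonglongrightarrow> (\<integral>\<omega>. G (\<lambda>k. L' (t k) \<omega>) \<partial>M')"
proof (rule LIMSEQ_I)
  interpret M: prob_space M by fact
  interpret M': prob_space M' by fact
  fix \<eta> :: real assume \<eta>: "\<eta> > 0"
  obtain l0 B where l0: "\<And>x y. \<bar>G x\<bar> \<le> B \<and> \<bar>G x - G y\<bar> \<le> l0 * (\<Sum>k\<le>K. \<bar>x k - y k\<bar>)"
    using G unfolding lipschitz_upto_def by blast
  define l where "l = max l0 0"
  have l: "0 \<le> l" "\<And>x y. \<bar>G x - G y\<bar> \<le> l * (\<Sum>k\<le>K. \<bar>x k - y k\<bar>)"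
  proof -
    fix x y :: "nat \<Rightarrow> real"
    have "l0 * (\<Sum>k\<le>K. \<bar>x k - y k\<bar>) \<le> l * (\<Sum>k\<le>K. \<bar>x k - y k\<bar>)"
      unfolding l_def by (intro mult_right_mono sum_nonneg) auto
    then show "\<bar>G x - G y\<bar> \<le> l * (\<Sum>k\<le>K. \<bar>x k - y k\<bar>)" using l0[of x y] by linarith
  qed (simp add: l_def)
  have GB: "\<bar>G x\<bar> \<le> B" for x using l0 by blast
  then have B: "0 \<le> B" using abs_ge_zero order_trans by blast
  define q where "q = l * (real K + 1)"
  have q: "0 \<le> q" using l by (simp add: q_def)
  define \<epsilon> where "\<epsilon> = \<eta> / (4 * (q + 1))"
  have \<epsilon>: "\<epsilon> > 0" using \<eta> q by (simp add: \<epsilon>_def)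
  have q\<epsilon>: "q * \<epsilon> < \<eta> / 2"
  proof -
    have "q * \<epsilon> = (q / (q + 1)) * (\<eta> / 4)" using q by (simp add: \<epsilon>_def)
    also have "\<dots> \<le> 1 * (\<eta> / 4)" using q \<eta> by (intro mult_right_mono) auto
    also have "\<dots> < \<eta> / 2" using \<eta> by simp
    finally show ?thesis .
  qed
  \<comment> \<open>Budget: q \<epsilon> < \<eta> / 2 off the exceptional events, and 2 B \<rho>
    \<le> \<eta> / 4 for each of \<open>S1\<close> and \<open>S2\<close>. The divisor B + 1 is
    positive even if B = 0.\<close>
  define \<rho> where "\<rho> = \<eta> / 8 / (B + 1)"
  have B1: "B + 1 > 0" using B by simp
  have \<rho>: "\<rho> > 0" "2 * B * \<rho> \<le> \<eta> / 4"
  proof -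
    show "\<rho> > 0" using \<eta> B1 by (simp add: \<rho>_def)
    then have "2 * B * \<rho> \<le> 2 * ((B + 1) * \<rho>)" by (simp add: algebra_simps)
    also have "(B + 1) * \<rho> = \<eta> / 8"
      unfolding \<rho>_def times_divide_eq_right[of _ "\<eta> / 8"] using B1 by (intro nonzero_mult_div_cancel_left) simp
    finally show "2 * B * \<rho> \<le> \<eta> / 4" by simp
  qed
  obtain A where A: "A > 0" "M'.prob {\<omega> \<in> space M'. A < L' (t K) \<omega>} < \<rho>"
    by (rule M'.tail_prob_small[OF L'm[OF t(1)] \<rho>(1)])
  \<comment> \<open>\<open>grid_sandwich\<close> gives twice the mesh h c, which after division by c
    is 2 h = \<epsilon>. The number J of grid points stays fixed while the mesh grows with n, so the
    bound of \<open>poisson_grid\<close> tends to 0.\<close>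
  define h where "h = \<epsilon> / 2"
  have h: "h > 0" using \<epsilon> by (simp add: h_def)
  obtain J :: nat where "A / h < real J" using reals_Archimedean2 by blast
  then have J: "A < real J * h" using h by (simp add: field_simps)
  have "(\<lambda>n. a / (h * real n powr \<alpha>)) \<longlonglongrightarrow> 0" for a
    using h \<alpha> by real_asymp
  then have "\<forall>\<^sub>F n in sequentially. (\<Sum>j\<le>J. real j) / (h * real n powr \<alpha>) < \<rho>"
    using \<rho>(1) by (rule order_tendstoD)
  then have "\<forall>\<^sub>F n in sequentially. norm ((\<integral>\<omega>. G (\<lambda>k. real (time_changed N L (real n * t k) \<omega>) / real n powr \<alpha>) \<partial>M) -
    (\<integral>\<omega>. G (\<lambda>k. L' (t k) \<omega>) \<partial>M')) < \<eta>"
    using eventually_gt_at_top[of 0]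
  proof eventually_elim
    case (elim n)
    define c where "c = real n powr \<alpha>"
    have n: "real n > 0" and c: "c > 0" using elim by (auto simp: c_def)
    define D where "D k \<omega> = real (time_changed N L (real n * t k) \<omega>) / c" for k \<omega>
    define E where "E k \<omega> = L (real n * t k) \<omega> / c" for k \<omega>
    define S1 where "S1 = {\<omega> \<in> space M. \<exists>j\<le>J. h * c < \<bar>real (N (real j * (h * c)) \<omega>) - real j * (h * c)\<bar>}"
    define S2 where "S2 = {\<omega> \<in> space M. A < E K \<omega>}"
    have nt: "0 \<le> real n * t k" for k using t n by simp
    have [measurable]: "time_changed N L (real n * t k) \<in> M \<rightarrow>\<^sub>M count_space UNIV" for k by (rule NLm[OF nt])
    have Dm[measurable]: "(\<lambda>\<omega>. D k \<omega>) \<in> borel_measurable M" for k unfolding D_def by measurable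
    have [measurable]: "L (real n * t k) \<in> borel_measurable M" for k by (rule Lm[OF nt])
    have Em[measurable]: "(\<lambda>\<omega>. E k \<omega>) \<in> borel_measurable M" for k unfolding E_def by measurable
    have GD: "(\<lambda>\<omega>. G (\<lambda>k. D k \<omega>)) \<in> borel_measurable M" and GE: "(\<lambda>\<omega>. G (\<lambda>k. E k \<omega>)) \<in> borel_measurable M"
      by (rule lipschitz_upto_measurable[OF G] Dm Em)+
    have hc: "h * c > 0" using h c by simp
    have [measurable]: "N (real j * (h * c)) \<in> M \<rightarrow>\<^sub>M count_space UNIV" for j :: nat
      using N hc by (auto simp: unit_poisson_process_def)
    have S1[measurable]: "S1 \<in> sets M" unfolding S1_def by measurable
    have S2[measurable]: "S2 \<in> sets M" unfolding S2_def by measurable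
    have P1: "M.prob S1 < \<rho>"
      using M.poisson_grid[OF N hc, of J] elim(1) unfolding S1_def c_def by linarith
    have P2: "M.prob S2 < \<rho>"
      using inverse_stable_scaling_integral(2)[where t = t, OF M M' L L' \<alpha> Lm L'm t n, of A K] A(2)
      unfolding S2_def E_def c_def by simp
    have iD: "integrable M (\<lambda>\<omega>. G (\<lambda>k. D k \<omega>))" and iE: "integrable M (\<lambda>\<omega>. G (\<lambda>k. E k \<omega>))"
      using GD GE by (auto intro!: M.integrable_const_bound[of _ B] simp: GB)
    have "\<bar>(\<integral>\<omega>. G (\<lambda>k. D k \<omega>) \<partial>M) - (\<integral>\<omega>. G (\<lambda>k. E k \<omega>) \<partial>M)\<bar> = \<bar>\<integral>\<omega>. G (\<lambda>k. D k \<omega>) - G (\<lambda>k. E k \<omega>) \<partial>M\<bar>"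
      using iD iE by simp
    also have "\<dots> \<le> (\<integral>\<omega>. \<bar>G (\<lambda>k. D k \<omega>) - G (\<lambda>k. E k \<omega>)\<bar> \<partial>M)" by (rule integral_abs_bound)
    also have "\<dots> \<le> (\<integral>\<omega>. q * \<epsilon> + (2 * B * indicat_real S1 \<omega> + 2 * B * indicat_real S2 \<omega>) \<partial>M)"
    proof (rule integral_mono_AE)
      show "integrable M (\<lambda>\<omega>. \<bar>G (\<lambda>k. D k \<omega>) - G (\<lambda>k. E k \<omega>)\<bar>)" using iD iE by simp
      show "integrable M (\<lambda>\<omega>. q * \<epsilon> + (2 * B * indicat_real S1 \<omega> + 2 * B * indicat_real S2 \<omega>))"
        by (auto intro!: Bochner_Integration.integrable_add integrable_mult_right integrable_real_indicator simp: less_top[symmetric])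
      show "AE \<omega> in M. \<bar>G (\<lambda>k. D k \<omega>) - G (\<lambda>k. E k \<omega>)\<bar> \<le> q * \<epsilon> + (2 * B * indicat_real S1 \<omega> + 2 * B * indicat_real S2 \<omega>)"
        using M.poisson_path[OF N] M.inverse_stable_subordinator_paths[OF L \<alpha>] AE_space
      proof eventually_elim
        case (elim \<omega>)
        have triv: "\<bar>G (\<lambda>k. D k \<omega>) - G (\<lambda>k. E k \<omega>)\<bar> \<le> 2 * B"
          using GB[of "\<lambda>k. D k \<omega>"] GB[of "\<lambda>k. E k \<omega>"] by linarith
        have qe0: "0 \<le> q * \<epsilon>" using q \<epsilon> by simp
        show ?case
        proof (cases "\<omega> \<in> S1 \<or> \<omega> \<in> S2")
          case True
          have "2 * B \<le> 2 * B * indicat_real S1 \<omega> + 2 * B * indicat_real S2 \<omega>"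
            using True B by (auto simp: indicator_def)
          then show ?thesis using triv qe0 by linarith
        next
          case False
          have grid: "\<bar>real (N (real j * (h * c)) \<omega>) - real j * (h * c)\<bar> \<le> h * c" if "j \<le> J" for j
            using False elim(3) that by (auto simp: S1_def not_less)
          have EK: "E K \<omega> \<le> A" using False elim(3) by (auto simp: S2_def not_less)
          have "\<bar>D k \<omega> - E k \<omega>\<bar> \<le> \<epsilon>" if k: "k \<le> K" for k
          proof -
            define s where "s = L (real n * t k) \<omega>"
            have tk: "t k \<le> t K" by (rule lift_Suc_mono_le[of t, OF t(2) k])
            have "L 0 \<omega> \<le> s" unfolding s_def using elim nt by (intro mono_onD[of "{0..}" "\<lambda>t. L t \<omega>"]) auto
            then have s0: "0 \<le> s" using elim by simp
            have "s \<le> L (real n * t K) \<omega>" unfolding s_def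
              using elim nt tk n by (intro mono_onD[of "{0..}" "\<lambda>t. L t \<omega>"]) auto
            also have "\<dots> \<le> A * c" using EK c by (simp add: E_def field_simps)
            also have "\<dots> < real J * h * c" using J c by simp
            finally have s1: "s < real J * (h * c)" by (simp add: mult_ac)
            have "\<bar>real (N s \<omega>) - s\<bar> \<le> 2 * (h * c)"
              using grid_sandwich[of "\<lambda>t. N t \<omega>" "h * c" J s] elim hc grid s0 s1 by auto
            also have "2 * (h * c) = \<epsilon> * c" by (simp add: h_def)
            finally have "\<bar>real (N s \<omega>) - s\<bar> / c \<le> \<epsilon>" using c by (simp add: field_simps)
            then show ?thesis using c by (simp add: D_def E_def time_changed_def s_def flip: diff_divide_distrib)
          qed
          then have "(\<Sum>k\<le>K. \<bar>D k \<omega> - E k \<omega>\<bar>) \<le> (\<Sum>k\<le>K. \<epsilon>)" by (intro sum_mono) auto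
          then have "l * (\<Sum>k\<le>K. \<bar>D k \<omega> - E k \<omega>\<bar>) \<le> l * (\<Sum>k\<le>K. \<epsilon>)" using l(1) by (rule mult_left_mono)
          also have "\<dots> = q * \<epsilon>" by (simp add: q_def algebra_simps)
          finally have "\<bar>G (\<lambda>k. D k \<omega>) - G (\<lambda>k. E k \<omega>)\<bar> \<le> q * \<epsilon>"
            using l(2)[of "\<lambda>k. D k \<omega>" "\<lambda>k. E k \<omega>"] by linarith
          then show ?thesis using False by simp
        qed
      qed
    qed
    also have "\<dots> = q * \<epsilon> + (2 * B * M.prob S1 + 2 * B * M.prob S2)"
      by (simp add: M.prob_space integrable_real_indicator less_top[symmetric])
    also have "\<dots> \<le> q * \<epsilon> + (2 * B * \<rho> + 2 * B * \<rho>)"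
      using P1 P2 B by (intro add_left_mono add_mono mult_left_mono) auto
    also have "\<dots> < \<eta>" using q\<epsilon> \<rho>(2) by linarith
    also have "(\<integral>\<omega>. G (\<lambda>k. E k \<omega>) \<partial>M) = (\<integral>\<omega>. G (\<lambda>k. L' (t k) \<omega>) \<partial>M')"
      unfolding E_def c_def by (rule inverse_stable_scaling_integral(1)[where t = t, OF M M' L L' \<alpha> Lm L'm t n G])
    finally show ?case by (simp add: D_def c_def)
  qed
  then show "\<exists>no. \<forall>n\<ge>no. norm ((\<integral>\<omega>. G (\<lambda>k. real (time_changed N L (real n * t k) \<omega>) / real n powr \<alpha>) \<partial>M) -
    (\<integral>\<omega>. G (\<lambda>k. L' (t k) \<omega>) \<partial>M')) < \<eta>"
    by (simp add: eventually_sequentially)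
qed

section \<open>Eigenvalue processes\<close>

lemma standardized_array_exists:
  assumes M: "prob_space M" and indep: "prob_space.indep_vars M (\<lambda>_. borel) (\<lambda>(i, k). X i k) (UNIV \<times> {1..})"
    and mean: "\<And>i k. k \<ge> 1 \<Longrightarrow> integrable M (X i k) \<and> (\<integral>\<omega>. X i k \<omega> \<partial>M) = 0"
    and variance: "\<And>i k. k \<ge> 1 \<Longrightarrow> prob_space.variance M (X i k) = 1"
    and moments: "\<And>l. l \<ge> (3::nat) \<Longrightarrow>
           \<exists>C. \<forall>i. \<forall>k\<ge>1. integrable M (\<lambda>\<omega>. \<bar>X i k \<omega>\<bar> ^ l) \<and> (\<integral>\<omega>. \<bar>X i k \<omega>\<bar> ^ l \<partial>M) \<le> C"
  obtains K3 K4 where "standardized_array M X K3 K4"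
proof -
  obtain K3 where K3: "\<And>i k. k \<ge> 1 \<Longrightarrow> (\<integral>\<omega>. \<bar>X i k \<omega>\<bar> ^ 3 \<partial>M) \<le> K3" using moments[of 3] by auto
  obtain K4 where K4: "\<And>i k. k \<ge> 1 \<Longrightarrow> integrable M (\<lambda>\<omega>. \<bar>X i k \<omega>\<bar> ^ 4) \<and> (\<integral>\<omega>. \<bar>X i k \<omega>\<bar> ^ 4 \<partial>M) \<le> K4"
    using moments[of 4] by auto
  have "\<bar>x\<bar> ^ 4 = x ^ 4" for x :: real by (simp add: power_even_abs)
  then have "standardized_array M X K3 K4"
    using M indep mean variance K3 K4 unfolding standardized_array_def standardized_array_axioms_def by simp
  then show thesis by (rule that)
qed

lemma floor_clock_tendsto:
  fixes t :: real
  assumes t: "0 \<le> t" shows "(\<lambda>n. real (nat \<lfloor>real n * t\<rfloor>) / real n) \<longlonglongrightarrow> t"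
proof (rule tendsto_sandwich)
  show "(\<lambda>n. t - 1 / real n) \<longlonglongrightarrow> t" by real_asymp
  show "\<forall>\<^sub>F n in sequentially. t - 1 / real n \<le> real (nat \<lfloor>real n * t\<rfloor>) / real n"
    using eventually_gt_at_top[of 0]
  proof eventually_elim
    case (elim n)
    have "real n * t - 1 \<le> real (nat \<lfloor>real n * t\<rfloor>)" by linarith
    then show ?case using elim by (simp add: pos_le_divide_eq left_diff_distrib right_diff_distrib mult.commute)
  qed
  show "\<forall>\<^sub>F n in sequentially. real (nat \<lfloor>real n * t\<rfloor>) / real n \<le> t"
    using eventually_gt_at_top[of 0]
  proof eventually_elim
    case (elim n)
    have "real (nat \<lfloor>real n * t\<rfloor>) \<le> real n * t" using t by simp
    then show ?case using elim by (simp add: field_simps)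
  qed
qed simp

lemma floor_clock_integral_tendsto:
  assumes M: "prob_space M" and M': "prob_space M'" and t: "\<And>k. 0 \<le> t k" and G: "lipschitz_upto K G"
  shows "(\<lambda>n. \<integral>\<omega>. G (\<lambda>k. real (nat \<lfloor>real n * t k\<rfloor>) / real n) \<partial>M) \<longlonglongrightarrow> (\<integral>\<omega>. G t \<partial>M')"
proof -
  interpret M: prob_space M by fact
  interpret M': prob_space M' by fact
  obtain l B where l: "\<And>x y. \<bar>G x - G y\<bar> \<le> l * (\<Sum>k\<le>K. \<bar>x k - y k\<bar>)"
    using G unfolding lipschitz_upto_def by blast
  have "(\<lambda>n. G (\<lambda>k. real (nat \<lfloor>real n * t k\<rfloor>) / real n)) \<longlonglongrightarrow> G t"
  proof (rule Lim_null_comparison[THEN Lim_null[THEN iffD2]])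
    show "\<forall>\<^sub>F n in sequentially. norm (G (\<lambda>k. real (nat \<lfloor>real n * t k\<rfloor>) / real n) - G t) \<le>
        l * (\<Sum>k\<le>K. \<bar>real (nat \<lfloor>real n * t k\<rfloor>) / real n - t k\<bar>)"
      using l by simp
    have "(\<lambda>n. l * (\<Sum>k\<le>K. \<bar>real (nat \<lfloor>real n * t k\<rfloor>) / real n - t k\<bar>)) \<longlonglongrightarrow> l * (\<Sum>k\<le>K. \<bar>t k - t k\<bar>)"
      by (intro tendsto_intros floor_clock_tendsto t)
    then show "(\<lambda>n. l * (\<Sum>k\<le>K. \<bar>real (nat \<lfloor>real n * t k\<rfloor>) / real n - t k\<bar>)) \<longlonglongrightarrow> 0" by simp
  qed
  then show ?thesis by (simp add: M.prob_space M'.prob_space)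
qed

lemma cbm_paths:
  assumes M: "prob_space M" and B: "standard_brownian_motion M B1" "standard_brownian_motion M B2"
  shows "\<And>t. t \<ge> 0 \<Longrightarrow> cbm B1 B2 t \<in> borel_measurable M" "AE \<omega> in M. continuous_on {0..} (\<lambda>t. cbm B1 B2 t \<omega>)"
    "AE \<omega> in M. cbm B1 B2 0 \<omega> = 0"
proof -
  have Y: "levy_process M B1" "levy_process M B2" using B by (simp_all add: standard_brownian_motion_def)
  show "cbm B1 B2 t \<in> borel_measurable M" if t: "t \<ge> 0" for t
  proof -
    note [measurable] = levy_processD(1)[OF Y(1) t] levy_processD(1)[OF Y(2) t]
    show ?thesis unfolding cbm_def[abs_def] by measurable
  qed
  have "AE \<omega> in M. continuous_on {0..} (\<lambda>t. B1 t \<omega>)" "AE \<omega> in M. continuous_on {0..} (\<lambda>t. B2 t \<omega>)"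
    using B by (simp_all add: standard_brownian_motion_def)
  then show "AE \<omega> in M. continuous_on {0..} (\<lambda>t. cbm B1 B2 t \<omega>)"
    by eventually_elim (auto simp: cbm_def intro!: continuous_intros)
  show "AE \<omega> in M. cbm B1 B2 0 \<omega> = 0"
    using levy_processD(2)[OF Y(1)] levy_processD(2)[OF Y(2)] by eventually_elim (simp add: cbm_def)
qed

lemma sample_path_component_measurable:
  assumes "sample_path Y \<in> M \<rightarrow>\<^sub>M Pi\<^sub>M {0..} (\<lambda>_. K)" and t: "t \<ge> 0" shows "Y t \<in> M \<rightarrow>\<^sub>M K"
proof -
  have "(\<lambda>\<omega>. sample_path Y \<omega> t) \<in> M \<rightarrow>\<^sub>M K"
    by (rule measurable_compose[OF assms(1) measurable_component_singleton]) (use t in simp)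
  then show ?thesis using t by (simp add: sample_path_def)
qed

theorem theorem5p2:
  fixes \<alpha> :: real
    and M :: "'a measure" and M' :: "'b measure"
    and X :: "nat \<Rightarrow> nat \<Rightarrow> 'a \<Rightarrow> real"
    and N :: "real \<Rightarrow> 'a \<Rightarrow> nat" and L :: "real \<Rightarrow> 'a \<Rightarrow> real" and U :: "nat \<Rightarrow> 'a \<Rightarrow> nat"
    and B1 B2 L' :: "real \<Rightarrow> 'b \<Rightarrow> real"
  assumes "0 < \<alpha>" "\<alpha> \<le> 1"
    and "prob_space M"
    and "prob_space.indep_vars M (\<lambda>_. borel) (\<lambda>(i, k). X i k) (UNIV \<times> {1..})"
    and "\<And>i k. k \<ge> 1 \<Longrightarrow> integrable M (X i k) \<and> (\<integral>\<omega>. X i k \<omega> \<partial>M) = 0"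
    and "\<And>i k. k \<ge> 1 \<Longrightarrow> prob_space.variance M (X i k) = 1"
    and "\<And>l. l \<ge> (3::nat) \<Longrightarrow>
           \<exists>C. \<forall>i. \<forall>k\<ge>1. integrable M (\<lambda>\<omega>. \<bar>X i k \<omega>\<bar> ^ l) \<and> (\<integral>\<omega>. \<bar>X i k \<omega>\<bar> ^ l \<partial>M) \<le> C"
    and "unit_poisson_process M N" and "inverse_stable_subordinator M \<alpha> L"
    and "independent_elements M path_algebra (sample_path N) path_algebra (sample_path L)"
    and "independent_elements M
           (Pi\<^sub>M (UNIV \<times> {1..}) (\<lambda>_. borel)) (\<lambda>\<omega>. \<lambda>(i, k)\<in>UNIV \<times> {1..}. X i k \<omega>)
           path_algebra (sample_path (time_changed N L))"
    and "\<And>n. n \<ge> 1 \<Longrightarrow> distr M (count_space UNIV) (U n) = measure_pmf (pmf_of_set {..<n})"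
    and "\<And>n. n \<ge> 1 \<Longrightarrow> independent_elements M (count_space UNIV) (U n)
           (Pi\<^sub>M (UNIV \<times> {1..}) (\<lambda>_. borel) \<Otimes>\<^sub>M path_algebra)
           (\<lambda>\<omega>. (\<lambda>(i, k)\<in>UNIV \<times> {1..}. X i k \<omega>, sample_path (time_changed N L) \<omega>))"
    and "prob_space M'"
    and "standard_brownian_motion M' B1" and "standard_brownian_motion M' B2"
    and "independent_elements M' path_algebra (sample_path B1) path_algebra (sample_path B2)"
    and "inverse_stable_subordinator M' \<alpha> L'"
    and "independent_elements M' path_algebra (sample_path (cbm B1 B2)) path_algebra (sample_path L')"
  shows "converges_weakly_J1 M
           (\<lambda>n t \<omega>. (1 / real n) *\<^sub>R
              circulant_eigenvalue n (\<lambda>j. walk X j (nat \<lfloor>real n * t\<rfloor>) \<omega>) (U n \<omega>))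
           M' (cbm B1 B2)
       \<and> converges_weakly_J1 M
           (\<lambda>n t \<omega>. real n powr (- (1 + \<alpha>) / 2) *\<^sub>R
              circulant_eigenvalue n (\<lambda>j. walk X j (time_changed N L (real n * t) \<omega>) \<omega>) (U n \<omega>))
           M' (time_changed (cbm B1 B2) L')"
proof -
  note \<alpha> = assms(1) and M = assms(3) and N = assms(8) and L = assms(9) and U = assms(12)
  note M' = assms(14) and B = assms(15,16) and iB = assms(17) and L' = assms(18) and iL' = assms(19)
  interpret M: prob_space M by fact
  interpret M': prob_space M' by fact
  obtain K3 K4 where "standardized_array M X K3 K4"
    by (rule standardized_array_exists[OF assms(3-7)])
  then interpret A: standardized_array M X K3 K4 .
  define F where "F \<omega> = (\<lambda>(i, k)\<in>UNIV \<times> {1..}. X i k \<omega>)" for \<omega>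
  \<comment> \<open>The index U n is given as independent of array and clock together; the locale
    needs the array independent of index and clock together.\<close>
  have rot: "independent_elements M array_space F (count_space UNIV \<Otimes>\<^sub>M path_algebra)
      (\<lambda>\<omega>. (U n \<omega>, sample_path (time_changed N L) \<omega>))" if "n \<ge> 1" for n
    unfolding F_def by (rule independent_elements_rotate[OF M assms(13)[OF that] assms(11)])
  \<comment> \<open>At stage n the clock is an image of the path p of
    \<open>time_changed N L\<close>: the path t \<mapsto> p (n t) in one case, and in the other the
    deterministic floor clock, for which g is constant.\<close>
  have clock_indep: "independent_elements M array_space F (count_space UNIV \<Otimes>\<^sub>M path_algebra) (\<lambda>\<omega>. (U n \<omega>, g (sample_path (time_changed N L) \<omega>)))"
    if "n \<ge> 1" and g: "g \<in> path_algebra \<rightarrow>\<^sub>M path_algebra" for n and g :: "(real \<Rightarrow> nat) \<Rightarrow> real \<Rightarrow> nat"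
  proof -
    have "(\<lambda>p. (fst p, g (snd p))) \<in> count_space UNIV \<Otimes>\<^sub>M path_algebra \<rightarrow>\<^sub>M (count_space UNIV :: nat measure) \<Otimes>\<^sub>M path_algebra"
      using g by measurable
    from independent_elements_compose[OF M rot[OF that(1)] measurable_ident this] show ?thesis by simp
  qed
  have Lm: "L t \<in> borel_measurable M" if "t \<ge> 0" for t
    by (rule sample_path_component_measurable[OF independent_elementsD(2)[OF M assms(10)] that])
  have L'm: "L' t \<in> borel_measurable M'" if "t \<ge> 0" for t
    by (rule sample_path_component_measurable[OF independent_elementsD(2)[OF M' iL'] that])
  have NLm: "time_changed N L t \<in> M \<rightarrow>\<^sub>M count_space UNIV" if "t \<ge> 0" for t
    using sample_path_component_measurable[OF independent_elementsD(2)[OF M assms(11)] that]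
    by (simp only: measurable_borel_nat)
  note W = cbm_paths[OF M' B] and L'_paths = M'.inverse_stable_subordinator_paths[OF L' \<alpha>]
  have grid: "0 \<le> real k / real N" "real k / real N \<le> real (Suc k) / real N" for k N :: nat
    by (simp_all add: divide_right_mono)

  \<comment> \<open>The deterministic case: the limit clock is \<Lambda> t = t, and the scale is 1 /
    sqrt (n * n).\<close>
  interpret C1: circulant_clock_limit M X K3 K4 U "\<lambda>n t \<omega>. nat \<lfloor>real n * t\<rfloor>" "\<lambda>n. real n" M' "\<lambda>t \<omega>. t" "cbm B1 B2"
  proof (unfold_locales, goal_cases)
    case (1 n)
    then show ?case by (rule U)
  next
    case (2 n)
    have "(\<lambda>p. \<lambda>t\<in>{0..}. nat \<lfloor>real n * t\<rfloor>) \<in> path_algebra \<rightarrow>\<^sub>M (path_algebra :: (real \<Rightarrow> nat) measure)"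
      by (intro measurable_restrict) simp
    from clock_indep[OF 2 this] show ?case unfolding F_def by (simp add: sample_path_def)
  next
    case (3 n)
    have "mono_on {0..} (\<lambda>t. nat \<lfloor>real n * t\<rfloor>)"
      by (intro mono_onI nat_mono floor_mono mult_left_mono) auto
    moreover have "\<forall>\<^sub>F s in at_right t. nat \<lfloor>real n * s\<rfloor> = nat \<lfloor>real n * t\<rfloor>" for t
      using floor_mult_at_right[of n t] 3 by (auto elim: eventually_mono)
    ultimately show ?case by simp
  next
    case (4 n)
    then show ?case by simp
  next
    case 5
    show ?case by (rule filterlim_real_sequentially)
  next
    case (6 t)
    then show ?case by (rule W)
  next
    case 7
    show ?case by (rule W)
  next
    case 8
    show ?case by (rule W)
  next
    case (9 t)
    show ?case by simp
  next
    case 10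
    show ?case by (simp add: mono_on_def continuous_on_id)
  next
    case (11 N K \<theta> \<phi>)
    show ?case
      using cbm_char[OF M' B iB, where l = "\<lambda>k. real k / real N" and K = K and \<theta> = \<theta> and \<phi> = \<phi>] grid by (simp add: M'.prob_space)
  next
    case (12 N K G)
    show ?case by (rule floor_clock_integral_tendsto[OF M M' grid(1) 12(2)])
  qed
  have "C1.scale n = 1 / real n" for n by (simp add: C1.scale_def)
  then have 1: "converges_weakly_J1 M (\<lambda>n t \<omega>. (1 / real n) *\<^sub>R
      circulant_eigenvalue n (\<lambda>j. walk X j (nat \<lfloor>real n * t\<rfloor>) \<omega>) (U n \<omega>)) M' (cbm B1 B2)"
    using C1.Z_converges_weakly by (simp add: C1.Z_def[abs_def])

  have L'0: "AE \<omega> in M'. \<forall>t\<ge>0. 0 \<le> L' t \<omega>"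
    using L'_paths
  proof eventually_elim
    case (elim \<omega>)
    then show ?case using mono_onD[of "{0..}" "\<lambda>t. L' t \<omega>" 0] by auto
  qed
  \<comment> \<open>The locale asks for measurability at each fixed time, so the time-changed
    Brownian motion is replaced by a version until the last step.\<close>
  obtain Y where Y: "\<And>t. t \<ge> 0 \<Longrightarrow> Y t \<in> borel_measurable M'" "AE \<omega> in M'. \<forall>t\<ge>0. Y t \<omega> = cbm B1 B2 (L' t \<omega>) \<omega>"
    by (rule time_changed_version[OF W(1,2) L'm L'0]) (assumption | rule that)+
  interpret C2: circulant_clock_limit M X K3 K4 U "\<lambda>n t \<omega>. time_changed N L (real n * t) \<omega>" "\<lambda>n. real n powr \<alpha>" M' L' Y
  proof (unfold_locales, goal_cases)
    case (1 n)
    then show ?case by (rule U)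
  next
    case (2 n)
    have "(\<lambda>p. \<lambda>t\<in>{0..}. p (real n * t)) \<in> path_algebra \<rightarrow>\<^sub>M (path_algebra :: (real \<Rightarrow> nat) measure)"
      by (intro measurable_restrict measurable_component_singleton) simp
    from clock_indep[OF 2 this] show ?case unfolding F_def by (simp add: sample_path_def cong: restrict_cong)
  next
    case (3 n)
    then show ?case using M.subordinated_poisson_path[OF N L \<alpha>, of "real n"] by simp
  next
    case (4 n)
    then show ?case by simp
  next
    case 5
    show ?case using \<alpha> by real_asymp
  next
    case (6 t)
    then show ?case by (rule Y)
  next
    case 7
    show ?case using Y(2) W(2) L'_paths L'0
    proof eventually_elim
      case (elim \<omega>)
      have "continuous_on {0..} (\<lambda>t. cbm B1 B2 (L' t \<omega>) \<omega>)"
        by (rule continuous_on_compose2[OF elim(2)]) (use elim in auto)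
      then show ?case by (rule continuous_on_eq) (use elim in auto)
    qed
  next
    case 8
    show ?case using Y(2) W(3) L'_paths by eventually_elim simp
  next
    case (9 t)
    then show ?case by (rule L'm)
  next
    case 10
    show ?case by (rule L'_paths)
  next
    case (11 N K \<theta> \<phi>)
    have "AE \<omega> in M'. L' 0 \<omega> = 0 \<and> mono_on {0..} (\<lambda>t. L' t \<omega>)" using L'_paths by eventually_elim simp
    from cbm_clock_char[OF M' B iB iL' this Y, where t = "\<lambda>k. real k / real N" and K = K and \<theta> = \<theta> and \<phi> = \<phi>] show ?case using grid by simp
  next
    case (12 N' K G)
    show ?case
      by (rule subordinated_poisson_tendsto[where t = "\<lambda>k. real k / real N'", OF M M' N L L' \<alpha> Lm L'm NLm grid 12(2)])
  qed
  \<comment> \<open>The exponent comes from (n * n^\<alpha>)^(-1/2). At n = 0 both sides are 0,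
    since 0 powr x = 0 and 1 / 0 = 0.\<close>
  have "C2.scale n = real n powr (- (1 + \<alpha>) / 2)" for n
  proof (cases "n = 0")
    case False
    then have "real n * real n powr \<alpha> = real n powr (1 + \<alpha>)" by (simp add: powr_add)
    then have "C2.scale n = 1 / real n powr ((1 + \<alpha>) / 2)"
      using False by (simp add: C2.scale_def powr_half_sqrt[symmetric] powr_powr)
    also have "\<dots> = real n powr (- ((1 + \<alpha>) / 2))" by (rule powr_minus_divide[symmetric])
    finally show ?thesis by (simp only: minus_divide_left)
  qed (simp add: C2.scale_def)
  then have "converges_weakly_J1 M (\<lambda>n t \<omega>. real n powr (- (1 + \<alpha>) / 2) *\<^sub>R
      circulant_eigenvalue n (\<lambda>j. walk X j (time_changed N L (real n * t) \<omega>) \<omega>) (U n \<omega>)) M' Y"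
    using C2.Z_converges_weakly by (simp add: C2.Z_def[abs_def])
  then have "converges_weakly_J1 M (\<lambda>n t \<omega>. real n powr (- (1 + \<alpha>) / 2) *\<^sub>R
      circulant_eigenvalue n (\<lambda>j. walk X j (time_changed N L (real n * t) \<omega>) \<omega>) (U n \<omega>)) M' (time_changed (cbm B1 B2) L')"
    by (rule converges_weakly_J1_cong_AE) (use Y(2) in \<open>simp add: time_changed_def\<close>)
  with 1 show ?thesis by (rule conjI)
qed

end
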